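(* Let $\mathcal{O}$ be a complete discrete valuation ring with finite residue field, and assume that the characteristic of $\mathcal{O}$ is two (so $\mathcal{O}\cong\mathbb{F}_q[[t]]$ with $q$ a power of $2$). Then the abscissa of convergence of the twist zeta function $\tilde{\zeta}_{\mathrm{GL}_2(\mathcal{O})}$ is $1$.
   Context: $\mathrm{GL}_2(\mathcal{O})$ carries its profinite topology and representations are continuous and complex. Two representations $\rho,\sigma$ of a group $G$ are twist equivalent if $\rho\cong\sigma\otimes\chi$ for some one-dimensional representation $\chi$ of $G$; equivalence classes are called twist isoclasses, and the dimension of a twist isoclass is that of any of its members. $\tilde r_i(G)$ is the number of twist isoclasses of irreducible representations of $G$ of dimension $i$, and $\tilde\zeta_G(s)=\sum_{i\ge1}\tilde r_i(G)i^{-s}$. The abscissa of convergence is the infimum of the real $s$ for which the series converges. *)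

theory Defs
  imports
    "HOL-Algebra.Ring_Divisibility"
    "HOL-Algebra.Ideal_Product"
    "HOL-Library.Extended_Nonnegative_Real"
    "HOL-Analysis.Function_Topology"
    "Jordan_Normal_Form.VS_Connect"
begin

text \<open>
  A discrete valuation ring is a local principal ideal domain that is not a field. The power
  \<open>\<mm>\<^sup>k\<close> of the maximal ideal is taken in the library's semiring of ideals \<^const>\<open>ideals_set\<close>,
  so that \<open>\<mm>\<^sup>0\<close> is the whole ring.
\<close>

locale discrete_valuation_ring = principal_domain R + maximalideal \<mm> R
  for \<mm> and R (structure) +
  assumes maximal_unique: "maximalideal I R \<Longrightarrow> I = \<mm>"
    and maximal_nonzero: "\<mm> \<noteq> {\<zero>}"

definition adic_Cauchy :: "'a set \<Rightarrow> ('a, 'b) ring_scheme \<Rightarrow> (nat \<Rightarrow> 'a) \<Rightarrow> bool" where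
  "adic_Cauchy \<mm> R X \<longleftrightarrow>
     (\<forall>k::nat. \<exists>N. \<forall>m\<ge>N. \<forall>n\<ge>N. X m \<ominus>\<^bsub>R\<^esub> X n \<in> \<mm> [^]\<^bsub>ideals_set R\<^esub> k)"

definition adic_limit :: "'a set \<Rightarrow> ('a, 'b) ring_scheme \<Rightarrow> (nat \<Rightarrow> 'a) \<Rightarrow> 'a \<Rightarrow> bool" where
  "adic_limit \<mm> R X l \<longleftrightarrow>
     (\<forall>k::nat. \<exists>N. \<forall>n\<ge>N. X n \<ominus>\<^bsub>R\<^esub> l \<in> \<mm> [^]\<^bsub>ideals_set R\<^esub> k)"

locale complete_dvr = discrete_valuation_ring +
  assumes complete:
    "\<lbrakk>range X \<subseteq> carrier R; adic_Cauchy \<mm> R X\<rbrakk> \<Longrightarrow> \<exists>l\<in>carrier R. adic_limit \<mm> R X l"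

definition GL :: "nat \<Rightarrow> 'a::comm_ring_1 mat monoid" where
  "GL n = units_of (ring_mat TYPE('a) n ())"

text \<open>
  The profinite topology on \<open>GL\<^sub>n(\<O>)\<close>, as the inverse limit of the groups \<open>GL\<^sub>n(\<O>/\<mm>\<^sup>k)\<close>: a base is
  formed by the cosets \<open>g K\<^sub>k\<close> of the principal congruence subgroups, and \<open>h \<in> g K\<^sub>k\<close> holds iff
  \<open>h \<equiv> g\<close> modulo \<open>\<mm>\<^sup>k\<close> entrywise.
\<close>

definition congruence_coset :: "'a::comm_ring_1 set \<Rightarrow> nat \<Rightarrow> nat \<Rightarrow> 'a mat \<Rightarrow> 'a mat set" where
  "congruence_coset \<mm> n k g =
     {h \<in> carrier (GL n). \<forall>i<n. \<forall>j<n. h $$ (i,j) - g $$ (i,j) \<in> \<mm> [^]\<^bsub>ideals_set class_ring\<^esub> k}"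

definition GL_topology :: "'a::comm_ring_1 set \<Rightarrow> nat \<Rightarrow> 'a mat topology" where
  "GL_topology \<mm> n = topology_generated_by {congruence_coset \<mm> n k g | k g. g \<in> carrier (GL n)}"

text \<open>
  In what follows a topological group is given by a group \<open>G\<close> together with a topology \<open>T\<close> on
  its carrier. Values of representations outside \<open>carrier G\<close> are irrelevant: they are
  ignored by \<open>rep_iso\<close>, hence do not affect the number of classes.
\<close>

definition continuous_rep ::
  "('g, 'b) monoid_scheme \<Rightarrow> 'g topology \<Rightarrow> nat \<Rightarrow> ('g \<Rightarrow> complex mat) \<Rightarrow> bool" where
  "continuous_rep G T n \<rho> \<longleftrightarrow>
     \<rho> \<in> hom G (GL n) \<and> (\<forall>i<n. \<forall>j<n. continuous_map T euclidean (\<lambda>g. \<rho> g $$ (i,j)))"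

definition irreducible_rep ::
  "('g, 'b) monoid_scheme \<Rightarrow> 'g topology \<Rightarrow> nat \<Rightarrow> ('g \<Rightarrow> complex mat) \<Rightarrow> bool" where
  "irreducible_rep G T n \<rho> \<longleftrightarrow>
     continuous_rep G T n \<rho> \<and> n \<noteq> 0 \<and>
     (\<forall>W. subspace class_ring W (module_vec TYPE(complex) n) \<and>
          (\<forall>g\<in>carrier G. \<forall>w\<in>W. \<rho> g *\<^sub>v w \<in> W)
        \<longrightarrow> W = {0\<^sub>v n} \<or> W = carrier_vec n)"

definition rep_iso ::
  "('g, 'b) monoid_scheme \<Rightarrow> nat \<Rightarrow> ('g \<Rightarrow> complex mat) \<Rightarrow> ('g \<Rightarrow> complex mat) \<Rightarrow> bool" where
  "rep_iso G n \<rho> \<sigma> \<longleftrightarrow> (\<exists>P\<in>carrier (GL n). \<forall>g\<in>carrier G. P * \<rho> g = \<sigma> g * P)"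

text \<open>\<open>\<sigma> \<otimes> \<chi>\<close> for a one-dimensional \<open>\<chi>\<close>, whose values are \<open>1 \<times> 1\<close> matrices.\<close>

definition rep_twist ::
  "('g \<Rightarrow> complex mat) \<Rightarrow> ('g \<Rightarrow> complex mat) \<Rightarrow> 'g \<Rightarrow> complex mat" where
  "rep_twist \<sigma> \<chi> g = (\<chi> g $$ (0,0)) \<cdot>\<^sub>m \<sigma> g"

definition twist_equivalent ::
  "('g, 'b) monoid_scheme \<Rightarrow> 'g topology \<Rightarrow> nat
     \<Rightarrow> ('g \<Rightarrow> complex mat) \<Rightarrow> ('g \<Rightarrow> complex mat) \<Rightarrow> bool" where
  "twist_equivalent G T n \<rho> \<sigma> \<longleftrightarrow>
     (\<exists>\<chi>. continuous_rep G T 1 \<chi> \<and> rep_iso G n \<rho> (rep_twist \<sigma> \<chi>))"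

definition twist_isoclasses ::
  "('g, 'b) monoid_scheme \<Rightarrow> 'g topology \<Rightarrow> nat \<Rightarrow> ('g \<Rightarrow> complex mat) set set" where
  "twist_isoclasses G T n =
     {\<rho>. irreducible_rep G T n \<rho>} //
     {(\<rho>, \<sigma>). irreducible_rep G T n \<rho> \<and> irreducible_rep G T n \<sigma> \<and> twist_equivalent G T n \<rho> \<sigma>}"

text \<open>The count is extended-valued, as \<^const>\<open>card\<close> would assign \<open>0\<close> to an infinite set.\<close>

definition twist_rep_count :: "('g, 'b) monoid_scheme \<Rightarrow> 'g topology \<Rightarrow> nat \<Rightarrow> enat" where
  "twist_rep_count G T n =
     (if finite (twist_isoclasses G T n) then enat (card (twist_isoclasses G T n)) else \<infinity>)"

text \<open>
  The series has non-negative terms, so for real \<open>s\<close> it always has a value in \<open>[0, \<infinity>]\<close> and it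
  converges iff that value is finite. The index is shifted: the summand at \<open>i\<close> belongs
  to dimension \<open>i + 1\<close>.
\<close>

definition twist_zeta :: "('g, 'b) monoid_scheme \<Rightarrow> 'g topology \<Rightarrow> real \<Rightarrow> ennreal" where
  "twist_zeta G T s =
     (\<Sum>i. ennreal_of_enat (twist_rep_count G T (Suc i)) * ennreal (real (Suc i) powr - s))"

definition abscissa_of_convergence :: "(real \<Rightarrow> ennreal) \<Rightarrow> ereal" where
  "abscissa_of_convergence \<zeta> = Inf {ereal s | s. \<zeta> s < \<infinity>}"

end

theory Submission
  imports Defs "Jordan_Normal_Form.Spectral_Radius"
begin

text \<open>
  Let \<open>\<O>\<close> be the ring, \<open>\<pi>\<close> a uniformizer, \<open>q\<close> the
  cardinality of the residue field, \<open>G = GL\<^sub>2(\<O>)\<close>, and let \<open>K l\<close> be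
  the kernel of the reduction of \<open>G\<close> modulo \<open>\<pi>\<^sup>l\<close>. Since
  \<open>GL\<^sub>n(\<complex>)\<close> has no small subgroups, a continuous representation is trivial on
  some \<open>K l\<close> (\<open>level_le_of_continuous_rep\<close>), hence is a representation of a
  finite group; in what follows it then has level at most \<open>l\<close>. The abscissa results from a
  comparison of dimensions with levels, and from counting twist isoclasses by their level instead of
  their dimension.

  Upper bound. In characteristic two the unipotent matrices \<open>u(x) = M2 1 x 0 1\<close> act by
  commuting involutions. Suppose that \<open>\<rho>\<close> has level at most \<open>l + 1\<close> and
  that some \<open>u(x)\<close> with \<open>\<pi>\<^sup>l\<close> dividing \<open>x\<close> acts
  non-trivially. Then a common eigenvector of all \<open>u(x)\<close> yields a character of the additive
  group which is non-trivial on \<open>\<pi>\<^sup>l \<O>\<close>; conjugation by diagonal matrices moves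
  it to \<open>q\<^sup>l\<^sup>+\<^sup>1 - q\<^sup>l\<close> different characters, and so
  \<open>\<rho>\<close> has dimension at least \<open>q\<^sup>l\<close>
  (\<open>dimension_ge_of_primitive\<close>). If, on the contrary, all these \<open>u(x)\<close> act
  trivially and \<open>l > 0\<close>, then on \<open>K l\<close> the representation depends only on the determinant, and a twist
  by a character of the determinant has level at most \<open>l\<close>
  (\<open>twist_to_lower_level\<close>). Therefore every twist isoclass of dimension \<open>n\<close> has
  a member of some level \<open>l\<close> with \<open>q\<^sup>l \<le> q n\<close>
  (\<open>class_has_small_level\<close>).

  On the other hand there are at most \<open>(l + 1) q\<^sup>l\<close> twist isoclasses with a member of
  level at most \<open>l\<close>, in all dimensions together (\<open>sum_classes_of_level_le\<close>).
  Indeed, characters of representations which are inequivalent up to twists by characters of the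
  determinant remain orthogonal on the subgroup of determinant one of
  \<open>GL\<^sub>2(\<O>/\<pi>\<^sup>l)\<close>, so that their number is at most the number of conjugacy
  classes that meet this subgroup (\<open>twist_classes_le_conjugacy_classes\<close>), and these classes
  have the normal forms of \<open>has_type_exists\<close> and \<open>conj_of_same_type\<close>.
  Consequently the zeta function at \<open>s > 1\<close> is at most \<open>\<Sum>l. (l + 1) q\<^sup>l
  (q\<^sup>l / q) powr - s\<close>, which is finite.

  Lower bound. A character \<open>\<chi>\<close> of the units modulo \<open>\<pi>\<^sup>l\<close> gives
  the character \<open>\<chi>(a)\<close> of the Borel subgroup, and an irreducible constituent of the
  representation induced from it has dimension at most \<open>2 q\<^sup>l\<close>. For primitive
  \<open>\<chi>\<close>, a Mackey computation on the double cosets of the Borel subgroup shows that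
  constituents for \<open>\<chi>\<close> and \<open>\<chi>'\<close> lie in the same twist isoclass only
  if \<open>\<chi>'\<close> is \<open>\<chi>\<close> or its inverse
  (\<open>principal_series_distinct\<close>). As there are at least \<open>q\<^sup>l / 4\<close>
  primitive characters, there are at least \<open>q\<^sup>l / 8\<close> twist isoclasses of dimension at
  most \<open>2 q\<^sup>l\<close> (\<open>many_classes_of_small_dimension\<close>). The zeta function at
  \<open>s < 1\<close> is therefore at least a constant times \<open>q powr (l * (1 - max s 0))\<close>
  for every \<open>l \<ge> 2\<close>, hence infinite.
\<close>

section \<open>Linear algebra\<close>

text \<open>
  Fewer linear conditions than unknowns: the induction uses one condition to eliminate one unknown that
  occurs in it with a non-zero coefficient.
\<close>

lemma nontrivial_relation:
  fixes a :: "'i \<Rightarrow> 'j \<Rightarrow> 'k::field"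
  assumes "finite J" "finite I" "card J < card I"
  shows "\<exists>c. (\<exists>i\<in>I. c i \<noteq> 0) \<and> (\<forall>j\<in>J. (\<Sum>i\<in>I. c i * a i j) = 0)"
  using assms
proof (induction J arbitrary: I a rule: finite_induct)
  case empty
  then obtain i where "i \<in> I" by fastforce
  then show ?case by (intro exI[of _ "\<lambda>_. 1"]) auto
next
  case (insert j0 J)
  show ?case
  proof (cases "\<forall>i\<in>I. a i j0 = 0")
    case True
    from insert.IH[of I a] insert.prems insert.hyps
    obtain c where "\<exists>i\<in>I. c i \<noteq> 0" "\<forall>j\<in>J. (\<Sum>i\<in>I. c i * a i j) = 0" by auto
    with True show ?thesis by (intro exI[of _ c]) auto
  next
    case False
    then obtain i0 where i0: "i0 \<in> I" "a i0 j0 \<noteq> 0" by auto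
    define I' where "I' = I - {i0}"
    define a' where "a' i j = a i j - a i j0 / a i0 j0 * a i0 j" for i j
    have I': "finite I'" "i0 \<notin> I'" "I = insert i0 I'" using insert.prems i0 by (auto simp: I'_def)
    have "card J < card I'" using insert I' by auto
    from insert.IH[OF I'(1) this, of a']
    obtain c where c: "\<exists>i\<in>I'. c i \<noteq> 0" "\<forall>j\<in>J. (\<Sum>i\<in>I'. c i * a' i j) = 0" by blast
    define s where "s = - (\<Sum>i\<in>I'. c i * a i j0) / a i0 j0"
    define c' where "c' = c(i0 := s)"
    have sum_c': "(\<Sum>i\<in>I. c' i * a i j) = s * a i0 j + (\<Sum>i\<in>I'. c i * a i j)" for j
    proof -
      have "(\<Sum>i\<in>I'. c' i * a i j) = (\<Sum>i\<in>I'. c i * a i j)"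
        using I' by (intro sum.cong) (auto simp: c'_def)
      then show ?thesis using I' by (simp add: c'_def)
    qed
    have "(\<Sum>i\<in>I. c' i * a i j) = 0" if "j \<in> insert j0 J" for j
    proof (cases "j = j0")
      case True
      then show ?thesis using i0 unfolding sum_c' by (simp add: s_def)
    next
      case False
      with that c have "(\<Sum>i\<in>I'. c i * a' i j) = 0" by auto
      also have "(\<Sum>i\<in>I'. c i * a' i j)
          = (\<Sum>i\<in>I'. c i * a i j) - (\<Sum>i\<in>I'. c i * a i j0) / a i0 j0 * a i0 j"
        by (simp add: a'_def algebra_simps sum_subtractf sum_distrib_left sum_divide_distrib)
      finally show ?thesis unfolding sum_c' by (simp add: s_def)
    qed
    moreover have "\<exists>i\<in>I. c' i \<noteq> 0" using c(1) I' by (auto simp: c'_def)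
    ultimately show ?thesis by blast
  qed
qed

text \<open>
  The functions \<open>a i\<close> on \<open>J\<close> are linearly independent, since a relation between
  them is tested by the \<open>b\<close> that are dual to them up to non-zero factors. This is how
  orthogonality relations of characters are turned into inequalities between cardinalities.
\<close>

lemma biorthogonal_card_le:
  fixes a :: "'i \<Rightarrow> 'j \<Rightarrow> 'k::field"
  assumes "finite J" "finite I"
    and off: "\<And>i i'. i \<in> I \<Longrightarrow> i' \<in> I \<Longrightarrow> i \<noteq> i' \<Longrightarrow> (\<Sum>j\<in>J. a i j * b j i') = 0"
    and diag: "\<And>i. i \<in> I \<Longrightarrow> (\<Sum>j\<in>J. a i j * b j i) \<noteq> 0"
  shows "card I \<le> card J"
proof (rule ccontr)
  assume "\<not> card I \<le> card J"
  with nontrivial_relation[of J I a] assms(1,2)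
  obtain c where c: "\<exists>i\<in>I. c i \<noteq> 0" "\<forall>j\<in>J. (\<Sum>i\<in>I. c i * a i j) = 0" by auto
  then obtain i0 where i0: "i0 \<in> I" "c i0 \<noteq> 0" by auto
  have "0 = (\<Sum>j\<in>J. (\<Sum>i\<in>I. c i * a i j) * b j i0)" using c by simp
  also have "\<dots> = (\<Sum>j\<in>J. \<Sum>i\<in>I. c i * (a i j * b j i0))"
    by (simp add: sum_distrib_right mult.assoc)
  also have "\<dots> = (\<Sum>i\<in>I. \<Sum>j\<in>J. c i * (a i j * b j i0))" by (rule sum.swap)
  also have "\<dots> = (\<Sum>i\<in>I. c i * (\<Sum>j\<in>J. a i j * b j i0))"
    by (simp add: sum_distrib_left)
  also have "\<dots> = (\<Sum>i\<in>I. if i = i0 then c i0 * (\<Sum>j\<in>J. a i0 j * b j i0) else 0)"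
    using off i0 by (intro sum.cong) auto
  also have "\<dots> = c i0 * (\<Sum>j\<in>J. a i0 j * b j i0)" using assms(2) i0 by simp
  finally show False using i0 diag by auto
qed

lemma subspace_vec_iff:
  "module.smult (module_vec TYPE('a::field) n) = (\<cdot>\<^sub>v)
   \<and> (subspace class_ring W (module_vec TYPE('a::field) n) \<longleftrightarrow>
     W \<subseteq> carrier_vec n \<and> 0\<^sub>v n \<in> W \<and> (\<forall>v\<in>W. \<forall>w\<in>W. v + w \<in> W) \<and> (\<forall>c. \<forall>v\<in>W. c \<cdot>\<^sub>v v \<in> W))"
  using vec_vs[where 'a='a, of n] vec_module[where 'a='a, of n]
  by (auto simp: VectorSpace.subspace_def submodule_def module_vec_simps)

lemmas subspace_vec = subspace_vec_iff[THEN conjunct2]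

definition mat_trace :: "'a::comm_monoid_add mat \<Rightarrow> 'a" where
  "mat_trace A = (\<Sum>i<dim_row A. A $$ (i,i))"

lemma mult_mat_index:
  assumes "A \<in> carrier_mat n m" "B \<in> carrier_mat m k" "i < n" "j < k"
  shows "(A * B) $$ (i,j) = (\<Sum>l<m. A $$ (i,l) * B $$ (l,j))"
  using assms by (auto simp: scalar_prod_def atLeast0LessThan)

lemma mult_mat_vec_index:
  assumes "A \<in> carrier_mat n m" "v \<in> carrier_vec m" "i < n"
  shows "(A *\<^sub>v v) $ i = (\<Sum>l<m. A $$ (i,l) * v $ l)"
  using assms by (auto simp: scalar_prod_def atLeast0LessThan)

lemma mat_trace_mult_comm:
  fixes A :: "'a::comm_ring_1 mat"
  assumes A: "A \<in> carrier_mat n m" and B: "B \<in> carrier_mat m n"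
  shows "mat_trace (A * B) = mat_trace (B * A)"
proof -
  have "mat_trace (A * B) = (\<Sum>i<n. \<Sum>l<m. A $$ (i,l) * B $$ (l,i))"
    using A by (auto simp: mat_trace_def mult_mat_index[OF A B] intro!: sum.cong)
  also have "\<dots> = (\<Sum>l<m. \<Sum>i<n. B $$ (l,i) * A $$ (i,l))"
    by (subst sum.swap) (simp add: mult.commute)
  also have "\<dots> = mat_trace (B * A)"
    using B by (auto simp: mat_trace_def mult_mat_index[OF B A] intro!: sum.cong)
  finally show ?thesis .
qed

lemma mat_trace_one: "mat_trace (1\<^sub>m n :: 'a::comm_ring_1 mat) = of_nat n"
  by (simp add: mat_trace_def)

lemma mult_unit_vec:
  fixes A :: "'a::comm_ring_1 mat"
  assumes "A \<in> carrier_mat n m" "j < m"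
  shows "A *\<^sub>v unit_vec m j = col A j"
  using assms by (intro eq_vecI) auto

lemma zero_mult_mat_vec:
  "v \<in> carrier_vec m \<Longrightarrow> 0\<^sub>m n m *\<^sub>v v = (0\<^sub>v n :: 'a::comm_ring_1 vec)"
  by (intro eq_vecI) auto

lemma smult_one_mult_mat_vec:
  "v \<in> carrier_vec n \<Longrightarrow> (c \<cdot>\<^sub>m 1\<^sub>m n) *\<^sub>v v = (c \<cdot>\<^sub>v v :: 'a::comm_ring_1 vec)"
  by (intro eq_vecI) auto

lemma mat_eqI_vec:
  fixes A :: "'a::comm_ring_1 mat"
  assumes A: "A \<in> carrier_mat n m" and B: "B \<in> carrier_mat n m"
    and eq: "\<And>v. v \<in> carrier_vec m \<Longrightarrow> A *\<^sub>v v = B *\<^sub>v v"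
  shows "A = B"
proof (rule eq_matI)
  fix i j assume "i < dim_row B" "j < dim_col B"
  with B have ij: "i < n" "j < m" by auto
  have "col A j = col B j"
    using eq[of "unit_vec m j"] ij A B by (simp add: mult_unit_vec[OF A] mult_unit_vec[OF B])
  then show "A $$ (i,j) = B $$ (i,j)" using A B ij by (metis carrier_matD index_col)
qed (use A B in auto)

lemma nonzero_vec_entry:
  assumes "v \<in> carrier_vec n" "v \<noteq> 0\<^sub>v n"
  obtains j where "j < n" "v $ j \<noteq> 0"
proof -
  have "\<not> (\<forall>j<n. v $ j = 0)"
  proof
    assume "\<forall>j<n. v $ j = 0"
    then have "v = 0\<^sub>v n" using assms(1) by (intro eq_vecI) simp_all
    with assms(2) show False ..
  qed
  then obtain j where "j < n" "v $ j \<noteq> 0" by auto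
  then show ?thesis by (rule that)
qed

section \<open>Matrix representations\<close>

lemma GL_carrier: "carrier (GL n) =
  {A \<in> carrier_mat n n. \<exists>B\<in>carrier_mat n n. A * B = 1\<^sub>m n \<and> B * A = (1\<^sub>m n :: 'a::comm_ring_1 mat)}"
  by (auto simp: GL_def units_of_def Units_def ring_mat_def)

lemma GL_mult: "mult (GL n) = (*)"
  by (simp add: GL_def units_of_def ring_mat_def)

lemma GL_one: "one (GL n) = 1\<^sub>m n"
  by (simp add: GL_def units_of_def ring_mat_def)

lemma group_GL: "group (GL n :: 'a::comm_ring_1 mat monoid)"
  unfolding GL_def by (rule monoid.units_group) (meson ring_mat ring.is_monoid)

text \<open>
  The purely algebraic part of \<open>irreducible_rep\<close>; the topology is treated separately.
\<close>

definition irrep :: "('g, 'b) monoid_scheme \<Rightarrow> nat \<Rightarrow> ('g \<Rightarrow> complex mat) \<Rightarrow> bool" where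
  "irrep G n \<rho> \<longleftrightarrow> \<rho> \<in> hom G (GL n) \<and> n \<noteq> 0 \<and>
     (\<forall>W. subspace class_ring W (module_vec TYPE(complex) n) \<and>
          (\<forall>g\<in>carrier G. \<forall>w\<in>W. \<rho> g *\<^sub>v w \<in> W)
        \<longrightarrow> W = {0\<^sub>v n} \<or> W = carrier_vec n)"

lemma irrepD:
  assumes "irrep G n \<rho>" "W \<subseteq> carrier_vec n" "0\<^sub>v n \<in> W" 
    "\<And>v w. v \<in> W \<Longrightarrow> w \<in> W \<Longrightarrow> v + w \<in> W" "\<And>c v. v \<in> W \<Longrightarrow> c \<cdot>\<^sub>v v \<in> W"
    "\<And>g w. g \<in> carrier G \<Longrightarrow> w \<in> W \<Longrightarrow> \<rho> g *\<^sub>v w \<in> W"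
  shows "W = {0\<^sub>v n} \<or> W = carrier_vec n"
proof -
  have "subspace class_ring W (module_vec TYPE(complex) n)"
    unfolding subspace_vec using assms(2-5) by simp
  moreover have "\<forall>g\<in>carrier G. \<forall>w\<in>W. \<rho> g *\<^sub>v w \<in> W" using assms(6) by simp
  ultimately show ?thesis using assms(1) unfolding irrep_def by metis
qed

lemma hom_GL_D:
  assumes "\<rho> \<in> hom G (GL n)"
  shows "g \<in> carrier G \<Longrightarrow> \<rho> g \<in> carrier_mat n n"
    and "g \<in> carrier G \<Longrightarrow> h \<in> carrier G \<Longrightarrow> \<rho> (g \<otimes>\<^bsub>G\<^esub> h) = \<rho> g * \<rho> h"
  using assms by (auto simp: hom_def GL_carrier GL_mult Pi_def)

lemma hom_GL_one:
  assumes "group G" "\<rho> \<in> hom G (GL n)"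
  shows "\<rho> \<one>\<^bsub>G\<^esub> = 1\<^sub>m n"
  using hom_one[OF assms(2,1) group_GL] by (simp add: GL_one)

lemma hom_GL_inv:
  assumes "group G" "\<rho> \<in> hom G (GL n)" "g \<in> carrier G"
  shows "\<rho> g * \<rho> (inv\<^bsub>G\<^esub> g) = 1\<^sub>m n" "\<rho> (inv\<^bsub>G\<^esub> g) * \<rho> g = 1\<^sub>m n"
proof -
  interpret group G by fact
  show "\<rho> g * \<rho> (inv\<^bsub>G\<^esub> g) = 1\<^sub>m n" "\<rho> (inv\<^bsub>G\<^esub> g) * \<rho> g = 1\<^sub>m n"
    using assms hom_GL_D(2)[OF assms(2), symmetric] hom_GL_one[OF assms(1,2)] by simp_all
qed

lemma hom_GL_I:
  assumes "group G" 
    and c: "\<And>g. g \<in> carrier G \<Longrightarrow> \<rho> g \<in> carrier_mat n n"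
    and m: "\<And>g h. g \<in> carrier G \<Longrightarrow> h \<in> carrier G \<Longrightarrow> \<rho> (g \<otimes>\<^bsub>G\<^esub> h) = \<rho> g * \<rho> h"
    and o: "\<rho> \<one>\<^bsub>G\<^esub> = (1\<^sub>m n :: 'a::comm_ring_1 mat)"
  shows "\<rho> \<in> hom G (GL n)"
proof -
  interpret group G by fact
  have "\<rho> g \<in> carrier (GL n)" if "g \<in> carrier G" for g
    using c[OF that] c[of "inv\<^bsub>G\<^esub> g"] m[of g "inv\<^bsub>G\<^esub> g"] m[of "inv\<^bsub>G\<^esub> g" g] o that
    by (auto simp: GL_carrier intro!: bexI[of _ "\<rho> (inv\<^bsub>G\<^esub> g)"])
  then show ?thesis using m by (auto simp: hom_def GL_mult)
qed

section \<open>Schur's lemma and orthogonality of characters\<close>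

text \<open>
  The kernel of the intertwiner \<open>P\<close> is invariant, and so is its image; hence
  \<open>P\<close> has a right inverse which is also a left inverse. That \<open>P\<close> is square
  follows by comparing the traces of the two products.
\<close>

lemma schur_invertible:
  assumes \<rho>: "irrep G n \<rho>" and \<sigma>: "irrep G m \<sigma>"
    and P: "P \<in> carrier_mat m n" and comm: "\<And>g. g \<in> carrier G \<Longrightarrow> P * \<rho> g = \<sigma> g * P"
    and nz: "P \<noteq> 0\<^sub>m m n"
  shows "n = m \<and> P \<in> carrier (GL n)"
proof -
  have r: "\<rho> g \<in> carrier_mat n n" "\<sigma> g \<in> carrier_mat m m" if "g \<in> carrier G" for g
    using \<rho> \<sigma> that hom_GL_D(1) by (auto simp: irrep_def)
  have cv: "P *\<^sub>v (\<rho> g *\<^sub>v v) = \<sigma> g *\<^sub>v (P *\<^sub>v v)" if "g \<in> carrier G" "v \<in> carrier_vec n" for g v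
    using comm[OF that(1)] r[OF that(1)] P that(2) by (metis assoc_mult_mat_vec)
  define K where "K = {v \<in> carrier_vec n. P *\<^sub>v v = 0\<^sub>v m}"
  have "K = {0\<^sub>v n} \<or> K = carrier_vec n"
  proof (rule irrepD[OF \<rho>])
    show "\<rho> g *\<^sub>v w \<in> K" if "g \<in> carrier G" "w \<in> K" for g w
      using that r[OF that(1)] cv[OF that(1)] P by (auto simp: K_def)
  qed (use P in \<open>auto simp: K_def mult_add_distrib_mat_vec mult_mat_vec\<close>)
  moreover have "K \<noteq> carrier_vec n"
  proof
    assume "K = carrier_vec n"
    then have "P = 0\<^sub>m m n" by (intro mat_eqI_vec[OF P]) (auto simp: K_def zero_mult_mat_vec)
    with nz show False by simp
  qed
  ultimately have K: "K = {0\<^sub>v n}" by simp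
  define I where "I = (\<lambda>v. P *\<^sub>v v) ` carrier_vec n"
  have "I = {0\<^sub>v m} \<or> I = carrier_vec m"
  proof (rule irrepD[OF \<sigma>])
    show "v + w \<in> I" if vw: "v \<in> I" "w \<in> I" for v w
    proof -
      from vw obtain x y where "x \<in> carrier_vec n" "y \<in> carrier_vec n" "v = P *\<^sub>v x" "w = P *\<^sub>v y"
        by (auto simp: I_def)
      then show ?thesis unfolding I_def
        by (intro image_eqI[of _ _ "x + y"]) (simp_all add: mult_add_distrib_mat_vec[OF P])
    qed
    show "c \<cdot>\<^sub>v v \<in> I" if v: "v \<in> I" for c v
    proof -
      from v obtain x where "x \<in> carrier_vec n" "v = P *\<^sub>v x" by (auto simp: I_def)
      then show ?thesis unfolding I_def
        by (intro image_eqI[of _ _ "c \<cdot>\<^sub>v x"]) (simp_all add: mult_mat_vec[OF P])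
    qed
    show "\<sigma> g *\<^sub>v w \<in> I" if g: "g \<in> carrier G" and w: "w \<in> I" for g w
    proof -
      from w obtain x where "x \<in> carrier_vec n" "w = P *\<^sub>v x" by (auto simp: I_def)
      then show ?thesis unfolding I_def using cv[OF g] r(1)[OF g]
        by (intro image_eqI[of _ _ "\<rho> g *\<^sub>v x"]) simp_all
    qed
    show "0\<^sub>v m \<in> I" using P by (auto simp: I_def image_iff intro!: bexI[of _ "0\<^sub>v n"])
  qed (use P in \<open>auto simp: I_def\<close>)
  moreover have "I \<noteq> {0\<^sub>v m}"
  proof
    assume "I = {0\<^sub>v m}"
    then have "K = carrier_vec n" by (auto simp: K_def I_def)
    with \<open>K \<noteq> carrier_vec n\<close> show False by simp
  qed
  ultimately have I: "I = carrier_vec m" by simp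
  have "\<forall>i. \<exists>v. v \<in> carrier_vec n \<and> P *\<^sub>v v = unit_vec m i"
    using I unfolding I_def by (metis imageE unit_vec_carrier)
  then obtain v where v: "\<And>i. v i \<in> carrier_vec n" "\<And>i. P *\<^sub>v v i = unit_vec m i" by metis
  define Q where "Q = mat_of_cols n (map v [0..<m])"
  have Q: "Q \<in> carrier_mat n m" by (auto simp: Q_def)
  have PQ: "P * Q = 1\<^sub>m m"
  proof (rule eq_matI)
    fix i j assume ij: "i < dim_row (1\<^sub>m m :: complex mat)" "j < dim_col (1\<^sub>m m :: complex mat)"
    have "(P * Q) $$ (i,j) = (P *\<^sub>v col Q j) $ i" using ij P Q by simp
    also have "col Q j = v j" using ij v(1) by (simp add: Q_def col_mat_of_cols)
    finally show "(P * Q) $$ (i,j) = 1\<^sub>m m $$ (i,j)" using ij v(2)[of j] by simp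
  qed (use P Q in auto)
  have QP: "Q * P = 1\<^sub>m n"
  proof (rule mat_eqI_vec)
    fix x :: "complex vec" assume x: "x \<in> carrier_vec n"
    have "P *\<^sub>v (Q *\<^sub>v (P *\<^sub>v x)) = (P * Q) *\<^sub>v (P *\<^sub>v x)"
      using P Q x by (metis assoc_mult_mat_vec mult_mat_vec_carrier)
    then have "P *\<^sub>v (Q *\<^sub>v (P *\<^sub>v x)) = P *\<^sub>v x" using P x PQ by simp
    then have "P *\<^sub>v (Q *\<^sub>v (P *\<^sub>v x) - x) = 0\<^sub>v m"
      using P Q x by (simp add: mult_minus_distrib_mat_vec[OF P])
    then have "Q *\<^sub>v (P *\<^sub>v x) - x \<in> K" using P Q x by (auto simp: K_def)
    then have "Q *\<^sub>v (P *\<^sub>v x) - x = 0\<^sub>v n" using K by simp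
    then have eq: "(Q *\<^sub>v (P *\<^sub>v x) - x) $ i = 0" if "i < n" for i using that by simp
    have "Q *\<^sub>v (P *\<^sub>v x) = x"
      by (rule eq_vecI) (use eq x P Q in \<open>auto simp del: index_mult_mat_vec\<close>)
    then show "(Q * P) *\<^sub>v x = 1\<^sub>m n *\<^sub>v x" using P Q x by (simp add: assoc_mult_mat_vec)
  qed (use P Q in auto)
  have "of_nat m = (of_nat n :: complex)"
    using mat_trace_mult_comm[OF P Q] PQ QP by (simp add: mat_trace_one)
  then have "n = m" by simp
  with P Q PQ QP show ?thesis by (auto simp: GL_carrier)
qed

lemma GL_cancel_vec:
  assumes "P \<in> carrier (GL n)" "v \<in> carrier_vec n" "P *\<^sub>v v = 0\<^sub>v n"
  shows "v = 0\<^sub>v n"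
proof -
  from assms obtain Q where Q: "Q \<in> carrier_mat n n" "Q * P = 1\<^sub>m n" and P: "P \<in> carrier_mat n n"
    by (auto simp: GL_carrier)
  have "v = (Q * P) *\<^sub>v v" using Q assms by simp
  also have "\<dots> = Q *\<^sub>v (P *\<^sub>v v)" by (rule assoc_mult_mat_vec[OF Q(1) P assms(2)])
  also have "\<dots> = 0\<^sub>v n" using Q assms(3) by auto
  finally show ?thesis .
qed

text \<open>
  For an eigenvalue \<open>c\<close> of \<open>P\<close>, the intertwiner \<open>P - c\<close> has a
  non-trivial kernel, so it is zero.
\<close>

lemma schur_scalar:
  assumes \<rho>: "irrep G n \<rho>" and P: "P \<in> carrier_mat n n"
    and comm: "\<And>g. g \<in> carrier G \<Longrightarrow> P * \<rho> g = \<rho> g * P"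
  shows "\<exists>c. P = c \<cdot>\<^sub>m 1\<^sub>m n"
proof -
  have n: "n > 0" using \<rho> by (simp add: irrep_def)
  from spectrum_non_empty[OF P n] obtain c v where ev: "eigenvector P v c"
    by (auto simp: spectrum_def eigenvalue_def)
  then have v: "v \<in> carrier_vec n" "v \<noteq> 0\<^sub>v n" "P *\<^sub>v v = c \<cdot>\<^sub>v v"
    using P by (auto simp: eigenvector_def)
  define R where "R = P - c \<cdot>\<^sub>m 1\<^sub>m n"
  have R: "R \<in> carrier_mat n n" using P by (auto simp: R_def)
  have Rv: "R *\<^sub>v v = 0\<^sub>v n"
    unfolding R_def using P v by (auto simp: minus_mult_distrib_mat_vec smult_one_mult_mat_vec)
  have Rcomm: "R * \<rho> g = \<rho> g * R" if g: "g \<in> carrier G" for g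
  proof -
    have r: "\<rho> g \<in> carrier_mat n n" using \<rho> g hom_GL_D(1) by (auto simp: irrep_def)
    have "R * \<rho> g = P * \<rho> g - (c \<cdot>\<^sub>m 1\<^sub>m n) * \<rho> g"
      unfolding R_def using P r by (intro minus_mult_distrib_mat) auto
    also have "(c \<cdot>\<^sub>m 1\<^sub>m n) * \<rho> g = \<rho> g * (c \<cdot>\<^sub>m 1\<^sub>m n)"
      using r by (simp add: mult_smult_distrib[of _ n n _ n] mult_smult_assoc_mat[of _ n n _ n])
    also have "P * \<rho> g = \<rho> g * P" by (rule comm[OF g])
    also have "\<rho> g * P - \<rho> g * (c \<cdot>\<^sub>m 1\<^sub>m n) = \<rho> g * R"
      unfolding R_def using P r by (intro mult_minus_distrib_mat[symmetric]) auto
    finally show ?thesis .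
  qed
  have "R = 0\<^sub>m n n"
    using schur_invertible[OF \<rho> \<rho> R Rcomm] GL_cancel_vec[OF _ v(1) Rv] v(2) by blast
  then have z: "R $$ (i,j) = 0" if "i < n" "j < n" for i j using that by simp
  have "P = c \<cdot>\<^sub>m 1\<^sub>m n"
    by (rule eq_matI) (use z P in \<open>auto simp: R_def\<close>)
  then show ?thesis by blast
qed

locale finite_group = group F for F (structure) +
  assumes fin: "finite (carrier F)"
begin

lemma sum_translate:
  assumes "h \<in> carrier F"
  shows "(\<Sum>g\<in>carrier F. f (h \<otimes> g)) = (\<Sum>g\<in>carrier F. f g)"
  by (rule sum.reindex_bij_witness[of _ "\<lambda>g. inv h \<otimes> g" "\<lambda>g. h \<otimes> g"])
    (use assms in \<open>auto simp: m_assoc[symmetric]\<close>)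

text \<open>
  The average of the elementary matrix \<open>E\<^sub>a\<^sub>b\<close>, that is, the sum of
  \<open>\<sigma> g * E\<^sub>a\<^sub>b * \<rho> (inv g)\<close> over the group.
\<close>

definition averaged :: "nat \<Rightarrow> nat \<Rightarrow> ('a \<Rightarrow> complex mat) \<Rightarrow> ('a \<Rightarrow> complex mat) \<Rightarrow> nat \<Rightarrow> nat \<Rightarrow> complex mat" where
  "averaged m n \<sigma> \<rho> a b = mat m n (\<lambda>(i,j). \<Sum>g\<in>carrier F. \<sigma> g $$ (i,a) * \<rho> (inv g) $$ (b,j))"

lemma averaged_intertwines:
  assumes \<sigma>: "\<sigma> \<in> hom F (GL m)" and \<rho>: "\<rho> \<in> hom F (GL n)" and ab: "a < m" "b < n"
    and h: "h \<in> carrier F"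
  shows "averaged m n \<sigma> \<rho> a b * \<rho> h = \<sigma> h * averaged m n \<sigma> \<rho> a b"
proof (rule eq_matI)
  let ?P = "averaged m n \<sigma> \<rho> a b"
  have P: "?P \<in> carrier_mat m n" by (simp add: averaged_def)
  note s = hom_GL_D[OF \<sigma>] and r = hom_GL_D[OF \<rho>]
  fix i j assume "i < dim_row (\<sigma> h * ?P)" "j < dim_col (\<sigma> h * ?P)"
  with P s(1)[OF h] have ij: "i < m" "j < n" by auto
  have "(\<sigma> h * ?P) $$ (i,j) = (\<Sum>k<m. \<sigma> h $$ (i,k) * (\<Sum>g\<in>carrier F. \<sigma> g $$ (k,a) * \<rho> (inv g) $$ (b,j)))"
    unfolding mult_mat_index[OF s(1)[OF h] P ij] using ij by (simp add: averaged_def)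
  also have "\<dots> = (\<Sum>g\<in>carrier F. (\<Sum>k<m. \<sigma> h $$ (i,k) * \<sigma> g $$ (k,a)) * \<rho> (inv g) $$ (b,j))"
    by (simp add: sum_distrib_left sum_distrib_right mult.assoc sum.swap[of _ _ "{..<m}"])
  also have "\<dots> = (\<Sum>g\<in>carrier F. \<sigma> (h \<otimes> g) $$ (i,a) * \<rho> (inv (h \<otimes> g) \<otimes> h) $$ (b,j))"
  proof (rule sum.cong[OF refl])
    fix g assume g: "g \<in> carrier F"
    have e: "inv (h \<otimes> g) \<otimes> h = inv g" using g h by (simp add: inv_mult_group m_assoc)
    show "(\<Sum>k<m. \<sigma> h $$ (i,k) * \<sigma> g $$ (k,a)) * \<rho> (inv g) $$ (b,j)
       = \<sigma> (h \<otimes> g) $$ (i,a) * \<rho> (inv (h \<otimes> g) \<otimes> h) $$ (b,j)"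
      unfolding e using g h ij ab by (simp only: s(2) mult_mat_index[OF s(1) s(1)])
  qed
  also have "\<dots> = (\<Sum>g\<in>carrier F. \<sigma> g $$ (i,a) * \<rho> (inv g \<otimes> h) $$ (b,j))"
    by (rule sum_translate[OF h])
  also have "\<dots> = (\<Sum>g\<in>carrier F. \<sigma> g $$ (i,a) * (\<Sum>k<n. \<rho> (inv g) $$ (b,k) * \<rho> h $$ (k,j)))"
    using h ij ab by (intro sum.cong[OF refl]) (simp only: r(2) inv_closed mult_mat_index[OF r(1) r(1)])
  also have "\<dots> = (\<Sum>k<n. (\<Sum>g\<in>carrier F. \<sigma> g $$ (i,a) * \<rho> (inv g) $$ (b,k)) * \<rho> h $$ (k,j))"
    by (simp add: sum_distrib_left sum_distrib_right mult.assoc sum.swap[of _ _ "{..<n}"])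
  also have "\<dots> = (?P * \<rho> h) $$ (i,j)"
    unfolding mult_mat_index[OF P r(1)[OF h] ij] using ij by (simp add: averaged_def)
  finally show "(?P * \<rho> h) $$ (i,j) = (\<sigma> h * ?P) $$ (i,j)" by simp
qed (use hom_GL_D(1)[OF \<sigma> h] hom_GL_D(1)[OF \<rho> h] in \<open>auto simp: averaged_def\<close>)

lemma sum_traces_averaged:
  assumes \<sigma>: "\<sigma> \<in> hom F (GL m)" and \<rho>: "\<rho> \<in> hom F (GL n)"
  shows "(\<Sum>g\<in>carrier F. mat_trace (\<sigma> g) * mat_trace (\<rho> (inv g)))
     = (\<Sum>a<m. \<Sum>b<n. averaged m n \<sigma> \<rho> a b $$ (a,b))"
proof -
  have "(\<Sum>g\<in>carrier F. mat_trace (\<sigma> g) * mat_trace (\<rho> (inv g)))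
     = (\<Sum>g\<in>carrier F. \<Sum>a<m. \<Sum>b<n. \<sigma> g $$ (a,a) * \<rho> (inv g) $$ (b,b))"
  proof (rule sum.cong[OF refl])
    fix g assume g: "g \<in> carrier F"
    then have "dim_row (\<sigma> g) = m" "dim_row (\<rho> (inv g)) = n"
      using hom_GL_D(1)[OF \<sigma>, of g] hom_GL_D(1)[OF \<rho>, of "inv g"] by auto
    then show "mat_trace (\<sigma> g) * mat_trace (\<rho> (inv g)) = (\<Sum>a<m. \<Sum>b<n. \<sigma> g $$ (a,a) * \<rho> (inv g) $$ (b,b))"
      by (simp add: mat_trace_def sum_product)
  qed
  also have "\<dots> = (\<Sum>a<m. \<Sum>b<n. \<Sum>g\<in>carrier F. \<sigma> g $$ (a,a) * \<rho> (inv g) $$ (b,b))"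
    by (simp only: sum.swap[of _ _ "carrier F"])
  also have "\<dots> = (\<Sum>a<m. \<Sum>b<n. averaged m n \<sigma> \<rho> a b $$ (a,b))"
    by (simp add: averaged_def)
  finally show ?thesis .
qed

text \<open>
  The averaged elementary matrices are intertwiners, hence vanish by Schur's lemma, and the sum of
  products of traces is a sum of entries of such matrices.
\<close>

lemma characters_orthogonal:
  assumes \<sigma>: "irrep F m \<sigma>" and \<rho>: "irrep F n \<rho>"
    and inequiv: "m = n \<Longrightarrow> \<not> (\<exists>P\<in>carrier (GL n). \<forall>g\<in>carrier F. P * \<rho> g = \<sigma> g * P)"
  shows "(\<Sum>g\<in>carrier F. mat_trace (\<sigma> g) * mat_trace (\<rho> (inv g))) = 0"
proof -
  have h: "\<sigma> \<in> hom F (GL m)" "\<rho> \<in> hom F (GL n)" using \<sigma> \<rho> by (auto simp: irrep_def)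
  have "averaged m n \<sigma> \<rho> a b = 0\<^sub>m m n" if ab: "a < m" "b < n" for a b
  proof (rule ccontr)
    assume "averaged m n \<sigma> \<rho> a b \<noteq> 0\<^sub>m m n"
    from schur_invertible[OF \<rho> \<sigma> _ averaged_intertwines[OF h ab] this]
    have "n = m \<and> averaged m n \<sigma> \<rho> a b \<in> carrier (GL n)" by (auto simp: averaged_def)
    with inequiv averaged_intertwines[OF h ab] show False by blast
  qed
  then show ?thesis by (simp add: sum_traces_averaged[OF h])
qed

text \<open>
  By Schur's lemma the averaged elementary matrices are scalar, and their traces determine the scalar.
\<close>

lemma character_norm:
  assumes \<rho>: "irrep F n \<rho>"
  shows "(\<Sum>g\<in>carrier F. mat_trace (\<rho> g) * mat_trace (\<rho> (inv g))) = of_nat (card (carrier F))"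
proof -
  have h: "\<rho> \<in> hom F (GL n)" and n: "n \<noteq> 0" using \<rho> by (auto simp: irrep_def)
  have P: "averaged n n \<rho> \<rho> a b $$ (a,b) = (if a = b then of_nat (card (carrier F)) / of_nat n else 0)"
    if ab: "a < n" "b < n" for a b
  proof -
    have "averaged n n \<rho> \<rho> a b \<in> carrier_mat n n" by (simp add: averaged_def)
    from schur_scalar[OF \<rho> this averaged_intertwines[OF h h ab]]
    obtain c where c: "averaged n n \<rho> \<rho> a b = c \<cdot>\<^sub>m 1\<^sub>m n" by blast
    have "of_nat n * c = mat_trace (averaged n n \<rho> \<rho> a b)" by (simp add: c mat_trace_def)
    also have "\<dots> = (\<Sum>g\<in>carrier F. \<Sum>i<n. \<rho> (inv g) $$ (b,i) * \<rho> g $$ (i,a))"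
      by (subst sum.swap) (simp add: mat_trace_def averaged_def mult.commute)
    also have "\<dots> = (\<Sum>g\<in>carrier F. (1\<^sub>m n :: complex mat) $$ (b,a))"
    proof (rule sum.cong[OF refl])
      fix g assume g: "g \<in> carrier F"
      show "(\<Sum>i<n. \<rho> (inv g) $$ (b,i) * \<rho> g $$ (i,a)) = (1\<^sub>m n :: complex mat) $$ (b,a)"
        using mult_mat_index[OF hom_GL_D(1)[OF h] hom_GL_D(1)[OF h], of "inv g" g b a] g ab
          hom_GL_inv(2)[OF is_group h g] by simp
    qed
    finally have "c = (if a = b then of_nat (card (carrier F)) / of_nat n else 0)"
      using ab n by (auto simp: field_simps)
    then show ?thesis using ab by (simp add: c)
  qed
  have "(\<Sum>a<n. \<Sum>b<n. averaged n n \<rho> \<rho> a b $$ (a,b))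
    = (\<Sum>a<n. \<Sum>b<n. if a = b then of_nat (card (carrier F)) / of_nat n else 0)"
    by (intro sum.cong refl) (simp add: P)
  also have "\<dots> = of_nat (card (carrier F))" using n by simp
  finally show ?thesis by (simp add: sum_traces_averaged[OF h h])
qed

end

lemma smult_mat_mult_vec:
  assumes "A \<in> carrier_mat n m" "v \<in> carrier_vec m"
  shows "(c \<cdot>\<^sub>m A) *\<^sub>v v = c \<cdot>\<^sub>v (A *\<^sub>v (v :: 'a::comm_ring_1 vec))"
  using assms by (intro eq_vecI) auto

lemma smult_smult_mat: "a \<cdot>\<^sub>m (b \<cdot>\<^sub>m A) = (a * b :: 'a::semigroup_mult) \<cdot>\<^sub>m A"
  by (rule eq_matI) (auto simp: mult.assoc)

lemma irrep_twist:
  assumes G: "group G" and \<rho>: "irrep G n \<rho>"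
    and mult: "\<And>g h. g \<in> carrier G \<Longrightarrow> h \<in> carrier G \<Longrightarrow> \<alpha> (g \<otimes>\<^bsub>G\<^esub> h) = \<alpha> g * \<alpha> h"
    and nz: "\<And>g. g \<in> carrier G \<Longrightarrow> \<alpha> g \<noteq> 0"
  shows "irrep G n (\<lambda>g. \<alpha> g \<cdot>\<^sub>m \<rho> g)"
proof -
  interpret group G by fact
  have h: "\<rho> \<in> hom G (GL n)" using \<rho> by (simp add: irrep_def)
  note r = hom_GL_D[OF h]
  have a1: "\<alpha> \<one>\<^bsub>G\<^esub> = 1" using mult[of "\<one>\<^bsub>G\<^esub>" "\<one>\<^bsub>G\<^esub>"] nz[of "\<one>\<^bsub>G\<^esub>"] by simp
  have "(\<lambda>g. \<alpha> g \<cdot>\<^sub>m \<rho> g) \<in> hom G (GL n)"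
  proof (rule hom_GL_I[OF G])
    show "\<alpha> (g \<otimes>\<^bsub>G\<^esub> k) \<cdot>\<^sub>m \<rho> (g \<otimes>\<^bsub>G\<^esub> k) = (\<alpha> g \<cdot>\<^sub>m \<rho> g) * (\<alpha> k \<cdot>\<^sub>m \<rho> k)"
      if gk: "g \<in> carrier G" "k \<in> carrier G" for g k
      using r(1)[OF gk(1)] r(1)[OF gk(2)]
      by (simp add: mult[OF gk] r(2)[OF gk] mult_smult_distrib[of _ n n _ n] mult_smult_assoc_mat[of _ n n _ n]
          smult_smult_mat mult.commute)
    show "\<alpha> \<one>\<^bsub>G\<^esub> \<cdot>\<^sub>m \<rho> \<one>\<^bsub>G\<^esub> = 1\<^sub>m n" by (simp add: a1 hom_GL_one[OF G h]) (auto intro: eq_matI)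
  qed (use r in auto)
  moreover have "W = {0\<^sub>v n} \<or> W = carrier_vec n"
    if W: "subspace class_ring W (module_vec TYPE(complex) n)"
      and inv: "\<forall>g\<in>carrier G. \<forall>w\<in>W. (\<alpha> g \<cdot>\<^sub>m \<rho> g) *\<^sub>v w \<in> W" for W
  proof -
    note W' = W[unfolded subspace_vec]
    have "\<forall>g\<in>carrier G. \<forall>w\<in>W. \<rho> g *\<^sub>v w \<in> W"
    proof (intro ballI)
      fix g w assume g: "g \<in> carrier G" and w: "w \<in> W"
      have "(1 / \<alpha> g) \<cdot>\<^sub>v ((\<alpha> g \<cdot>\<^sub>m \<rho> g) *\<^sub>v w) \<in> W" using inv g w W' by blast
      moreover have wc: "w \<in> carrier_vec n" using w W' by auto
      ultimately show "\<rho> g *\<^sub>v w \<in> W"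
        using nz[OF g] by (simp add: smult_mat_mult_vec[OF r(1)[OF g] wc] smult_smult_assoc)
    qed
    then show ?thesis using \<rho> W unfolding irrep_def by metis
  qed
  ultimately show ?thesis using \<rho> unfolding irrep_def by blast
qed

lemma mat_trace_smult: "A \<in> carrier_mat n n \<Longrightarrow> mat_trace (c \<cdot>\<^sub>m A) = (c::'a::comm_ring_1) * mat_trace A"
  by (simp add: mat_trace_def sum_distrib_left)

lemma mat_trace_similar:
  fixes A :: "'a::comm_ring_1 mat"
  assumes P: "P \<in> carrier (GL n)" and A: "A \<in> carrier_mat n n" and B: "B \<in> carrier_mat n n"
    and eq: "P * A = B * P"
  shows "mat_trace A = mat_trace B"
proof -
  from P obtain Q where Q: "Q \<in> carrier_mat n n" "Q * P = 1\<^sub>m n" "P * Q = 1\<^sub>m n" and P': "P \<in> carrier_mat n n"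
    by (auto simp: GL_carrier)
  have "A = Q * P * A" using Q A by simp
  also have "\<dots> = Q * (B * P)" unfolding eq[symmetric] by (rule assoc_mult_mat[OF Q(1) P' A])
  finally have "mat_trace A = mat_trace (Q * (B * P))" by simp
  also have "\<dots> = mat_trace ((B * P) * Q)" using Q P' B by (intro mat_trace_mult_comm) auto
  also have "(B * P) * Q = B * (P * Q)" by (rule assoc_mult_mat[OF B P' Q(1)])
  finally show ?thesis using Q B by simp
qed

text \<open>
  Summing a character sum over all twists by \<open>X\<close> restricts it to the subgroup
  \<open>N\<close> on which all members of \<open>X\<close> are trivial. Therefore the characters of the
  \<open>\<rho> i\<close>, which are orthogonal on \<open>F\<close> even after twisting, are orthogonal
  on \<open>N\<close>. They are class functions, so their number is bounded by the number of values of
  any map \<open>cl\<close> on \<open>N\<close> that separates conjugacy classes of \<open>F\<close>. The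
  members of \<open>X\<close> are extended by zero outside \<open>F\<close>, which makes equality of
  characters the same as equality of functions.
\<close>

lemma (in finite_group) twist_classes_le_conjugacy_classes:
  fixes X :: "('a \<Rightarrow> complex) set" and \<rho> :: "'i \<Rightarrow> 'a \<Rightarrow> complex mat"
  assumes finX: "finite X"
    and one: "(\<lambda>g. if g \<in> carrier F then 1 else 0) \<in> X"
    and closed: "\<And>\<alpha> \<beta>. \<alpha> \<in> X \<Longrightarrow> \<beta> \<in> X \<Longrightarrow> (\<lambda>g. \<alpha> g * \<beta> g) \<in> X"
    and mult: "\<And>\<alpha> g h. \<alpha> \<in> X \<Longrightarrow> g \<in> carrier F \<Longrightarrow> h \<in> carrier F \<Longrightarrow> \<alpha> (g \<otimes> h) = \<alpha> g * \<alpha> h"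
    and nz: "\<And>\<alpha> g. \<alpha> \<in> X \<Longrightarrow> g \<in> carrier F \<Longrightarrow> \<alpha> g \<noteq> 0"
    and out: "\<And>\<alpha> g. \<alpha> \<in> X \<Longrightarrow> g \<notin> carrier F \<Longrightarrow> \<alpha> g = 0"
  defines "N \<equiv> {g \<in> carrier F. \<forall>\<alpha>\<in>X. \<alpha> g = 1}"
  assumes finI: "finite I" and irr: "\<And>i. i \<in> I \<Longrightarrow> irrep F (n i) (\<rho> i)"
    and inequiv: "\<And>i j \<alpha>. i \<in> I \<Longrightarrow> j \<in> I \<Longrightarrow> i \<noteq> j \<Longrightarrow> \<alpha> \<in> X \<Longrightarrow> n i = n j \<Longrightarrow>
       \<not> (\<exists>P\<in>carrier (GL (n j)). \<forall>g\<in>carrier F. P * \<rho> j g = (\<alpha> g \<cdot>\<^sub>m \<rho> i g) * P)"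
    and conj: "\<And>g h. g \<in> N \<Longrightarrow> h \<in> N \<Longrightarrow> cl g = cl h \<Longrightarrow> \<exists>x\<in>carrier F. x \<otimes> g \<otimes> inv x = h"
  shows "card I \<le> card (cl ` N)"
proof (rule biorthogonal_card_le)
  have finN: "finite N" using fin by (simp add: N_def)
  then show "finite (cl ` N)" by simp
  show "finite I" by fact
  have sumX: "(\<Sum>\<alpha>\<in>X. \<alpha> g) = (if g \<in> N then of_nat (card X) else 0)" if g: "g \<in> carrier F" for g
  proof (cases "g \<in> N")
    case True
    then have "(\<Sum>\<alpha>\<in>X. \<alpha> g) = (\<Sum>\<alpha>\<in>X. 1)" by (intro sum.cong) (auto simp: N_def)
    with True show ?thesis by simp
  next
    case False
    \<comment> \<open>Multiplication by \<open>\<beta>\<close> permutes \<open>X\<close>, so the sum is equal to \<open>\<beta> g\<close> times itself.\<close>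
    then obtain \<beta> where \<beta>: "\<beta> \<in> X" "\<beta> g \<noteq> 1" using g by (auto simp: N_def)
    define T where "T \<alpha> = (\<lambda>g. \<beta> g * \<alpha> g)" for \<alpha>
    have "inj_on T X"
    proof (rule inj_onI)
      fix \<alpha> \<alpha>' assume a: "\<alpha> \<in> X" "\<alpha>' \<in> X" "T \<alpha> = T \<alpha>'"
      show "\<alpha> = \<alpha>'"
      proof
        fix x show "\<alpha> x = \<alpha>' x"
          using fun_cong[OF a(3), of x] nz[OF \<beta>(1), of x] out[OF a(1), of x] out[OF a(2), of x]
          by (cases "x \<in> carrier F") (auto simp: T_def)
      qed
    qed
    moreover have "T ` X \<subseteq> X" using closed \<beta> by (auto simp: T_def)
    ultimately have "T ` X = X" using finX by (simp add: endo_inj_surj)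
    with \<open>inj_on T X\<close> have "bij_betw T X X" by (simp add: bij_betw_def)
    then have "(\<Sum>\<alpha>\<in>X. \<alpha> g) = (\<Sum>\<alpha>\<in>X. T \<alpha> g)" by (rule sum.reindex_bij_betw[symmetric])
    also have "\<dots> = \<beta> g * (\<Sum>\<alpha>\<in>X. \<alpha> g)" by (simp add: T_def sum_distrib_left)
    finally have "(1 - \<beta> g) * (\<Sum>\<alpha>\<in>X. \<alpha> g) = 0" by (simp add: algebra_simps)
    with \<beta> False show ?thesis by simp
  qed
  have cX: "card X > 0" using finX one by (auto simp: card_gt_0_iff)
  define rep where "rep c = (SOME g. g \<in> N \<and> cl g = c)" for c
  have rep: "rep (cl g) \<in> N \<and> cl (rep (cl g)) = cl g" if "g \<in> N" for g
    unfolding rep_def by (rule someI[of _ g]) (use that in auto)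
  define tr where "tr i g = mat_trace (\<rho> i g)" for i g
  define a where "a i c = tr i (rep c)" for i c
  define b where "b c i = (\<Sum>g\<in>{g\<in>N. cl g = c}. tr i (inv g))" for c i
  have h: "\<rho> i \<in> hom F (GL (n i))" if "i \<in> I" for i using irr[OF that] by (simp add: irrep_def)
  have tr_conj: "tr i (x \<otimes> g \<otimes> inv x) = tr i g" if i: "i \<in> I" and g: "g \<in> carrier F" and x: "x \<in> carrier F" for i g x
    unfolding tr_def
  proof (rule mat_trace_similar[symmetric])
    show "\<rho> i x \<in> carrier (GL (n i))" using h[OF i] x by (auto simp: hom_def)
    have "x \<otimes> g = (x \<otimes> g \<otimes> inv x) \<otimes> x" using g x by (simp add: m_assoc)
    then show "\<rho> i x * \<rho> i g = \<rho> i (x \<otimes> g \<otimes> inv x) * \<rho> i x"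
      using hom_GL_D(2)[OF h[OF i]] g x by (metis inv_closed m_closed)
  qed (use hom_GL_D(1)[OF h[OF i]] g x in auto)
  have pair: "(\<Sum>c\<in>cl ` N. a i c * b c j) = (\<Sum>g\<in>N. tr i g * tr j (inv g))" if i: "i \<in> I" for i j
  proof -
    have "(\<Sum>c\<in>cl ` N. a i c * b c j) = (\<Sum>c\<in>cl ` N. \<Sum>g\<in>{g\<in>N. cl g = c}. tr i g * tr j (inv g))"
    proof (rule sum.cong[OF refl])
      fix c assume "c \<in> cl ` N"
      then have rc: "rep c \<in> N" "cl (rep c) = c" using rep by auto
      have "tr i g = a i c" if g: "g \<in> N" "cl g = c" for g
      proof -
        from conj[OF rc(1) g(1)] rc g obtain x where x: "x \<in> carrier F" "x \<otimes> rep c \<otimes> inv x = g" by auto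
        have "rep c \<in> carrier F" using rc by (simp add: N_def)
        from tr_conj[OF i this x(1)] x(2) show ?thesis by (simp add: a_def)
      qed
      then show "a i c * b c j = (\<Sum>g\<in>{g\<in>N. cl g = c}. tr i g * tr j (inv g))"
        by (simp add: b_def sum_distrib_left)
    qed
    also have "\<dots> = (\<Sum>g\<in>N. tr i g * tr j (inv g))" by (rule sum.image_gen[OF finN, symmetric])
    finally show ?thesis .
  qed
  have pairX: "of_nat (card X) * (\<Sum>g\<in>N. tr i g * tr j (inv g))
     = (\<Sum>\<alpha>\<in>X. \<Sum>g\<in>carrier F. mat_trace (\<alpha> g \<cdot>\<^sub>m \<rho> i g) * mat_trace (\<rho> j (inv g)))"
    if i: "i \<in> I" for i j
  proof -
    have "(\<Sum>\<alpha>\<in>X. \<Sum>g\<in>carrier F. mat_trace (\<alpha> g \<cdot>\<^sub>m \<rho> i g) * mat_trace (\<rho> j (inv g)))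
      = (\<Sum>g\<in>carrier F. \<Sum>\<alpha>\<in>X. \<alpha> g * (tr i g * tr j (inv g)))"
      by (subst sum.swap) (intro sum.cong refl,
          simp add: mat_trace_smult[OF hom_GL_D(1)[OF h[OF i]]] tr_def mult.assoc)
    also have "\<dots> = (\<Sum>g\<in>carrier F. if g \<in> N then of_nat (card X) * (tr i g * tr j (inv g)) else 0)"
      by (intro sum.cong refl) (simp add: sum_distrib_right[symmetric] sumX)
    also have "\<dots> = (\<Sum>g\<in>N. of_nat (card X) * (tr i g * tr j (inv g)))"
      by (rule sum.mono_neutral_cong_right) (use fin in \<open>auto simp: N_def\<close>)
    finally show ?thesis by (simp add: sum_distrib_left)
  qed
  have irrX: "irrep F (n i) (\<lambda>g. \<alpha> g \<cdot>\<^sub>m \<rho> i g)" if "i \<in> I" "\<alpha> \<in> X" for i \<alpha>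
    by (rule irrep_twist[OF is_group irr[OF that(1)]]) (use mult nz that in auto)
  show "(\<Sum>c\<in>cl ` N. a i c * b c j) = 0" if ij: "i \<in> I" "j \<in> I" "i \<noteq> j" for i j
  proof -
    have "(\<Sum>\<alpha>\<in>X. \<Sum>g\<in>carrier F. mat_trace (\<alpha> g \<cdot>\<^sub>m \<rho> i g) * mat_trace (\<rho> j (inv g))) = 0"
      by (intro sum.neutral ballI characters_orthogonal[OF irrX irr]) (use ij inequiv in auto)
    with pairX[OF ij(1), of j] cX show ?thesis by (simp add: pair[OF ij(1)])
  qed
  show "(\<Sum>c\<in>cl ` N. a i c * b c i) \<noteq> 0" if i: "i \<in> I" for i
  proof -
    \<comment> \<open>The diagonal term: each \<open>s \<alpha>\<close> is zero or the group order, and the trivial twist contributes the latter.\<close>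
    define s where "s \<alpha> = (\<Sum>g\<in>carrier F. mat_trace (\<alpha> g \<cdot>\<^sub>m \<rho> i g) * mat_trace (\<rho> i (inv g)))" for \<alpha>
    have s: "s \<alpha> = of_nat (card (carrier F))"
      if P: "P \<in> carrier (GL (n i))" "\<forall>g\<in>carrier F. P * \<rho> i g = (\<alpha> g \<cdot>\<^sub>m \<rho> i g) * P" for \<alpha> P
    proof -
      have "s \<alpha> = (\<Sum>g\<in>carrier F. mat_trace (\<rho> i g) * mat_trace (\<rho> i (inv g)))"
        unfolding s_def
      proof (rule sum.cong[OF refl])
        fix g assume g: "g \<in> carrier F"
        have "mat_trace (\<rho> i g) = mat_trace (\<alpha> g \<cdot>\<^sub>m \<rho> i g)"
          using hom_GL_D(1)[OF h[OF i] g] P g by (intro mat_trace_similar[OF P(1)]) auto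
        then show "mat_trace (\<alpha> g \<cdot>\<^sub>m \<rho> i g) * mat_trace (\<rho> i (inv g))
           = mat_trace (\<rho> i g) * mat_trace (\<rho> i (inv g))" by simp
      qed
      then show ?thesis by (simp add: character_norm[OF irr[OF i]])
    qed
    have s0: "s \<alpha> = of_nat (card (carrier F)) \<or> s \<alpha> = 0" if \<alpha>: "\<alpha> \<in> X" for \<alpha>
    proof (cases "\<exists>P\<in>carrier (GL (n i)). \<forall>g\<in>carrier F. P * \<rho> i g = (\<alpha> g \<cdot>\<^sub>m \<rho> i g) * P")
      case True
      then show ?thesis using s by blast
    next
      case False
      then show ?thesis unfolding s_def using characters_orthogonal[OF irrX[OF i \<alpha>] irr[OF i]] by blast
    qed
    let ?e = "\<lambda>g. if g \<in> carrier F then 1 else (0::complex)"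
    have "1\<^sub>m (n i) \<in> carrier (GL (n i) :: complex mat monoid)" using group.is_monoid[OF group_GL] 
      monoid.one_closed by (metis GL_one)
    moreover have "\<forall>g\<in>carrier F. 1\<^sub>m (n i) * \<rho> i g = (?e g \<cdot>\<^sub>m \<rho> i g) * 1\<^sub>m (n i)"
    proof
      fix g assume g: "g \<in> carrier F"
      have r: "\<rho> i g \<in> carrier_mat (n i) (n i)" by (rule hom_GL_D(1)[OF h[OF i] g])
      have "(1::complex) \<cdot>\<^sub>m \<rho> i g = \<rho> i g" by (rule eq_matI) auto
      then show "1\<^sub>m (n i) * \<rho> i g = (?e g \<cdot>\<^sub>m \<rho> i g) * 1\<^sub>m (n i)" using g r by simp
    qed
    ultimately have s1: "s ?e = of_nat (card (carrier F))" by (rule s)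
    have "\<exists>m. s \<alpha> = of_nat m" if "\<alpha> \<in> X" for \<alpha> using s0[OF that] by (metis of_nat_0)
    then obtain m where m: "\<And>\<alpha>. \<alpha> \<in> X \<Longrightarrow> s \<alpha> = of_nat (m \<alpha>)" by metis
    have "(\<Sum>\<alpha>\<in>X. s \<alpha>) = of_nat (\<Sum>\<alpha>\<in>X. m \<alpha>)" by (simp add: m)
    moreover have "m ?e = card (carrier F)" using m[OF one] s1 by simp
    then have "m ?e > 0" using fin by (auto simp: card_gt_0_iff)
    then have "(\<Sum>\<alpha>\<in>X. m \<alpha>) > 0" using finX one by (metis gr_zeroI sum_eq_0_iff)
    ultimately have "(\<Sum>\<alpha>\<in>X. s \<alpha>) \<noteq> 0" by (metis of_nat_eq_0_iff less_not_refl)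
    then show ?thesis using pairX[OF i, of i] cX unfolding pair[OF i] s_def by auto
  qed
qed

section \<open>Irreducible representations containing a given character of a subgroup\<close>

lemma injective_mat_le:
  fixes B :: "'a::field mat"
  assumes B: "B \<in> carrier_mat n k" and inj: "\<And>x. x \<in> carrier_vec k \<Longrightarrow> B *\<^sub>v x = 0\<^sub>v n \<Longrightarrow> x = 0\<^sub>v k"
  shows "k \<le> n"
proof (rule ccontr)
  assume "\<not> k \<le> n"
  with nontrivial_relation[of "{..<n}" "{..<k}" "\<lambda>i j. B $$ (j,i)"]
  obtain c where c: "\<exists>i<k. c i \<noteq> 0" "\<forall>j<n. (\<Sum>i<k. c i * B $$ (j,i)) = 0" by auto
  have "B *\<^sub>v vec k c = 0\<^sub>v n"
  proof (rule eq_vecI)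
    fix i assume "i < dim_vec (0\<^sub>v n :: 'a vec)"
    then have i: "i < n" by simp
    then show "(B *\<^sub>v vec k c) $ i = 0\<^sub>v n $ i"
      using c(2) by (simp add: mult_mat_vec_index[OF B _ i] mult.commute)
  qed (use B in auto)
  from inj[OF _ this] have "vec k c = 0\<^sub>v k" by simp
  then have "c i = 0" if "i < k" for i using that by (metis index_vec index_zero_vec(1))
  with c(1) show False by auto
qed

lemma injective_mat_append:
  fixes B :: "'a::field mat"
  assumes B: "B \<in> carrier_mat n k" and inj: "\<And>x. x \<in> carrier_vec k \<Longrightarrow> B *\<^sub>v x = 0\<^sub>v n \<Longrightarrow> x = 0\<^sub>v k"
    and w: "w \<in> carrier_vec n" "\<And>x. x \<in> carrier_vec k \<Longrightarrow> B *\<^sub>v x \<noteq> w"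
  shows "\<exists>B'\<in>carrier_mat n (Suc k). \<forall>x\<in>carrier_vec (Suc k).
    B' *\<^sub>v x = B *\<^sub>v vec k (\<lambda>i. x $ i) + x $ k \<cdot>\<^sub>v w \<and> (B' *\<^sub>v x = 0\<^sub>v n \<longrightarrow> x = 0\<^sub>v (Suc k))"
proof -
  define B' where "B' = mat n (Suc k) (\<lambda>(i,j). if j < k then B $$ (i,j) else w $ i)"
  have B': "B' \<in> carrier_mat n (Suc k)" by (simp add: B'_def)
  have e: "B' *\<^sub>v x = B *\<^sub>v vec k (\<lambda>i. x $ i) + x $ k \<cdot>\<^sub>v w" if x: "x \<in> carrier_vec (Suc k)" for x
  proof (rule eq_vecI)
    fix i assume "i < dim_vec (B *\<^sub>v vec k (\<lambda>i. x $ i) + x $ k \<cdot>\<^sub>v w)"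
    then have i: "i < n" using w by simp
    show "(B' *\<^sub>v x) $ i = (B *\<^sub>v vec k (\<lambda>i. x $ i) + x $ k \<cdot>\<^sub>v w) $ i"
      unfolding mult_mat_vec_index[OF B' x i]
      using i w B by (simp add: mult_mat_vec_index[OF B _ i] B'_def mult.commute del: index_mult_mat_vec)
  qed (use w B in \<open>auto simp: B'_def\<close>)
  have "x = 0\<^sub>v (Suc k)" if x: "x \<in> carrier_vec (Suc k)" and z: "B' *\<^sub>v x = 0\<^sub>v n" for x
  proof -
    let ?y = "vec k (\<lambda>i. x $ i)"
    have sum0: "B *\<^sub>v ?y + x $ k \<cdot>\<^sub>v w = 0\<^sub>v n" using e[OF x] z by simp
    have xk: "x $ k = 0"
    proof (rule ccontr)
      assume nz: "x $ k \<noteq> 0"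
      have "B *\<^sub>v ((- 1 / x $ k) \<cdot>\<^sub>v ?y) = w"
      proof (rule eq_vecI)
        fix i assume "i < dim_vec w"
        then have i: "i < n" using w by simp
        have "(B *\<^sub>v ?y + x $ k \<cdot>\<^sub>v w) $ i = 0" using sum0 i by simp
        then have "(B *\<^sub>v ?y) $ i = - (x $ k * w $ i)" using i w B by (simp add: eq_neg_iff_add_eq_0 del: index_mult_mat_vec)
        then show "(B *\<^sub>v ((- 1 / x $ k) \<cdot>\<^sub>v ?y)) $ i = w $ i"
          using nz i B by (simp add: mult_mat_vec[OF B] del: index_mult_mat_vec)
      qed (use B w in auto)
      with w(2) show False by simp
    qed
    have zw: "0 \<cdot>\<^sub>v w = 0\<^sub>v n" using w by (intro eq_vecI) auto
    have "B *\<^sub>v ?y = 0\<^sub>v n" using sum0 xk w B zw by simp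
    from inj[OF _ this] have y0: "?y = 0\<^sub>v k" by simp
    have "x $ i = 0" if "i < k" for i using arg_cong[OF y0, of "\<lambda>v. v $ i"] that by simp
    then show ?thesis using x xk by (intro eq_vecI) (auto simp: less_Suc_eq)
  qed
  with B' e show ?thesis by blast
qed

text \<open>
  Here representations are given by matrices, so an invariant subspace must be identified with some
  \<open>\<complex>\<^sup>k\<close> before it becomes a representation. The columns of \<open>B\<close>
  are a basis of \<open>W\<close>, found as a largest injective matrix with columns in \<open>W\<close>.
\<close>

lemma subspace_as_image:
  fixes W :: "'a::field vec set"
  assumes W: "W \<subseteq> carrier_vec n" "0\<^sub>v n \<in> W" "\<And>v w. v \<in> W \<Longrightarrow> w \<in> W \<Longrightarrow> v + w \<in> W"
    "\<And>c v. v \<in> W \<Longrightarrow> c \<cdot>\<^sub>v v \<in> W"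
  shows "\<exists>k B. B \<in> carrier_mat n k \<and> k \<le> n \<and> W = (\<lambda>x. B *\<^sub>v x) ` carrier_vec k \<and>
    (\<forall>x\<in>carrier_vec k. B *\<^sub>v x = 0\<^sub>v n \<longrightarrow> x = 0\<^sub>v k) \<and> (k = n \<longrightarrow> W = carrier_vec n)"
proof -
  define Q where "Q k \<longleftrightarrow> (\<exists>B\<in>carrier_mat n k. (\<forall>x\<in>carrier_vec k. B *\<^sub>v x \<in> W \<and> (B *\<^sub>v x = 0\<^sub>v n \<longrightarrow> x = 0\<^sub>v k)))"
    for k
  have "Q 0" unfolding Q_def
  proof (intro bexI[of _ "0\<^sub>m n 0"] ballI conjI impI)
    fix x :: "'a vec" assume x: "x \<in> carrier_vec 0"
    show "x = 0\<^sub>v 0" using x by (intro eq_vecI) auto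
    show "0\<^sub>m n 0 *\<^sub>v x \<in> W" using W(2) x by (simp add: zero_mult_mat_vec)
  qed simp
  have bound: "\<forall>k. Q k \<longrightarrow> k \<le> n" unfolding Q_def by (intro allI impI, elim bexE, rule injective_mat_le) auto
  define k where "k = Greatest Q"
  have k: "Q k" "\<And>j. Q j \<Longrightarrow> j \<le> k"
    unfolding k_def using GreatestI_nat[of Q 0 n] Greatest_le_nat[of Q _ n] \<open>Q 0\<close> bound by simp_all
  from k(1) obtain B where B: "B \<in> carrier_mat n k" "\<And>x. x \<in> carrier_vec k \<Longrightarrow> B *\<^sub>v x \<in> W"
    "\<And>x. x \<in> carrier_vec k \<Longrightarrow> B *\<^sub>v x = 0\<^sub>v n \<Longrightarrow> x = 0\<^sub>v k" unfolding Q_def by blast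
  have surj: "w \<in> (\<lambda>x. B *\<^sub>v x) ` carrier_vec k" if w: "w \<in> W" for w
  proof (rule ccontr)
    assume "w \<notin> (\<lambda>x. B *\<^sub>v x) ` carrier_vec k"
    then have nw: "B *\<^sub>v x \<noteq> w" if "x \<in> carrier_vec k" for x using that by blast
    have wc: "w \<in> carrier_vec n" using w W(1) by auto
    obtain B' where B': "B' \<in> carrier_mat n (Suc k)"
      "\<And>x. x \<in> carrier_vec (Suc k) \<Longrightarrow> B' *\<^sub>v x = B *\<^sub>v vec k (\<lambda>i. x $ i) + x $ k \<cdot>\<^sub>v w"
      "\<And>x. x \<in> carrier_vec (Suc k) \<Longrightarrow> B' *\<^sub>v x = 0\<^sub>v n \<Longrightarrow> x = 0\<^sub>v (Suc k)"
      using injective_mat_append[OF B(1) B(3) wc nw] by metis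
    have "Q (Suc k)" unfolding Q_def
    proof (intro bexI[of _ B'] ballI conjI impI)
      fix x :: "'a vec" assume x: "x \<in> carrier_vec (Suc k)"
      show "B' *\<^sub>v x \<in> W" unfolding B'(2)[OF x] by (intro W(3) B(2) W(4) w) simp
      show "B' *\<^sub>v x = 0\<^sub>v n \<Longrightarrow> x = 0\<^sub>v (Suc k)" by (rule B'(3)[OF x])
    qed (rule B'(1))
    with k(2) show False by force
  qed
  have full: "W = carrier_vec n" if kn: "k = n"
  proof (rule ccontr)
    assume "W \<noteq> carrier_vec n"
    then obtain w where w: "w \<in> carrier_vec n" "w \<notin> W" using W(1) by auto
    then have nw: "B *\<^sub>v x \<noteq> w" if "x \<in> carrier_vec k" for x using B(2)[OF that] by auto
    obtain B' where B': "B' \<in> carrier_mat n (Suc k)"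
      "\<And>x. x \<in> carrier_vec (Suc k) \<Longrightarrow> B' *\<^sub>v x = B *\<^sub>v vec k (\<lambda>i. x $ i) + x $ k \<cdot>\<^sub>v w"
      "\<And>x. x \<in> carrier_vec (Suc k) \<Longrightarrow> B' *\<^sub>v x = 0\<^sub>v n \<Longrightarrow> x = 0\<^sub>v (Suc k)"
      using injective_mat_append[OF B(1) B(3) w(1) nw] by metis
    have "Suc k \<le> n" by (rule injective_mat_le[OF B'(1,3)])
    with kn show False by simp
  qed
  have "k \<le> n" using bound k(1) by simp
  moreover have "W = (\<lambda>x. B *\<^sub>v x) ` carrier_vec k" using surj B(2) by auto
  ultimately show ?thesis using B(1,3) full by blast
qed

lemma injective_mat_cancel:
  fixes B :: "'a::field mat"
  assumes B: "B \<in> carrier_mat n k" and inj: "\<And>x. x \<in> carrier_vec k \<Longrightarrow> B *\<^sub>v x = 0\<^sub>v n \<Longrightarrow> x = 0\<^sub>v k"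
    and XY: "X \<in> carrier_mat k m" "Y \<in> carrier_mat k m" and eq: "B * X = B * Y"
  shows "X = Y"
proof (rule mat_eqI_vec[OF XY])
  fix v :: "'a vec" assume v: "v \<in> carrier_vec m"
  have "B *\<^sub>v (X *\<^sub>v v) = (B * X) *\<^sub>v v" using B XY v by simp
  also have "\<dots> = B *\<^sub>v (Y *\<^sub>v v)" using B XY v by (simp add: eq)
  finally have "B *\<^sub>v (X *\<^sub>v v - Y *\<^sub>v v) = 0\<^sub>v n"
    using B XY v by (simp add: mult_minus_distrib_mat_vec[OF B])
  from inj[OF _ this] have z: "X *\<^sub>v v - Y *\<^sub>v v = 0\<^sub>v k" using XY v by simp
  show "X *\<^sub>v v = Y *\<^sub>v v"
  proof (rule eq_vecI)
    fix i assume "i < dim_vec (Y *\<^sub>v v)"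
    then show "(X *\<^sub>v v) $ i = (Y *\<^sub>v v) $ i"
      using arg_cong[OF z, of "\<lambda>u. u $ i"] XY v by (auto simp del: index_mult_mat_vec)
  qed (use XY in auto)
qed

text \<open>
  \<open>M g\<close> is determined by \<open>\<rho> g * B = B * M g\<close>, because \<open>B\<close> is
  injective; this also makes \<open>M\<close> multiplicative.
\<close>

lemma restrict_to_subspace:
  assumes G: "group G" and \<rho>: "\<rho> \<in> hom G (GL n)"
    and B: "B \<in> carrier_mat n k" and inj: "\<And>x. x \<in> carrier_vec k \<Longrightarrow> B *\<^sub>v x = 0\<^sub>v n \<Longrightarrow> x = 0\<^sub>v k"
    and inv: "\<And>g x. g \<in> carrier G \<Longrightarrow> x \<in> carrier_vec k \<Longrightarrow> \<exists>y\<in>carrier_vec k. \<rho> g *\<^sub>v (B *\<^sub>v x) = B *\<^sub>v (y :: 'a::field vec)"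
  shows "\<exists>M \<in> hom G (GL k). \<forall>g\<in>carrier G. \<rho> g * B = B * M g"
proof -
  interpret group G by fact
  note r = hom_GL_D[OF \<rho>]
  have "\<exists>M\<in>carrier_mat k k. \<rho> g * B = B * M" if g: "g \<in> carrier G" for g
  proof -
    have "\<forall>j. \<exists>y. y \<in> carrier_vec k \<and> \<rho> g *\<^sub>v (B *\<^sub>v unit_vec k j) = B *\<^sub>v y" using inv[OF g] by (meson unit_vec_carrier)
    then obtain y where y: "\<And>j. y j \<in> carrier_vec k" "\<And>j. \<rho> g *\<^sub>v (B *\<^sub>v unit_vec k j) = B *\<^sub>v y j" by metis
    define M where "M = mat_of_cols k (map y [0..<k])"
    have M: "M \<in> carrier_mat k k" by (auto simp: M_def)
    have "\<rho> g * B = B * M"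
    proof (rule eq_matI)
      fix i j assume "i < dim_row (B * M)" "j < dim_col (B * M)"
      then have ij: "i < n" "j < k" using B M by auto
      have "(\<rho> g * B) $$ (i,j) = (\<rho> g *\<^sub>v col B j) $ i" using ij B r(1)[OF g] by simp
      also have "col B j = B *\<^sub>v unit_vec k j" using ij B by (simp add: mult_unit_vec[OF B])
      also have "\<rho> g *\<^sub>v (B *\<^sub>v unit_vec k j) = B *\<^sub>v col M j" using y ij by (simp add: M_def col_mat_of_cols)
      also have "(B *\<^sub>v col M j) $ i = (B * M) $$ (i,j)" using ij B M by simp
      finally show "(\<rho> g * B) $$ (i,j) = (B * M) $$ (i,j)" .
    qed (use r(1)[OF g] B M in auto)
    with M show ?thesis by blast
  qed
  then obtain M where M: "\<And>g. g \<in> carrier G \<Longrightarrow> M g \<in> carrier_mat k k"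
    "\<And>g. g \<in> carrier G \<Longrightarrow> \<rho> g * B = B * M g" by metis
  have "M \<in> hom G (GL k)"
  proof (rule hom_GL_I[OF G])
    show "M (g \<otimes>\<^bsub>G\<^esub> h) = M g * M h" if gh: "g \<in> carrier G" "h \<in> carrier G" for g h
    proof (rule injective_mat_cancel[OF B inj])
      have "B * M (g \<otimes>\<^bsub>G\<^esub> h) = \<rho> (g \<otimes>\<^bsub>G\<^esub> h) * B" using M(2) gh by simp
      also have "\<dots> = \<rho> g * (\<rho> h * B)" unfolding r(2)[OF gh]
        by (rule assoc_mult_mat[OF r(1)[OF gh(1)] r(1)[OF gh(2)] B])
      also have "\<dots> = (\<rho> g * B) * M h" unfolding M(2)[OF gh(2)] 
        by (rule assoc_mult_mat[OF r(1)[OF gh(1)] B M(1)[OF gh(2)], symmetric])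
      also have "\<dots> = B * (M g * M h)" unfolding M(2)[OF gh(1)]
        by (rule assoc_mult_mat[OF B M(1)[OF gh(1)] M(1)[OF gh(2)]])
      finally show "B * M (g \<otimes>\<^bsub>G\<^esub> h) = B * (M g * M h)" .
      show "M (g \<otimes>\<^bsub>G\<^esub> h) \<in> carrier_mat k k" using gh by (intro M(1)) simp
      show "M g * M h \<in> carrier_mat k k" by (rule mult_carrier_mat[OF M(1)[OF gh(1)] M(1)[OF gh(2)]])
    qed
    show "M \<one>\<^bsub>G\<^esub> = 1\<^sub>m k"
    proof (rule injective_mat_cancel[OF B inj])
      show "B * M \<one>\<^bsub>G\<^esub> = B * 1\<^sub>m k" using B hom_GL_one[OF G \<rho>] by (simp add: M(2)[symmetric])
      show "M \<one>\<^bsub>G\<^esub> \<in> carrier_mat k k" by (intro M(1)) simp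
    qed auto
  qed (use M in auto)
  with M(2) show ?thesis by blast
qed

text \<open>
  A representative is chosen from \<open>R0\<close> in a way that depends only on the coset.
\<close>

lemma (in group) left_transversal_within:
  assumes H: "subgroup H G" and fin: "finite R0" and sub: "R0 \<subseteq> carrier G"
    and cover: "\<And>g. g \<in> carrier G \<Longrightarrow> \<exists>r\<in>R0. inv r \<otimes> g \<in> H"
  shows "\<exists>R\<subseteq>R0. \<forall>g\<in>carrier G. \<exists>!r. r \<in> R \<and> inv r \<otimes> g \<in> H"
proof -
  interpret H: subgroup H G by fact
  have trans: "inv r \<otimes> h \<in> H" if "inv r \<otimes> g \<in> H" "inv g \<otimes> h \<in> H" "r \<in> carrier G" "g \<in> carrier G" "h \<in> carrier G" for r g h
  proof -
    have "(inv r \<otimes> g) \<otimes> (inv g \<otimes> h) \<in> H" using that(1,2) by (rule H.m_closed)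
    moreover have "g \<otimes> (inv g \<otimes> h) = h" using that(4,5) by (simp add: m_assoc[symmetric])
    ultimately show ?thesis using that(3-5) by (simp add: m_assoc)
  qed
  have sym: "inv h \<otimes> g \<in> H" if "inv g \<otimes> h \<in> H" "g \<in> carrier G" "h \<in> carrier G" for g h
    using H.m_inv_closed[OF that(1)] that by (simp add: inv_mult_group)
  define f where "f g = (SOME r. r \<in> {r \<in> R0. inv r \<otimes> g \<in> H})" for g
  have f: "f g \<in> R0 \<and> inv (f g) \<otimes> g \<in> H" if "g \<in> carrier G" for g
    using someI_ex[of "\<lambda>r. r \<in> {r \<in> R0. inv r \<otimes> g \<in> H}"] cover[OF that] unfolding f_def by blast
  have f_eq: "f g = f h" if "inv g \<otimes> h \<in> H" "g \<in> carrier G" "h \<in> carrier G" for g h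
  proof -
    have "{r \<in> R0. inv r \<otimes> g \<in> H} = {r \<in> R0. inv r \<otimes> h \<in> H}"
      using trans[of _ g h] trans[of _ h g] sym[of g h] that sub by blast
    then show ?thesis by (simp add: f_def)
  qed
  show ?thesis
  proof (intro exI[of _ "f ` carrier G"] conjI ballI)
    show "f ` carrier G \<subseteq> R0" using f by auto
    show "\<exists>!r. r \<in> f ` carrier G \<and> inv r \<otimes> g \<in> H" if g: "g \<in> carrier G" for g
    proof (rule ex1I[of _ "f g"])
      show "f g \<in> f ` carrier G \<and> inv (f g) \<otimes> g \<in> H" using f g by auto
      fix r assume r: "r \<in> f ` carrier G \<and> inv r \<otimes> g \<in> H"
      then obtain k where k: "k \<in> carrier G" "r = f k" by auto
      have rc: "r \<in> carrier G" using f k sub by auto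
      have "inv k \<otimes> g \<in> H" using trans[of k r g] sym[of r k] f[OF k(1)] k r rc g by auto
      then show "r = f g" using f_eq[of k g] k g by simp
    qed
  qed
qed

text \<open>
  The monomial matrices of the representation induced from \<open>\<theta>\<close>, with respect to the
  transversal \<open>R\<close>. The functional \<open>\<phi>\<close> is the coordinate that belongs to
  the coset \<open>H\<close>. The last property says that the translates of \<open>\<phi>\<close> span
  the dual space; it is kept because it passes to subrepresentations.
\<close>

lemma (in group) induced_representation:
  assumes H: "subgroup H G" and mult: "\<And>a b. a \<in> H \<Longrightarrow> b \<in> H \<Longrightarrow> \<theta> (a \<otimes> b) = \<theta> a * (\<theta> b :: complex)"
    and one: "\<theta> \<one> = 1"
    and R: "finite R" "R \<subseteq> carrier G" "\<And>g. g \<in> carrier G \<Longrightarrow> \<exists>!r. r \<in> R \<and> inv r \<otimes> g \<in> H"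
  shows "\<exists>\<rho> \<phi>. \<rho> \<in> hom G (GL (card R)) \<and> \<phi> \<in> carrier_vec (card R) \<and> card R > 0
    \<and> (\<forall>b\<in>H. \<forall>x\<in>carrier_vec (card R). \<phi> \<bullet> (\<rho> b *\<^sub>v x) = \<theta> b * (\<phi> \<bullet> x))
    \<and> (\<forall>x\<in>carrier_vec (card R). (\<forall>g\<in>carrier G. \<phi> \<bullet> (\<rho> g *\<^sub>v x) = 0) \<longrightarrow> x = 0\<^sub>v (card R))"
proof -
  interpret H: subgroup H G by fact
  define N where "N = card R"
  obtain e where e: "bij_betw e {0..<N} R" using ex_bij_betw_nat_finite[OF R(1)] by (auto simp: N_def)
  have eR: "e i \<in> R" "e i \<in> carrier G" if "i < N" for i
  proof -
    show "e i \<in> R" using e that by (force simp: bij_betw_def)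
    then show "e i \<in> carrier G" using R(2) by auto
  qed
  have e_inj: "i = j" if "e i = e j" "i < N" "j < N" for i j
    using e that by (auto simp: bij_betw_def inj_on_def)
  have ex: "\<exists>k. k < N \<and> inv (e k) \<otimes> g \<in> H" if g: "g \<in> carrier G" for g
  proof -
    from R(3)[OF g] obtain r where r: "r \<in> R" "inv r \<otimes> g \<in> H" by blast
    from r(1) obtain k where "k < N" "e k = r" using e by (auto simp: bij_betw_def)
    with r(2) show ?thesis by blast
  qed
  define idx where "idx g = (SOME k. k < N \<and> inv (e k) \<otimes> g \<in> H)" for g
  have idx: "idx g < N" "inv (e (idx g)) \<otimes> g \<in> H" if "g \<in> carrier G" for g
    using someI_ex[OF ex[OF that]] by (auto simp: idx_def)
  have idx_unique: "l = idx g" if "g \<in> carrier G" "l < N" "inv (e l) \<otimes> g \<in> H" for g l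
  proof -
    have "e l = e (idx g)" using R(3)[OF that(1)] eR(1)[OF that(2)] eR(1)[OF idx(1)[OF that(1)]] that(3) idx(2)[OF that(1)] by blast
    then show ?thesis by (rule e_inj[OF _ that(2) idx(1)[OF that(1)]])
  qed
  have e_unique: "i = j" if "i < N" "j < N" "inv (e i) \<otimes> e j \<in> H" for i j
    using idx_unique[OF eR(2)[OF that(2)] that(1,3)] idx_unique[OF eR(2)[OF that(2)] that(2)] eR(2)[OF that(2)] by simp
  \<comment> \<open>\<open>\<theta>\<close> extended by zero: the entries of the induced matrices are values of \<open>L\<close>.\<close>
  define L where "L x = (if x \<in> H then \<theta> x else 0)" for x
  have L_right: "L (x \<otimes> b) = L x * \<theta> b" if "x \<in> carrier G" "b \<in> H" for x b
  proof -
    have "x \<otimes> b \<in> H \<longleftrightarrow> x \<in> H"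
    proof
      assume "x \<otimes> b \<in> H"
      then have "(x \<otimes> b) \<otimes> inv b \<in> H" by (rule H.m_closed[OF _ H.m_inv_closed[OF that(2)]])
      also have "(x \<otimes> b) \<otimes> inv b = x"
        using that(1) H.mem_carrier[OF that(2)] by (simp only: m_assoc inv_closed r_inv r_one)
      finally show "x \<in> H" .
    qed (use that in auto)
    then show ?thesis using that mult by (auto simp: L_def)
  qed
  define \<rho> where "\<rho> g = mat N N (\<lambda>(i,j). L (inv (e i) \<otimes> g \<otimes> e j))" for g
  have \<rho>c: "\<rho> g \<in> carrier_mat N N" for g by (simp add: \<rho>_def)
  have hom: "\<rho> \<in> hom G (GL N)"
  proof (rule hom_GL_I[OF is_group \<rho>c])
    show "\<rho> (g \<otimes> h) = \<rho> g * \<rho> h" if gh: "g \<in> carrier G" "h \<in> carrier G" for g h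
    proof (rule eq_matI)
      fix i k assume "i < dim_row (\<rho> g * \<rho> h)" "k < dim_col (\<rho> g * \<rho> h)"
      then have ik: "i < N" "k < N" using \<rho>c by (auto simp: \<rho>_def)
      define j where "j = idx (h \<otimes> e k)"
      have hk: "h \<otimes> e k \<in> carrier G" using gh eR(2)[OF ik(2)] by simp
      have j: "j < N" "inv (e j) \<otimes> (h \<otimes> e k) \<in> H" using idx[OF hk] by (simp_all add: j_def)
      have "(\<rho> g * \<rho> h) $$ (i,k) = (\<Sum>l<N. L (inv (e i) \<otimes> g \<otimes> e l) * L (inv (e l) \<otimes> h \<otimes> e k))"
        unfolding mult_mat_index[OF \<rho>c \<rho>c ik] using ik by (simp add: \<rho>_def)
      also have "\<dots> = (\<Sum>l<N. if l = j then L (inv (e i) \<otimes> g \<otimes> e j) * L (inv (e j) \<otimes> h \<otimes> e k) else 0)"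
      proof (intro sum.cong refl)
        fix l assume "l \<in> {..<N}"
        then have l: "l < N" by simp
        have "inv (e l) \<otimes> h \<otimes> e k = inv (e l) \<otimes> (h \<otimes> e k)" using gh eR(2)[OF l] eR(2)[OF ik(2)] by (simp add: m_assoc)
        then have "L (inv (e l) \<otimes> h \<otimes> e k) = 0" if "l \<noteq> j" 
          using idx_unique[OF hk l] that unfolding j_def[symmetric] L_def by metis
        then show "L (inv (e i) \<otimes> g \<otimes> e l) * L (inv (e l) \<otimes> h \<otimes> e k)
          = (if l = j then L (inv (e i) \<otimes> g \<otimes> e j) * L (inv (e j) \<otimes> h \<otimes> e k) else 0)" by simp
      qed
      also have "\<dots> = L (inv (e i) \<otimes> g \<otimes> e j) * L (inv (e j) \<otimes> h \<otimes> e k)" using j(1) by simp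
      also have "\<dots> = L (inv (e i) \<otimes> g \<otimes> e j) * \<theta> (inv (e j) \<otimes> (h \<otimes> e k))"
        using j(2) gh eR(2)[OF j(1)] eR(2)[OF ik(2)] by (simp add: L_def m_assoc)
      also have "\<dots> = L ((inv (e i) \<otimes> g \<otimes> e j) \<otimes> (inv (e j) \<otimes> (h \<otimes> e k)))"
        by (rule L_right[symmetric]) (use j(2) gh eR(2)[OF ik(1)] eR(2)[OF j(1)] in auto)
      also have "(inv (e i) \<otimes> g \<otimes> e j) \<otimes> (inv (e j) \<otimes> (h \<otimes> e k)) = inv (e i) \<otimes> (g \<otimes> h) \<otimes> e k"
      proof -
        have "e j \<otimes> (inv (e j) \<otimes> (h \<otimes> e k)) = h \<otimes> e k"
          using gh eR(2)[OF j(1)] eR(2)[OF ik(2)] by (simp add: m_assoc[symmetric])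
        then show ?thesis
          using gh eR(2)[OF ik(1)] eR(2)[OF j(1)] eR(2)[OF ik(2)] by (simp add: m_assoc)
      qed
      finally show "\<rho> (g \<otimes> h) $$ (i,k) = (\<rho> g * \<rho> h) $$ (i,k)" using ik by (simp add: \<rho>_def)
    qed (auto simp: \<rho>_def)
    show "\<rho> \<one> = 1\<^sub>m N"
    proof (rule eq_matI)
      fix i j assume "i < dim_row (1\<^sub>m N :: complex mat)" "j < dim_col (1\<^sub>m N :: complex mat)"
      then have ij: "i < N" "j < N" by auto
      have "inv (e i) \<otimes> e j \<notin> H" if "i \<noteq> j" using e_unique[OF ij] that by blast
      then show "\<rho> \<one> $$ (i,j) = 1\<^sub>m N $$ (i,j)"
        using ij eR(2)[OF ij(1)] eR(2)[OF ij(2)] by (cases "i = j") (simp_all add: \<rho>_def L_def one)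
    qed (auto simp: \<rho>_def)
  qed
  define k where "k = idx \<one>"
  have k: "k < N" "inv (e k) \<in> H" using idx[of \<one>] eR(2)[of k] by (simp_all add: k_def)
  have ek: "e k \<in> H" using H.m_inv_closed[OF k(2)] eR(2)[OF k(1)] by simp
  have \<phi>\<rho>: "unit_vec N k \<bullet> (\<rho> g *\<^sub>v x) = (\<Sum>j<N. L (inv (e k) \<otimes> g \<otimes> e j) * x $ j)" if x: "x \<in> carrier_vec N" for g x
  proof -
    have "unit_vec N k \<bullet> (\<rho> g *\<^sub>v x) = (\<rho> g *\<^sub>v x) $ k"
      using \<rho>c[of g] x k by (simp add: scalar_prod_left_unit del: index_mult_mat_vec)
    also have "\<dots> = (\<Sum>j<N. L (inv (e k) \<otimes> g \<otimes> e j) * x $ j)"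
      unfolding mult_mat_vec_index[OF \<rho>c x k(1)] using k(1) by (simp add: \<rho>_def)
    finally show ?thesis .
  qed
  show ?thesis
    unfolding N_def[symmetric]
  proof (intro exI[of _ \<rho>] exI[of _ "unit_vec N k"] conjI ballI impI)
    show "\<rho> \<in> hom G (GL N)" by (fact hom)
    show "N > 0" using k by simp
    show "unit_vec N k \<bullet> (\<rho> b *\<^sub>v x) = \<theta> b * (unit_vec N k \<bullet> x)" if b: "b \<in> H" and x: "x \<in> carrier_vec N" for b x
    proof -
      have "(\<Sum>j<N. L (inv (e k) \<otimes> b \<otimes> e j) * x $ j) = (\<Sum>j<N. if j = k then \<theta> b * x $ k else 0)"
      proof (intro sum.cong refl)
        fix j assume "j \<in> {..<N}"
        then have j: "j < N" by simp
        have bc: "b \<in> carrier G" using b by simp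
        have *: "j = k" if m: "inv (e k) \<otimes> b \<otimes> e j \<in> H"
        proof -
          have "inv b \<otimes> (e k \<otimes> (inv (e k) \<otimes> b \<otimes> e j)) \<in> H"
            by (rule H.m_closed[OF H.m_inv_closed[OF b] H.m_closed[OF ek m]])
          also have "inv b \<otimes> (e k \<otimes> (inv (e k) \<otimes> b \<otimes> e j)) = e j"
          proof -
            have "e k \<otimes> (inv (e k) \<otimes> b \<otimes> e j) = b \<otimes> e j"
              using bc eR(2)[OF j] eR(2)[OF k(1)] by (simp add: m_assoc[symmetric])
            moreover have "inv b \<otimes> (b \<otimes> e j) = e j"
              using bc eR(2)[OF j] by (simp add: m_assoc[symmetric])
            ultimately show ?thesis by simp
          qed
          finally have "inv (e k) \<otimes> e j \<in> H" using k(2) by (rule H.m_closed[rotated])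
          then show ?thesis using e_unique[OF k(1) j] by simp
        qed
        have "\<theta> (inv (e k) \<otimes> b \<otimes> e k) = \<theta> b"
        proof -
          have "\<theta> (inv (e k) \<otimes> b \<otimes> e k) = \<theta> (inv (e k)) * \<theta> b * \<theta> (e k)"
            using mult k(2) b ek by (simp add: H.m_closed)
          also have "\<dots> = \<theta> (inv (e k) \<otimes> e k) * \<theta> b" using mult[OF k(2) ek] by simp
          finally show ?thesis using eR(2)[OF k(1)] one by simp
        qed
        moreover have "inv (e k) \<otimes> b \<otimes> e j \<notin> H" if "j \<noteq> k" using * that by blast
        ultimately show "L (inv (e k) \<otimes> b \<otimes> e j) * x $ j = (if j = k then \<theta> b * x $ k else 0)"
          using k(2) b ek by (cases "j = k") (simp_all add: L_def)
      qed
      also have "\<dots> = \<theta> b * x $ k" using k by simp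
      finally show ?thesis using x k by (simp add: \<phi>\<rho>[OF x])
    qed
    show "x = 0\<^sub>v N" if x: "x \<in> carrier_vec N" and z: "\<forall>g\<in>carrier G. unit_vec N k \<bullet> (\<rho> g *\<^sub>v x) = 0" for x
    proof (rule eq_vecI)
      fix i assume "i < dim_vec (0\<^sub>v N :: complex vec)"
      then have i: "i < N" by simp
      note c = eR(2)[OF i] eR(2)[OF k(1)]
      have "0 = (\<Sum>j<N. L (inv (e k) \<otimes> (e k \<otimes> inv (e i)) \<otimes> e j) * x $ j)"
        using z[rule_format, of "e k \<otimes> inv (e i)"] c by (simp only: \<phi>\<rho>[OF x] m_closed inv_closed)
      also have "\<dots> = (\<Sum>j<N. if j = i then x $ i else 0)"
      proof (intro sum.cong refl)
        fix j assume "j \<in> {..<N}"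
        then have j: "j < N" by simp
        have q: "inv (e k) \<otimes> (e k \<otimes> inv (e i)) \<otimes> e j = inv (e i) \<otimes> e j"
          using c by (simp add: m_assoc[symmetric])
        have "inv (e i) \<otimes> e j \<notin> H" if "j \<noteq> i" using e_unique[OF i j] that by blast
        then show "L (inv (e k) \<otimes> (e k \<otimes> inv (e i)) \<otimes> e j) * x $ j = (if j = i then x $ i else 0)"
          using c unfolding q by (cases "j = i") (simp_all add: L_def one)
      qed
      also have "\<dots> = x $ i" using i by simp
      finally show "x $ i = 0\<^sub>v N $ i" using i by simp
    qed (use x in auto)
  qed (simp add: k)
qed

text \<open>
  An irreducible constituent on which \<open>\<phi>\<close> does not vanish, obtained without complete
  reducibility. Consider the representations with an eigenfunctional \<open>\<phi>\<close> for which no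
  non-zero vector is killed by all translates of \<open>\<phi>\<close>. The restriction of
  \<open>\<phi>\<close> to a non-zero invariant subspace \<open>W\<close> has the same property; hence a
  representation of least dimension with such a \<open>\<phi>\<close> is irreducible.
\<close>

lemma (in group) irrep_with_eigenfunctional:
  assumes H: "subgroup H G" and mult: "\<And>a b. a \<in> H \<Longrightarrow> b \<in> H \<Longrightarrow> \<theta> (a \<otimes> b) = \<theta> a * (\<theta> b :: complex)"
    and one: "\<theta> \<one> = 1" and fin: "finite R0" and sub: "R0 \<subseteq> carrier G"
    and cover: "\<And>g. g \<in> carrier G \<Longrightarrow> \<exists>r\<in>R0. inv r \<otimes> g \<in> H"
  shows "\<exists>d \<rho> \<phi>. irrep G d \<rho> \<and> d \<le> card R0 \<and> \<phi> \<in> carrier_vec d \<and> \<phi> \<noteq> 0\<^sub>v d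
    \<and> (\<forall>b\<in>H. \<forall>x\<in>carrier_vec d. \<phi> \<bullet> (\<rho> b *\<^sub>v x) = \<theta> b * (\<phi> \<bullet> x))"
proof -
  interpret H: subgroup H G by fact
  define Q where "Q d \<rho> \<phi> \<longleftrightarrow> \<rho> \<in> hom G (GL d) \<and> \<phi> \<in> carrier_vec d \<and> d > 0
     \<and> (\<forall>b\<in>H. \<forall>x\<in>carrier_vec d. \<phi> \<bullet> (\<rho> b *\<^sub>v x) = \<theta> b * (\<phi> \<bullet> x))
     \<and> (\<forall>x\<in>carrier_vec d. (\<forall>g\<in>carrier G. \<phi> \<bullet> (\<rho> g *\<^sub>v x) = 0) \<longrightarrow> x = 0\<^sub>v d)" for d \<rho> \<phi>
  obtain R where R: "R \<subseteq> R0" "\<And>g. g \<in> carrier G \<Longrightarrow> \<exists>!r. r \<in> R \<and> inv r \<otimes> g \<in> H"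
    using left_transversal_within[OF H fin sub cover] by metis
  have R': "finite R" "R \<subseteq> carrier G" "card R \<le> card R0"
    using R(1) fin sub by (auto intro: finite_subset card_mono)
  have "\<exists>\<rho> \<phi>. Q (card R) \<rho> \<phi>"
    unfolding Q_def using induced_representation[OF H mult one R'(1,2) R(2)] by metis
  define d where "d = (LEAST d. \<exists>\<rho> \<phi>. Q d \<rho> \<phi>)"
  have "\<exists>\<rho> \<phi>. Q d \<rho> \<phi>" unfolding d_def using \<open>\<exists>\<rho> \<phi>. Q (card R) \<rho> \<phi>\<close> by (rule LeastI)
  then obtain \<rho> \<phi> where q: "Q d \<rho> \<phi>" by blast
  have dR: "d \<le> card R" unfolding d_def using \<open>\<exists>\<rho> \<phi>. Q (card R) \<rho> \<phi>\<close> by (rule Least_le)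
  have minimal: "d \<le> k" if "Q k \<sigma> \<psi>" for k \<sigma> \<psi> unfolding d_def using that by (intro Least_le) blast
  have hom: "\<rho> \<in> hom G (GL d)" and \<phi>: "\<phi> \<in> carrier_vec d" and d0: "d > 0"
    and eig: "\<And>b x. b \<in> H \<Longrightarrow> x \<in> carrier_vec d \<Longrightarrow> \<phi> \<bullet> (\<rho> b *\<^sub>v x) = \<theta> b * (\<phi> \<bullet> x)"
    and cyc: "\<And>x. x \<in> carrier_vec d \<Longrightarrow> (\<forall>g\<in>carrier G. \<phi> \<bullet> (\<rho> g *\<^sub>v x) = 0) \<Longrightarrow> x = 0\<^sub>v d"
    using q unfolding Q_def by simp_all
  have "irrep G d \<rho>" unfolding irrep_def
  proof (intro conjI allI impI)
    fix W assume "subspace class_ring W (module_vec TYPE(complex) d) \<and> (\<forall>g\<in>carrier G. \<forall>w\<in>W. \<rho> g *\<^sub>v w \<in> W)"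
    then have W: "W \<subseteq> carrier_vec d" "0\<^sub>v d \<in> W" "\<And>v w. v \<in> W \<Longrightarrow> w \<in> W \<Longrightarrow> v + w \<in> W"
      "\<And>c v. v \<in> W \<Longrightarrow> c \<cdot>\<^sub>v v \<in> W" and WG: "\<And>g w. g \<in> carrier G \<Longrightarrow> w \<in> W \<Longrightarrow> \<rho> g *\<^sub>v w \<in> W"
      by (auto simp: subspace_vec)
    obtain k B where B: "B \<in> carrier_mat d k" "k \<le> d" "W = (\<lambda>x. B *\<^sub>v x) ` carrier_vec k"
      "\<And>x. x \<in> carrier_vec k \<Longrightarrow> B *\<^sub>v x = 0\<^sub>v d \<Longrightarrow> x = 0\<^sub>v k" "k = d \<Longrightarrow> W = carrier_vec d"
      using subspace_as_image[OF W] by metis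
    have "\<exists>y\<in>carrier_vec k. \<rho> g *\<^sub>v (B *\<^sub>v x) = B *\<^sub>v y" if "g \<in> carrier G" "x \<in> carrier_vec k" for g x
    proof -
      have "\<rho> g *\<^sub>v (B *\<^sub>v x) \<in> W" using that(2) B(3) by (intro WG that(1)) auto
      then show ?thesis unfolding B(3) by auto
    qed
    from restrict_to_subspace[OF is_group hom B(1) B(4) this]
    obtain M where M: "M \<in> hom G (GL k)" "\<And>g. g \<in> carrier G \<Longrightarrow> \<rho> g * B = B * M g" by blast
    define \<psi> where "\<psi> = transpose_mat B *\<^sub>v \<phi>"
    have \<psi>c: "\<psi> \<in> carrier_vec k" using B(1) \<phi> by (simp add: \<psi>_def)
    have \<psi>: "\<psi> \<bullet> x = \<phi> \<bullet> (B *\<^sub>v x)" if x: "x \<in> carrier_vec k" for x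
      using transpose_vec_mult_scalar[OF B(1) x \<phi>] by (simp add: \<psi>_def)
    have BM: "B *\<^sub>v (M g *\<^sub>v x) = \<rho> g *\<^sub>v (B *\<^sub>v x)" if g: "g \<in> carrier G" and x: "x \<in> carrier_vec k" for g x
    proof -
      have "B *\<^sub>v (M g *\<^sub>v x) = (B * M g) *\<^sub>v x" 
        by (rule assoc_mult_mat_vec[OF B(1) hom_GL_D(1)[OF M(1) g] x, symmetric])
      also have "\<dots> = \<rho> g *\<^sub>v (B *\<^sub>v x)" unfolding M(2)[OF g, symmetric]
        by (rule assoc_mult_mat_vec[OF hom_GL_D(1)[OF hom g] B(1) x])
      finally show ?thesis .
    qed
    have Mx: "M g *\<^sub>v x \<in> carrier_vec k" if "g \<in> carrier G" "x \<in> carrier_vec k" for g x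
      using hom_GL_D(1)[OF M(1) that(1)] that(2) by simp
    show "W = {0\<^sub>v d} \<or> W = carrier_vec d"
    proof (cases "k = 0")
      case True
      have "x = 0\<^sub>v 0" if "x \<in> carrier_vec 0" for x :: "complex vec" using that by (intro eq_vecI) auto
      then have "W \<subseteq> {B *\<^sub>v 0\<^sub>v 0}" unfolding B(3) True by auto
      with W(2) have "W = {0\<^sub>v d}" by (metis empty_iff insert_iff subset_singletonD)
      then show ?thesis by simp
    next
      case False
      have "Q k M \<psi>" unfolding Q_def
      proof (intro conjI ballI impI)
        fix b and x :: "complex vec" assume b: "b \<in> H" and x: "x \<in> carrier_vec k"
        show "\<psi> \<bullet> (M b *\<^sub>v x) = \<theta> b * (\<psi> \<bullet> x)"
          using b x B(1) eig[OF b, of "B *\<^sub>v x"] by (simp add: \<psi> Mx BM)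
      next
        fix x :: "complex vec" assume x: "x \<in> carrier_vec k" and z: "\<forall>g\<in>carrier G. \<psi> \<bullet> (M g *\<^sub>v x) = 0"
        have "\<forall>g\<in>carrier G. \<phi> \<bullet> (\<rho> g *\<^sub>v (B *\<^sub>v x)) = 0" using z x by (simp add: \<psi> Mx BM)
        then have "B *\<^sub>v x = 0\<^sub>v d" using B(1) x by (intro cyc) auto
        then show "x = 0\<^sub>v k" by (rule B(4)[OF x])
      qed (use M(1) \<psi>c False in simp_all)
      then have "d \<le> k" by (rule minimal)
      with B(2) have "k = d" by simp
      then show ?thesis using B(5) by simp
    qed
  qed (use hom d0 in auto)
  moreover have "\<phi> \<noteq> 0\<^sub>v d"
  proof
    assume z: "\<phi> = 0\<^sub>v d"
    have u: "unit_vec d 0 = (0\<^sub>v d :: complex vec)"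
    proof (rule cyc)
      show "\<forall>g\<in>carrier G. \<phi> \<bullet> (\<rho> g *\<^sub>v unit_vec d 0) = 0"
        unfolding z
        by (intro ballI scalar_prod_left_zero mult_mat_vec_carrier[of _ d d] hom_GL_D(1)[OF hom]) auto
    qed simp
    have "unit_vec d 0 $ 0 = (0\<^sub>v d :: complex vec) $ 0" by (simp only: u)
    with d0 show False by simp
  qed
  moreover have "d \<le> card R0" using dR R'(3) by simp
  ultimately show ?thesis
    by (intro exI[of _ d] exI[of _ \<rho>] exI[of _ \<phi>] conjI ballI) (use \<phi> eig in simp_all)
qed

text \<open>
  The vector \<open>v\<close> is the sum of \<open>\<theta> (inv b) \<cdot> \<rho> b x\<close> over
  \<open>H\<close>, for a vector \<open>x\<close> with \<open>\<phi> x \<noteq> 0\<close>. It is non-zero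
  because \<open>\<phi> v\<close> is \<open>card H\<close> times \<open>\<phi> x\<close>.
\<close>

lemma (in finite_group) eigenvector_of_eigenfunctional:
  assumes H: "subgroup H F" and mult: "\<And>a b. a \<in> H \<Longrightarrow> b \<in> H \<Longrightarrow> \<theta> (a \<otimes> b) = \<theta> a * (\<theta> b :: complex)"
    and one: "\<theta> \<one> = 1" and \<rho>: "\<rho> \<in> hom F (GL d)" and \<phi>: "\<phi> \<in> carrier_vec d" "\<phi> \<noteq> 0\<^sub>v d"
    and eig: "\<And>b x. b \<in> H \<Longrightarrow> x \<in> carrier_vec d \<Longrightarrow> \<phi> \<bullet> (\<rho> b *\<^sub>v x) = \<theta> b * (\<phi> \<bullet> x)"
  shows "\<exists>v\<in>carrier_vec d. v \<noteq> 0\<^sub>v d \<and> (\<forall>b\<in>H. \<rho> b *\<^sub>v v = \<theta> b \<cdot>\<^sub>v v)"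
proof -
  interpret H: subgroup H F by fact
  have finH: "finite H" using H.subset fin by (rule finite_subset)
  note r = hom_GL_D[OF \<rho>]
  from \<phi> obtain j where j: "j < d" "\<phi> $ j \<noteq> 0"
    by (metis carrier_vecD eq_vecI index_zero_vec(1) index_zero_vec(2))
  let ?x = "unit_vec d j :: complex vec"
  define v where "v = vec d (\<lambda>i. \<Sum>b\<in>H. \<theta> (inv b) * (\<rho> b *\<^sub>v ?x) $ i)"
  have vc: "v \<in> carrier_vec d" by (simp add: v_def)
  have "\<phi> \<bullet> v = (\<Sum>i<d. \<phi> $ i * (\<Sum>b\<in>H. \<theta> (inv b) * (\<rho> b *\<^sub>v ?x) $ i))"
    by (simp add: scalar_prod_def v_def atLeast0LessThan)
  also have "\<dots> = (\<Sum>b\<in>H. \<theta> (inv b) * (\<Sum>i<d. \<phi> $ i * (\<rho> b *\<^sub>v ?x) $ i))"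
    by (simp add: sum_distrib_left sum.swap[of _ _ "{..<d}"] mult.left_commute)
  also have "\<dots> = (\<Sum>b\<in>H. \<theta> (inv b) * (\<phi> \<bullet> (\<rho> b *\<^sub>v ?x)))"
    using r(1) by (intro sum.cong refl) (simp add: scalar_prod_def[of \<phi>] atLeast0LessThan carrier_matD[OF r(1)])
  also have "\<dots> = (\<Sum>b\<in>H. \<phi> \<bullet> ?x)"
  proof (intro sum.cong refl)
    fix b assume b: "b \<in> H"
    have "\<theta> (inv b) * \<theta> b = 1" using mult[of "inv b" b] b one by simp
    then show "\<theta> (inv b) * (\<phi> \<bullet> (\<rho> b *\<^sub>v ?x)) = \<phi> \<bullet> ?x" using eig[OF b, of ?x] by (simp add: mult.assoc[symmetric])
  qed
  also have "\<dots> = of_nat (card H) * \<phi> $ j" using j \<phi>(1) by (simp add: scalar_prod_right_unit)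
  finally have "\<phi> \<bullet> v \<noteq> 0" using j finH H.one_closed by (auto simp del: H.one_closed)
  then have "v \<noteq> 0\<^sub>v d" using \<phi>(1) by auto
  moreover have "\<rho> c *\<^sub>v v = \<theta> c \<cdot>\<^sub>v v" if c: "c \<in> H" for c
  proof (rule eq_vecI)
    fix i assume "i < dim_vec (\<theta> c \<cdot>\<^sub>v v)"
    then have i: "i < d" by (simp add: v_def)
    have cc: "c \<in> carrier F" using c by simp
    have "(\<rho> c *\<^sub>v v) $ i = (\<Sum>l<d. \<rho> c $$ (i,l) * (\<Sum>b\<in>H. \<theta> (inv b) * (\<rho> b *\<^sub>v ?x) $ l))"
      unfolding mult_mat_vec_index[OF r(1)[OF cc] vc i] by (simp add: v_def)
    also have "\<dots> = (\<Sum>b\<in>H. \<theta> (inv b) * (\<Sum>l<d. \<rho> c $$ (i,l) * (\<rho> b *\<^sub>v ?x) $ l))"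
      by (simp add: sum_distrib_left sum.swap[of _ _ "{..<d}"] mult.left_commute)
    also have "\<dots> = (\<Sum>b\<in>H. \<theta> (inv b) * (\<rho> (c \<otimes> b) *\<^sub>v ?x) $ i)"
    proof (intro sum.cong refl)
      fix b assume b: "b \<in> H"
      have "\<rho> (c \<otimes> b) *\<^sub>v ?x = \<rho> c *\<^sub>v (\<rho> b *\<^sub>v ?x)"
        unfolding r(2)[OF cc H.mem_carrier[OF b]]
        by (rule assoc_mult_mat_vec[OF r(1)[OF cc] r(1)[OF H.mem_carrier[OF b]] unit_vec_carrier])
      moreover have "\<rho> b *\<^sub>v ?x \<in> carrier_vec d" using r(1)[of b] b by simp
      ultimately show "\<theta> (inv b) * (\<Sum>l<d. \<rho> c $$ (i,l) * (\<rho> b *\<^sub>v ?x) $ l) = \<theta> (inv b) * (\<rho> (c \<otimes> b) *\<^sub>v ?x) $ i"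
        using mult_mat_vec_index[OF r(1)[OF cc] _ i] by simp
    qed
    also have "\<dots> = (\<Sum>b\<in>H. \<theta> (inv (inv c \<otimes> b)) * (\<rho> b *\<^sub>v ?x) $ i)"
      by (rule sum.reindex_bij_witness[of _ "\<lambda>b. inv c \<otimes> b" "\<lambda>b. c \<otimes> b"])
        (use c in \<open>auto simp: m_assoc[symmetric]\<close>)
    also have "\<dots> = (\<Sum>b\<in>H. \<theta> c * (\<theta> (inv b) * (\<rho> b *\<^sub>v ?x) $ i))"
      using c mult by (intro sum.cong refl) (simp add: inv_mult_group)
    also have "\<dots> = (\<theta> c \<cdot>\<^sub>v v) $ i" using i by (simp add: v_def sum_distrib_left)
    finally show "(\<rho> c *\<^sub>v v) $ i = (\<theta> c \<cdot>\<^sub>v v) $ i" .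
  qed (use r(1)[of c] c in \<open>auto simp: v_def\<close>)
  ultimately show ?thesis using vc by blast
qed

section \<open>Residues modulo powers of a uniformizer\<close>

text \<open>
  What the counting needs to know about a discrete valuation ring: \<open>\<pi>\<close> generates the
  maximal ideal, and \<open>D\<close> is a finite set of digits, one for each residue class.
\<close>

locale uniformizer =
  fixes \<pi> :: "'a::idom" and D :: "'a set"
  assumes pi_nz: "\<pi> \<noteq> 0" and unit_iff: "x dvd 1 \<longleftrightarrow> \<not> \<pi> dvd x"
    and fin_D: "finite D" and D_ex1: "\<exists>!d. d \<in> D \<and> \<pi> dvd x - d"
begin

definition q :: nat where "q = card D"

lemma pi_pow_nz [simp]: "\<pi> ^ k \<noteq> 0"
  using pi_nz by simp

lemma unit_mult: "x dvd 1 \<Longrightarrow> y dvd 1 \<Longrightarrow> (x * y :: 'a) dvd 1"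
  by simp

lemma unit_mult_iff: "(x * y :: 'a) dvd 1 \<longleftrightarrow> x dvd 1 \<and> y dvd 1"
  by (rule is_unit_mult_iff)

lemma not_unit_pi: "\<not> \<pi> dvd 1"
  using unit_iff[of 1] by simp

lemma unit_cong:
  assumes "\<pi> ^ k dvd x - y" "k > 0"
  shows "x dvd 1 \<longleftrightarrow> y dvd 1"
proof -
  have "\<pi> dvd x - y" using assms by (meson dvd_power dvd_trans)
  then have "\<pi> dvd x \<longleftrightarrow> \<pi> dvd y" by (metis dvd_diff_right_iff dvd_diff_left_iff diff_diff_eq2 add_diff_cancel_left' dvd_add_right_iff diff_add_cancel)
  then show ?thesis by (simp add: unit_iff)
qed

lemma card_D_ge: "q \<ge> 2"
proof -
  obtain d0 d1 where d: "d0 \<in> D" "\<pi> dvd 0 - d0" "d1 \<in> D" "\<pi> dvd 1 - d1" using D_ex1 by metis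
  have "d0 \<noteq> d1"
  proof
    assume "d0 = d1"
    then have "\<pi> dvd (1 - d1) - (0 - d1)" using dvd_diff[OF d(4) d(2)] by simp
    with not_unit_pi show False by simp
  qed
  then have "card {d0, d1} = 2" by simp
  moreover have "card {d0, d1} \<le> q" unfolding q_def using d fin_D by (intro card_mono) auto
  ultimately show ?thesis by simp
qed

lemma valuation:
  assumes "\<not> \<pi> ^ l dvd x"
  obtains i u where "i < l" "x = \<pi> ^ i * u" "u dvd 1"
proof -
  define i where "i = (LEAST j. \<not> \<pi> ^ Suc j dvd x)"
  have "l > 0" using assms by (cases l) auto
  then have ex: "\<not> \<pi> ^ Suc (l - 1) dvd x" using assms by simp
  have i: "\<not> \<pi> ^ Suc i dvd x" unfolding i_def by (rule LeastI[of "\<lambda>j. \<not> \<pi> ^ Suc j dvd x", OF ex])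
  have "i \<le> l - 1" unfolding i_def by (rule Least_le) (rule ex)
  with \<open>l > 0\<close> have "i < l" by simp
  have "\<pi> ^ i dvd x"
  proof (cases i)
    case (Suc j)
    then show ?thesis using not_less_Least[of j "\<lambda>j. \<not> \<pi> ^ Suc j dvd x"] i_def by auto
  qed simp
  then obtain u where u: "x = \<pi> ^ i * u" by (auto simp: dvd_def)
  have "\<not> \<pi> dvd u" using i u by (auto simp: dvd_def mult.assoc)
  then show ?thesis by (intro that[OF \<open>i < l\<close> u]) (simp add: unit_iff)
qed

text \<open>
  Representatives modulo \<open>\<pi>\<^sup>k\<close>: the truncated \<open>\<pi>\<close>-adic expansions
  with digits in \<open>D\<close>.
\<close>

primrec reps :: "nat \<Rightarrow> 'a set" where
  "reps 0 = {0}"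
| "reps (Suc k) = (\<lambda>(s, d). s + \<pi> ^ k * d) ` (reps k \<times> D)"

lemma finite_reps: "finite (reps k)"
  by (induction k) (auto simp: fin_D)

lemma reps_ex: "\<exists>s\<in>reps k. \<pi> ^ k dvd x - s"
proof (induction k)
  case (Suc k)
  then obtain s y where s: "s \<in> reps k" "x - s = \<pi> ^ k * y" by (auto simp: dvd_def)
  obtain d where d: "d \<in> D" "\<pi> dvd y - d" using D_ex1[of y] by blast
  have "x - (s + \<pi> ^ k * d) = \<pi> ^ k * (y - d)" using s(2) by (simp add: algebra_simps)
  then have "\<pi> ^ Suc k dvd x - (s + \<pi> ^ k * d)" using d(2) by (simp add: mult.commute[of \<pi>] mult_dvd_mono)
  moreover have "s + \<pi> ^ k * d \<in> reps (Suc k)" using s d by force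
  ultimately show ?case by blast
qed auto

lemma reps_digits_unique:
  assumes IH: "\<And>s s'. s \<in> reps k \<Longrightarrow> s' \<in> reps k \<Longrightarrow> \<pi> ^ k dvd s - s' \<Longrightarrow> s = s'"
    and sd: "s \<in> reps k" "s' \<in> reps k" "d \<in> D" "d' \<in> D"
    and dv: "\<pi> ^ Suc k dvd (s + \<pi> ^ k * d) - (s' + \<pi> ^ k * d')"
  shows "s = s' \<and> d = d'"
proof -
  have "\<pi> ^ k dvd (s + \<pi> ^ k * d) - (s' + \<pi> ^ k * d')"
    using dv by (metis dvd_trans le_imp_power_dvd lessI less_imp_le)
  then have "\<pi> ^ k dvd ((s + \<pi> ^ k * d) - (s' + \<pi> ^ k * d')) - \<pi> ^ k * (d - d')"
    by (rule dvd_diff) simp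
  then have "\<pi> ^ k dvd s - s'" by (simp add: algebra_simps)
  with IH sd have s: "s = s'" by simp
  have "(s + \<pi> ^ k * d) - (s' + \<pi> ^ k * d') = \<pi> ^ k * (d - d')" using s by (simp add: algebra_simps)
  with dv have "\<pi> ^ k * \<pi> dvd \<pi> ^ k * (d - d')" by (simp add: mult.commute)
  then have "\<pi> dvd d - d'" using pi_nz by simp
  moreover have "\<pi> dvd d - d" by simp
  ultimately have "d = d'" using D_ex1[of d] sd by blast
  with s show ?thesis by simp
qed

lemma reps_unique:
  "s \<in> reps k \<Longrightarrow> s' \<in> reps k \<Longrightarrow> \<pi> ^ k dvd s - s' \<Longrightarrow> s = s'"
proof (induction k arbitrary: s s')
  case (Suc k)
  from Suc.prems obtain r d r' d' where rd: "s = r + \<pi> ^ k * d" "s' = r' + \<pi> ^ k * d'"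
    "r \<in> reps k" "r' \<in> reps k" "d \<in> D" "d' \<in> D" by auto
  have "r = r' \<and> d = d'"
    by (rule reps_digits_unique[of k]) (use Suc rd in auto)
  with rd show ?case by simp
qed auto

lemma card_reps: "card (reps k) = q ^ k"
proof (induction k)
  case (Suc k)
  have "inj_on (\<lambda>(s, d). s + \<pi> ^ k * d) (reps k \<times> D)"
  proof (rule inj_onI, clarify)
    fix s d s' d' assume a: "s \<in> reps k" "d \<in> D" "s' \<in> reps k" "d' \<in> D" "s + \<pi> ^ k * d = s' + \<pi> ^ k * d'"
    show "s = s' \<and> d = d'"
      by (rule reps_digits_unique[of k]) (use a reps_unique in auto)
  qed
  then have "card (reps (Suc k)) = card (reps k \<times> D)" unfolding reps.simps by (rule card_image)
  then show ?case using Suc by (simp add: card_cartesian_product q_def mult.commute)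
qed simp

definition red :: "nat \<Rightarrow> 'a \<Rightarrow> 'a" where
  "red k x = (SOME s. s \<in> reps k \<and> \<pi> ^ k dvd x - s)"

lemma red: "red k x \<in> reps k" "\<pi> ^ k dvd x - red k x"
  using someI_ex[of "\<lambda>s. s \<in> reps k \<and> \<pi> ^ k dvd x - s"] reps_ex[of k x] by (auto simp: red_def)

definition unit_reps :: "nat \<Rightarrow> 'a set" where
  "unit_reps k = {s \<in> reps k. s dvd 1}"

lemma finite_unit_reps: "finite (unit_reps k)"
  by (simp add: unit_reps_def finite_reps)

text \<open>
  The non-units modulo \<open>\<pi>\<^sup>k\<^sup>+\<^sup>1\<close> are \<open>\<pi>\<close> times an
  element that is determined modulo \<open>\<pi>\<^sup>k\<close>.
\<close>

lemma card_unit_reps_ge: "q ^ Suc k \<le> card (unit_reps (Suc k)) + q ^ k"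
proof -
  define N where "N = {s \<in> reps (Suc k). \<pi> dvd s}"
  define f where "f s = red k (SOME y. s = \<pi> * y)" for s
  have fs: "\<pi> ^ Suc k dvd s - \<pi> * f s" if "s \<in> N" for s
  proof -
    have "\<exists>y. s = \<pi> * y" using that by (auto simp: N_def dvd_def)
    then have s: "s = \<pi> * (SOME y. s = \<pi> * y)" by (rule someI_ex)
    then have "s - \<pi> * f s = \<pi> * ((SOME y. s = \<pi> * y) - f s)" by (metis right_diff_distrib)
    then show ?thesis using red(2)[of k "SOME y. s = \<pi> * y"] by (simp add: f_def mult_dvd_mono)
  qed
  have "inj_on f N"
  proof (rule inj_onI)
    fix s s' assume a: "s \<in> N" "s' \<in> N" "f s = f s'"
    have "\<pi> ^ Suc k dvd (s - \<pi> * f s) - (s' - \<pi> * f s')" using dvd_diff[OF fs[OF a(1)] fs[OF a(2)]] .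
    then have "\<pi> ^ Suc k dvd s - s'" using a(3) by simp
    then show "s = s'" using a(1,2) by (intro reps_unique[of _ "Suc k"]) (simp_all add: N_def del: reps.simps)
  qed
  moreover have "f ` N \<subseteq> reps k" by (auto simp: f_def red)
  ultimately have "card N \<le> card (reps k)" by (rule card_inj_on_le[OF _ _ finite_reps])
  moreover have "reps (Suc k) = unit_reps (Suc k) \<union> N"
    by (auto simp: unit_reps_def N_def unit_iff simp del: reps.simps)
  then have "card (reps (Suc k)) \<le> card (unit_reps (Suc k)) + card N" using card_Un_le by metis
  ultimately show ?thesis using card_reps by (metis add_le_cancel_left le_trans)
qed

lemma card_unit_reps_ge_half: "l > 0 \<Longrightarrow> q ^ l \<le> 2 * card (unit_reps l)"
proof -
  assume "l > 0"
  then obtain k where l: "l = Suc k" using gr0_implies_Suc by blast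
  have "2 * q ^ k \<le> q * q ^ k" using card_D_ge by (rule mult_right_mono) simp
  then show ?thesis using card_unit_reps_ge[of k] unfolding l power_Suc by linarith
qed

lemma card_unit_reps_ge_power: "q ^ k \<le> card (unit_reps (Suc k))"
proof -
  have "2 * q ^ k \<le> q * q ^ k" using card_D_ge by (rule mult_right_mono) simp
  then show ?thesis using card_unit_reps_ge[of k] unfolding power_Suc by linarith
qed

lemma red_unit_reps: "x dvd 1 \<Longrightarrow> l > 0 \<Longrightarrow> red l x \<in> unit_reps l"
  using red[of l x] unit_cong[OF red(2)[of l x]] by (simp add: unit_reps_def)

end

section \<open>Two by two matrices\<close>

definition M2 :: "'a \<Rightarrow> 'a \<Rightarrow> 'a \<Rightarrow> 'a \<Rightarrow> 'a mat" where
  "M2 a b c d = mat 2 2 (\<lambda>(i,j). if i = 0 then if j = 0 then a else b else if j = 0 then c else d)"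

lemma M2_carrier [simp]: "M2 a b c d \<in> carrier_mat 2 2"
  by (simp add: M2_def)

lemma M2_index [simp]:
  "M2 a b c d $$ (0,0) = a" "M2 a b c d $$ (0,Suc 0) = b" "M2 a b c d $$ (Suc 0,0) = c" "M2 a b c d $$ (Suc 0,Suc 0) = d"
  by (simp_all add: M2_def)

lemma M2_eta: "A \<in> carrier_mat 2 2 \<Longrightarrow> A = M2 (A $$ (0,0)) (A $$ (0,1)) (A $$ (1,0)) (A $$ (1,1))"
  by (rule eq_matI) (auto simp: M2_def less_2_cases_iff)

lemma M2_cases:
  assumes "A \<in> carrier_mat 2 2"
  obtains a b c d where "A = M2 a b c d"
  using M2_eta[OF assms] by blast

lemma M2_eq_iff [simp]: "M2 a b c d = M2 a' b' c' d' \<longleftrightarrow> a = a' \<and> b = b' \<and> c = c' \<and> d = d'"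
  by (metis M2_index)

lemma M2_mult [simp]:
  "M2 a b c d * M2 a' b' c' d' = M2 (a*a' + b*c') (a*b' + b*d') (c*a' + d*c') (c*b' + d*(d'::'a::comm_ring_1))"
  by (rule eq_matI) (auto simp: M2_def scalar_prod_def less_2_cases_iff numeral_2_eq_2)

lemma M2_one: "1\<^sub>m 2 = M2 1 0 0 (1::'a::comm_ring_1)"
  by (rule eq_matI) (auto simp: M2_def less_2_cases_iff)

definition det2 :: "'a::comm_ring_1 mat \<Rightarrow> 'a" where
  "det2 A = A $$ (0,0) * A $$ (1,1) - A $$ (0,1) * A $$ (1,0)"

lemma det2_M2 [simp]: "det2 (M2 a b c d) = a * d - b * c"
  by (simp add: det2_def)

lemma det2_mult: "A \<in> carrier_mat 2 2 \<Longrightarrow> B \<in> carrier_mat 2 2 \<Longrightarrow> det2 (A * B) = det2 A * det2 B"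
  by (elim M2_cases) (simp add: algebra_simps)

abbreviation GL2 :: "'a::comm_ring_1 mat monoid" where "GL2 \<equiv> GL 2"

lemma GL2_carrier: "carrier GL2 = {A \<in> carrier_mat 2 2. det2 A dvd (1::'a::comm_ring_1)}"
proof (intro Set.set_eqI iffI)
  fix A :: "'a mat" assume "A \<in> carrier GL2"
  then obtain B where B: "A \<in> carrier_mat 2 2" "B \<in> carrier_mat 2 2" "A * B = 1\<^sub>m 2" by (auto simp: GL_carrier)
  have "det2 A * det2 B = 1" using det2_mult[OF B(1,2)] B(3) by (simp add: M2_one)
  then show "A \<in> {A \<in> carrier_mat 2 2. det2 A dvd 1}" using B(1) by (metis (mono_tags) dvd_triv_left mem_Collect_eq)
next
  fix A :: "'a mat" assume "A \<in> {A \<in> carrier_mat 2 2. det2 A dvd 1}"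
  then have A: "A \<in> carrier_mat 2 2" "det2 A dvd 1" by auto
  then obtain u where u: "1 = det2 A * u" by (auto simp: dvd_def)
  from A obtain a b c d where e: "A = M2 a b c d" by (elim M2_cases)
  have ud: "(a * d - b * c) * u = 1" using u by (simp add: e)
  then have ud': "a * (d * u) - b * (c * u) = 1" "d * u * a - b * u * c = 1"
    by (simp_all add: algebra_simps)
  have "A * M2 (d * u) (- (b * u)) (- (c * u)) (a * u) = 1\<^sub>m 2"
    "M2 (d * u) (- (b * u)) (- (c * u)) (a * u) * A = 1\<^sub>m 2"
    using ud by (auto simp: e M2_one algebra_simps)
  then show "A \<in> carrier GL2" using A(1) by (auto simp: GL_carrier intro!: bexI[of _ "M2 (d * u) (- (b * u)) (- (c * u)) (a * u)"])
qed

lemma M2_in_GL2 [simp]: "M2 a b c d \<in> carrier GL2 \<longleftrightarrow> (a * d - b * c :: 'a::comm_ring_1) dvd 1"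
  by (simp add: GL2_carrier)

lemma GL2_cases:
  assumes "g \<in> carrier (GL2 :: 'a::comm_ring_1 mat monoid)"
  obtains a b c d where "g = M2 a b c d" "(a * d - b * c) dvd 1"
  using assms by (auto simp: GL2_carrier elim!: M2_cases)

interpretation GL2: group "GL2 :: 'a::comm_ring_1 mat monoid"
  by (rule group_GL)

lemma GL2_mult [simp]: "x \<otimes>\<^bsub>GL n\<^esub> y = x * y"
  by (simp add: GL_mult)

lemma GL2_one: "\<one>\<^bsub>GL2\<^esub> = M2 1 0 0 (1::'a::comm_ring_1)"
  by (simp add: GL_one M2_one)

lemma GL2_inv_eqI:
  assumes "x \<in> carrier GL2" "y \<in> carrier GL2" "x * y = M2 1 0 0 (1::'a::comm_ring_1)"
  shows "inv\<^bsub>GL2\<^esub> x = y"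
  using GL2.inv_equality[of y x] GL2.inv_comm[of x y] assms by (simp add: GL2_one)

section \<open>Characters of the unit group\<close>

context uniformizer
begin

lemma unit_power: "x dvd 1 \<Longrightarrow> x ^ n dvd (1::'a)"
  by (induction n) (simp_all add: unit_mult)

lemma unit_nz: "x dvd (1::'a) \<Longrightarrow> x \<noteq> 0"
  using dvd_0_left by fastforce

lemma unit_inverse:
  assumes "x dvd (1::'a)"
  obtains y where "y dvd 1" "x * y = 1"
proof -
  from assms obtain y where "1 = x * y" unfolding dvd_def by blast
  then have y: "x * y = 1" by simp
  show ?thesis by (rule that[of y]) (use dvd_triv_right[of y x] y in simp_all)
qed

text \<open>
  A character of a group \<open>H\<close> of units, as a function on the whole ring whose values outside
  \<open>H\<close> are arbitrary. Such characters are extended step by step to larger groups.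
\<close>

definition partial_char :: "'a set \<Rightarrow> ('a \<Rightarrow> complex) \<Rightarrow> bool" where
  "partial_char H \<chi> \<longleftrightarrow> 1 \<in> H \<and> (\<forall>x\<in>H. \<forall>y\<in>H. x * y \<in> H \<and> \<chi> (x * y) = \<chi> x * \<chi> y)
     \<and> (\<forall>x\<in>H. \<exists>y\<in>H. x * y = 1) \<and> (\<forall>x\<in>H. \<chi> x \<noteq> 0)"

lemma partial_charD:
  assumes "partial_char H \<chi>"
  shows "1 \<in> H" "x \<in> H \<Longrightarrow> y \<in> H \<Longrightarrow> x * y \<in> H" "x \<in> H \<Longrightarrow> y \<in> H \<Longrightarrow> \<chi> (x * y) = \<chi> x * \<chi> y"
    "x \<in> H \<Longrightarrow> \<exists>y\<in>H. x * y = 1" "x \<in> H \<Longrightarrow> \<chi> x \<noteq> 0"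
  using assms by (auto simp: partial_char_def)

lemma partial_char_one: "partial_char H \<chi> \<Longrightarrow> \<chi> 1 = 1"
  using partial_charD(3)[of H \<chi> 1 1] partial_charD(1)[of H \<chi>] partial_charD(5)[of H \<chi> 1] by simp

lemma partial_char_pow:
  assumes "partial_char H \<chi>" "x \<in> H"
  shows "x ^ n \<in> H \<and> \<chi> (x ^ n) = \<chi> x ^ n"
  by (induction n) (use partial_charD[OF assms(1)] partial_char_one[OF assms(1)] assms(2) in auto)

lemma partial_char_divide:
  assumes pc: "partial_char H \<chi>" and "x * y \<in> H" "x \<in> H"
  shows "y \<in> H"
proof -
  from partial_charD(4)[OF pc assms(3)] obtain x' where x': "x' \<in> H" "x * x' = 1" by blast
  have "(x * y) * x' = (x * x') * y" by (simp only: mult_ac)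
  also have "\<dots> = y" unfolding x'(2) by simp
  finally have e: "(x * y) * x' = y" .
  have "(x * y) * x' \<in> H" by (rule partial_charD(2)[OF pc assms(2) x'(1)])
  then show ?thesis unfolding e .
qed

text \<open>
  Extension to the group generated by \<open>H\<close> and \<open>a\<close>. Since \<open>m\<close> is
  the order of \<open>a\<close> modulo \<open>H\<close>, a power of \<open>a\<close> lies in
  \<open>H\<close> only if its exponent is a multiple of \<open>m\<close>; hence every
  \<open>m\<close>-th root of \<open>\<chi> (a ^ m)\<close> is admissible as value at \<open>a\<close>.
\<close>

lemma adjoin_element:
  assumes pc: "partial_char H \<chi>" and a: "a \<noteq> 0"
    and m: "m > 0" "a ^ m \<in> H" "\<And>r. 0 < r \<Longrightarrow> r < m \<Longrightarrow> a ^ r \<notin> H" and z: "z ^ m = \<chi> (a ^ m)"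
  shows "\<exists>H' \<chi>'. partial_char H' \<chi>' \<and> H \<subseteq> H' \<and> a \<in> H' \<and> \<chi>' a = z \<and> (\<forall>x\<in>H. \<chi>' x = \<chi> x)"
proof -
  note D = partial_charD[OF pc]
  have z0: "z \<noteq> 0" using z m D(5)[OF m(2)] by (metis power_0_left not_gr_zero)
  have pow: "\<chi> (a ^ n) = z ^ n" if n: "a ^ n \<in> H" for n
  proof -
    let ?k = "n div m" and ?r = "n mod m"
    have e: "a ^ n = (a ^ m) ^ ?k * a ^ ?r" by (simp add: power_mult[symmetric] power_add[symmetric])
    have k: "(a ^ m) ^ ?k \<in> H" "\<chi> ((a ^ m) ^ ?k) = z ^ (m * ?k)"
      using partial_char_pow[OF pc m(2)] z by (auto simp: power_mult)
    have "a ^ ?r \<in> H" using partial_char_divide[OF pc _ k(1)] n e by simp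
    then have "?r = 0" using m(3)[of ?r] m(1) by (metis gr_zeroI mod_less_divisor)
    then have "m * ?k = n" by auto
    then show ?thesis using e k \<open>?r = 0\<close> by simp
  qed
  have wd': "\<chi> h * z ^ i = \<chi> h' * z ^ j" if h: "h \<in> H" "h' \<in> H" "h * a ^ i = h' * a ^ j" and ij: "i \<le> j" for h h' i j
  proof -
    have j: "j = (j - i) + i" using ij by simp
    have "h * a ^ i = (h' * a ^ (j - i)) * a ^ i" using h(3) by (subst (asm) j) (simp add: power_add mult_ac)
    then have e: "h = h' * a ^ (j - i)" using a by simp
    then have "a ^ (j - i) \<in> H" using partial_char_divide[OF pc _ h(2)] h(1) by simp
    then have "\<chi> h = \<chi> h' * z ^ (j - i)" using e D(3)[OF h(2)] pow by metis
    then show ?thesis using j by (metis power_add mult.assoc)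
  qed
  have wd: "\<chi> h * z ^ i = \<chi> h' * z ^ j" if "h \<in> H" "h' \<in> H" "h * a ^ i = h' * a ^ j" for h h' i j
    using wd'[of h h' i j] wd'[of h' h j i] that by (cases "i \<le> j") auto
  define H' where "H' = {h * a ^ i | h i. h \<in> H}"
  define \<chi>' where "\<chi>' x = (SOME c. \<exists>h i. h \<in> H \<and> x = h * a ^ i \<and> c = \<chi> h * z ^ i)" for x
  have val: "\<chi>' (h * a ^ i) = \<chi> h * z ^ i" if h: "h \<in> H" for h i
  proof -
    have "\<exists>h' j. h' \<in> H \<and> h * a ^ i = h' * a ^ j \<and> \<chi>' (h * a ^ i) = \<chi> h' * z ^ j"
      unfolding \<chi>'_def by (rule someI_ex) (use h in blast)
    then show ?thesis using wd[OF h] by metis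
  qed
  have "partial_char H' \<chi>'" unfolding partial_char_def
  proof (intro conjI ballI)
    show "1 \<in> H'" using D(1) unfolding H'_def by (intro CollectI exI[of _ 1] exI[of _ 0]) simp
  next
    fix x y assume "x \<in> H'" "y \<in> H'"
    then obtain h i k j where e: "x = h * a ^ i" "y = k * a ^ j" "h \<in> H" "k \<in> H" by (auto simp: H'_def)
    have xy: "x * y = (h * k) * a ^ (i + j)" "h * k \<in> H" using e D(2) by (simp_all add: power_add mult_ac)
    show "x * y \<in> H'" unfolding H'_def using xy by blast
    show "\<chi>' (x * y) = \<chi>' x * \<chi>' y"
      unfolding xy(1) val[OF xy(2)] unfolding e(1,2) val[OF e(3)] val[OF e(4)] D(3)[OF e(3,4)]
      by (simp add: power_add mult_ac)
  next
    fix x assume "x \<in> H'"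
    then obtain h i where e: "x = h * a ^ i" "h \<in> H" by (auto simp: H'_def)
    obtain h' where h': "h' \<in> H" "h * h' = 1" using D(4)[OF e(2)] by blast
    obtain b where b: "b \<in> H" "a ^ m * b = 1" using D(4)[OF m(2)] by blast
    have mi: "a ^ i * a ^ ((m - 1) * i) = (a ^ m) ^ i"
      using m(1) by (simp add: power_mult[symmetric] power_add[symmetric]) (metis Suc_pred mult_Suc)
    have "x * ((h' * b ^ i) * a ^ ((m - 1) * i)) = (h * h') * (a ^ i * a ^ ((m - 1) * i) * b ^ i)"
      by (simp add: e mult_ac)
    also have "\<dots> = (a ^ m * b) ^ i" unfolding mi by (simp add: h' power_mult_distrib)
    also have "\<dots> = 1" by (simp add: b)
    finally have "x * ((h' * b ^ i) * a ^ ((m - 1) * i)) = 1" .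
    moreover have "(h' * b ^ i) * a ^ ((m - 1) * i) \<in> H'"
      unfolding H'_def using D(2)[OF h'(1)] partial_char_pow[OF pc b(1)] by blast
    ultimately show "\<exists>y\<in>H'. x * y = 1" by blast
    show "\<chi>' x \<noteq> 0" using e val D(5) z0 by simp
  qed
  moreover have "H \<subseteq> H'"
  proof
    fix h assume "h \<in> H" then show "h \<in> H'" unfolding H'_def by (intro CollectI exI[of _ h] exI[of _ 0]) simp
  qed
  moreover have "a \<in> H'" using D(1) unfolding H'_def by (intro CollectI exI[of _ 1] exI[of _ 1]) simp
  moreover have "\<chi>' a = z" using val[OF D(1), of 1] partial_char_one[OF pc] by simp
  moreover have "\<forall>x\<in>H. \<chi>' x = \<chi> x" using val[of _ 0] by simp
  ultimately show ?thesis by blast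
qed

lemma complex_nth_root:
  assumes "m > 0"
  shows "\<exists>z::complex. z ^ m = c"
proof (intro exI)
  have "(rcis (root m (cmod c)) (Arg c / m)) ^ m = rcis (cmod c) (Arg c)"
    using assms by (simp add: DeMoivre2)
  then show "(rcis (root m (cmod c)) (Arg c / m)) ^ m = c" by (simp add: rcis_cmod_Arg)
qed

lemma adjoin_finite:
  assumes "finite S" and pc: "partial_char H \<chi>" and S: "\<And>a. a \<in> S \<Longrightarrow> a \<noteq> 0 \<and> (\<exists>n>0. a ^ n \<in> H)"
  shows "\<exists>H' \<chi>'. partial_char H' \<chi>' \<and> H \<subseteq> H' \<and> S \<subseteq> H' \<and> (\<forall>x\<in>H. \<chi>' x = \<chi> x)"
  using assms(1) S
proof (induction S rule: finite_induct)
  case empty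
  then show ?case using pc by blast
next
  case (insert a S)
  then obtain H1 \<chi>1 where 1: "partial_char H1 \<chi>1" "H \<subseteq> H1" "S \<subseteq> H1" "\<forall>x\<in>H. \<chi>1 x = \<chi> x" by auto
  from insert.prems[of a] obtain n where n: "n > 0" "a ^ n \<in> H" and a0: "a \<noteq> 0" by auto
  define m where "m = (LEAST m. m > 0 \<and> a ^ m \<in> H1)"
  have m: "m > 0 \<and> a ^ m \<in> H1" unfolding m_def by (rule LeastI[of _ n]) (use n 1(2) in auto)
  have least: "a ^ r \<notin> H1" if "0 < r" "r < m" for r using not_less_Least[of r "\<lambda>m. m > 0 \<and> a ^ m \<in> H1"] that m_def by auto
  obtain z where "z ^ m = \<chi>1 (a ^ m)" using complex_nth_root m by blast
  with adjoin_element[OF 1(1) a0, of m z] m least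
  obtain H' \<chi>' where "partial_char H' \<chi>'" "H1 \<subseteq> H'" "a \<in> H'" "\<forall>x\<in>H1. \<chi>' x = \<chi>1 x" by auto
  then show ?case using 1 by (intro exI[of _ H'] exI[of _ \<chi>']) auto
qed

text \<open>
  The characters of the group of units of \<open>\<O>/\<pi>\<^sup>l\<close>, extended by zero to
  \<open>\<O>\<close>.
\<close>

definition unit_chars :: "nat \<Rightarrow> ('a \<Rightarrow> complex) set" where
  "unit_chars l = {\<chi>. (\<forall>x. \<not> x dvd 1 \<longrightarrow> \<chi> x = 0)
     \<and> (\<forall>x y. x dvd 1 \<longrightarrow> y dvd 1 \<longrightarrow> \<chi> (x * y) = \<chi> x * \<chi> y)
     \<and> (\<forall>x. x dvd 1 \<longrightarrow> \<pi> ^ l dvd x - 1 \<longrightarrow> \<chi> x = 1)}"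

lemma unit_charsD:
  assumes "\<chi> \<in> unit_chars l"
  shows "\<not> x dvd 1 \<Longrightarrow> \<chi> x = 0" "x dvd 1 \<Longrightarrow> y dvd 1 \<Longrightarrow> \<chi> (x * y) = \<chi> x * \<chi> y"
    "x dvd 1 \<Longrightarrow> \<pi> ^ l dvd x - 1 \<Longrightarrow> \<chi> x = 1"
  using assms by (auto simp: unit_chars_def)

lemma unit_chars_one: "\<chi> \<in> unit_chars l \<Longrightarrow> \<chi> 1 = 1"
  using unit_charsD(3)[of \<chi> l 1] by simp

lemma unit_chars_nz:
  assumes "\<chi> \<in> unit_chars l" "x dvd 1"
  shows "\<chi> x \<noteq> 0"
proof -
  obtain y where y: "y dvd 1" "x * y = 1" using unit_inverse[OF assms(2)] .
  then have "\<chi> x * \<chi> y = 1" using unit_charsD(2)[OF assms y(1)] unit_chars_one[OF assms(1)] by simp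
  then show ?thesis by auto
qed

lemma unit_chars_cong:
  assumes "\<chi> \<in> unit_chars l" "x dvd 1" "y dvd 1" "\<pi> ^ l dvd x - y"
  shows "\<chi> x = \<chi> y"
proof -
  obtain z where zu: "z dvd 1" and z: "y * z = 1" using unit_inverse[OF assms(3)] .
  have "x * z - 1 = (x - y) * z" unfolding left_diff_distrib z ..
  then have "\<pi> ^ l dvd x * z - 1" using assms(4) by simp
  then have "\<chi> (x * z) = 1" by (intro unit_charsD(3)[OF assms(1)] unit_mult assms(2) zu)
  moreover have "\<chi> (y * z) = 1" unfolding z by (rule unit_chars_one[OF assms(1)])
  ultimately have "\<chi> x * \<chi> z = \<chi> y * \<chi> z"
    using unit_charsD(2)[OF assms(1) assms(2) zu] unit_charsD(2)[OF assms(1) assms(3) zu] by simp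
  then show ?thesis using unit_chars_nz[OF assms(1) zu] by simp
qed

lemma unit_chars_mult: "\<chi> \<in> unit_chars l \<Longrightarrow> \<psi> \<in> unit_chars l \<Longrightarrow> (\<lambda>x. \<chi> x * \<psi> x) \<in> unit_chars l"
  by (auto simp: unit_chars_def)

lemma unit_chars_inverse: "\<chi> \<in> unit_chars l \<Longrightarrow> (\<lambda>x. inverse (\<chi> x)) \<in> unit_chars l"
  by (auto simp: unit_chars_def)

lemma trivial_unit_char: "(\<lambda>x. if x dvd 1 then 1 else 0) \<in> unit_chars l"
  by (auto simp: unit_chars_def)

text \<open>
  Pigeonhole principle for the powers of \<open>x\<close> in the finite set of residues.
\<close>

lemma unit_power_cong_one:
  assumes "x dvd 1"
  shows "\<exists>n>0. \<pi> ^ l dvd x ^ n - 1"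
proof -
  have "\<not> inj_on (\<lambda>i. red l (x ^ i)) (UNIV :: nat set)"
  proof
    assume "inj_on (\<lambda>i. red l (x ^ i)) (UNIV :: nat set)"
    moreover have "finite (range (\<lambda>i. red l (x ^ i)))"
      by (rule finite_subset[OF _ finite_reps[of l]]) (auto simp: red)
    ultimately show False using finite_imageD infinite_UNIV_nat by blast
  qed
  then obtain i j :: nat where ij: "i < j" "red l (x ^ i) = red l (x ^ j)"
    using linorder_inj_onI'[of UNIV "\<lambda>i::nat. red l (x ^ i)"] by blast
  have "\<pi> ^ l dvd (x ^ j - red l (x ^ j)) - (x ^ i - red l (x ^ i))" by (rule dvd_diff[OF red(2) red(2)])
  then have "\<pi> ^ l dvd x ^ j - x ^ i" using ij(2) by simp
  moreover have "x ^ j = x ^ i * x ^ (j - i)" using ij(1) by (simp only: power_add[symmetric]) simp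
  then have "x ^ j - x ^ i = x ^ i * (x ^ (j - i) - 1)" by (simp add: right_diff_distrib)
  ultimately have "\<pi> ^ l dvd x ^ i * (x ^ (j - i) - 1)" by simp
  then have "\<pi> ^ l dvd (x ^ i * (x ^ (j - i) - 1)) * y" for y by (rule dvd_mult2)
  moreover have "x ^ i dvd 1" using assms by (rule unit_power)
  then obtain y where y: "x ^ i * y = 1" by (rule unit_inverse)
  ultimately have "\<pi> ^ l dvd (x ^ i * (x ^ (j - i) - 1)) * y" by blast
  also have "(x ^ i * (x ^ (j - i) - 1)) * y = (x ^ i * y) * (x ^ (j - i) - 1)" by (simp only: mult_ac)
  finally have "\<pi> ^ l dvd x ^ (j - i) - 1" using y by simp
  with ij(1) show ?thesis by (intro exI[of _ "j - i"]) simp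
qed

definition cong_one :: "nat \<Rightarrow> 'a set" where
  "cong_one l = {x. x dvd 1 \<and> \<pi> ^ l dvd x - 1}"

lemma cong_one_group:
  "1 \<in> cong_one l" "x \<in> cong_one l \<Longrightarrow> y \<in> cong_one l \<Longrightarrow> x * y \<in> cong_one l"
  "x \<in> cong_one l \<Longrightarrow> \<exists>y\<in>cong_one l. x * y = 1"
proof -
  show "1 \<in> cong_one l" by (simp add: cong_one_def)
  show "x * y \<in> cong_one l" if "x \<in> cong_one l" "y \<in> cong_one l"
  proof -
    have e: "x * y - 1 = (x - 1) * y + (y - 1)" by (simp add: algebra_simps)
    have "\<pi> ^ l dvd x * y - 1" unfolding e using that by (intro dvd_add) (auto simp: cong_one_def)
    then show ?thesis using that unfolding cong_one_def by (simp add: unit_mult)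
  qed
  show "\<exists>y\<in>cong_one l. x * y = 1" if x: "x \<in> cong_one l"
  proof -
    from x have "x dvd 1" by (simp add: cong_one_def)
    then obtain y where y1: "y dvd 1" and y: "x * y = 1" by (rule unit_inverse)
    have e: "- ((x - 1) * y) = y - 1" unfolding left_diff_distrib y by simp
    have "\<pi> ^ l dvd - ((x - 1) * y)" using x by (simp add: cong_one_def)
    then have "\<pi> ^ l dvd y - 1" unfolding e .
    then show ?thesis using y y1 by (intro bexI[of _ y]) (simp_all add: cong_one_def)
  qed
qed

text \<open>
  It suffices to adjoin the finitely many representatives of the units modulo
  \<open>\<pi>\<^sup>l\<close>; the values can be chosen because \<open>\<complex>\<close> contains all
  roots.
\<close>

lemma extend_to_unit_char:
  assumes pc: "partial_char H \<chi>" and sub: "cong_one l \<subseteq> H" and l: "l > 0"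
    and triv: "\<And>x. x \<in> cong_one l \<Longrightarrow> \<chi> x = 1"
  shows "\<exists>\<psi>\<in>unit_chars l. \<forall>x\<in>H. \<psi> x = \<chi> x"
proof -
  have fo: "a \<noteq> 0 \<and> (\<exists>n>0. a ^ n \<in> H)" if "a \<in> unit_reps l" for a
  proof
    have a: "a dvd 1" using that by (simp add: unit_reps_def)
    then show "a \<noteq> 0" by (rule unit_nz)
    from unit_power_cong_one[OF a, of l] obtain n where n: "n > 0" "\<pi> ^ l dvd a ^ n - 1" by metis
    then have "a ^ n \<in> cong_one l" using a by (simp add: cong_one_def unit_power)
    then have "a ^ n \<in> H" using sub by (rule subsetD[rotated])
    with n(1) show "\<exists>n>0. a ^ n \<in> H" by metis
  qed
  obtain H' \<chi>' where H': "partial_char H' \<chi>'" "H \<subseteq> H'" "unit_reps l \<subseteq> H'" "\<forall>x\<in>H. \<chi>' x = \<chi> x"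
    using adjoin_finite[OF finite_unit_reps[of l] pc fo] by metis
  have all: "x \<in> H'" if x: "x dvd 1" for x
  proof -
    let ?r = "red l x"
    have r: "?r \<in> unit_reps l" by (rule red_unit_reps[OF x l])
    then have "?r dvd 1" by (simp add: unit_reps_def)
    then obtain y where y: "y dvd 1" "?r * y = 1" by (rule unit_inverse)
    have "x * y - 1 = (x - ?r) * y" unfolding left_diff_distrib y(2) ..
    then have "\<pi> ^ l dvd x * y - 1" using dvd_mult2[OF red(2)[of l x], of y] by simp
    then have "x * y \<in> cong_one l" using x y(1) by (simp add: cong_one_def unit_mult)
    then have "x * y \<in> H'" by (rule subsetD[OF H'(2) subsetD[OF sub]])
    moreover have "?r \<in> H'" by (rule subsetD[OF H'(3) r])
    ultimately have "?r * (x * y) \<in> H'" using partial_charD(2)[OF H'(1)] by simp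
    also have "?r * (x * y) = (?r * y) * x" by (simp only: mult_ac)
    finally show ?thesis by (simp add: y(2))
  qed
  define \<psi> where "\<psi> x = (if x dvd 1 then \<chi>' x else 0)" for x
  have "\<psi> \<in> unit_chars l"
    unfolding unit_chars_def
  proof (intro CollectI conjI allI impI)
    fix x assume "x dvd 1" "\<pi> ^ l dvd x - 1"
    then have "x \<in> cong_one l" by (simp add: cong_one_def)
    then have "\<chi>' x = 1" using subsetD[OF sub] H'(4) triv by simp
    then show "\<psi> x = 1" using \<open>x dvd 1\<close> by (simp add: \<psi>_def)
  qed (simp_all add: \<psi>_def all partial_charD(3)[OF H'(1)])
  moreover have "x dvd 1" if "x \<in> H" for x using partial_charD(4)[OF pc that] by (metis dvd_triv_left)
  then have "\<forall>x\<in>H. \<psi> x = \<chi> x" using H'(4) by (simp add: \<psi>_def)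
  ultimately show ?thesis by (intro bexI[of _ \<psi>])
qed

lemma partial_char_cong_one: "partial_char (cong_one l) (\<lambda>_. 1)"
  using cong_one_group by (auto simp: partial_char_def)

text \<open>
  The order \<open>m\<close> of \<open>u\<close> modulo \<open>\<pi>\<^sup>l\<close> is at least two, so
  an \<open>m\<close>-th root of unity other than \<open>1\<close> can be prescribed as the value at
  \<open>u\<close> and then extended.
\<close>

lemma unit_chars_separate:
  assumes u: "u dvd 1" "\<not> \<pi> ^ l dvd u - 1"
  shows "\<exists>\<psi>\<in>unit_chars l. \<psi> u \<noteq> 1"
proof -
  have l: "l > 0" using u by (cases l) auto
  from unit_power_cong_one[OF u(1), of l] obtain n where n: "n > 0" "\<pi> ^ l dvd u ^ n - 1" by blast
  define m where "m = (LEAST m. m > 0 \<and> u ^ m \<in> cong_one l)"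
  have m: "m > 0 \<and> u ^ m \<in> cong_one l" unfolding m_def
    by (rule LeastI[of _ n]) (use n u in \<open>auto simp: cong_one_def unit_power\<close>)
  have least: "u ^ r \<notin> cong_one l" if "0 < r" "r < m" for r
    using not_less_Least[of r "\<lambda>m. m > 0 \<and> u ^ m \<in> cong_one l"] that m_def by auto
  have "m \<noteq> 1" using m u by (auto simp: cong_one_def)
  then have m2: "m \<ge> 2" using m by simp
  have "\<exists>z::complex. z ^ m = 1 \<and> z \<noteq> 1"
  proof (rule ccontr)
    assume "\<not> ?thesis"
    then have "{z::complex. z ^ m = 1} = {1}" using m by auto
    then have "card {z::complex. z ^ m = 1} = 1" by simp
    moreover have "card {z::complex. z ^ m = 1} = m" by (rule card_roots_unity_eq) (use m in simp)
    ultimately show False using m2 by simp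
  qed
  then obtain z :: complex where z: "z ^ m = 1" "z \<noteq> 1" by blast
  have "u \<noteq> 0" using u by auto
  from adjoin_element[OF partial_char_cong_one this, of m l z] m least z
  obtain H' \<chi>' where H': "partial_char H' \<chi>'" "cong_one l \<subseteq> H'" "u \<in> H'" "\<chi>' u = z" "\<forall>x\<in>cong_one l. \<chi>' x = 1"
    by auto
  from extend_to_unit_char[OF H'(1,2) l] H'(5) obtain \<psi> where "\<psi> \<in> unit_chars l" "\<forall>x\<in>H'. \<psi> x = \<chi>' x" by blast
  with H' z show ?thesis by metis
qed

text \<open>
  A character is determined by its values at the representatives, which are roots of unity of bounded
  order.
\<close>

lemma finite_unit_chars: "finite (unit_chars l)"
proof -
  have "\<forall>x. \<exists>n. x dvd 1 \<longrightarrow> n > 0 \<and> \<pi> ^ l dvd x ^ n - 1" using unit_power_cong_one by blast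
  then obtain N where N: "\<And>x. x dvd 1 \<Longrightarrow> N x > 0 \<and> \<pi> ^ l dvd x ^ N x - 1" by metis
  have pow: "\<chi> (x ^ n) = \<chi> x ^ n" if "\<chi> \<in> unit_chars l" "x dvd 1" for \<chi> x and n :: nat
    by (induction n) (simp_all add: that unit_power unit_chars_one[OF that(1)] unit_charsD(2)[OF that(1)])
  define f where "f \<chi> = restrict \<chi> (unit_reps l)" for \<chi> :: "'a \<Rightarrow> complex"
  show ?thesis
  proof (cases "l = 0")
    case True
    have "\<chi> = (\<lambda>x. if x dvd 1 then 1 else 0)" if "\<chi> \<in> unit_chars l" for \<chi>
      using unit_charsD(1,3)[OF that] True by auto
    then have "unit_chars l \<subseteq> {\<lambda>x. if x dvd 1 then 1 else 0}" by blast
    then show ?thesis by (rule finite_subset) simp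
  next
    case False
    then have l: "l > 0" by simp
    have "f ` unit_chars l \<subseteq> (\<Pi>\<^sub>E x\<in>unit_reps l. {z. z ^ N x = 1})"
    proof (intro image_subsetI)
      fix \<chi> assume \<chi>: "\<chi> \<in> unit_chars l"
      have "\<chi> x ^ N x = 1" if "x \<in> unit_reps l" for x
      proof -
        have x: "x dvd 1" using that by (simp add: unit_reps_def)
        then have "\<chi> (x ^ N x) = 1" using N[OF x] by (intro unit_charsD(3)[OF \<chi>] unit_power[OF x]) simp
        then show ?thesis using pow[OF \<chi> x] by simp
      qed
      then show "f \<chi> \<in> (\<Pi>\<^sub>E x\<in>unit_reps l. {z. z ^ N x = 1})" by (auto simp: f_def)
    qed
    moreover have "finite (\<Pi>\<^sub>E x\<in>unit_reps l. {z::complex. z ^ N x = 1})"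
      by (intro finite_PiE finite_unit_reps finite_roots_unity) (use N in \<open>auto simp: unit_reps_def Suc_le_eq\<close>)
    ultimately have "finite (f ` unit_chars l)" by (rule finite_subset)
    moreover have "inj_on f (unit_chars l)"
    proof (rule inj_onI)
      fix \<chi> \<psi> assume c: "\<chi> \<in> unit_chars l" "\<psi> \<in> unit_chars l" and e: "f \<chi> = f \<psi>"
      show "\<chi> = \<psi>"
      proof
        fix x show "\<chi> x = \<psi> x"
        proof (cases "x dvd 1")
          case True
          have r: "red l x \<in> unit_reps l" by (rule red_unit_reps[OF True l])
          then have ru: "red l x dvd 1" by (simp add: unit_reps_def)
          have "\<chi> (red l x) = \<psi> (red l x)" using fun_cong[OF e, of "red l x"] r by (simp add: f_def)
          then show ?thesis using unit_chars_cong[OF c(1) True ru red(2)] unit_chars_cong[OF c(2) True ru red(2)] by simp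
        next
          case False
          then show ?thesis by (simp add: unit_charsD(1)[OF c(1)] unit_charsD(1)[OF c(2)])
        qed
      qed
    qed
    ultimately show ?thesis by (rule finite_imageD)
  qed
qed

text \<open>
  Multiplication by a character that is not \<open>1\<close> at \<open>u\<close> permutes the characters.
\<close>

lemma sum_unit_chars:
  assumes u: "u dvd 1" "\<not> \<pi> ^ l dvd u - 1"
  shows "(\<Sum>\<chi>\<in>unit_chars l. \<chi> u) = 0"
proof -
  from unit_chars_separate[OF u] obtain \<beta> where \<beta>: "\<beta> \<in> unit_chars l" "\<beta> u \<noteq> 1" by blast
  define T where "T \<chi> = (\<lambda>x. \<beta> x * \<chi> x)" for \<chi> :: "'a \<Rightarrow> complex"
  have inj: "inj_on T (unit_chars l)"
  proof (rule inj_onI)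
    fix \<chi> \<psi> assume c: "\<chi> \<in> unit_chars l" "\<psi> \<in> unit_chars l" and e: "T \<chi> = T \<psi>"
    show "\<chi> = \<psi>"
    proof
      fix x show "\<chi> x = \<psi> x"
        using fun_cong[OF e, of x] unit_chars_nz[OF \<beta>(1), of x] unit_charsD(1)[OF c(1), of x] unit_charsD(1)[OF c(2), of x]
        by (cases "x dvd 1") (auto simp: T_def)
    qed
  qed
  have "T ` unit_chars l \<subseteq> unit_chars l" using unit_chars_mult \<beta> by (auto simp: T_def)
  with inj have "bij_betw T (unit_chars l) (unit_chars l)"
    by (simp add: bij_betw_def endo_inj_surj finite_unit_chars)
  then have "(\<Sum>\<chi>\<in>unit_chars l. \<chi> u) = (\<Sum>\<chi>\<in>unit_chars l. T \<chi> u)" by (rule sum.reindex_bij_betw[symmetric])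
  also have "\<dots> = \<beta> u * (\<Sum>\<chi>\<in>unit_chars l. \<chi> u)" by (simp add: T_def sum_distrib_left)
  finally have "(1 - \<beta> u) * (\<Sum>\<chi>\<in>unit_chars l. \<chi> u) = 0" by (simp add: algebra_simps)
  with \<beta> show ?thesis by simp
qed

text \<open>
  By the orthogonality relations, evaluations at different units are biorthogonal functions on the set of
  characters.
\<close>

lemma card_unit_reps_le_unit_chars:
  assumes l: "l > 0"
  shows "card (unit_reps l) \<le> card (unit_chars l)"
proof (rule biorthogonal_card_le)
  show "finite (unit_chars l)" "finite (unit_reps l)" by (fact finite_unit_chars, fact finite_unit_reps)
  have cpos: "card (unit_chars l) > 0"
    using trivial_unit_char[of l] finite_unit_chars by (auto simp: card_gt_0_iff)
  have inverse: "\<chi> u * inverse (\<chi> v) = \<chi> (u * w)" if "\<chi> \<in> unit_chars l" "u dvd 1" "v dvd 1" "w dvd 1" "v * w = 1" for \<chi> u v w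
  proof -
    have "\<chi> v * \<chi> w = 1" using unit_charsD(2)[OF that(1,3,4)] unit_chars_one[OF that(1)] that(5) by simp
    then have "inverse (\<chi> v) = \<chi> w" by (rule inverse_unique)
    then show ?thesis using unit_charsD(2)[OF that(1,2,4)] by simp
  qed
  fix u v assume u: "u \<in> unit_reps l"
  then have u1: "u dvd 1" by (simp add: unit_reps_def)
  show "(\<Sum>\<chi>\<in>unit_chars l. \<chi> u * inverse (\<chi> u)) \<noteq> 0"
  proof -
    have "(\<Sum>\<chi>\<in>unit_chars l. \<chi> u * inverse (\<chi> u)) = (\<Sum>\<chi>\<in>unit_chars l. 1)"
      by (intro sum.cong refl) (simp add: unit_chars_nz[OF _ u1])
    then show ?thesis using cpos by simp
  qed
  assume v: "v \<in> unit_reps l" "u \<noteq> v"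
  then have v1: "v dvd 1" by (simp add: unit_reps_def)
  then obtain w where w1: "w dvd 1" and w: "v * w = 1" by (rule unit_inverse)
  have "\<not> \<pi> ^ l dvd u * w - 1"
  proof
    assume "\<pi> ^ l dvd u * w - 1"
    then have "\<pi> ^ l dvd (u * w - 1) * v" by simp
    also have "(u * w - 1) * v = u * (v * w) - v" by (simp add: algebra_simps)
    also have "\<dots> = u - v" unfolding w by simp
    finally have "u = v" using u v by (intro reps_unique) (auto simp: unit_reps_def)
    with v show False by simp
  qed
  then have "(\<Sum>\<chi>\<in>unit_chars l. \<chi> (u * w)) = 0" by (rule sum_unit_chars[OF unit_mult[OF u1 w1]])
  then show "(\<Sum>\<chi>\<in>unit_chars l. \<chi> u * inverse (\<chi> v)) = 0"
    using inverse[OF _ u1 v1 w1 w] by simp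
qed

text \<open>
  The characters modulo \<open>\<pi>\<^sup>l\<close> that are not characters modulo
  \<open>\<pi>\<^sup>l\<^sup>-\<^sup>1\<close>.
\<close>

definition primitive_chars :: "nat \<Rightarrow> ('a \<Rightarrow> complex) set" where
  "primitive_chars l = {\<chi> \<in> unit_chars l. \<exists>x\<in>cong_one (l - 1). \<chi> x \<noteq> 1}"

text \<open>
  Multiplication by a fixed primitive character maps the imprimitive characters injectively to primitive
  ones.
\<close>

lemma card_unit_chars_le_primitive:
  assumes l: "l \<ge> 2"
  shows "card (unit_chars l) \<le> 2 * card (primitive_chars l)"
proof -
  define u where "u = 1 + \<pi> ^ (l - 1)"
  have d: "\<pi> ^ (l - 1) dvd u - 1" by (simp add: u_def)
  then have u1: "u dvd 1" using unit_cong[of "l - 1" u 1] l by simp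
  have "\<not> \<pi> ^ l dvd u - 1"
  proof
    assume "\<pi> ^ l dvd u - 1"
    then have "\<pi> ^ (l - 1) * \<pi> dvd \<pi> ^ (l - 1) * 1" using l
      by (simp add: u_def power_Suc2[symmetric])
    then have "\<pi> dvd 1" using pi_nz by (simp only: dvd_mult_cancel_left) simp
    with not_unit_pi show False by simp
  qed
  from unit_chars_separate[OF u1 this] obtain \<beta> where \<beta>: "\<beta> \<in> unit_chars l" "\<beta> u \<noteq> 1" by blast
  have uc: "u \<in> cong_one (l - 1)" using d u1 by (simp add: cong_one_def)
  define N where "N = unit_chars l - primitive_chars l"
  define T where "T \<chi> = (\<lambda>x. \<beta> x * \<chi> x)" for \<chi> :: "'a \<Rightarrow> complex"
  have "inj_on T N"
  proof (rule inj_onI)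
    fix \<chi> \<psi> assume c: "\<chi> \<in> N" "\<psi> \<in> N" and e: "T \<chi> = T \<psi>"
    have c': "\<chi> \<in> unit_chars l" "\<psi> \<in> unit_chars l" using c by (auto simp: N_def)
    show "\<chi> = \<psi>"
    proof
      fix x show "\<chi> x = \<psi> x"
        using fun_cong[OF e, of x] unit_chars_nz[OF \<beta>(1), of x] unit_charsD(1)[OF c'(1), of x] unit_charsD(1)[OF c'(2), of x]
        by (cases "x dvd 1") (auto simp: T_def)
    qed
  qed
  moreover have "T ` N \<subseteq> primitive_chars l"
  proof (rule image_subsetI)
    fix \<chi> assume "\<chi> \<in> N"
    then have "\<chi> \<in> unit_chars l" "\<chi> u = 1" using uc by (auto simp: N_def primitive_chars_def)
    then show "T \<chi> \<in> primitive_chars l"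
      using \<beta> uc unit_chars_mult[OF \<beta>(1)] by (auto simp: primitive_chars_def T_def intro!: bexI[of _ u])
  qed
  moreover have fp: "finite (primitive_chars l)"
    using finite_unit_chars[of l] by (simp add: primitive_chars_def)
  ultimately have "card N \<le> card (primitive_chars l)" by (rule card_inj_on_le)
  moreover have "unit_chars l = N \<union> primitive_chars l" by (auto simp: N_def primitive_chars_def)
  then have "card (unit_chars l) \<le> card N + card (primitive_chars l)" by (metis card_Un_le)
  ultimately show ?thesis by simp
qed

lemma card_primitive_chars_ge:
  assumes l: "l \<ge> 2"
  shows "q ^ l \<le> 4 * card (primitive_chars l)"
  using card_unit_reps_ge_half[of l] card_unit_reps_le_unit_chars[of l] card_unit_chars_le_primitive[OF l] l by simp

end

section \<open>Congruence subgroups\<close>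

lemma irrep_pullback:
  assumes G: "group G" and F: "group F" and p: "p \<in> hom G F" and surj: "p ` carrier G = carrier F"
    and e: "\<And>g. g \<in> carrier G \<Longrightarrow> \<sigma> (p g) = \<rho> g"
  shows "irrep F n \<sigma> \<longleftrightarrow> irrep G n \<rho>"
proof -
  interpret G: group G by fact
  interpret F: group F by fact
  have pc: "p g \<in> carrier F" if "g \<in> carrier G" for g using p that by (auto simp: hom_def)
  have ball: "(\<forall>x\<in>carrier F. P (\<sigma> x)) \<longleftrightarrow> (\<forall>g\<in>carrier G. P (\<rho> g))" for P
  proof -
    have "(\<forall>x\<in>carrier F. P (\<sigma> x)) \<longleftrightarrow> (\<forall>g\<in>carrier G. P (\<sigma> (p g)))" unfolding surj[symmetric] by simp
    also have "\<dots> \<longleftrightarrow> (\<forall>g\<in>carrier G. P (\<rho> g))" using e by simp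
    finally show ?thesis .
  qed
  have "\<sigma> \<in> hom F (GL n) \<longleftrightarrow> (\<forall>x\<in>carrier F. \<sigma> x \<in> carrier (GL n)) \<and> (\<forall>x\<in>carrier F. \<forall>y\<in>carrier F. \<sigma> (x \<otimes>\<^bsub>F\<^esub> y) = \<sigma> x * \<sigma> y)"
    by (auto simp: hom_def GL_mult)
  also have "(\<forall>x\<in>carrier F. \<forall>y\<in>carrier F. \<sigma> (x \<otimes>\<^bsub>F\<^esub> y) = \<sigma> x * \<sigma> y)
     \<longleftrightarrow> (\<forall>g\<in>carrier G. \<forall>h\<in>carrier G. \<sigma> (p g \<otimes>\<^bsub>F\<^esub> p h) = \<sigma> (p g) * \<sigma> (p h))"
    unfolding surj[symmetric] by simp
  also have "\<dots> \<longleftrightarrow> (\<forall>g\<in>carrier G. \<forall>h\<in>carrier G. \<rho> (g \<otimes>\<^bsub>G\<^esub> h) = \<rho> g * \<rho> h)"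
    using p by (simp add: e[symmetric] hom_mult)
  also have "(\<forall>x\<in>carrier F. \<sigma> x \<in> carrier (GL n)) \<longleftrightarrow> (\<forall>g\<in>carrier G. \<rho> g \<in> carrier (GL n))" by (rule ball)
  also have "(\<forall>g\<in>carrier G. \<rho> g \<in> carrier (GL n)) \<and> (\<forall>g\<in>carrier G. \<forall>h\<in>carrier G. \<rho> (g \<otimes>\<^bsub>G\<^esub> h) = \<rho> g * \<rho> h)
     \<longleftrightarrow> \<rho> \<in> hom G (GL n)"
    by (auto simp: hom_def GL_mult)
  finally have hom: "\<sigma> \<in> hom F (GL n) \<longleftrightarrow> \<rho> \<in> hom G (GL n)" .
  show ?thesis unfolding irrep_def hom ball[of "\<lambda>A. \<forall>w\<in>_. A *\<^sub>v w \<in> _"] by (rule refl)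
qed

context uniformizer
begin

definition mcong :: "nat \<Rightarrow> 'a mat \<Rightarrow> 'a mat \<Rightarrow> bool" where
  "mcong l A B \<longleftrightarrow> (\<forall>i<2. \<forall>j<2. \<pi> ^ l dvd A $$ (i,j) - B $$ (i,j))"

lemma mcong_M2: "mcong l (M2 a b c d) (M2 a' b' c' d') \<longleftrightarrow>
   \<pi> ^ l dvd a - a' \<and> \<pi> ^ l dvd b - b' \<and> \<pi> ^ l dvd c - c' \<and> \<pi> ^ l dvd d - d'"
  by (auto simp: mcong_def less_2_cases_iff)

lemma mcong_refl: "mcong l A A"
  by (simp add: mcong_def)

lemma mcong_sym: "mcong l A B \<Longrightarrow> mcong l B A"
  unfolding mcong_def using dvd_minus_iff by (metis minus_diff_eq)

lemma dvd_diff_trans: "(x::'a) dvd a - b \<Longrightarrow> x dvd b - c \<Longrightarrow> x dvd a - c"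
  using dvd_add[of x "a - b" "b - c"] by simp

lemma mcong_trans: "mcong l A B \<Longrightarrow> mcong l B C \<Longrightarrow> mcong l A C"
  unfolding mcong_def using dvd_diff_trans by metis

lemma cong_mult: "(x::'a) dvd a - a' \<Longrightarrow> x dvd b - b' \<Longrightarrow> x dvd a * b - a' * b'"
proof -
  assume "x dvd a - a'" "x dvd b - b'"
  then have "x dvd (a - a') * b + a' * (b - b')" by (intro dvd_add dvd_mult dvd_mult2)
  then show ?thesis by (simp add: algebra_simps)
qed

lemma cong_add: "(x::'a) dvd a - a' \<Longrightarrow> x dvd b - b' \<Longrightarrow> x dvd (a + b) - (a' + b')"
  using dvd_add[of x "a - a'" "b - b'"] by (simp add: algebra_simps)

lemma cong_diff: "(x::'a) dvd a - a' \<Longrightarrow> x dvd b - b' \<Longrightarrow> x dvd (a - b) - (a' - b')"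
  using dvd_diff[of x "a - a'" "b - b'"] by (simp add: algebra_simps)

lemma mcong_mult:
  assumes "A \<in> carrier_mat 2 2" "A' \<in> carrier_mat 2 2" "B \<in> carrier_mat 2 2" "B' \<in> carrier_mat 2 2"
    and "mcong l A A'" "mcong l B B'"
  shows "mcong l (A * B) (A' * B')"
  using assms by (elim M2_cases) (auto simp: mcong_M2 intro!: cong_add cong_mult)

lemma mcong_det:
  assumes "A \<in> carrier_mat 2 2" "B \<in> carrier_mat 2 2" "mcong l A B"
  shows "\<pi> ^ l dvd det2 A - det2 B"
  using assms by (elim M2_cases) (auto simp: mcong_M2 intro!: cong_diff cong_mult)

lemma mcong_mono: "k \<le> l \<Longrightarrow> mcong l A B \<Longrightarrow> mcong k A B"
  unfolding mcong_def using le_imp_power_dvd[of k l \<pi>] dvd_trans by metis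

text \<open>
  The principal congruence subgroup of level \<open>l\<close>.
\<close>

definition K :: "nat \<Rightarrow> 'a mat set" where
  "K l = {g \<in> carrier GL2. mcong l g (M2 1 0 0 1)}"

lemma GL2_mat: "g \<in> carrier GL2 \<Longrightarrow> (g :: 'a mat) \<in> carrier_mat 2 2"
  by (simp add: GL2_carrier)

lemma GL2_mult_closed: "g \<in> carrier GL2 \<Longrightarrow> h \<in> carrier GL2 \<Longrightarrow> (g * h :: 'a mat) \<in> carrier GL2"
  using GL2.m_closed[of g h] by simp

lemma GL2_inv_mult: "g \<in> carrier GL2 \<Longrightarrow> inv\<^bsub>GL2\<^esub> g * (g :: 'a mat) = M2 1 0 0 1"
  "g \<in> carrier GL2 \<Longrightarrow> (g :: 'a mat) * inv\<^bsub>GL2\<^esub> g = M2 1 0 0 1"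
  using GL2.l_inv[of g] GL2.r_inv[of g] by (simp_all add: GL2_one)

lemma M2_one_mult [simp]:
  "g \<in> carrier_mat 2 2 \<Longrightarrow> M2 1 0 0 1 * g = (g :: 'a mat)" "g \<in> carrier_mat 2 2 \<Longrightarrow> g * M2 1 0 0 1 = (g :: 'a mat)"
  by (simp_all add: M2_one[symmetric])

lemma GL2_inv_cancel:
  assumes "k \<in> carrier GL2" "g \<in> carrier GL2"
  shows "inv\<^bsub>GL2\<^esub> k * (k * g) = (g :: 'a mat)" "k * (inv\<^bsub>GL2\<^esub> k * g) = (g :: 'a mat)"
proof -
  have i: "inv\<^bsub>GL2\<^esub> k \<in> carrier GL2" using assms by simp
  show "inv\<^bsub>GL2\<^esub> k * (k * g) = g"
    using assoc_mult_mat[OF GL2_mat[OF i] GL2_mat[OF assms(1)] GL2_mat[OF assms(2)]] assms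
    by (simp add: GL2_inv_mult GL2_mat)
  show "k * (inv\<^bsub>GL2\<^esub> k * g) = g"
    using assoc_mult_mat[OF GL2_mat[OF assms(1)] GL2_mat[OF i] GL2_mat[OF assms(2)]] assms
    by (simp add: GL2_inv_mult GL2_mat)
qed

lemma K_normal: "K l \<lhd> GL2"
  unfolding GL2.normal_inv_iff
proof (intro conjI ballI)
  show "subgroup (K l) GL2"
  proof (rule GL2.subgroupI)
    show "K l \<subseteq> carrier GL2" by (auto simp: K_def)
    show "K l \<noteq> {}" by (auto simp: K_def mcong_M2 intro!: exI[of _ "M2 1 0 0 1"])
    show "inv\<^bsub>GL2\<^esub> g \<in> K l" if "g \<in> K l" for g
    proof -
      from that have g: "g \<in> carrier GL2" "mcong l g (M2 1 0 0 1)" by (auto simp: K_def)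
      then have "mcong l (g * inv\<^bsub>GL2\<^esub> g) (M2 1 0 0 1 * inv\<^bsub>GL2\<^esub> g)"
        by (intro mcong_mult mcong_refl GL2_mat GL2.inv_closed) auto
      then show ?thesis using g by (auto simp: K_def GL2_inv_mult GL2_mat intro: mcong_sym)
    qed
    show "g \<otimes>\<^bsub>GL2\<^esub> h \<in> K l" if "g \<in> K l" "h \<in> K l" for g h
    proof -
      from that have g: "g \<in> carrier GL2" "mcong l g (M2 1 0 0 1)" "h \<in> carrier GL2" "mcong l h (M2 1 0 0 1)"
        by (auto simp: K_def)
      then have "mcong l (g * h) (M2 1 0 0 1 * M2 1 0 0 1)" by (intro mcong_mult GL2_mat) auto
      then show ?thesis using g by (simp add: K_def GL2_mult_closed)
    qed
  qed
  fix x g :: "'a mat" assume x: "x \<in> carrier GL2" and "g \<in> K l"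
  then have g: "g \<in> carrier GL2" "mcong l g (M2 1 0 0 1)" by (auto simp: K_def)
  have "mcong l (x * g * inv\<^bsub>GL2\<^esub> x) (x * M2 1 0 0 1 * inv\<^bsub>GL2\<^esub> x)"
    using x g by (intro mcong_mult mcong_refl GL2_mat GL2_mult_closed GL2.inv_closed) auto
  then show "x \<otimes>\<^bsub>GL2\<^esub> g \<otimes>\<^bsub>GL2\<^esub> inv\<^bsub>GL2\<^esub> x \<in> K l"
    using x g by (simp add: K_def GL2_mat GL2_inv_mult GL2_mult_closed)
qed

text \<open>
  The finite group \<open>GL\<^sub>2(\<O>/\<pi>\<^sup>l)\<close>, as a quotient of
  \<open>GL\<^sub>2(\<O>)\<close>.
\<close>

abbreviation Q :: "nat \<Rightarrow> 'a mat set monoid" where "Q l \<equiv> GL2 Mod K l"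

definition coset :: "nat \<Rightarrow> 'a mat \<Rightarrow> 'a mat set" where
  "coset l g = K l #>\<^bsub>GL2\<^esub> g"

lemma group_Q: "group (Q l)"
  by (rule normal.factorgroup_is_group[OF K_normal])

lemma coset_hom: "coset l \<in> hom GL2 (Q l)"
  unfolding coset_def[abs_def] by (rule normal.r_coset_hom_Mod[OF K_normal])

lemma carrier_Q: "carrier (Q l) = coset l ` carrier GL2"
  by (auto simp: carrier_FactGroup coset_def)

lemma coset_mult: "g \<in> carrier GL2 \<Longrightarrow> h \<in> carrier GL2 \<Longrightarrow> coset l g \<otimes>\<^bsub>Q l\<^esub> coset l h = coset l (g * h)"
  using hom_mult[OF coset_hom, of g h l] by simp

lemma coset_inv: "g \<in> carrier GL2 \<Longrightarrow> inv\<^bsub>Q l\<^esub> (coset l g) = coset l (inv\<^bsub>GL2\<^esub> g)"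
proof -
  interpret h: group_hom GL2 "Q l" "coset l"
    by (intro group_hom.intro group_hom_axioms.intro group_GL group_Q coset_hom)
  show "g \<in> carrier GL2 \<Longrightarrow> ?thesis" by simp
qed

lemma coset_eq_iff:
  assumes g: "g \<in> carrier GL2" and h: "h \<in> carrier GL2"
  shows "coset l g = coset l h \<longleftrightarrow> mcong l g h"
proof
  have sub: "subgroup (K l) GL2" using K_normal normal.axioms(1) by blast
  assume "coset l g = coset l h"
  then have "g \<in> K l #>\<^bsub>GL2\<^esub> h" using GL2.rcos_self[OF g sub] by (simp add: coset_def)
  then obtain k where k: "k \<in> K l" "g = k * h" by (auto simp: r_coset_def)
  then have "mcong l (k * h) (M2 1 0 0 1 * h)" using h
    by (intro mcong_mult mcong_refl GL2_mat) (auto simp: K_def)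
  then show "mcong l g h" using k h by (simp add: GL2_mat)
next
  have sub: "subgroup (K l) GL2" using K_normal normal.axioms(1) by blast
  assume c: "mcong l g h"
  have "mcong l (g * inv\<^bsub>GL2\<^esub> h) (h * inv\<^bsub>GL2\<^esub> h)"
    using g h c by (intro mcong_mult mcong_refl GL2_mat GL2.inv_closed)
  then have k: "g * inv\<^bsub>GL2\<^esub> h \<in> K l" using g h by (simp add: K_def GL2_inv_mult GL2_mult_closed)
  have "g = (g * inv\<^bsub>GL2\<^esub> h) * h"
    using GL2.m_assoc[of g "inv\<^bsub>GL2\<^esub> h" h] g h by (simp add: GL2_inv_mult GL2_mat)
  then have "g \<in> K l #>\<^bsub>GL2\<^esub> h" using k unfolding r_coset_def by auto
  then show "coset l g = coset l h" unfolding coset_def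
    using GL2.repr_independence[OF _ h sub] by blast
qed

definition red_mat :: "nat \<Rightarrow> 'a mat \<Rightarrow> 'a \<times> 'a \<times> 'a \<times> 'a" where
  "red_mat l g = (red l (g $$ (0,0)), red l (g $$ (0,1)), red l (g $$ (1,0)), red l (g $$ (1,1)))"

lemma mcong_of_red_mat:
  assumes "red_mat l g = red_mat l h"
  shows "mcong l g h"
proof -
  have "\<pi> ^ l dvd x - y" if "red l x = red l y" for x y
    using dvd_diff[OF red(2)[of l x] red(2)[of l y]] that by simp
  then show ?thesis using assms by (auto simp: mcong_def red_mat_def less_2_cases_iff)
qed

lemma finite_carrier_Q: "finite (carrier (Q l))"
proof -
  have "finite (red_mat l ` carrier GL2)"
    by (rule finite_subset[of _ "reps l \<times> reps l \<times> reps l \<times> reps l"])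
      (auto simp: red_mat_def red finite_reps)
  moreover have "coset l ` carrier GL2 \<subseteq> (\<lambda>t. coset l (SOME g. g \<in> carrier GL2 \<and> red_mat l g = t)) ` (red_mat l ` carrier GL2)"
  proof
    fix C assume "C \<in> coset l ` carrier GL2"
    then obtain g where g: "g \<in> carrier GL2" "C = coset l g" by auto
    let ?h = "SOME h. h \<in> carrier GL2 \<and> red_mat l h = red_mat l g"
    have h: "?h \<in> carrier GL2 \<and> red_mat l ?h = red_mat l g" by (rule someI[of _ g]) (use g in auto)
    then have "coset l ?h = C" using g coset_eq_iff mcong_of_red_mat by auto
    then show "C \<in> (\<lambda>t. coset l (SOME g. g \<in> carrier GL2 \<and> red_mat l g = t)) ` (red_mat l ` carrier GL2)"
      using g by blast
  qed
  ultimately show ?thesis unfolding carrier_Q by (meson finite_imageI finite_subset)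
qed

lemma finite_group_Q: "finite_group (Q l)"
  by (intro finite_group.intro finite_group_axioms.intro group_Q finite_carrier_Q)

definition lift :: "('a mat \<Rightarrow> 'b) \<Rightarrow> 'a mat set \<Rightarrow> 'b" where
  "lift f C = f (SOME g. g \<in> C)"

lemma lift_coset:
  assumes inv: "\<And>g h. g \<in> carrier GL2 \<Longrightarrow> h \<in> carrier GL2 \<Longrightarrow> mcong l g h \<Longrightarrow> f g = f h"
    and g: "g \<in> carrier GL2"
  shows "lift f (coset l g) = f g"
proof -
  have sub: "subgroup (K l) GL2" using K_normal normal.axioms(1) by blast
  let ?h = "SOME h. h \<in> coset l g"
  have h: "?h \<in> coset l g" by (rule someI[of _ g]) (simp add: coset_def GL2.rcos_self[OF g sub])
  have hc: "?h \<in> carrier GL2" using h GL2.r_coset_subset_G[OF subgroup.subset[OF sub] g] by (auto simp: coset_def)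
  have "coset l ?h = coset l g" using h GL2.repr_independence[OF _ g sub] by (simp add: coset_def)
  then have "mcong l ?h g" using coset_eq_iff[OF hc g] by simp
  then show ?thesis unfolding lift_def by (rule inv[OF hc g])
qed

text \<open>
  The function \<open>f\<close> factors through \<open>Q l\<close>; for a homomorphism this means that
  \<open>K l\<close> lies in its kernel.
\<close>

definition level_le :: "nat \<Rightarrow> ('a mat \<Rightarrow> 'b) \<Rightarrow> bool" where
  "level_le l f \<longleftrightarrow> (\<forall>g\<in>carrier GL2. \<forall>h\<in>carrier GL2. mcong l g h \<longrightarrow> f g = f h)"

lemma lift_coset_of_level: "level_le l f \<Longrightarrow> g \<in> carrier GL2 \<Longrightarrow> lift f (coset l g) = f g"
  by (rule lift_coset) (auto simp: level_le_def)

lemma irrep_lift: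
  assumes "level_le l \<rho>"
  shows "irrep (Q l) n (lift \<rho>) \<longleftrightarrow> irrep GL2 n \<rho>"
  by (rule irrep_pullback[OF group_GL group_Q coset_hom]) (auto simp: carrier_Q lift_coset_of_level[OF assms])

lemma irrep_inflate: "irrep GL2 n (\<lambda>g. \<sigma> (coset l g)) \<longleftrightarrow> irrep (Q l) n \<sigma>"
  by (rule irrep_pullback[OF group_GL group_Q coset_hom, symmetric]) (auto simp: carrier_Q)

lemma level_le_inflate: "level_le l (\<lambda>g. \<sigma> (coset l g))"
  unfolding level_le_def using coset_eq_iff by metis

lemma level_le_hom:
  assumes \<rho>: "\<rho> \<in> hom GL2 (GL n)" and triv: "\<And>g. g \<in> K l \<Longrightarrow> \<rho> g = 1\<^sub>m n"
  shows "level_le l \<rho>"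
  unfolding level_le_def
proof (intro ballI impI)
  fix g h assume g: "g \<in> carrier GL2" and h: "h \<in> carrier GL2" and c: "mcong l g h"
  let ?k = "inv\<^bsub>GL2\<^esub> g * h"
  have kc: "?k \<in> carrier GL2" using g h by (intro GL2_mult_closed GL2.inv_closed)
  have "mcong l (inv\<^bsub>GL2\<^esub> g * g) ?k"
    using g h c by (intro mcong_mult mcong_refl GL2_mat GL2.inv_closed)
  then have "?k \<in> K l" using kc g by (simp add: K_def GL2_inv_mult mcong_sym)
  then have "\<rho> ?k = 1\<^sub>m n" by (rule triv)
  moreover have "g * ?k = h" using GL2_inv_cancel(2)[OF g h] .
  then have "\<rho> h = \<rho> g * \<rho> ?k" using hom_GL_D(2)[OF \<rho> g kc] by simp
  ultimately show "\<rho> g = \<rho> h" using hom_GL_D(1)[OF \<rho> g] by simp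
qed

end

section \<open>Continuity\<close>

definition entry_norm :: "nat \<Rightarrow> complex mat \<Rightarrow> real" where
  "entry_norm n A = (\<Sum>i<n. \<Sum>j<n. cmod (A $$ (i,j)))"

lemma entry_norm_nonneg: "entry_norm n A \<ge> 0"
  by (simp add: entry_norm_def sum_nonneg)

lemma entry_norm_add:
  assumes "A \<in> carrier_mat n n" "B \<in> carrier_mat n n"
  shows "entry_norm n (A + B) \<le> entry_norm n A + entry_norm n B"
proof -
  have "entry_norm n (A + B) \<le> (\<Sum>i<n. \<Sum>j<n. cmod (A $$ (i,j)) + cmod (B $$ (i,j)))"
    unfolding entry_norm_def using assms by (intro sum_mono) (auto intro: norm_triangle_ineq)
  then show ?thesis by (simp add: entry_norm_def sum.distrib)
qed

lemma entry_norm_mult: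
  assumes A: "A \<in> carrier_mat n n" and B: "B \<in> carrier_mat n n"
  shows "entry_norm n (A * B) \<le> entry_norm n A * entry_norm n B"
proof -
  have "entry_norm n (A * B) \<le> (\<Sum>i<n. \<Sum>j<n. \<Sum>k<n. cmod (A $$ (i,k)) * cmod (B $$ (k,j)))"
    unfolding entry_norm_def
  proof (intro sum_mono)
    fix i j assume "i \<in> {..<n}" "j \<in> {..<n}"
    then have "(A * B) $$ (i,j) = (\<Sum>k<n. A $$ (i,k) * B $$ (k,j))" by (intro mult_mat_index[OF A B]) auto
    then have "cmod ((A * B) $$ (i,j)) \<le> (\<Sum>k<n. cmod (A $$ (i,k) * B $$ (k,j)))" by (simp only: norm_sum)
    then show "cmod ((A * B) $$ (i,j)) \<le> (\<Sum>k<n. cmod (A $$ (i,k)) * cmod (B $$ (k,j)))" by (simp only: norm_mult)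
  qed
  also have "\<dots> = (\<Sum>i<n. \<Sum>k<n. cmod (A $$ (i,k)) * (\<Sum>j<n. cmod (B $$ (k,j))))"
  proof (rule sum.cong[OF refl])
    fix i
    show "(\<Sum>j<n. \<Sum>k<n. cmod (A $$ (i,k)) * cmod (B $$ (k,j))) = (\<Sum>k<n. cmod (A $$ (i,k)) * (\<Sum>j<n. cmod (B $$ (k,j))))"
      unfolding sum_distrib_left by (rule sum.swap)
  qed
  also have "\<dots> \<le> (\<Sum>i<n. \<Sum>k<n. cmod (A $$ (i,k)) * entry_norm n B)"
  proof (intro sum_mono mult_left_mono)
    fix i k assume k: "k \<in> {..<n}"
    show "(\<Sum>j<n. cmod (B $$ (k,j))) \<le> entry_norm n B"
      unfolding entry_norm_def by (rule member_le_sum[OF k]) (auto simp: sum_nonneg)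
  qed auto
  also have "\<dots> = entry_norm n A * entry_norm n B"
    by (simp add: entry_norm_def sum_distrib_right)
  finally show ?thesis .
qed

lemma entry_norm_zero_iff:
  assumes "A \<in> carrier_mat n n"
  shows "entry_norm n A = 0 \<longleftrightarrow> A = 0\<^sub>m n n"
proof
  assume "entry_norm n A = 0"
  then have "\<forall>i\<in>{..<n}. (\<Sum>j<n. cmod (A $$ (i,j))) = 0"
    unfolding entry_norm_def by (subst (asm) sum_nonneg_eq_0_iff) (auto simp: sum_nonneg)
  then have "\<forall>i\<in>{..<n}. \<forall>j\<in>{..<n}. cmod (A $$ (i,j)) = 0"
    by (subst (asm) sum_nonneg_eq_0_iff) auto
  then show "A = 0\<^sub>m n n" using assms by (intro eq_matI) auto
qed (simp add: entry_norm_def)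

text \<open>
  If \<open>\<rho> g = 1 + E\<close>, then \<open>\<rho> (g\<^sup>2) - 1 = 2 E + E\<^sup>2\<close>, and
  for \<open>E\<close> of norm at most \<open>1/2\<close> this has norm at least \<open>3/2\<close> times
  that of \<open>E\<close>. Repeated squaring would therefore leave every neighbourhood of the identity,
  unless \<open>E = 0\<close>.
\<close>

lemma no_small_subgroups:
  assumes mat: "\<And>g. g \<in> H \<Longrightarrow> \<rho> g \<in> carrier_mat n n"
    and closed: "\<And>g. g \<in> H \<Longrightarrow> g \<otimes>\<^bsub>G\<^esub> g \<in> H"
    and mult: "\<And>g. g \<in> H \<Longrightarrow> \<rho> (g \<otimes>\<^bsub>G\<^esub> g) = \<rho> g * \<rho> g"
    and small: "\<And>g. g \<in> H \<Longrightarrow> entry_norm n (\<rho> g - 1\<^sub>m n) \<le> 1/2"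
    and g: "g \<in> H"
  shows "\<rho> g = 1\<^sub>m n"
proof -
  define s where "s g = entry_norm n (\<rho> g - 1\<^sub>m n)" for g
  have step: "3/2 * s g \<le> s (g \<otimes>\<^bsub>G\<^esub> g)" if g: "g \<in> H" for g
  proof -
    define E where "E = \<rho> g - 1\<^sub>m n"
    have E: "E \<in> carrier_mat n n" using mat[OF g] by (simp add: E_def minus_carrier_mat)
    have r: "\<rho> g = 1\<^sub>m n + E" using mat[OF g] by (intro eq_matI) (auto simp: E_def)
    have one: "1\<^sub>m n \<in> carrier_mat n n" by simp
    have E1: "1\<^sub>m n + E \<in> carrier_mat n n" using E by simp
    have "\<rho> g * \<rho> g = 1\<^sub>m n + E + (E + E * E)"
      unfolding r add_mult_distrib_mat[OF one E E1] mult_add_distrib_mat[OF E one E] using E by simp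
    then have E2: "\<rho> (g \<otimes>\<^bsub>G\<^esub> g) - 1\<^sub>m n = E + E + E * E" (is "?F = _")
      unfolding mult[OF g] using E by (intro eq_matI) auto
    have F: "?F \<in> carrier_mat n n" unfolding E2 using E by auto
    have "E + E = ?F + (- (E * E))" unfolding E2 using E by (intro eq_matI) auto
    moreover have "entry_norm n (- (E * E)) = entry_norm n (E * E)" using E by (simp add: entry_norm_def)
    ultimately have "entry_norm n (E + E) \<le> entry_norm n ?F + entry_norm n (E * E)"
      using entry_norm_add[OF F, of "- (E * E)"] E by simp
    moreover have "entry_norm n (E + E) = 2 * entry_norm n E"
    proof -
      have "entry_norm n (E + E) = (\<Sum>i<n. \<Sum>j<n. 2 * cmod (E $$ (i,j)))"
        unfolding entry_norm_def using E by (intro sum.cong refl) (auto simp: mult_2[symmetric] norm_mult)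
      then show ?thesis by (simp add: entry_norm_def sum_distrib_left)
    qed
    moreover have "entry_norm n (E * E) \<le> entry_norm n E * (1/2)"
    proof (rule order.trans[OF entry_norm_mult[OF E E]])
      show "entry_norm n E * entry_norm n E \<le> entry_norm n E * (1/2)"
        using small[OF g] by (intro mult_left_mono entry_norm_nonneg) (simp add: E_def)
    qed
    ultimately show ?thesis by (simp add: s_def E_def)
  qed
  have "\<exists>h\<in>H. (3/2) ^ k * s g \<le> s h" for k
  proof (induction k)
    case 0
    show ?case using g by (intro bexI[of _ g]) auto
  next
    case (Suc k)
    then obtain h where h: "h \<in> H" "(3/2) ^ k * s g \<le> s h" by blast
    have "(3/2) ^ Suc k * s g = 3/2 * ((3/2) ^ k * s g)" by simp
    also have "\<dots> \<le> 3/2 * s h" using h(2) by (intro mult_left_mono) auto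
    also have "\<dots> \<le> s (h \<otimes>\<^bsub>G\<^esub> h)" by (rule step[OF h(1)])
    finally show ?case using closed[OF h(1)] by blast
  qed
  then have bound: "(3/2) ^ k * s g \<le> 1/2" for k using small unfolding s_def by (meson order.trans)
  have "s g = 0"
  proof (rule ccontr)
    assume "s g \<noteq> 0"
    then have pos: "s g > 0" using entry_norm_nonneg[of n "\<rho> g - 1\<^sub>m n"] by (simp add: s_def)
    obtain k where "1 / s g < (3/2::real) ^ k" using real_arch_pow[of "3/2" "1 / s g"] by auto
    then have "1 < (3/2) ^ k * s g" using pos by (simp add: field_simps)
    with bound[of k] show False by simp
  qed
  then have "\<rho> g - 1\<^sub>m n = 0\<^sub>m n n"
    using entry_norm_zero_iff[of "\<rho> g - 1\<^sub>m n" n] mat[OF g] by (simp add: s_def minus_carrier_mat)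
  then have e: "(\<rho> g - 1\<^sub>m n) $$ (i,j) = 0" if "i < n" "j < n" for i j using that by simp
  show ?thesis
  proof (rule eq_matI)
    fix i j assume "i < dim_row (1\<^sub>m n :: complex mat)" "j < dim_col (1\<^sub>m n :: complex mat)"
    then show "\<rho> g $$ (i,j) = 1\<^sub>m n $$ (i,j)" using e[of i j] by simp
  qed (use mat[OF g] in auto)
qed

text \<open>
  The additional assumption relates \<open>\<pi>\<close> to the powers of \<open>\<mm>\<close>, by which
  the topology is defined.
\<close>

locale uniformizer_ideal = uniformizer +
  fixes \<mm> :: "'a set"
  assumes ideal_power: "\<mm> [^]\<^bsub>ideals_set class_ring\<^esub> k = {x. \<pi> ^ k dvd x}"
begin

abbreviation T :: "'a mat topology" where "T \<equiv> GL_topology \<mm> 2"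

lemma congruence_coset_eq: "congruence_coset \<mm> 2 k g = {h \<in> carrier GL2. mcong k h g}"
  by (auto simp: congruence_coset_def mcong_def ideal_power)

lemma topspace_T: "topspace T = carrier GL2"
  unfolding GL_topology_def topology_generated_by_topspace
  by (auto simp: congruence_coset_eq intro: mcong_refl)

lemma openin_T_coset: "g \<in> carrier GL2 \<Longrightarrow> openin T {h \<in> carrier GL2. mcong k h g}"
  unfolding GL_topology_def congruence_coset_eq[symmetric]
  by (rule topology_generated_by_Basis) blast

lemma openin_T_nhd:
  assumes "openin T U" "g \<in> U" "g \<in> carrier GL2"
  shows "\<exists>k. {h \<in> carrier GL2. mcong k h g} \<subseteq> U"
proof -
  have "generate_topology_on {congruence_coset \<mm> 2 k g | k g. g \<in> carrier GL2} U"
    using assms(1) unfolding GL_topology_def openin_topology_generated_by_iff .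
  then show ?thesis using assms(2)
  proof (induction U)
    case Empty
    then show ?case by simp
  next
    case (Int a b)
    then obtain k1 k2 where k: "{h \<in> carrier GL2. mcong k1 h g} \<subseteq> a" "{h \<in> carrier GL2. mcong k2 h g} \<subseteq> b" by blast
    have "{h \<in> carrier GL2. mcong (max k1 k2) h g} \<subseteq> a \<inter> b"
    proof
      fix h assume h: "h \<in> {h \<in> carrier GL2. mcong (max k1 k2) h g}"
      then have "mcong k1 h g" "mcong k2 h g" using mcong_mono[of _ "max k1 k2" h g] by auto
      with h k show "h \<in> a \<inter> b" by auto
    qed
    then show ?case by blast
  next
    case (UN C)
    then obtain c where c: "c \<in> C" "g \<in> c" by auto
    from UN(2)[OF c] obtain k where "{h \<in> carrier GL2. mcong k h g} \<subseteq> c" by blast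
    with c(1) show ?case by blast
  next
    case (Basis s)
    then obtain k x where s: "s = congruence_coset \<mm> 2 k x" by auto
    have "{h \<in> carrier GL2. mcong k h g} \<subseteq> s"
    proof
      fix h assume h: "h \<in> {h \<in> carrier GL2. mcong k h g}"
      have "mcong k g x" using Basis(2) unfolding s congruence_coset_eq by simp
      with h mcong_trans[of k h g x] show "h \<in> s" unfolding s congruence_coset_eq by simp
    qed
    then show ?case by blast
  qed
qed

lemma continuous_of_level_le:
  assumes "level_le l f"
  shows "continuous_map T euclidean f"
  unfolding continuous_map_def
proof (intro conjI allI impI)
  show "f \<in> topspace T \<rightarrow> topspace euclidean" by simp
  fix U :: "'b set"
  show "openin T {x \<in> topspace T. f x \<in> U}"
  proof (subst openin_subopen, intro ballI)
    fix g assume g: "g \<in> {x \<in> topspace T. f x \<in> U}"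
    then have gc: "g \<in> carrier GL2" by (simp add: topspace_T)
    have "{h \<in> carrier GL2. mcong l h g} \<subseteq> {x \<in> topspace T. f x \<in> U}"
    proof
      fix h assume h: "h \<in> {h \<in> carrier GL2. mcong l h g}"
      then have "f h = f g" using assms gc unfolding level_le_def by blast
      then show "h \<in> {x \<in> topspace T. f x \<in> U}" using g h by (simp add: topspace_T)
    qed
    then show "\<exists>S. openin T S \<and> g \<in> S \<and> S \<subseteq> {x \<in> topspace T. f x \<in> U}"
      using openin_T_coset[OF gc, of l] gc by (intro exI[of _ "{h \<in> carrier GL2. mcong l h g}"]) (simp add: mcong_refl)
  qed
qed

lemma continuous_rep_of_level_le:
  assumes "\<rho> \<in> hom GL2 (GL n)" "level_le l \<rho>"
  shows "continuous_rep GL2 T n \<rho>"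
proof -
  have "level_le l (\<lambda>g. \<rho> g $$ (i,j))" for i j
    using assms(2) unfolding level_le_def by metis
  then show ?thesis unfolding continuous_rep_def using assms(1) continuous_of_level_le by blast
qed

text \<open>
  By continuity, \<open>\<rho>\<close> maps some \<open>K l\<close> into the ball of
  \<open>no_small_subgroups\<close>.
\<close>

lemma level_le_of_continuous_rep:
  assumes "continuous_rep GL2 T n \<rho>"
  shows "\<exists>l. level_le l \<rho>"
proof -
  have hom: "\<rho> \<in> hom GL2 (GL n)" using assms by (simp add: continuous_rep_def)
  \<comment> \<open>Such a bound for each of the \<open>n * n\<close> entries gives a norm of at most \<open>1/2\<close>, also for \<open>n = 0\<close>.\<close>
  define \<epsilon> where "\<epsilon> = 1 / (2 * (real n + 1) ^ 2)"
  have eps: "\<epsilon> > 0" by (simp add: \<epsilon>_def)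
  let ?e = "M2 1 0 0 1 :: 'a mat"
  have ec: "?e \<in> carrier GL2" by simp
  have \<rho>e: "\<rho> ?e = 1\<^sub>m n" using hom_GL_one[OF group_GL hom] by (simp add: GL2_one)
  have "\<exists>k. \<forall>h\<in>carrier GL2. mcong k h ?e \<longrightarrow> cmod (\<rho> h $$ (i,j) - 1\<^sub>m n $$ (i,j)) < \<epsilon>" if ij: "i < n" "j < n" for i j
  proof -
    let ?V = "{z. cmod (z - 1\<^sub>m n $$ (i,j)) < \<epsilon>}"
    let ?U = "{x \<in> topspace T. \<rho> x $$ (i,j) \<in> ?V}"
    have "open ?V" by (intro open_Collect_less continuous_intros)
    have "continuous_map T euclidean (\<lambda>g. \<rho> g $$ (i,j))" using assms ij by (simp add: continuous_rep_def)
    then have "openin T ?U" by (rule openin_continuous_map_preimage) (simp add: \<open>open ?V\<close> open_openin[symmetric])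
    moreover have "?e \<in> ?U" using eps ec by (simp add: topspace_T \<rho>e)
    ultimately have "\<exists>k. {h \<in> carrier GL2. mcong k h ?e} \<subseteq> ?U" using ec by (rule openin_T_nhd)
    then obtain k where k: "{h \<in> carrier GL2. mcong k h ?e} \<subseteq> ?U" ..
    show ?thesis
    proof (intro exI[of _ k] ballI impI)
      fix h assume "h \<in> carrier GL2" "mcong k h ?e"
      then have "h \<in> ?U" by (intro subsetD[OF k]) simp
      then show "cmod (\<rho> h $$ (i,j) - 1\<^sub>m n $$ (i,j)) < \<epsilon>" by simp
    qed
  qed
  then obtain k where k: "\<And>i j h. i < n \<Longrightarrow> j < n \<Longrightarrow> h \<in> carrier GL2 \<Longrightarrow> mcong (k i j) h ?e \<Longrightarrow>
      cmod (\<rho> h $$ (i,j) - 1\<^sub>m n $$ (i,j)) < \<epsilon>" by metis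
  define l where "l = Max (insert 0 ((\<lambda>(i,j). k i j) ` ({..<n} \<times> {..<n})))"
  have kl: "k i j \<le> l" if "i < n" "j < n" for i j unfolding l_def using that by (intro Max_ge) auto
  have small: "entry_norm n (\<rho> g - 1\<^sub>m n) \<le> 1/2" if g: "g \<in> K l" for g
  proof -
    have gc: "g \<in> carrier GL2" and gl: "mcong l g ?e" using g by (auto simp: K_def)
    have "entry_norm n (\<rho> g - 1\<^sub>m n) \<le> (\<Sum>i<n. \<Sum>j<n. \<epsilon>)"
      unfolding entry_norm_def
    proof (intro sum_mono)
      fix i j assume "i \<in> {..<n}" "j \<in> {..<n}"
      then have ij: "i < n" "j < n" by auto
      have "cmod (\<rho> g $$ (i,j) - 1\<^sub>m n $$ (i,j)) < \<epsilon>" by (rule k[OF ij gc mcong_mono[OF kl[OF ij] gl]])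
      then show "cmod ((\<rho> g - 1\<^sub>m n) $$ (i,j)) \<le> \<epsilon>" using ij hom_GL_D(1)[OF hom gc] by simp
    qed
    also have "\<dots> = (real n)^2 * \<epsilon>" by (simp add: power2_eq_square)
    also have "\<dots> \<le> (real n + 1)^2 * \<epsilon>" using eps by (intro mult_right_mono power_mono) auto
    also have "\<dots> = 1/2" by (simp add: \<epsilon>_def)
    finally show ?thesis .
  qed
  have sub: "subgroup (K l) GL2" using K_normal normal.axioms(1) by blast
  have Kc: "g \<in> carrier GL2" if "g \<in> K l" for g using that by (simp add: K_def)
  have "\<rho> g = 1\<^sub>m n" if "g \<in> K l" for g
  proof (rule no_small_subgroups[where H = "K l" and G = GL2])
    show "h \<otimes>\<^bsub>GL2\<^esub> h \<in> K l" if "h \<in> K l" for h using subgroup.m_closed[OF sub that that] .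
    show "\<rho> (h \<otimes>\<^bsub>GL2\<^esub> h) = \<rho> h * \<rho> h" if "h \<in> K l" for h by (rule hom_GL_D(2)[OF hom Kc[OF that] Kc[OF that]])
    show "\<rho> h \<in> carrier_mat n n" if "h \<in> K l" for h by (rule hom_GL_D(1)[OF hom Kc[OF that]])
  qed (use small that in auto)
  then have "level_le l \<rho>" by (intro level_le_hom[OF hom])
  then show ?thesis by blast
qed

lemma irreducible_rep_iff: "irreducible_rep GL2 T n \<rho> \<longleftrightarrow> irrep GL2 n \<rho> \<and> (\<exists>l. level_le l \<rho>)"
proof
  assume a: "irreducible_rep GL2 T n \<rho>"
  then have c: "continuous_rep GL2 T n \<rho>" by (simp add: irreducible_rep_def)
  then have h: "\<rho> \<in> hom GL2 (GL n)" by (simp add: continuous_rep_def)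
  have "irrep GL2 n \<rho>"
    using a unfolding irreducible_rep_def irrep_def by (elim conjE, intro conjI h) assumption+
  with level_le_of_continuous_rep[OF c] show "irrep GL2 n \<rho> \<and> (\<exists>l. level_le l \<rho>)" by simp
next
  assume a: "irrep GL2 n \<rho> \<and> (\<exists>l. level_le l \<rho>)"
  then obtain l where l: "level_le l \<rho>" and r: "irrep GL2 n \<rho>" by metis
  then have "\<rho> \<in> hom GL2 (GL n)" by (simp add: irrep_def)
  then have c: "continuous_rep GL2 T n \<rho>" using l by (rule continuous_rep_of_level_le)
  show "irreducible_rep GL2 T n \<rho>"
    using r unfolding irreducible_rep_def irrep_def by (elim conjE, intro conjI c) assumption+
qed

end

section \<open>Dimension and level\<close>

text \<open>
  Eigenvectors of which any two are separated by the eigenvalues of a common eigenoperator are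
  independent: in a shortest relation, apply an operator that separates two of its terms and subtract a
  multiple of the relation; the result is shorter.
\<close>

lemma eigenvectors_card_le:
  fixes v :: "'i \<Rightarrow> complex vec"
  assumes fin: "finite I" and v: "\<And>i. i \<in> I \<Longrightarrow> v i \<in> carrier_vec n" "\<And>i. i \<in> I \<Longrightarrow> v i \<noteq> 0\<^sub>v n"
    and sep: "\<And>i j. i \<in> I \<Longrightarrow> j \<in> I \<Longrightarrow> i \<noteq> j \<Longrightarrow>
      \<exists>A e. A \<in> carrier_mat n n \<and> (\<forall>k\<in>I. A *\<^sub>v v k = e k \<cdot>\<^sub>v v k) \<and> e i \<noteq> e j"
  shows "card I \<le> n"
proof (rule ccontr)
  assume "\<not> card I \<le> n"
  with nontrivial_relation[of "{..<n}" I "\<lambda>i j. v i $ j"] fin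
  obtain c0 where c0: "\<exists>i\<in>I. c0 i \<noteq> 0" "\<forall>j\<in>{..<n}. (\<Sum>i\<in>I. c0 i * v i $ j) = 0" by auto
  have "\<forall>i\<in>I. c i = 0" if "\<forall>j\<in>{..<n}. (\<Sum>i\<in>I. c i * v i $ j) = 0" for c
    using that
  proof (induction "card {i\<in>I. c i \<noteq> 0}" arbitrary: c rule: less_induct)
    case (less c)
    show ?case
    proof (rule ccontr)
      assume "\<not> (\<forall>i\<in>I. c i = 0)"
      then obtain i where i: "i \<in> I" "c i \<noteq> 0" by blast
      show False
      proof (cases "\<exists>j\<in>I. j \<noteq> i \<and> c j \<noteq> 0")
        case False
        have "v i = 0\<^sub>v n"
        proof (rule eq_vecI)
          fix r assume "r < dim_vec (0\<^sub>v n :: complex vec)"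
          then have r: "r < n" by simp
          have "(\<Sum>k\<in>I. c k * v k $ r) = (\<Sum>k\<in>I. if k = i then c i * v i $ r else 0)"
            using False by (intro sum.cong) auto
          then have "c i * v i $ r = 0" using less.prems r fin i by simp
          then show "v i $ r = 0\<^sub>v n $ r" using i r by simp
        qed (use v(1)[OF i(1)] in auto)
        with v(2)[OF i(1)] show False by simp
      next
        case True
        then obtain j where j: "j \<in> I" "j \<noteq> i" "c j \<noteq> 0" by blast
        obtain A e where A: "A \<in> carrier_mat n n" "\<forall>k\<in>I. A *\<^sub>v v k = e k \<cdot>\<^sub>v v k" "e i \<noteq> e j"
          using sep[OF i(1) j(1)] j(2) by metis
        define c' where "c' k = c k * (e k - e j)" for k
        have "{k\<in>I. c' k \<noteq> 0} \<subset> {k\<in>I. c k \<noteq> 0}" using j by (auto simp: c'_def)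
        then have "card {k\<in>I. c' k \<noteq> 0} < card {k\<in>I. c k \<noteq> 0}" using fin by (intro psubset_card_mono) auto
        moreover have "\<forall>r\<in>{..<n}. (\<Sum>k\<in>I. c' k * v k $ r) = 0"
        proof
          fix r assume "r \<in> {..<n}"
          then have r: "r < n" by simp
          have "(\<Sum>k\<in>I. c k * e k * v k $ r) = (\<Sum>k\<in>I. c k * (\<Sum>s<n. A $$ (r,s) * v k $ s))"
          proof (intro sum.cong refl)
            fix k assume k: "k \<in> I"
            have "e k * v k $ r = (A *\<^sub>v v k) $ r" using A(2) k v(1)[OF k] r by simp
            also have "\<dots> = (\<Sum>s<n. A $$ (r,s) * v k $ s)" by (rule mult_mat_vec_index[OF A(1) v(1)[OF k] r])
            finally show "c k * e k * v k $ r = c k * (\<Sum>s<n. A $$ (r,s) * v k $ s)" by (simp add: mult.assoc)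
          qed
          also have "\<dots> = (\<Sum>s<n. A $$ (r,s) * (\<Sum>k\<in>I. c k * v k $ s))"
            by (simp add: sum_distrib_left sum.swap[of _ _ I] mult.left_commute)
          also have "\<dots> = 0" using less.prems by simp
          finally have "(\<Sum>k\<in>I. c k * e k * v k $ r) = 0" .
          moreover have "(\<Sum>k\<in>I. c k * v k $ r) = 0" using less.prems r by simp
          moreover have "(\<Sum>k\<in>I. c' k * v k $ r) = (\<Sum>k\<in>I. c k * e k * v k $ r) - e j * (\<Sum>k\<in>I. c k * v k $ r)"
            by (simp add: c'_def sum_distrib_left sum_subtractf[symmetric] algebra_simps)
          ultimately show "(\<Sum>k\<in>I. c' k * v k $ r) = 0" by simp
        qed
        ultimately have "\<forall>k\<in>I. c' k = 0" by (rule less.hyps)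
        then have "c' i = 0" using i(1) by simp
        then show False using i(2) A(3) by (simp add: c'_def)
      qed
    qed
  qed
  with c0 show False by blast
qed

text \<open>
  An involution \<open>A\<close> splits the space without any choice of roots: for a vector
  \<open>v\<close>, either \<open>A v + v\<close> is zero, and then \<open>A v = - v\<close>, or it is
  fixed by \<open>A\<close>. Being an eigenvector of the matrices that commute with \<open>A\<close> is
  inherited by \<open>A v + v\<close>.
\<close>

lemma commuting_involutions_eigenvector:
  fixes B :: "complex mat"
  assumes "finite S" and S: "\<And>A. A \<in> S \<Longrightarrow> A \<in> carrier_mat n n" "\<And>A. A \<in> S \<Longrightarrow> A * A = 1\<^sub>m n"
    "\<And>A A'. A \<in> S \<Longrightarrow> A' \<in> S \<Longrightarrow> A * A' = A' * A"
    and B: "B \<in> carrier_mat n n" "\<And>A. A \<in> S \<Longrightarrow> A * B = B * A"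
    and w: "w \<in> carrier_vec n" "w \<noteq> 0\<^sub>v n" "B *\<^sub>v w = c \<cdot>\<^sub>v w"
  shows "\<exists>v\<in>carrier_vec n. v \<noteq> 0\<^sub>v n \<and> B *\<^sub>v v = c \<cdot>\<^sub>v v \<and> (\<forall>A\<in>S. \<exists>\<epsilon>. A *\<^sub>v v = \<epsilon> \<cdot>\<^sub>v v)"
  using assms(1) S B(2)
proof (induction S rule: finite_induct)
  case empty
  then show ?case using w by auto
next
  case (insert A S)
  then have "\<exists>v\<in>carrier_vec n. v \<noteq> 0\<^sub>v n \<and> B *\<^sub>v v = c \<cdot>\<^sub>v v \<and> (\<forall>A\<in>S. \<exists>\<epsilon>. A *\<^sub>v v = \<epsilon> \<cdot>\<^sub>v v)"
    by simp
  then obtain v where v: "v \<in> carrier_vec n" "v \<noteq> 0\<^sub>v n" "B *\<^sub>v v = c \<cdot>\<^sub>v v" "\<forall>A\<in>S. \<exists>\<epsilon>. A *\<^sub>v v = \<epsilon> \<cdot>\<^sub>v v"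
    by metis
  have A: "A \<in> carrier_mat n n" "A * A = 1\<^sub>m n" using insert.prems by auto
  have Av: "A *\<^sub>v v \<in> carrier_vec n" using A v by simp
  define z where "z = A *\<^sub>v v + v"
  have zc: "z \<in> carrier_vec n" using Av v by (simp add: z_def)
  have through: "C *\<^sub>v z = \<epsilon> \<cdot>\<^sub>v z" if C: "C \<in> carrier_mat n n" "A * C = C * A" "C *\<^sub>v v = \<epsilon> \<cdot>\<^sub>v v" for C \<epsilon>
  proof -
    have "C *\<^sub>v (A *\<^sub>v v) = (A * C) *\<^sub>v v" unfolding C(2) by (rule assoc_mult_mat_vec[OF C(1) A(1) v(1), symmetric])
    also have "\<dots> = A *\<^sub>v (\<epsilon> \<cdot>\<^sub>v v)" unfolding C(3)[symmetric] by (rule assoc_mult_mat_vec[OF A(1) C(1) v(1)])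
    also have "\<dots> = \<epsilon> \<cdot>\<^sub>v (A *\<^sub>v v)" by (rule mult_mat_vec[OF A(1) v(1)])
    finally have "C *\<^sub>v z = \<epsilon> \<cdot>\<^sub>v (A *\<^sub>v v) + \<epsilon> \<cdot>\<^sub>v v"
      unfolding z_def by (simp only: mult_add_distrib_mat_vec[OF C(1) Av v(1)] C(3))
    then show ?thesis unfolding z_def by (simp only: smult_add_distrib_vec[OF Av v(1)])
  qed
  show ?case
  proof (cases "z = 0\<^sub>v n")
    case True
    have "A *\<^sub>v v = (-1) \<cdot>\<^sub>v v"
    proof (rule eq_vecI)
      fix i assume "i < dim_vec ((-1) \<cdot>\<^sub>v v)"
      then have i: "i < n" using v(1) by simp
      have "z $ i = 0" using True i by simp
      then show "(A *\<^sub>v v) $ i = ((-1) \<cdot>\<^sub>v v) $ i" using i v(1) A(1) by (simp add: z_def eq_neg_iff_add_eq_0 del: index_mult_mat_vec)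
    qed (use A v in auto)
    then have "\<exists>\<epsilon>. A *\<^sub>v v = \<epsilon> \<cdot>\<^sub>v v" by (rule exI)
    with v show ?thesis by (intro bexI[of _ v]) simp_all
  next
    case False
    have "A *\<^sub>v z = (A * A) *\<^sub>v v + A *\<^sub>v v"
      unfolding z_def assoc_mult_mat_vec[OF A(1) A(1) v(1)] by (rule mult_add_distrib_mat_vec[OF A(1) Av v(1)])
    also have "\<dots> = z" using A(2) v(1) Av by (simp add: z_def comm_add_vec[OF Av v(1)])
    finally have "A *\<^sub>v z = 1 \<cdot>\<^sub>v z" by simp
    then have "\<exists>\<epsilon>. A *\<^sub>v z = \<epsilon> \<cdot>\<^sub>v z" by (rule exI)
    moreover have "\<exists>\<epsilon>. C *\<^sub>v z = \<epsilon> \<cdot>\<^sub>v z" if C: "C \<in> S" for C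
    proof -
      from v(4) C obtain \<epsilon> where e: "C *\<^sub>v v = \<epsilon> \<cdot>\<^sub>v v" by metis
      show ?thesis by (rule exI, rule through[OF _ _ e]) (use insert.prems C in auto)
    qed
    moreover have "B *\<^sub>v z = c \<cdot>\<^sub>v z" by (rule through[OF B(1) _ v(3)]) (use insert.prems in auto)
    ultimately show ?thesis using False zc by (intro bexI[of _ z] conjI ballI) auto
  qed
qed

context uniformizer
begin

text \<open>
  The matrices \<open>U x = \<rho> (M2 1 x 0 1)\<close> are commuting involutions, because \<open>x + x =
  0\<close>. A common eigenvector \<open>v\<close> on which \<open>U y0\<close> is \<open>-1\<close> has
  an eigenvalue character \<open>\<epsilon>\<close>. For a unit \<open>a\<close> the vector \<open>\<rho>
  (diag a 1) v\<close> has the eigenvalue character \<open>x \<mapsto> \<epsilon> (x / a)\<close>, and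
  these are distinct for units that are distinct modulo \<open>\<pi>\<^sup>l\<^sup>+\<^sup>1\<close>.
\<close>

lemma dimension_ge_of_primitive:
  fixes \<rho> :: "'a mat \<Rightarrow> complex mat"
  assumes char2: "(1::'a) + 1 = 0" and \<rho>: "\<rho> \<in> hom GL2 (GL n)" and lev: "level_le (Suc l) \<rho>"
    and y0: "\<pi> ^ l dvd y0" "\<rho> (M2 1 y0 0 1) \<noteq> 1\<^sub>m n"
  shows "q ^ l \<le> n"
proof -
  define U where "U x = \<rho> (M2 1 x 0 1)" for x
  note r = hom_GL_D[OF \<rho>]
  have Uc: "U x \<in> carrier_mat n n" for x unfolding U_def by (rule r(1)) simp
  have Umult: "U x * U y = U (x + y)" for x y
    unfolding U_def using r(2)[of "M2 1 x 0 1" "M2 1 y 0 1"] by (simp add: add.commute)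
  have x2: "x + x = 0" for x :: 'a using char2 by (metis distrib_left mult.right_neutral mult_zero_right)
  have U0: "U 0 = 1\<^sub>m n" using hom_GL_one[OF group_GL \<rho>] by (simp add: U_def GL2_one)
  have Uinv: "U x * U x = 1\<^sub>m n" for x by (simp add: Umult x2 U0)
  have Ured: "U x = U (red (Suc l) x)" for x
    unfolding U_def using lev red(2)[of "Suc l" x]
    by (simp add: level_le_def mcong_M2 del: power_Suc)
  have "\<exists>x\<in>carrier_vec n. U y0 *\<^sub>v x - x \<noteq> 0\<^sub>v n"
  proof (rule ccontr)
    assume neg: "\<not> ?thesis"
    have "U y0 = 1\<^sub>m n"
    proof (rule mat_eqI_vec[OF Uc])
      fix x :: "complex vec" assume x: "x \<in> carrier_vec n"
      have "U y0 *\<^sub>v x - x = 0\<^sub>v n" using neg x by blast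
      then have z: "(U y0 *\<^sub>v x - x) $ i = 0" if "i < n" for i by (simp only: index_zero_vec that)
      have "(U y0 *\<^sub>v x) $ i = x $ i" if i: "i < n" for i
        using z[OF i] x i index_minus_vec(1)[of i x "U y0 *\<^sub>v x"] by (simp del: index_mult_mat_vec index_minus_vec)
      then show "U y0 *\<^sub>v x = 1\<^sub>m n *\<^sub>v x" using x Uc[of y0] by (intro eq_vecI) (simp_all del: index_mult_mat_vec)
    qed simp
    with y0(2) show False by (simp add: U_def)
  qed
  then obtain x where x: "x \<in> carrier_vec n" "U y0 *\<^sub>v x - x \<noteq> 0\<^sub>v n" by blast
  \<comment> \<open>As \<open>U y0\<close> is an involution, \<open>U y0 x - x\<close> is an eigenvector with eigenvalue \<open>-1\<close>.\<close>
  define w where "w = U y0 *\<^sub>v x - x"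
  have Ux: "U y0 *\<^sub>v x \<in> carrier_vec n" using Uc[of y0] x by simp
  have w: "w \<in> carrier_vec n" "w \<noteq> 0\<^sub>v n" using x Ux by (auto simp: w_def)
  have "U y0 *\<^sub>v w = (U y0 * U y0) *\<^sub>v x - U y0 *\<^sub>v x"
    unfolding w_def assoc_mult_mat_vec[OF Uc Uc x(1)] by (rule mult_minus_distrib_mat_vec[OF Uc Ux x(1)])
  also have "(U y0 * U y0) *\<^sub>v x = x" unfolding Uinv using x(1) by simp
  also have "x - U y0 *\<^sub>v x = (-1) \<cdot>\<^sub>v w"
  proof (rule eq_vecI)
    fix i assume "i < dim_vec ((-1) \<cdot>\<^sub>v w)"
    then have i: "i < dim_vec x" "i < dim_vec (U y0 *\<^sub>v x)" using w(1) x(1) Ux by (metis carrier_vecD index_smult_vec(2))+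
    then show "(x - U y0 *\<^sub>v x) $ i = ((-1) \<cdot>\<^sub>v w) $ i" unfolding w_def by (simp del: index_mult_mat_vec dim_mult_mat_vec)
  qed (simp only: index_minus_vec(2) index_smult_vec(2) carrier_vecD[OF w(1)] carrier_vecD[OF Ux])
  finally have w3: "U y0 *\<^sub>v w = (-1) \<cdot>\<^sub>v w" .
  have "\<exists>v\<in>carrier_vec n. v \<noteq> 0\<^sub>v n \<and> U y0 *\<^sub>v v = (-1) \<cdot>\<^sub>v v \<and> (\<forall>A\<in>U ` reps (Suc l). \<exists>\<epsilon>. A *\<^sub>v v = \<epsilon> \<cdot>\<^sub>v v)"
  proof (rule commuting_involutions_eigenvector[OF _ _ _ _ Uc _ w w3])
    show "finite (U ` reps (Suc l))" by (intro finite_imageI finite_reps)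
    show "A \<in> carrier_mat n n" if A: "A \<in> U ` reps (Suc l)" for A
      using A Uc by (elim imageE) simp
    show "A * A = 1\<^sub>m n" if A: "A \<in> U ` reps (Suc l)" for A
      using A by (elim imageE) (simp only: Uinv)
    show "A * U y0 = U y0 * A" if A: "A \<in> U ` reps (Suc l)" for A
      using A by (elim imageE) (simp only: Umult add.commute)
    show "A * A' = A' * A" if A: "A \<in> U ` reps (Suc l)" "A' \<in> U ` reps (Suc l)" for A A'
      using A by (elim imageE) (simp only: Umult add.commute)
  qed
  then obtain v where v: "v \<in> carrier_vec n" "v \<noteq> 0\<^sub>v n" "U y0 *\<^sub>v v = (-1) \<cdot>\<^sub>v v"
    "\<And>A. A \<in> U ` reps (Suc l) \<Longrightarrow> \<exists>\<epsilon>. A *\<^sub>v v = \<epsilon> \<cdot>\<^sub>v v" by metis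
  have "\<exists>\<epsilon>. U x *\<^sub>v v = \<epsilon> \<cdot>\<^sub>v v" for x using v(4)[of "U x"] Ured[of x] red(1)[of "Suc l" x] by blast
  then obtain \<epsilon> where \<epsilon>: "\<And>x. U x *\<^sub>v v = \<epsilon> x \<cdot>\<^sub>v v" by metis
  from v(1,2) obtain i0 where i0: "i0 < n" "v $ i0 \<noteq> 0"
    by (metis carrier_vecD eq_vecI index_zero_vec(1) index_zero_vec(2))
  have scalar: "a = b" if "a \<cdot>\<^sub>v v = b \<cdot>\<^sub>v v" for a b
    using arg_cong[OF that, of "\<lambda>u. u $ i0"] i0 v(1) by simp
  have \<epsilon>_add: "\<epsilon> (x + y) = \<epsilon> x * \<epsilon> y" for x y
  proof (rule scalar)
    have "\<epsilon> (x + y) \<cdot>\<^sub>v v = (U x * U y) *\<^sub>v v" by (simp only: Umult \<epsilon>)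
    also have "\<dots> = U x *\<^sub>v (\<epsilon> y \<cdot>\<^sub>v v)" unfolding \<epsilon>[of y, symmetric] by (rule assoc_mult_mat_vec[OF Uc Uc v(1)])
    also have "\<dots> = \<epsilon> y \<cdot>\<^sub>v (\<epsilon> x \<cdot>\<^sub>v v)" unfolding \<epsilon>[of x, symmetric] by (rule mult_mat_vec[OF Uc v(1)])
    finally show "\<epsilon> (x + y) \<cdot>\<^sub>v v = (\<epsilon> x * \<epsilon> y) \<cdot>\<^sub>v v" by (simp add: smult_smult_assoc mult.commute)
  qed
  have \<epsilon>0: "\<epsilon> y0 = -1" using scalar \<epsilon>[of y0] v(3) by simp
  have "\<epsilon> 0 = 1" using scalar[of "\<epsilon> 0" 1] \<epsilon>[of 0] U0 v(1) by simp
  then have \<epsilon>_nz: "\<epsilon> x \<noteq> 0" for x using \<epsilon>_add[of x x] x2[of x] by auto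
  define inv' where "inv' a = (SOME b. a * b = (1::'a))" for a
  have inv': "a * inv' a = 1" if a: "a dvd 1" for a
  proof -
    obtain b where b: "b dvd 1" "a * b = 1" using unit_inverse[OF a] .
    have "\<exists>b. a * b = 1" by (rule exI[of _ b]) (rule b(2))
    then show ?thesis unfolding inv'_def by (rule someI_ex)
  qed
  define va where "va a = \<rho> (M2 a 0 0 1) *\<^sub>v v" for a
  have units: "a dvd 1" if "a \<in> unit_reps (Suc l)" for a using that by (simp add: unit_reps_def)
  have Uva: "U x *\<^sub>v va a = \<epsilon> (inv' a * x) \<cdot>\<^sub>v va a" if a: "a dvd 1" for x a
  proof -
    have dc: "M2 a 0 0 1 \<in> carrier GL2" using a by simp
    have uc: "M2 1 x 0 1 \<in> carrier GL2" "M2 1 (inv' a * x) 0 1 \<in> carrier GL2" for x by simp_all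
    have "M2 1 x 0 1 * M2 a 0 0 1 = M2 a 0 0 1 * M2 1 (inv' a * x) 0 1"
      using inv'[OF a] by (simp add: mult.assoc[symmetric])
    then have e: "U x * \<rho> (M2 a 0 0 1) = \<rho> (M2 a 0 0 1) * U (inv' a * x)"
      unfolding U_def using r(2)[OF uc(1) dc, of x] r(2)[OF dc uc(2)] by (simp only: GL2_mult)
    have "U x *\<^sub>v va a = (U x * \<rho> (M2 a 0 0 1)) *\<^sub>v v"
      unfolding va_def by (rule assoc_mult_mat_vec[OF Uc r(1)[OF dc] v(1), symmetric])
    also have "\<dots> = \<rho> (M2 a 0 0 1) *\<^sub>v (\<epsilon> (inv' a * x) \<cdot>\<^sub>v v)"
      unfolding e \<epsilon>[symmetric] by (rule assoc_mult_mat_vec[OF r(1)[OF dc] Uc v(1)])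
    also have "\<dots> = \<epsilon> (inv' a * x) \<cdot>\<^sub>v va a" unfolding va_def by (rule mult_mat_vec[OF r(1)[OF dc] v(1)])
    finally show ?thesis .
  qed
  have "card (unit_reps (Suc l)) \<le> n"
  proof (rule eigenvectors_card_le[of _ va])
    show "finite (unit_reps (Suc l))" by (rule finite_unit_reps)
    fix a assume a: "a \<in> unit_reps (Suc l)"
    have dc: "M2 a 0 0 1 \<in> carrier GL2" using units[OF a] by simp
    show "va a \<in> carrier_vec n" unfolding va_def using r(1)[OF dc] v(1) by simp
    show "va a \<noteq> 0\<^sub>v n"
    proof
      assume "va a = 0\<^sub>v n"
      moreover have "\<rho> (M2 a 0 0 1) \<in> carrier (GL n)" using \<rho> dc by (auto simp: hom_def)
      ultimately have "v = 0\<^sub>v n" using GL_cancel_vec[OF _ v(1)] unfolding va_def by simp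
      with v(2) show False by simp
    qed
  next
    fix a b assume a: "a \<in> unit_reps (Suc l)" and b: "b \<in> unit_reps (Suc l)" and ab: "a \<noteq> b"
    have "\<not> \<pi> ^ Suc l dvd a - b"
    proof
      assume "\<pi> ^ Suc l dvd a - b"
      then have "a = b" using a b unfolding unit_reps_def by (intro reps_unique[of _ "Suc l"]) simp_all
      with ab show False by simp
    qed
    then obtain i z where iz: "i < Suc l" "a - b = \<pi> ^ i * z" "z dvd 1" by (rule valuation)
    obtain s where s: "y0 = \<pi> ^ l * s" using y0(1) by (auto simp: dvd_def)
    \<comment> \<open>This \<open>x\<close> solves \<open>x / a - x / b = y0\<close>, so that the two eigenvalues at \<open>x\<close> differ by the sign \<open>\<epsilon> y0\<close>.\<close>
    define x where "x = - (s * \<pi> ^ (l - i) * a * b * inv' z)"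
    have pl: "\<pi> ^ i * \<pi> ^ (l - i) = \<pi> ^ l" using iz(1) by (simp add: power_add[symmetric])
    have "inv' a * x - inv' b * x = - (s * \<pi> ^ (l - i) * inv' z) * ((a * inv' a) * b - (b * inv' b) * a)"
      by (simp add: x_def algebra_simps)
    also have "\<dots> = s * \<pi> ^ (l - i) * inv' z * (a - b)"
      by (simp add: inv' units a b algebra_simps)
    also have "\<dots> = s * (\<pi> ^ i * \<pi> ^ (l - i)) * (z * inv' z)" by (simp add: iz(2) mult_ac)
    also have "\<dots> = y0" by (simp add: inv' iz(3) pl s mult.commute)
    finally have "inv' a * x = inv' b * x + y0" by (simp add: algebra_simps)
    then have "\<epsilon> (inv' a * x) = - \<epsilon> (inv' b * x)" by (simp add: \<epsilon>_add \<epsilon>0)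
    then have ne: "\<epsilon> (inv' a * x) \<noteq> \<epsilon> (inv' b * x)" using \<epsilon>_nz[of "inv' b * x"] by auto
    show "\<exists>A e. A \<in> carrier_mat n n \<and> (\<forall>k\<in>unit_reps (Suc l). A *\<^sub>v va k = e k \<cdot>\<^sub>v va k) \<and> e a \<noteq> e b"
      by (intro exI[of _ "U x"] exI[of _ "\<lambda>k. \<epsilon> (inv' k * x)"] conjI ballI Uc ne Uva units)
  qed
  then show ?thesis using card_unit_reps_ge_power[of l] by simp
qed

lemma one_smult_mat [simp]: "(1::'b::monoid_mult) \<cdot>\<^sub>m A = A"
  by (rule eq_matI) auto

lemma unit_chars_mono:
  assumes "k \<le> l" "\<chi> \<in> unit_chars k"
  shows "\<chi> \<in> unit_chars l"
  unfolding unit_chars_def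
proof (intro CollectI conjI allI impI)
  fix x assume x: "x dvd 1" "\<pi> ^ l dvd x - 1"
  show "\<chi> x = 1"
    by (rule unit_charsD(3)[OF assms(2) x(1) dvd_trans[OF le_imp_power_dvd[OF assms(1)] x(2)]])
qed (use unit_charsD(1,2)[OF assms(2)] in auto)

lemma det2_GL2_unit: "g \<in> carrier GL2 \<Longrightarrow> det2 g dvd (1::'a)"
  by (simp add: GL2_carrier)

lemma det2_GL2_mult: "g \<in> carrier GL2 \<Longrightarrow> h \<in> carrier GL2 \<Longrightarrow> det2 (g * h) = det2 g * det2 (h :: 'a mat)"
  by (intro det2_mult GL2_mat)

lemma irrep_det_twist:
  assumes "irrep GL2 n \<rho>" "\<alpha> \<in> unit_chars l"
  shows "irrep GL2 n (\<lambda>g. \<alpha> (det2 g) \<cdot>\<^sub>m \<rho> g)"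
proof (rule irrep_twist[OF group_GL assms(1)])
  show "\<alpha> (det2 (g \<otimes>\<^bsub>GL2\<^esub> h)) = \<alpha> (det2 g) * \<alpha> (det2 h)" if "g \<in> carrier GL2" "h \<in> carrier GL2" for g h
    using unit_charsD(2)[OF assms(2) det2_GL2_unit[OF that(1)] det2_GL2_unit[OF that(2)]] that
    by (simp add: det2_GL2_mult)
  show "\<alpha> (det2 g) \<noteq> 0" if "g \<in> carrier GL2" for g
    by (rule unit_chars_nz[OF assms(2) det2_GL2_unit[OF that]])
qed

text \<open>
  The unipotent matrices congruent to \<open>1\<close> modulo \<open>\<pi>\<^sup>l\<close>, and the
  conjugates of these, generate the elements of determinant one of \<open>K l\<close>, by the Gauss
  decomposition. Hence on \<open>K l\<close> the representation depends only on the determinant; it is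
  invariant under conjugation there, so by Schur's lemma it is scalar, and the scalar is a character of
  the units congruent to \<open>1\<close> modulo \<open>\<pi>\<^sup>l\<close>. The inverse of an
  extension of this character to all units is the required twist.
\<close>

lemma twist_to_lower_level:
  fixes \<rho> :: "'a mat \<Rightarrow> complex mat"
  assumes l: "l > 0" and \<rho>: "irrep GL2 n \<rho>" and lev: "level_le (Suc l) \<rho>"
    and triv: "\<And>y. \<pi> ^ l dvd y \<Longrightarrow> \<rho> (M2 1 y 0 1) = 1\<^sub>m n"
  shows "\<exists>\<alpha>\<in>unit_chars (Suc l). level_le l (\<lambda>g. \<alpha> (det2 g) \<cdot>\<^sub>m \<rho> g)"
proof -
  have hom: "\<rho> \<in> hom GL2 (GL n)" and n0: "n \<noteq> 0" using \<rho> by (auto simp: irrep_def)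
  note r = hom_GL_D[OF hom]
  have rm: "\<rho> (g * h) = \<rho> g * \<rho> h" if "g \<in> carrier GL2" "h \<in> carrier GL2" for g h using r(2)[OF that] by simp
  have rm2: "\<rho> X = \<rho> g * \<rho> h" if "X = g * h" "g \<in> carrier GL2" "h \<in> carrier GL2" for X g h
    unfolding that(1) by (rule rm[OF that(2,3)])
  have rm3: "\<rho> X = \<rho> g * (\<rho> h * \<rho> k)" if "X = g * (h * k)" "g \<in> carrier GL2" "h \<in> carrier GL2" "k \<in> carrier GL2" for X g h k
    unfolding that(1) rm[OF that(2) GL2_mult_closed[OF that(3,4)]] rm[OF that(3,4)] ..
  have \<rho>1: "\<rho> (M2 1 0 0 1) = 1\<^sub>m n" using hom_GL_one[OF group_GL hom] by (simp add: GL2_one)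
  have cu: "a dvd 1" if "\<pi> ^ l dvd a - 1" for a using unit_cong[OF that l] by simp
  have lower: "\<rho> (M2 1 0 y 1) = 1\<^sub>m n" if y: "\<pi> ^ l dvd y" for y
  proof -
    have w: "M2 0 1 1 0 \<in> carrier (GL2 :: 'a mat monoid)" by simp
    have ww: "\<rho> (M2 0 1 1 0) * \<rho> (M2 0 1 1 0) = 1\<^sub>m n" using rm[OF w w] \<rho>1 by simp
    have u: "M2 1 y 0 1 \<in> carrier GL2" by simp
    have "M2 1 0 y 1 = M2 0 1 1 0 * (M2 1 y 0 1 * M2 0 1 1 0)" by simp
    then have "\<rho> (M2 1 0 y 1) = \<rho> (M2 0 1 1 0) * (\<rho> (M2 1 y 0 1) * \<rho> (M2 0 1 1 0))"
      by (rule rm3[OF _ w u w])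
    also have "\<dots> = 1\<^sub>m n" unfolding triv[OF y] using ww r(1)[OF w] by simp
    finally show ?thesis .
  qed
  have diag: "\<rho> (M2 a 0 0 b) = 1\<^sub>m n" if ab: "a * b = 1" "\<pi> ^ l dvd a - 1" for a b
  proof -
    define y where "y = 1 - a"
    have y: "\<pi> ^ l dvd y" unfolding y_def using ab(2) dvd_minus_iff[of "\<pi> ^ l" "a - 1"] by simp
    have a: "a = 1 - y" by (simp add: y_def)
    have L: "M2 1 0 1 1 \<in> carrier (GL2 :: 'a mat monoid)" "M2 1 0 (-1) 1 \<in> carrier (GL2 :: 'a mat monoid)" by simp_all
    have u: "M2 1 y 0 1 \<in> carrier GL2" by simp
    \<comment> \<open>This conjugate of a unipotent matrix lies in the kernel of \<open>\<rho>\<close>, and \<open>diag a b\<close> is the diagonal part in its Gauss decomposition.\<close>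
    have "M2 a y (-y) (1 + y) = M2 1 0 1 1 * (M2 1 y 0 1 * M2 1 0 (-1) 1)" by (simp add: a)
    then have "\<rho> (M2 a y (-y) (1 + y)) = \<rho> (M2 1 0 1 1) * (\<rho> (M2 1 y 0 1) * \<rho> (M2 1 0 (-1) 1))"
      by (rule rm3[OF _ L(1) u L(2)])
    also have "\<dots> = \<rho> (M2 1 0 1 1 * M2 1 0 (-1) 1)"
      unfolding triv[OF y] rm[OF L] using r(1)[OF L(2)] by simp
    also have "\<dots> = 1\<^sub>m n" using \<rho>1 by simp
    finally have h: "\<rho> (M2 a y (-y) (1 + y)) = 1\<^sub>m n" .
    have c: "M2 1 0 (- (y * b)) 1 \<in> carrier GL2" "M2 a 0 0 b \<in> carrier GL2" "M2 1 (b * y) 0 1 \<in> carrier GL2"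
      using ab by simp_all
    have e1: "b * (1 - y * y) = 1 + y"
    proof -
      have "b * (1 - y * y) = (a * b) * (1 + y)" by (simp add: a algebra_simps)
      then show ?thesis by (simp add: ab)
    qed
    have e2: "y * b * a = y" "a * (b * y) = y" using ab(1) by (simp_all add: mult.assoc mult.commute[of b a] mult.assoc[symmetric, of a b])
    have "M2 1 0 (- (y * b)) 1 * (M2 a 0 0 b * M2 1 (b * y) 0 1) = M2 a (a * (b * y)) (- (y * b * a)) (b - y * b * (a * (b * y)))"
      by (simp add: algebra_simps)
    also have "b - y * b * (a * (b * y)) = 1 + y" unfolding e2 e1[symmetric] by (simp add: algebra_simps)
    finally have "M2 a y (- y) (1 + y) = M2 1 0 (- (y * b)) 1 * (M2 a 0 0 b * M2 1 (b * y) 0 1)" unfolding e2 by (rule sym)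
    then have "\<rho> (M2 a y (-y) (1 + y)) = \<rho> (M2 1 0 (- (y * b)) 1) * (\<rho> (M2 a 0 0 b) * \<rho> (M2 1 (b * y) 0 1))"
      by (rule rm3[OF _ c])
    also have "\<rho> (M2 1 0 (- (y * b)) 1) = 1\<^sub>m n" using y by (intro lower) simp
    also have "\<rho> (M2 1 (b * y) 0 1) = 1\<^sub>m n" using y by (intro triv) simp
    finally show ?thesis using h r(1)[OF c(2)] by simp
  qed
  have by_det: "\<rho> g = \<rho> (M2 (det2 g) 0 0 1)" if g: "g \<in> K l" for g
  proof -
    have gc: "g \<in> carrier GL2" and gl: "mcong l g (M2 1 0 0 1)" using g by (auto simp: K_def)
    obtain a b c d where e: "g = M2 a b c d" and D1: "(a * d - b * c) dvd 1" using GL2_cases[OF gc] by metis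
    have gm: "\<pi> ^ l dvd a - 1" "\<pi> ^ l dvd b" "\<pi> ^ l dvd c" "\<pi> ^ l dvd d - 1" using gl by (auto simp: e mcong_M2)
    \<comment> \<open>The Gauss decomposition of \<open>g\<close>: its unipotent parts are in the kernel of \<open>\<rho>\<close>, and of the diagonal part only the determinant matters, by the fact \<open>diag\<close>.\<close>
    define D where "D = a * d - b * c"
    obtain a' where a': "a' dvd 1" "a * a' = 1" using unit_inverse[OF cu[OF gm(1)]] .
    obtain D' where D': "D' dvd 1" "D * D' = 1" using unit_inverse[OF D1] unfolding D_def .
    have cc: "M2 1 0 (c * a') 1 \<in> carrier GL2" "M2 a 0 0 (D * a') \<in> carrier GL2" "M2 1 (a' * b) 0 1 \<in> carrier GL2"
      using a' D1 cu[OF gm(1)] by (simp_all add: D_def unit_mult)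
    have e3: "a * (a' * b) = b" "c * a' * a = c" using a'(2) by (simp_all add: mult.assoc mult.commute[of a' a] mult.assoc[symmetric, of a a'])
    have e4: "c * a' * (a * (a' * b)) + D * a' = d"
    proof -
      have "c * a' * (a * (a' * b)) + D * a' = (a * a') * d + (c * a' * b) * (a * a' - 1)" by (simp add: D_def algebra_simps)
      then show ?thesis by (simp add: a')
    qed
    have "M2 1 0 (c * a') 1 * (M2 a 0 0 (D * a') * M2 1 (a' * b) 0 1)
      = M2 a (a * (a' * b)) (c * a' * a) (c * a' * (a * (a' * b)) + D * a')" by simp
    also have "\<dots> = g" unfolding e3 e e4[unfolded e3] by simp
    finally have "g = M2 1 0 (c * a') 1 * (M2 a 0 0 (D * a') * M2 1 (a' * b) 0 1)" by (rule sym)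
    then have "\<rho> g = \<rho> (M2 1 0 (c * a') 1) * (\<rho> (M2 a 0 0 (D * a')) * \<rho> (M2 1 (a' * b) 0 1))"
      by (rule rm3[OF _ cc])
    also have "\<rho> (M2 1 0 (c * a') 1) = 1\<^sub>m n" using gm by (intro lower) simp
    also have "\<rho> (M2 1 (a' * b) 0 1) = 1\<^sub>m n" using gm by (intro triv) simp
    finally have g1: "\<rho> g = \<rho> (M2 a 0 0 (D * a'))" using r(1)[OF cc(2)] by simp
    have dc: "M2 D 0 0 1 \<in> carrier GL2" "M2 (a * D') 0 0 (D * a') \<in> carrier GL2"
      using D1 D' a' cu[OF gm(1)] by (simp_all add: D_def unit_mult)
    have "D * (a * D') = (D * D') * a" by (simp only: mult_ac)
    then have "M2 a 0 0 (D * a') = M2 D 0 0 1 * M2 (a * D') 0 0 (D * a')" by (simp add: D')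
    then have "\<rho> (M2 a 0 0 (D * a')) = \<rho> (M2 D 0 0 1) * \<rho> (M2 (a * D') 0 0 (D * a'))" by (rule rm2[OF _ dc])
    also have "\<rho> (M2 (a * D') 0 0 (D * a')) = 1\<^sub>m n"
    proof (rule diag)
      have "(a * D') * (D * a') = (a * a') * (D * D')" by (simp only: mult_ac)
      then show "(a * D') * (D * a') = 1" by (simp add: a' D')
      have "\<pi> ^ l dvd D - 1"
        using mcong_det[OF GL2_mat[OF gc] _ gl] by (simp add: e D_def)
      then have "\<pi> ^ l dvd (a - 1) * D' - (D - 1) * D'" by (rule dvd_diff[OF dvd_mult2[OF gm(1)] dvd_mult2])
      also have "(a - 1) * D' - (D - 1) * D' = a * D' - D * D'" by (simp add: algebra_simps)
      finally show "\<pi> ^ l dvd a * D' - 1" by (simp add: D')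
    qed
    finally show ?thesis using g1 r(1)[OF dc(1)] by (simp add: e D_def)
  qed
  have diag_K: "M2 D 0 0 1 \<in> K l" if "D \<in> cong_one l" for D
    using that by (simp add: K_def cong_one_def mcong_M2)
  have scalar: "\<exists>c. \<rho> (M2 D 0 0 1) = c \<cdot>\<^sub>m 1\<^sub>m n" if D: "D \<in> cong_one l" for D
  proof (rule schur_scalar[OF \<rho>])
    let ?M = "M2 D 0 0 1"
    have Mc: "?M \<in> carrier GL2" using diag_K[OF D] by (simp add: K_def)
    show "\<rho> ?M \<in> carrier_mat n n" by (rule r(1)[OF Mc])
    fix h :: "'a mat" assume h: "h \<in> carrier GL2"
    let ?N = "h * ?M * inv\<^bsub>GL2\<^esub> h"
    have ic: "inv\<^bsub>GL2\<^esub> h \<in> carrier GL2" using h by simp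
    have hM: "h * ?M \<in> carrier GL2" by (rule GL2_mult_closed[OF h Mc])
    have N: "?N \<in> K l" using normal.inv_op_closed2[OF K_normal h diag_K[OF D]] by simp
    then have Nc: "?N \<in> carrier GL2" by (simp add: K_def)
    have "det2 h * det2 (inv\<^bsub>GL2\<^esub> h) = 1"
      using det2_GL2_mult[OF h ic] GL2_inv_mult(2)[OF h] by simp
    then have "det2 ?N = det2 ?M"
      using det2_GL2_mult[OF hM ic] det2_GL2_mult[OF h Mc] by (simp only: mult_ac) (simp add: mult.left_commute)
    then have "\<rho> ?N = \<rho> ?M" using by_det[OF N] by simp
    moreover have "?N * h = h * ?M"
      using assoc_mult_mat[OF GL2_mat[OF hM] GL2_mat[OF ic] GL2_mat[OF h]] GL2_inv_mult(1)[OF h] GL2_mat[OF hM] by simp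
    then have "\<rho> ?N * \<rho> h = \<rho> h * \<rho> ?M" using rm[OF Nc h] rm[OF h Mc] by simp
    ultimately show "\<rho> ?M * \<rho> h = \<rho> h * \<rho> ?M" by simp
  qed
  define c where "c D = \<rho> (M2 D 0 0 1) $$ (0,0)" for D
  have c: "\<rho> (M2 D 0 0 1) = c D \<cdot>\<^sub>m 1\<^sub>m n" if D: "D \<in> cong_one l" for D
  proof -
    from scalar[OF D] obtain k where k: "\<rho> (M2 D 0 0 1) = k \<cdot>\<^sub>m 1\<^sub>m n" by blast
    then have "c D = k" using n0 by (simp add: c_def)
    with k show ?thesis by simp
  qed
  have c_mult: "c (x * y) = c x * c y" if x: "x \<in> cong_one l" and y: "y \<in> cong_one l" for x y
  proof -
    have "M2 x 0 0 1 * M2 y 0 0 1 = M2 (x * y) 0 0 1" by simp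
    then have "\<rho> (M2 (x * y) 0 0 1) = \<rho> (M2 x 0 0 1) * \<rho> (M2 y 0 0 1)"
      using rm[of "M2 x 0 0 1" "M2 y 0 0 1"] x y by (simp add: cong_one_def)
    then have "\<rho> (M2 (x * y) 0 0 1) = (c x \<cdot>\<^sub>m 1\<^sub>m n) * (c y \<cdot>\<^sub>m 1\<^sub>m n)" by (simp only: c[OF x] c[OF y])
    also have "\<dots> = (c x * c y) \<cdot>\<^sub>m 1\<^sub>m n"
      by (simp add: mult_smult_distrib[of _ n n _ n] mult_smult_assoc_mat[of _ n n _ n] smult_smult_mat mult.commute)
    finally show ?thesis using n0 by (simp add: c_def)
  qed
  have c_one: "c x = 1" if x: "x \<in> cong_one (Suc l)" for x
  proof -
    have "mcong (Suc l) (M2 x 0 0 1) (M2 1 0 0 1)" using x unfolding cong_one_def mcong_M2 by simp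
    moreover have "M2 x 0 0 1 \<in> carrier GL2" using x by (simp add: cong_one_def)
    ultimately have "\<rho> (M2 x 0 0 1) = \<rho> (M2 1 0 0 1)" using lev unfolding level_le_def by simp
    then show ?thesis using \<rho>1 n0 by (simp add: c_def)
  qed
  have pc: "partial_char (cong_one l) c"
    unfolding partial_char_def
  proof (intro conjI ballI)
    show "1 \<in> cong_one l" by (rule cong_one_group(1))
    fix x assume x: "x \<in> cong_one l"
    show "\<exists>y\<in>cong_one l. x * y = 1" by (rule cong_one_group(3)[OF x])
    then obtain y where y: "y \<in> cong_one l" "x * y = 1" by blast
    have "c x * c y = 1" using c_mult[OF x y(1)] c_one[OF cong_one_group(1)] by (simp add: y(2))
    then show "c x \<noteq> 0" by auto
  next
    fix x y assume x: "x \<in> cong_one l" and y: "y \<in> cong_one l"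
    show "x * y \<in> cong_one l" by (rule cong_one_group(2)[OF x y])
    show "c (x * y) = c x * c y" by (rule c_mult[OF x y])
  qed
  have "cong_one (Suc l) \<subseteq> cong_one l"
    unfolding cong_one_def using dvd_trans[OF le_imp_power_dvd[of l "Suc l" \<pi>]] by auto
  from extend_to_unit_char[OF pc this _ c_one]
  obtain \<psi> where \<psi>: "\<psi> \<in> unit_chars (Suc l)" "\<forall>x\<in>cong_one l. \<psi> x = c x" by auto
  define \<alpha> where "\<alpha> x = inverse (\<psi> x)" for x
  have \<alpha>: "\<alpha> \<in> unit_chars (Suc l)" unfolding \<alpha>_def[abs_def] by (rule unit_chars_inverse[OF \<psi>(1)])
  have "level_le l (\<lambda>g. \<alpha> (det2 g) \<cdot>\<^sub>m \<rho> g)"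
  proof (rule level_le_hom)
    show "(\<lambda>g. \<alpha> (det2 g) \<cdot>\<^sub>m \<rho> g) \<in> hom GL2 (GL n)"
      using irrep_det_twist[OF \<rho> \<alpha>] by (simp add: irrep_def)
    fix g assume g: "g \<in> K l"
    then have gc: "g \<in> carrier GL2" and gl: "mcong l g (M2 1 0 0 1)" by (auto simp: K_def)
    have D: "det2 g \<in> cong_one l"
      using mcong_det[OF GL2_mat[OF gc] _ gl] det2_GL2_unit[OF gc] by (simp add: cong_one_def)
    have "\<psi> (det2 g) \<noteq> 0" by (rule unit_chars_nz[OF \<psi>(1) det2_GL2_unit[OF gc]])
    moreover have "\<psi> (det2 g) = c (det2 g)" using \<psi>(2) D by blast
    ultimately show "\<alpha> (det2 g) \<cdot>\<^sub>m \<rho> g = 1\<^sub>m n"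
      unfolding by_det[OF g] c[OF D] \<alpha>_def smult_smult_mat by (simp add: one_smult_mat)
  qed
  with \<alpha> show ?thesis by blast
qed

text \<open>
  Descent on the level: as long as the dimension is smaller than \<open>dimension_ge_of_primitive\<close>
  requires, the level can be lowered by a twist.
\<close>

lemma exists_twist_of_small_level:
  fixes \<rho> :: "'a mat \<Rightarrow> complex mat"
  assumes char2: "(1::'a) + 1 = 0" and "irrep GL2 n \<rho>" "level_le l \<rho>"
  shows "\<exists>\<alpha>\<in>unit_chars l. \<exists>k. level_le k (\<lambda>g. \<alpha> (det2 g) \<cdot>\<^sub>m \<rho> g) \<and> q ^ k \<le> q * n"
  using assms(2,3)
proof (induction l arbitrary: \<rho>)
  have triv: "\<exists>\<alpha>\<in>unit_chars l. level_le l (\<lambda>g. \<alpha> (det2 g) \<cdot>\<^sub>m \<rho> g)" if "level_le l \<rho>" for l and \<rho> :: "'a mat \<Rightarrow> complex mat"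
  proof (rule bexI)
    show "(\<lambda>x. if x dvd 1 then 1 else 0) \<in> unit_chars l" by (rule trivial_unit_char)
    show "level_le l (\<lambda>g. (if det2 g dvd 1 then 1 else 0) \<cdot>\<^sub>m \<rho> g)"
      unfolding level_le_def
    proof (intro ballI impI)
      fix g h :: "'a mat" assume g: "g \<in> carrier GL2" and h: "h \<in> carrier GL2" and "mcong l g h"
      then have "\<rho> g = \<rho> h" using that unfolding level_le_def by blast
      then show "(if det2 g dvd 1 then 1 else 0) \<cdot>\<^sub>m \<rho> g = (if det2 h dvd 1 then 1 else 0) \<cdot>\<^sub>m \<rho> h"
        using g h by (simp add: GL2_carrier)
    qed
  qed
  {
    case 0
    then have "n > 0" by (simp add: irrep_def)
    then have "q ^ 0 \<le> q * n" using card_D_ge by simp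
    with triv[OF 0(2)] show ?case by blast
  next
    case (Suc l)
    have hom: "\<rho> \<in> hom GL2 (GL n)" and n: "n > 0" using Suc.prems by (auto simp: irrep_def)
    show ?case
    proof (cases "q ^ l \<le> n")
      case True
      then have "q ^ Suc l \<le> q * n" by simp
      with triv[OF Suc.prems(2)] show ?thesis by blast
    next
      case False
      then have l: "l > 0" using n by (cases l) auto
      have "\<rho> (M2 1 y 0 1) = 1\<^sub>m n" if "\<pi> ^ l dvd y" for y
        using dimension_ge_of_primitive[OF char2 hom Suc.prems(2) that] False by blast
      from twist_to_lower_level[OF l Suc.prems this]
      obtain \<alpha> where \<alpha>: "\<alpha> \<in> unit_chars (Suc l)" "level_le l (\<lambda>g. \<alpha> (det2 g) \<cdot>\<^sub>m \<rho> g)" by blast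
      from Suc.IH[OF irrep_det_twist[OF Suc.prems(1) \<alpha>(1)] \<alpha>(2)]
      obtain \<beta> k where \<beta>: "\<beta> \<in> unit_chars l" "level_le k (\<lambda>g. \<beta> (det2 g) \<cdot>\<^sub>m (\<alpha> (det2 g) \<cdot>\<^sub>m \<rho> g))" "q ^ k \<le> q * n"
        by blast
      have "(\<lambda>x. \<beta> x * \<alpha> x) \<in> unit_chars (Suc l)"
        by (rule unit_chars_mult[OF unit_chars_mono[OF _ \<beta>(1)] \<alpha>(1)]) simp
      moreover have "level_le k (\<lambda>g. (\<beta> (det2 g) * \<alpha> (det2 g)) \<cdot>\<^sub>m \<rho> g)"
        using \<beta>(2) by (simp only: smult_smult_mat)
      ultimately show ?thesis using \<beta>(3) by (intro bexI[of _ "\<lambda>x. \<beta> x * \<alpha> x"] exI[of _ k] conjI)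
    qed
  }
qed

end

section \<open>Conjugacy classes\<close>

context uniformizer
begin

text \<open>
  Conjugacy in \<open>GL\<^sub>2(\<O>/\<pi>\<^sup>l)\<close>, in terms of representatives in
  \<open>GL\<^sub>2(\<O>)\<close>.
\<close>

definition conj_mod :: "nat \<Rightarrow> 'a mat \<Rightarrow> 'a mat \<Rightarrow> bool" where
  "conj_mod l g h \<longleftrightarrow> (\<exists>x\<in>carrier GL2. \<exists>y\<in>carrier GL2. x * y = M2 1 0 0 1 \<and> y * x = M2 1 0 0 1 \<and> mcong l (x * g * y) h)"

lemma mat22_mult: "x \<in> carrier_mat 2 2 \<Longrightarrow> y \<in> carrier_mat 2 2 \<Longrightarrow> x * y \<in> carrier_mat 2 2"
  by simp

lemma mat22_assoc:
  "x \<in> carrier_mat 2 2 \<Longrightarrow> y \<in> carrier_mat 2 2 \<Longrightarrow> z \<in> carrier_mat 2 2 \<Longrightarrow> (x * y) * z = x * (y * (z :: 'a mat))"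
  by (rule assoc_mult_mat)

lemma conj_mod_exact:
  assumes "x * y = M2 1 0 0 1" "y * x = M2 1 0 0 1" "x * g * y = h" "x \<in> carrier GL2" "y \<in> carrier GL2"
  shows "conj_mod l g h"
  unfolding conj_mod_def using assms by (intro bexI[of _ x] bexI[of _ y]) (simp_all add: mcong_refl)

lemma conj_mod_of_mcong:
  assumes "mcong l g h" "g \<in> carrier_mat 2 2"
  shows "conj_mod l g h"
  unfolding conj_mod_def using assms by (intro bexI[of _ "M2 1 0 0 1"]) simp_all

lemma conj_mod_sym:
  assumes "conj_mod l g h" and g: "g \<in> carrier_mat 2 2" and h: "h \<in> carrier_mat 2 2"
  shows "conj_mod l h g"
proof -
  obtain x y where xy: "x \<in> carrier GL2" "y \<in> carrier GL2" "x * y = M2 1 0 0 1" "y * x = M2 1 0 0 1"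
    "mcong l (x * g * y) h" using assms(1) unfolding conj_mod_def by (elim bexE conjE)
  have m: "x \<in> carrier_mat 2 2" "y \<in> carrier_mat 2 2" using xy(1,2) by (simp_all add: GL2_mat)
  have "mcong l (y * h * x) (y * (x * g * y) * x)"
    by (intro mcong_mult mcong_refl mat22_mult m g h mcong_sym[OF xy(5)])
  also have "y * (x * g * y) * x = (y * x) * g * (y * x)"
    using m g by (simp only: mat22_assoc mat22_mult)
  also have "\<dots> = g" using g by (simp add: xy(4))
  finally show ?thesis unfolding conj_mod_def using xy(1-4) by (intro bexI[of _ y] bexI[of _ x] conjI)
qed

lemma conj_mod_trans:
  assumes "conj_mod l g h" "conj_mod l h k" and g: "g \<in> carrier_mat 2 2" and h: "h \<in> carrier_mat 2 2"
  shows "conj_mod l g k"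
proof -
  obtain x y where xy: "x \<in> carrier GL2" "y \<in> carrier GL2" "x * y = M2 1 0 0 1" "y * x = M2 1 0 0 1"
    "mcong l (x * g * y) h" using assms(1) unfolding conj_mod_def by (elim bexE conjE)
  obtain z w where zw: "z \<in> carrier GL2" "w \<in> carrier GL2" "z * w = M2 1 0 0 1" "w * z = M2 1 0 0 1"
    "mcong l (z * h * w) k" using assms(2) unfolding conj_mod_def by (elim bexE conjE)
  have m: "x \<in> carrier_mat 2 2" "y \<in> carrier_mat 2 2" "z \<in> carrier_mat 2 2" "w \<in> carrier_mat 2 2"
    using xy(1,2) zw(1,2) by (simp_all add: GL2_mat)
  have "mcong l (z * (x * g * y) * w) (z * h * w)"
    by (intro mcong_mult mcong_refl mat22_mult m g h xy(5))
  then have "mcong l (z * (x * g * y) * w) k" using zw(5) by (rule mcong_trans)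
  also have "z * (x * g * y) * w = (z * x) * g * (y * w)" using m g by (simp only: mat22_assoc mat22_mult)
  finally have c: "mcong l ((z * x) * g * (y * w)) k" .
  have "(z * x) * (y * w) = z * ((x * y) * w)" using m by (simp only: mat22_assoc mat22_mult)
  also have "\<dots> = M2 1 0 0 1" using m zw(3) by (simp add: xy(3))
  finally have i1: "(z * x) * (y * w) = M2 1 0 0 1" .
  have "(y * w) * (z * x) = y * ((w * z) * x)" using m by (simp only: mat22_assoc mat22_mult)
  also have "\<dots> = M2 1 0 0 1" using m xy(4) by (simp add: zw(4))
  finally have i2: "(y * w) * (z * x) = M2 1 0 0 1" .
  show ?thesis unfolding conj_mod_def
    using c i1 i2 GL2_mult_closed xy(1,2) zw(1,2) by (intro bexI[of _ "z * x"] bexI[of _ "y * w"] conjI) simp_all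
qed

lemma conj_mod_coset:
  assumes "conj_mod l g h" and g: "g \<in> carrier GL2" and h: "h \<in> carrier GL2"
  shows "\<exists>X\<in>carrier (Q l). X \<otimes>\<^bsub>Q l\<^esub> coset l g \<otimes>\<^bsub>Q l\<^esub> inv\<^bsub>Q l\<^esub> X = coset l h"
proof -
  obtain x y where xy: "x \<in> carrier GL2" "y \<in> carrier GL2" "x * y = M2 1 0 0 1"
    "mcong l (x * g * y) h" using assms(1) unfolding conj_mod_def by (elim bexE conjE)
  have "inv\<^bsub>GL2\<^esub> x = y" by (rule GL2_inv_eqI[OF xy(1-3)])
  then have "coset l x \<otimes>\<^bsub>Q l\<^esub> coset l g \<otimes>\<^bsub>Q l\<^esub> inv\<^bsub>Q l\<^esub> (coset l x) = coset l (x * g * y)"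
    using xy(1,2) g by (simp only: coset_inv coset_mult GL2_mult_closed)
  also have "\<dots> = coset l h"
    using xy(4) coset_eq_iff[of "x * g * y" h l] GL2_mult_closed xy(1,2) g h by simp
  finally show ?thesis using xy(1) by (intro bexI[of _ "coset l x"]) (simp_all add: carrier_Q)
qed

text \<open>
  Representatives modulo \<open>\<pi>\<^sup>j\<close>, where for \<open>j = 0\<close> the only residue
  class is represented by \<open>1\<close> instead of \<open>0\<close>. Then the upper left entry of a
  normal form of determinant one is a unit also for \<open>j = 0\<close>.
\<close>

definition shifted_reps :: "nat \<Rightarrow> 'a set" where
  "shifted_reps j = (if j = 0 then {1} else reps j)"

lemma shifted_reps_ex: "\<exists>d\<in>shifted_reps j. \<pi> ^ j dvd x - d"
  using reps_ex[of j x] by (auto simp: shifted_reps_def)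

lemma card_shifted_reps: "card (shifted_reps j) = q ^ j"
  by (simp add: shifted_reps_def card_reps)

lemma finite_shifted_reps: "finite (shifted_reps j)"
  by (simp add: shifted_reps_def finite_reps)

text \<open>
  Parameters \<open>(j, d, e)\<close> of a normal form modulo \<open>\<pi>\<^sup>l\<close> with entries
  \<open>d\<close>, \<open>\<pi>\<^sup>j e\<close>, \<open>\<pi>\<^sup>j\<close> and an unspecified
  fourth one, which is determined by the others once the determinant is given. For each \<open>j\<close>
  there are \<open>q\<^sup>j\<close> choices of \<open>d\<close> and
  \<open>q\<^sup>l\<^sup>-\<^sup>j\<close> choices of \<open>e\<close>.
\<close>

definition types :: "nat \<Rightarrow> (nat \<times> 'a \<times> 'a) set" where
  "types l = (SIGMA j:{..l}. shifted_reps j \<times> reps (l - j))"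

lemma finite_types: "finite (types l)"
  unfolding types_def by (intro finite_SigmaI finite_cartesian_product finite_shifted_reps finite_reps) simp

lemma card_types: "card (types l) = (l + 1) * q ^ l"
proof -
  have "card (types l) = (\<Sum>j\<le>l. card (shifted_reps j \<times> reps (l - j)))"
    unfolding types_def by (intro card_SigmaI) (simp_all add: finite_shifted_reps finite_reps)
  also have "\<dots> = (\<Sum>j\<le>l. q ^ l)"
    by (intro sum.cong refl) (simp add: card_cartesian_product card_shifted_reps card_reps power_add[symmetric])
  finally show ?thesis by simp
qed

definition has_type :: "nat \<Rightarrow> 'a mat \<Rightarrow> nat \<times> 'a \<times> 'a \<Rightarrow> bool" where
  "has_type l g = (\<lambda>(j, d, e). \<exists>b. conj_mod l g (M2 d (\<pi> ^ j * e) (\<pi> ^ j) b))"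

lemma has_type_of_conj:
  assumes "conj_mod l g h" "has_type l h \<tau>" "g \<in> carrier_mat 2 2" "h \<in> carrier_mat 2 2"
  shows "has_type l g \<tau>"
  using assms conj_mod_trans[of l g h] unfolding has_type_def by (cases \<tau>) auto

text \<open>
  The case in which the lower left entry is exactly divisible by \<open>\<pi>\<^sup>j\<close>. A diagonal
  conjugation turns it into \<open>\<pi>\<^sup>j\<close>; a unipotent one then changes the upper left
  entry by any multiple of \<open>\<pi>\<^sup>j\<close>.
\<close>

lemma has_type_cyclic:
  assumes j: "j \<le> l" and b: "\<pi> ^ j dvd b" and ad: "\<pi> ^ j dvd a - d" and c: "c dvd 1"
  shows "\<exists>\<tau>\<in>types l. has_type l (M2 a b (\<pi> ^ j * c) d) \<tau>"
proof -
  obtain c' where c': "c' dvd 1" "c * c' = 1" using unit_inverse[OF c] .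
  have c'': "c' * c = 1" using c'(2) by (simp add: mult.commute)
  obtain d0 where d0: "d0 \<in> shifted_reps j" "\<pi> ^ j dvd a - d0" using shifted_reps_ex by metis
  then obtain z where z: "a - d0 = \<pi> ^ j * z" by (elim dvdE)
  from b obtain b1 where b1: "b = \<pi> ^ j * b1" by (elim dvdE)
  from ad obtain f where f: "a - d = \<pi> ^ j * f" by (elim dvdE)
  define e0 where "e0 = c * b1 + z * f - z * z"
  define e where "e = red (l - j) e0"
  have s1: "conj_mod l (M2 a b (\<pi> ^ j * c) d) (M2 a (c * b) (\<pi> ^ j) d)"
  proof (rule conj_mod_exact[of "M2 c 0 0 1" "M2 c' 0 0 1"])
    show "M2 c 0 0 1 * M2 a b (\<pi> ^ j * c) d * M2 c' 0 0 1 = M2 a (c * b) (\<pi> ^ j) d"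
    proof -
      have "c * a * c' = (c * c') * a" "\<pi> ^ j * c * c' = \<pi> ^ j * (c * c')" by (simp_all only: mult_ac)
      then show ?thesis by (simp add: c')
    qed
  qed (use c c' c'' in simp_all)
  have s2: "conj_mod l (M2 a (c * b) (\<pi> ^ j) d) (M2 d0 (\<pi> ^ j * e0) (\<pi> ^ j) (d + \<pi> ^ j * z))"
  proof (rule conj_mod_exact[of "M2 1 (-z) 0 1" "M2 1 z 0 1"])
    have a: "a = d0 + \<pi> ^ j * z" using z by (simp add: algebra_simps)
    have d: "d = d0 + \<pi> ^ j * z - \<pi> ^ j * f" using f a by (simp add: algebra_simps)
    show "M2 1 (-z) 0 1 * M2 a (c * b) (\<pi> ^ j) d * M2 1 z 0 1 = M2 d0 (\<pi> ^ j * e0) (\<pi> ^ j) (d + \<pi> ^ j * z)"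
      unfolding d by (simp add: a e0_def b1 algebra_simps)
  qed simp_all
  have s3: "conj_mod l (M2 d0 (\<pi> ^ j * e0) (\<pi> ^ j) (d + \<pi> ^ j * z)) (M2 d0 (\<pi> ^ j * e) (\<pi> ^ j) (d + \<pi> ^ j * z))"
  proof (rule conj_mod_of_mcong)
    have "\<pi> ^ l = \<pi> ^ j * \<pi> ^ (l - j)" using j by (simp add: power_add[symmetric])
    then have "\<pi> ^ l dvd \<pi> ^ j * (e0 - e)" using red(2)[of "l - j" e0] by (simp add: e_def mult_dvd_mono)
    then show "mcong l (M2 d0 (\<pi> ^ j * e0) (\<pi> ^ j) (d + \<pi> ^ j * z)) (M2 d0 (\<pi> ^ j * e) (\<pi> ^ j) (d + \<pi> ^ j * z))"
      by (simp add: mcong_M2 right_diff_distrib)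
  qed simp
  have "has_type l (M2 a b (\<pi> ^ j * c) d) (j, d0, e)"
    unfolding has_type_def using conj_mod_trans[OF s1 conj_mod_trans[OF s2 s3]] by auto
  moreover have "(j, d0, e) \<in> types l" using j d0(1) red(1) by (auto simp: types_def e_def)
  ultimately show ?thesis by (rule bexI)
qed

text \<open>
  Let \<open>j \<le> l\<close> be maximal such that \<open>g\<close> is scalar modulo
  \<open>\<pi>\<^sup>j\<close>. If \<open>j < l\<close>, one of \<open>b\<close>, \<open>c\<close>,
  \<open>a - d\<close> is exactly divisible by \<open>\<pi>\<^sup>j\<close>, and after a permutation or a
  unipotent conjugation it is the lower left entry.
\<close>

lemma has_type_exists:
  assumes g: "g \<in> carrier GL2"
  shows "\<exists>\<tau>\<in>types l. has_type l g \<tau>"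
proof -
  obtain a b c d where e: "g = M2 a b c d" using GL2_cases[OF g] by metis
  define S where "S j \<longleftrightarrow> \<pi> ^ j dvd b \<and> \<pi> ^ j dvd c \<and> \<pi> ^ j dvd a - d" for j
  show ?thesis
  proof (cases "S l")
    case True
    obtain d0 where d0: "d0 \<in> shifted_reps l" "\<pi> ^ l dvd a - d0" using shifted_reps_ex by metis
    have "mcong l g (M2 d0 (\<pi> ^ l * 0) (\<pi> ^ l) d)"
      using True d0(2) by (simp add: e S_def mcong_M2)
    then have "has_type l g (l, d0, 0)"
      unfolding has_type_def using conj_mod_of_mcong GL2_mat[OF g] by auto
    moreover have "(l, d0, 0) \<in> types l" using d0(1) by (simp add: types_def)
    ultimately show ?thesis by (rule bexI)
  next
    case False
    define j where "j = (LEAST j. \<not> S (Suc j))"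
    have S0: "S 0" by (simp add: S_def)
    then have "l > 0" using False by (cases l) auto
    then have ex: "\<not> S (Suc (l - 1))" using False by simp
    have nS: "\<not> S (Suc j)" unfolding j_def by (rule LeastI[of "\<lambda>j. \<not> S (Suc j)", OF ex])
    have "j \<le> l - 1" unfolding j_def by (rule Least_le) (rule ex)
    then have jl: "j \<le> l" by simp
    have "S j"
    proof (cases j)
      case (Suc i)
      then show ?thesis using not_less_Least[of i "\<lambda>j. \<not> S (Suc j)"] j_def by auto
    qed (simp add: S0)
    then have Sj: "\<pi> ^ j dvd b" "\<pi> ^ j dvd c" "\<pi> ^ j dvd a - d" by (simp_all add: S_def)
    then obtain b1 c1 f where f: "b = \<pi> ^ j * b1" "c = \<pi> ^ j * c1" "a - d = \<pi> ^ j * f" by (elim dvdE)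
    have pS: "\<pi> ^ Suc j dvd \<pi> ^ j * x \<longleftrightarrow> \<pi> dvd x" for x
      unfolding power_Suc2 dvd_mult_cancel_left using pi_pow_nz[of j] by blast
    have "\<not> (\<pi> dvd b1 \<and> \<pi> dvd c1 \<and> \<pi> dvd f)" using nS unfolding S_def f pS .
    then consider (c) "c1 dvd 1" | (b) "b1 dvd 1" | (f) "\<not> c1 dvd 1" "\<not> b1 dvd 1" "f dvd 1" unfolding unit_iff by blast
    then show ?thesis
    proof cases
      case c
      show ?thesis unfolding e f(2) by (rule has_type_cyclic[OF jl Sj(1,3) c])
    next
      case b
      have "conj_mod l g (M2 d c b a)"
        by (rule conj_mod_exact[of "M2 0 1 1 0" "M2 0 1 1 0"]) (simp_all add: e)
      moreover have "\<exists>\<tau>\<in>types l. has_type l (M2 d c b a) \<tau>"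
        unfolding f(1) by (rule has_type_cyclic[OF jl Sj(2) _ b]) (use Sj(3) dvd_minus_iff[of "\<pi> ^ j" "a - d"] in simp)
      ultimately show ?thesis using has_type_of_conj[of l g "M2 d c b a"] GL2_mat[OF g] by auto
    next
      case f'': f
      \<comment> \<open>The lower left entry becomes \<open>c + (a - d) - b\<close>, and only \<open>a - d\<close> is not divisible by a higher power of \<open>\<pi>\<close>.\<close>
      have h: "conj_mod l g (M2 (a - b) b (\<pi> ^ j * (c1 + f - b1)) (b + d))"
      proof (rule conj_mod_exact[of "M2 1 0 1 1" "M2 1 0 (-1) 1"])
        have "\<pi> ^ j * (c1 + f - b1) = c + (a - d) - b" by (simp add: f algebra_simps)
        then show "M2 1 0 1 1 * g * M2 1 0 (-1) 1 = M2 (a - b) b (\<pi> ^ j * (c1 + f - b1)) (b + d)"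
          unfolding e by (simp add: algebra_simps)
      qed simp_all
      have "c1 + f - b1 dvd 1"
      proof -
        have "\<pi> dvd (c1 + f - b1) - f" using f''(1,2) unfolding unit_iff by (simp add: dvd_diff)
        then show ?thesis using unit_cong[of 1 "c1 + f - b1" f] f''(3) by simp
      qed
      moreover have "\<pi> ^ j dvd (a - b) - (b + d)"
      proof -
        have "\<pi> ^ j dvd (a - d) - (b + b)" by (rule dvd_diff[OF Sj(3) dvd_add[OF Sj(1,1)]])
        then show ?thesis by (simp add: algebra_simps)
      qed
      ultimately have "\<exists>\<tau>\<in>types l. has_type l (M2 (a - b) b (\<pi> ^ j * (c1 + f - b1)) (b + d)) \<tau>"
        by (intro has_type_cyclic[OF jl Sj(1)])
      then show ?thesis using has_type_of_conj[OF h] GL2_mat[OF g] by auto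
    qed
  qed
qed

lemma conj_mod_det:
  assumes "conj_mod l g h" "g \<in> carrier_mat 2 2" "h \<in> carrier_mat 2 2"
  shows "\<pi> ^ l dvd det2 g - det2 h"
proof -
  obtain x y where xy: "x \<in> carrier GL2" "y \<in> carrier GL2" "x * y = M2 1 0 0 1"
    "mcong l (x * g * y) h" using assms(1) unfolding conj_mod_def by (elim bexE conjE)
  have m: "x \<in> carrier_mat 2 2" "y \<in> carrier_mat 2 2" using xy(1,2) by (simp_all add: GL2_mat)
  have "det2 (x * g * y) = (det2 x * det2 y) * det2 g"
    using m assms by (simp add: det2_mult mat22_mult mult_ac)
  also have "det2 x * det2 y = 1" using det2_mult[OF m] by (simp add: xy(3))
  finally have "det2 (x * g * y) = det2 g" by simp
  then show ?thesis using mcong_det[OF _ assms(3) xy(4)] m assms by simp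
qed

text \<open>
  Determinant one modulo \<open>\<pi>\<^sup>l\<close> makes \<open>d\<close> a unit, so the fourth entry
  of the normal form is determined modulo \<open>\<pi>\<^sup>l\<close>.
\<close>

lemma conj_of_same_type:
  assumes g: "g \<in> carrier GL2" "\<pi> ^ l dvd det2 g - 1" and h: "h \<in> carrier GL2" "\<pi> ^ l dvd det2 h - 1"
    and \<tau>: "\<tau> \<in> types l" "has_type l g \<tau>" "has_type l h \<tau>"
  shows "conj_mod l g h"
proof -
  obtain j d e where t: "\<tau> = (j, d, e)" by (cases \<tau>)
  obtain b b' where b: "conj_mod l g (M2 d (\<pi> ^ j * e) (\<pi> ^ j) b)" "conj_mod l h (M2 d (\<pi> ^ j * e) (\<pi> ^ j) b')"
    using \<tau>(2,3) by (auto simp: has_type_def t)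
  have jl: "j \<le> l" and dj: "d \<in> shifted_reps j" using \<tau>(1) by (auto simp: types_def t)
  have D: "\<pi> ^ l dvd (d * b - \<pi> ^ j * e * \<pi> ^ j) - 1"
    if "conj_mod l k (M2 d (\<pi> ^ j * e) (\<pi> ^ j) b)" "k \<in> carrier GL2" "\<pi> ^ l dvd det2 k - 1" for k b
    using dvd_diff[OF that(3) conj_mod_det[OF that(1) GL2_mat[OF that(2)]]] by simp
  have D1: "\<pi> ^ l dvd (d * b - \<pi> ^ j * e * \<pi> ^ j) - 1" by (rule D[OF b(1) g])
  have D2: "\<pi> ^ l dvd (d * b' - \<pi> ^ j * e * \<pi> ^ j) - 1" by (rule D[OF b(2) h])
  have du: "d dvd 1"
  proof (cases "j = 0")
    case True
    then show ?thesis using dj by (simp add: shifted_reps_def)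
  next
    case False
    have "\<pi> ^ j dvd (d * b - \<pi> ^ j * e * \<pi> ^ j) - 1" using dvd_trans[OF le_imp_power_dvd[OF jl] D1] .
    then have "\<pi> ^ j dvd ((d * b - \<pi> ^ j * e * \<pi> ^ j) - 1) + \<pi> ^ j * e * \<pi> ^ j" by (rule dvd_add) simp
    then have "\<pi> ^ j dvd d * b - 1" by (simp add: algebra_simps)
    then have "d * b dvd 1" using unit_cong[of j "d * b" 1] False by simp
    then show ?thesis using unit_mult_iff by blast
  qed
  have "\<pi> ^ l dvd ((d * b - \<pi> ^ j * e * \<pi> ^ j) - 1) - ((d * b' - \<pi> ^ j * e * \<pi> ^ j) - 1)" by (rule dvd_diff[OF D1 D2])
  then have db: "\<pi> ^ l dvd d * (b - b')" by (simp add: algebra_simps)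
  obtain d' where d': "d' dvd 1" "d * d' = 1" using unit_inverse[OF du] .
  have "d' * (d * (b - b')) = (d * d') * (b - b')" by (simp only: mult_ac)
  also have "\<dots> = b - b'" unfolding d'(2) by simp
  finally have "\<pi> ^ l dvd b - b'" using dvd_mult[OF db, of d'] by (simp only:)
  then have "mcong l (M2 d (\<pi> ^ j * e) (\<pi> ^ j) b) (M2 d (\<pi> ^ j * e) (\<pi> ^ j) b')" by (simp add: mcong_M2)
  from conj_mod_of_mcong[OF this] conj_mod_sym[OF b(2)]
  show ?thesis using conj_mod_trans[OF b(1)] conj_mod_trans GL2_mat[OF g(1)] GL2_mat[OF h(1)] by (metis M2_carrier)
qed

end

section \<open>Counting twist isoclasses by level\<close>

lemma GL_one_carrier: "1\<^sub>m n \<in> carrier (GL n :: 'a::comm_ring_1 mat monoid)"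
  by (auto simp: GL_carrier)

context uniformizer_ideal
begin

text \<open>
  Continuous one-dimensional representations as scalar functions.
\<close>

definition linear_char :: "('a mat \<Rightarrow> complex) \<Rightarrow> bool" where
  "linear_char t \<longleftrightarrow> (\<forall>g\<in>carrier GL2. \<forall>h\<in>carrier GL2. t (g * h) = t g * t h)
     \<and> (\<forall>g\<in>carrier GL2. t g \<noteq> 0) \<and> (\<exists>l. level_le l t)"

lemma linear_char_of_continuous_rep:
  assumes "continuous_rep GL2 T 1 \<chi>"
  shows "linear_char (\<lambda>g. \<chi> g $$ (0,0))"
proof -
  have hom: "\<chi> \<in> hom GL2 (GL 1)" using assms by (simp add: continuous_rep_def)
  note r = hom_GL_D[OF hom]
  have mult: "\<chi> (g * h) $$ (0,0) = \<chi> g $$ (0,0) * \<chi> h $$ (0,0)" if "g \<in> carrier GL2" "h \<in> carrier GL2" for g h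
    using r(2)[OF that] mult_mat_index[OF r(1)[OF that(1)] r(1)[OF that(2)], of 0 0] by simp
  have "\<chi> g $$ (0,0) \<noteq> 0" if g: "g \<in> carrier GL2" for g
  proof -
    have "\<chi> g $$ (0,0) * \<chi> (inv\<^bsub>GL2\<^esub> g) $$ (0,0) = \<chi> (M2 1 0 0 1) $$ (0,0)"
      using mult[OF g GL2.inv_closed[OF g]] by (simp add: GL2_inv_mult g)
    also have "\<dots> = 1" using hom_GL_one[OF group_GL hom] by (simp add: GL2_one)
    finally show ?thesis by auto
  qed
  moreover have "\<exists>l. level_le l (\<lambda>g. \<chi> g $$ (0,0))"
    using level_le_of_continuous_rep[OF assms] unfolding level_le_def by metis
  ultimately show ?thesis using mult unfolding linear_char_def by simp
qed

lemma continuous_rep_of_linear_char: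
  assumes t: "linear_char t"
  shows "continuous_rep GL2 T 1 (\<lambda>g. mat 1 1 (\<lambda>_. t g))"
proof -
  have tm: "t (g * h) = t g * t h" if "g \<in> carrier GL2" "h \<in> carrier GL2" for g h
    using t that by (simp add: linear_char_def)
  obtain l where l: "level_le l t" using t by (auto simp: linear_char_def)
  have "M2 1 0 0 1 \<in> carrier (GL2 :: 'a mat monoid)" by simp
  then have t1: "t (M2 1 0 0 1) = 1" using tm[of "M2 1 0 0 1" "M2 1 0 0 1"] t by (simp add: linear_char_def)
  show ?thesis
  proof (rule continuous_rep_of_level_le)
    show "(\<lambda>g. mat 1 1 (\<lambda>_. t g)) \<in> hom GL2 (GL 1)"
    proof (rule hom_GL_I[OF group_GL])
      show "mat 1 1 (\<lambda>_. t (g \<otimes>\<^bsub>GL2\<^esub> h)) = mat 1 1 (\<lambda>_. t g) * mat 1 1 (\<lambda>_. t h)"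
        if "g \<in> carrier GL2" "h \<in> carrier GL2" for g h
        by (rule eq_matI) (simp_all add: tm[OF that] scalar_prod_def)
      show "mat 1 1 (\<lambda>_. t \<one>\<^bsub>GL2\<^esub>) = 1\<^sub>m 1"
        by (rule eq_matI) (simp_all add: GL2_one t1)
    qed simp
    show "level_le l (\<lambda>g. mat 1 1 (\<lambda>_. t g))"
      unfolding level_le_def
    proof (intro ballI impI)
      fix g h assume "g \<in> carrier GL2" "h \<in> carrier GL2" "mcong l g h"
      then have "t g = t h" using l unfolding level_le_def by metis
      then show "mat 1 1 (\<lambda>_. t g) = mat 1 1 (\<lambda>_. t h)" by simp
    qed
  qed
qed

lemma twist_equivalent_iff:
  "twist_equivalent GL2 T n \<rho> \<sigma> \<longleftrightarrow>
     (\<exists>t. linear_char t \<and> (\<exists>P\<in>carrier (GL n). \<forall>g\<in>carrier GL2. P * \<rho> g = (t g \<cdot>\<^sub>m \<sigma> g) * P))"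
proof
  assume "twist_equivalent GL2 T n \<rho> \<sigma>"
  then obtain \<chi> where "continuous_rep GL2 T 1 \<chi>" "rep_iso GL2 n \<rho> (rep_twist \<sigma> \<chi>)"
    unfolding twist_equivalent_def by (elim exE conjE)
  then show "\<exists>t. linear_char t \<and> (\<exists>P\<in>carrier (GL n). \<forall>g\<in>carrier GL2. P * \<rho> g = (t g \<cdot>\<^sub>m \<sigma> g) * P)"
    unfolding rep_iso_def rep_twist_def by (intro exI[of _ "\<lambda>g. \<chi> g $$ (0,0)"] conjI linear_char_of_continuous_rep)
next
  assume "\<exists>t. linear_char t \<and> (\<exists>P\<in>carrier (GL n). \<forall>g\<in>carrier GL2. P * \<rho> g = (t g \<cdot>\<^sub>m \<sigma> g) * P)"
  then obtain t where t: "linear_char t" "\<exists>P\<in>carrier (GL n). \<forall>g\<in>carrier GL2. P * \<rho> g = (t g \<cdot>\<^sub>m \<sigma> g) * P"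
    by (elim exE conjE)
  show "twist_equivalent GL2 T n \<rho> \<sigma>"
    unfolding twist_equivalent_def rep_iso_def rep_twist_def
    by (rule exI[of _ "\<lambda>g. mat 1 1 (\<lambda>_. t g)"]) (use t continuous_rep_of_linear_char[OF t(1)] in simp)
qed

abbreviation irreps :: "nat \<Rightarrow> ('a mat \<Rightarrow> complex mat) set" where
  "irreps n \<equiv> {\<rho>. irreducible_rep GL2 T n \<rho>}"

abbreviation twist_rel :: "nat \<Rightarrow> (('a mat \<Rightarrow> complex mat) \<times> ('a mat \<Rightarrow> complex mat)) set" where
  "twist_rel n \<equiv> {(\<rho>, \<sigma>). irreducible_rep GL2 T n \<rho> \<and> irreducible_rep GL2 T n \<sigma> \<and> twist_equivalent GL2 T n \<rho> \<sigma>}"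

lemma irreps_mat: "\<rho> \<in> irreps n \<Longrightarrow> g \<in> carrier GL2 \<Longrightarrow> \<rho> g \<in> carrier_mat n n"
  using hom_GL_D(1) by (auto simp: irreducible_rep_iff irrep_def)

lemma linear_char_trivial: "linear_char (\<lambda>_. 1)"
  by (auto simp: linear_char_def level_le_def)

lemma linear_char_inverse: "linear_char t \<Longrightarrow> linear_char (\<lambda>g. inverse (t g))"
  unfolding linear_char_def level_le_def by simp

lemma linear_char_mult:
  assumes "linear_char s" "linear_char t"
  shows "linear_char (\<lambda>g. s g * t g)"
proof -
  obtain k l where k: "level_le k s" and l: "level_le l t" using assms by (auto simp: linear_char_def)
  have "level_le (max k l) (\<lambda>g. s g * t g)"
    unfolding level_le_def
  proof (intro ballI impI)
    fix g h assume g: "g \<in> carrier GL2" and h: "h \<in> carrier GL2" and c: "mcong (max k l) g h"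
    have "mcong k g h" "mcong l g h" using mcong_mono[OF _ c] by auto
    then have "s g = s h" "t g = t h" using k l g h unfolding level_le_def by metis+
    then show "s g * t g = s h * t h" by simp
  qed
  then have "\<exists>m. level_le m (\<lambda>g. s g * t g)" by (rule exI)
  then show ?thesis using assms by (simp add: linear_char_def)
qed

lemma linear_char_det: "\<alpha> \<in> unit_chars l \<Longrightarrow> linear_char (\<lambda>g. \<alpha> (det2 g))"
  unfolding linear_char_def
proof (intro conjI ballI)
  assume \<alpha>: "\<alpha> \<in> unit_chars l"
  show "\<alpha> (det2 (g * h)) = \<alpha> (det2 g) * \<alpha> (det2 h)" if "g \<in> carrier GL2" "h \<in> carrier GL2" for g h
    using unit_charsD(2)[OF \<alpha> det2_GL2_unit[OF that(1)] det2_GL2_unit[OF that(2)]] that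
    by (simp add: det2_GL2_mult)
  show "\<alpha> (det2 g) \<noteq> 0" if "g \<in> carrier GL2" for g by (rule unit_chars_nz[OF \<alpha> det2_GL2_unit[OF that]])
  have "level_le l (\<lambda>g. \<alpha> (det2 g))"
    unfolding level_le_def
  proof (intro ballI impI)
    fix g h :: "'a mat" assume g: "g \<in> carrier GL2" and h: "h \<in> carrier GL2" and "mcong l g h"
    then have "\<pi> ^ l dvd det2 g - det2 h" by (intro mcong_det GL2_mat)
    then show "\<alpha> (det2 g) = \<alpha> (det2 h)" by (rule unit_chars_cong[OF \<alpha> det2_GL2_unit[OF g] det2_GL2_unit[OF h]])
  qed
  then show "\<exists>l. level_le l (\<lambda>g. \<alpha> (det2 g))" by (rule exI)
qed

lemma twist_rel_equiv: "equiv (irreps n) (twist_rel n)"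
proof (rule equivI)
  show "twist_rel n \<subseteq> irreps n \<times> irreps n" by auto
  show "refl_on (irreps n) (twist_rel n)"
  proof (rule refl_onI)
    fix \<rho> assume \<rho>: "\<rho> \<in> irreps n"
    have "twist_equivalent GL2 T n \<rho> \<rho>"
      unfolding twist_equivalent_iff
    proof (intro exI[of _ "\<lambda>_. 1"] conjI linear_char_trivial bexI[of _ "1\<^sub>m n"] ballI GL_one_carrier)
      fix g :: "'a mat" assume g: "g \<in> carrier GL2"
      show "1\<^sub>m n * \<rho> g = (1 \<cdot>\<^sub>m \<rho> g) * 1\<^sub>m n" using irreps_mat[OF \<rho> g] by simp
    qed
    then show "(\<rho>, \<rho>) \<in> twist_rel n" using \<rho> by simp
  qed
  show "sym (twist_rel n)"
  proof (rule symI)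
    fix \<rho> \<sigma> assume a: "(\<rho>, \<sigma>) \<in> twist_rel n"
    then have \<rho>: "\<rho> \<in> irreps n" and \<sigma>: "\<sigma> \<in> irreps n" and "twist_equivalent GL2 T n \<rho> \<sigma>" by auto
    then obtain t P where t: "linear_char t" and P: "P \<in> carrier (GL n)"
      "\<forall>g\<in>carrier GL2. P * \<rho> g = (t g \<cdot>\<^sub>m \<sigma> g) * P" unfolding twist_equivalent_iff by (elim exE conjE bexE)
    from P(1) obtain R where R: "R \<in> carrier_mat n n" "P * R = 1\<^sub>m n" "R * P = 1\<^sub>m n" and Pc: "P \<in> carrier_mat n n"
      by (auto simp: GL_carrier)
    have RG: "R \<in> carrier (GL n)" using R Pc by (auto simp: GL_carrier)
    have "R * \<sigma> g = (inverse (t g) \<cdot>\<^sub>m \<rho> g) * R" if g: "g \<in> carrier GL2" for g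
    proof -
      have s: "\<sigma> g \<in> carrier_mat n n" and r: "\<rho> g \<in> carrier_mat n n" using irreps_mat \<rho> \<sigma> g by auto
      have tg: "t g \<noteq> 0" using t g by (simp add: linear_char_def)
      have "R * (P * \<rho> g) * R = (R * P) * (\<rho> g * R)"
        using R(1) Pc r by (simp only: assoc_mult_mat[of _ n n _ n _ n] mult_carrier_mat[of _ n n _ n])
      then have 1: "R * (P * \<rho> g) * R = \<rho> g * R" using R(1,3) r by simp
      have "R * ((t g \<cdot>\<^sub>m \<sigma> g) * P) * R = t g \<cdot>\<^sub>m (R * \<sigma> g * (P * R))"
        using R(1) Pc s by (simp only: assoc_mult_mat[of _ n n _ n _ n] mult_carrier_mat[of _ n n _ n]
            mult_smult_assoc_mat[of _ n n _ n] mult_smult_distrib[of _ n n _ n] smult_carrier_mat)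
      then have 2: "R * ((t g \<cdot>\<^sub>m \<sigma> g) * P) * R = t g \<cdot>\<^sub>m (R * \<sigma> g)" using R(1,2) s by simp
      have "\<rho> g * R = t g \<cdot>\<^sub>m (R * \<sigma> g)" using 1 2 P(2) g by simp
      then have "(inverse (t g) \<cdot>\<^sub>m \<rho> g) * R = inverse (t g) \<cdot>\<^sub>m (t g \<cdot>\<^sub>m (R * \<sigma> g))"
        using mult_smult_assoc_mat[OF r R(1)] by simp
      then show ?thesis using tg by (simp add: smult_smult_mat)
    qed
    then have "twist_equivalent GL2 T n \<sigma> \<rho>"
      unfolding twist_equivalent_iff using linear_char_inverse[OF t] RG
      by (intro exI[of _ "\<lambda>g. inverse (t g)"] conjI bexI[of _ R] ballI)
    then show "(\<sigma>, \<rho>) \<in> twist_rel n" using \<rho> \<sigma> by simp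
  qed
  show "trans (twist_rel n)"
  proof (rule transI)
    fix \<rho> \<sigma> \<tau> assume a: "(\<rho>, \<sigma>) \<in> twist_rel n" "(\<sigma>, \<tau>) \<in> twist_rel n"
    then have \<rho>: "\<rho> \<in> irreps n" and \<sigma>: "\<sigma> \<in> irreps n" and \<tau>: "\<tau> \<in> irreps n"
      and e: "twist_equivalent GL2 T n \<rho> \<sigma>" "twist_equivalent GL2 T n \<sigma> \<tau>" by auto
    from e(1) obtain t P where t: "linear_char t" and P: "P \<in> carrier (GL n)"
      "\<forall>g\<in>carrier GL2. P * \<rho> g = (t g \<cdot>\<^sub>m \<sigma> g) * P" unfolding twist_equivalent_iff by (elim exE conjE bexE)
    from e(2) obtain s R where s: "linear_char s" and R: "R \<in> carrier (GL n)"
      "\<forall>g\<in>carrier GL2. R * \<sigma> g = (s g \<cdot>\<^sub>m \<tau> g) * R" unfolding twist_equivalent_iff by (elim exE conjE bexE)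
    have c: "P \<in> carrier_mat n n" "R \<in> carrier_mat n n" using P(1) R(1) by (auto simp: GL_carrier)
    have RP: "R * P \<in> carrier (GL n)" using group.is_monoid[OF group_GL] monoid.m_closed R(1) P(1) by (metis GL_mult)
    have "(R * P) * \<rho> g = ((t g * s g) \<cdot>\<^sub>m \<tau> g) * (R * P)" if g: "g \<in> carrier GL2" for g
    proof -
      have m: "\<rho> g \<in> carrier_mat n n" "\<sigma> g \<in> carrier_mat n n" "\<tau> g \<in> carrier_mat n n" using irreps_mat \<rho> \<sigma> \<tau> g by auto
      have "(R * P) * \<rho> g = R * (P * \<rho> g)" by (rule assoc_mult_mat[OF c(2,1) m(1)])
      also have "P * \<rho> g = t g \<cdot>\<^sub>m (\<sigma> g * P)" using P(2) g mult_smult_assoc_mat[OF m(2) c(1)] by simp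
      also have "R * (t g \<cdot>\<^sub>m (\<sigma> g * P)) = t g \<cdot>\<^sub>m (R * (\<sigma> g * P))" using c m by (simp add: mult_smult_distrib[of _ n n _ n])
      also have "R * (\<sigma> g * P) = (R * \<sigma> g) * P" by (rule assoc_mult_mat[OF c(2) m(2) c(1), symmetric])
      also have "R * \<sigma> g = s g \<cdot>\<^sub>m (\<tau> g * R)" using R(2) g mult_smult_assoc_mat[OF m(3) c(2)] by simp
      also have "(s g \<cdot>\<^sub>m (\<tau> g * R)) * P = s g \<cdot>\<^sub>m ((\<tau> g * R) * P)" using c m by (simp add: mult_smult_assoc_mat[of _ n n _ n])
      also have "(\<tau> g * R) * P = \<tau> g * (R * P)" by (rule assoc_mult_mat[OF m(3) c(2,1)])
      also have "t g \<cdot>\<^sub>m (s g \<cdot>\<^sub>m (\<tau> g * (R * P))) = ((t g * s g) \<cdot>\<^sub>m \<tau> g) * (R * P)"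
        using c m by (simp add: mult_smult_assoc_mat[of _ n n _ n] smult_smult_mat)
      finally show ?thesis .
    qed
    then have "twist_equivalent GL2 T n \<rho> \<tau>"
      unfolding twist_equivalent_iff using linear_char_mult[OF t s] RP
      by (intro exI[of _ "\<lambda>g. t g * s g"] conjI bexI[of _ "R * P"] ballI)
    then show "(\<rho>, \<tau>) \<in> twist_rel n" using \<rho> \<tau> by simp
  qed
qed

abbreviation twist_classes :: "nat \<Rightarrow> ('a mat \<Rightarrow> complex mat) set set" where
  "twist_classes n \<equiv> twist_isoclasses GL2 T n"

lemma classes_eq: "twist_classes n = irreps n // twist_rel n"
  by (simp add: twist_isoclasses_def)

lemma class_subset: "C \<in> twist_classes n \<Longrightarrow> C \<subseteq> irreps n"
  unfolding classes_eq using twist_rel_equiv by (rule in_quotient_imp_subset)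

lemma class_nonempty: "C \<in> twist_classes n \<Longrightarrow> C \<noteq> {}"
  unfolding classes_eq using twist_rel_equiv by (rule in_quotient_imp_non_empty)

lemma class_eqI:
  assumes "C \<in> twist_classes n" "C' \<in> twist_classes n" "\<rho> \<in> C" "\<sigma> \<in> C'" "twist_equivalent GL2 T n \<rho> \<sigma>"
  shows "C = C'"
proof (rule quotient_eqI[OF twist_rel_equiv _ _ assms(3,4)])
  show "C \<in> irreps n // twist_rel n" "C' \<in> irreps n // twist_rel n" using assms(1,2) by (simp_all add: classes_eq)
  show "(\<rho>, \<sigma>) \<in> twist_rel n" using class_subset[OF assms(1)] class_subset[OF assms(2)] assms(3-5) by auto
qed

lemma class_closed:
  assumes "C \<in> twist_classes n" "\<rho> \<in> C" "\<sigma> \<in> irreps n" "twist_equivalent GL2 T n \<rho> \<sigma>"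
  shows "\<sigma> \<in> C"
  using in_quotient_imp_closed[OF twist_rel_equiv, of C n \<rho> \<sigma>] assms class_subset[OF assms(1)]
  by (auto simp: classes_eq)

definition classes_of_level :: "nat \<Rightarrow> nat \<Rightarrow> ('a mat \<Rightarrow> complex mat) set set" where
  "classes_of_level l n = {C \<in> twist_classes n. \<exists>\<rho>\<in>C. level_le l \<rho>}"

text \<open>
  Apply \<open>twist_classes_le_conjugacy_classes\<close> to \<open>Q l\<close>, with the characters of
  the determinant as \<open>X\<close>: they separate the units modulo \<open>\<pi>\<^sup>l\<close>, so
  that \<open>N\<close> consists of the classes of matrices of determinant one, which are distinguished
  up to conjugacy by their types. The index set \<open>I\<close> may combine classes of different
  dimensions.
\<close>

lemma finite_family_of_level:
  fixes I :: "(nat \<times> ('a mat \<Rightarrow> complex mat) set) set"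
  assumes fin: "finite I" and I: "\<And>n C. (n, C) \<in> I \<Longrightarrow> C \<in> classes_of_level l n"
  shows "card I \<le> (l + 1) * q ^ l"
proof -
  interpret Q: finite_group "Q l" by (rule finite_group_Q)
  define rep where "rep i = (SOME \<rho>. \<rho> \<in> snd i \<and> level_le l \<rho>)" for i :: "nat \<times> ('a mat \<Rightarrow> complex mat) set"
  have rep: "rep i \<in> snd i \<and> level_le l (rep i)" if "i \<in> I" for i
  proof -
    have "snd i \<in> classes_of_level l (fst i)" using I[of "fst i" "snd i"] that by simp
    then have "\<exists>\<rho>. \<rho> \<in> snd i \<and> level_le l \<rho>" by (auto simp: classes_of_level_def)
    then show ?thesis unfolding rep_def by (rule someI_ex)
  qed
  have cls: "snd i \<in> twist_classes (fst i)" if "i \<in> I" for i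
    using I[of "fst i" "snd i"] that by (simp add: classes_of_level_def)
  have repi: "rep i \<in> irreps (fst i)" if "i \<in> I" for i using class_subset[OF cls[OF that]] rep[OF that] by auto
  define ext where "ext \<alpha> C = (if C \<in> carrier (Q l) then lift (\<lambda>g. \<alpha> (det2 g)) C else 0)" for \<alpha> :: "'a \<Rightarrow> complex" and C
  have lev: "level_le l (\<lambda>g. \<alpha> (det2 g))" if "\<alpha> \<in> unit_chars l" for \<alpha>
    unfolding level_le_def
  proof (intro ballI impI)
    fix g h :: "'a mat" assume g: "g \<in> carrier GL2" and h: "h \<in> carrier GL2" and "mcong l g h"
    then have "\<pi> ^ l dvd det2 g - det2 h" by (intro mcong_det GL2_mat)
    then show "\<alpha> (det2 g) = \<alpha> (det2 h)" by (rule unit_chars_cong[OF that det2_GL2_unit[OF g] det2_GL2_unit[OF h]])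
  qed
  have ext: "ext \<alpha> (coset l g) = \<alpha> (det2 g)" if "\<alpha> \<in> unit_chars l" "g \<in> carrier GL2" for \<alpha> g
    using lift_coset_of_level[OF lev[OF that(1)] that(2)] that(2) by (simp add: ext_def carrier_Q)
  define X where "X = ext ` unit_chars l"
  define pick where "pick C = (SOME g. g \<in> carrier GL2 \<and> coset l g = C)" for C
  have pick: "pick C \<in> carrier GL2 \<and> coset l (pick C) = C" if "C \<in> carrier (Q l)" for C
  proof -
    have "\<exists>g. g \<in> carrier GL2 \<and> coset l g = C" using that unfolding carrier_Q by blast
    then show ?thesis unfolding pick_def by (rule someI_ex)
  qed
  define cl where "cl C = (SOME \<tau>. \<tau> \<in> types l \<and> has_type l (pick C) \<tau>)" for C
  have cl: "cl C \<in> types l \<and> has_type l (pick C) (cl C)" if "C \<in> carrier (Q l)" for C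
  proof -
    have "\<exists>\<tau>. \<tau> \<in> types l \<and> has_type l (pick C) \<tau>" using has_type_exists pick[OF that] by blast
    then show ?thesis unfolding cl_def by (rule someI_ex)
  qed
  define N where "N = {C \<in> carrier (Q l). \<forall>\<alpha>\<in>X. \<alpha> C = 1}"
  have Ndet: "\<pi> ^ l dvd det2 (pick C) - 1" if C: "C \<in> N" for C
  proof (rule ccontr)
    assume n: "\<not> \<pi> ^ l dvd det2 (pick C) - 1"
    have Cc: "C \<in> carrier (Q l)" using C by (simp add: N_def)
    have p: "pick C \<in> carrier GL2" "coset l (pick C) = C" using pick[OF Cc] by auto
    from unit_chars_separate[OF det2_GL2_unit[OF p(1)] n] obtain \<alpha> where \<alpha>: "\<alpha> \<in> unit_chars l" "\<alpha> (det2 (pick C)) \<noteq> 1"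
      by (elim bexE)
    have "ext \<alpha> C = 1" using C \<alpha>(1) by (simp add: N_def X_def)
    then show False using ext[OF \<alpha>(1) p(1)] p(2) \<alpha>(2) by simp
  qed
  have "card I \<le> card (cl ` N)"
    unfolding N_def
  proof (rule Q.twist_classes_le_conjugacy_classes[where n = fst and \<rho> = "\<lambda>i. lift (rep i)"])
    show "finite X" by (simp add: X_def finite_unit_chars)
    show "(\<lambda>C. if C \<in> carrier (Q l) then 1 else 0) \<in> X"
      unfolding X_def
    proof (rule image_eqI)
      show "(\<lambda>x. if x dvd 1 then 1 else 0) \<in> unit_chars l" by (rule trivial_unit_char)
      show "(\<lambda>C. if C \<in> carrier (Q l) then 1 else 0) = ext (\<lambda>x. if x dvd 1 then 1 else 0)"
      proof
        fix C show "(if C \<in> carrier (Q l) then 1 else 0) = ext (\<lambda>x. if x dvd 1 then 1 else 0) C"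
        proof (cases "C \<in> carrier (Q l)")
          case True
          then obtain g where "g \<in> carrier GL2" "C = coset l g" unfolding carrier_Q by blast
          then show ?thesis using ext[OF trivial_unit_char, of g] True det2_GL2_unit[of g] by simp
        qed (simp add: ext_def)
      qed
    qed
    show "(\<lambda>C. \<alpha> C * \<beta> C) \<in> X" if ab: "\<alpha> \<in> X" "\<beta> \<in> X" for \<alpha> \<beta>
    proof -
      from ab obtain a b where a: "a \<in> unit_chars l" "\<alpha> = ext a" and b: "b \<in> unit_chars l" "\<beta> = ext b" by (auto simp: X_def)
      have "(\<lambda>C. \<alpha> C * \<beta> C) = ext (\<lambda>x. a x * b x)"
      proof
        fix C show "\<alpha> C * \<beta> C = ext (\<lambda>x. a x * b x) C" by (simp add: a b ext_def lift_def)
      qed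
      then show ?thesis using unit_chars_mult[OF a(1) b(1)] by (auto simp: X_def)
    qed
    show "\<alpha> (C \<otimes>\<^bsub>Q l\<^esub> C') = \<alpha> C * \<alpha> C'" if a: "\<alpha> \<in> X" "C \<in> carrier (Q l)" "C' \<in> carrier (Q l)" for \<alpha> C C'
    proof -
      from a obtain \<alpha>' g h where e: "\<alpha>' \<in> unit_chars l" "\<alpha> = ext \<alpha>'" "g \<in> carrier GL2" "C = coset l g" "h \<in> carrier GL2" "C' = coset l h"
        by (auto simp: X_def carrier_Q)
      show ?thesis
        unfolding e(2,4,6) coset_mult[OF e(3,5)] ext[OF e(1) GL2_mult_closed[OF e(3,5)]] ext[OF e(1,3)] ext[OF e(1,5)]
          det2_GL2_mult[OF e(3,5)]
        by (rule unit_charsD(2)[OF e(1) det2_GL2_unit[OF e(3)] det2_GL2_unit[OF e(5)]])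
    qed
    show "\<alpha> C \<noteq> 0" if a: "\<alpha> \<in> X" "C \<in> carrier (Q l)" for \<alpha> C
    proof -
      from a obtain \<alpha>' g where e: "\<alpha>' \<in> unit_chars l" "\<alpha> = ext \<alpha>'" "g \<in> carrier GL2" "C = coset l g"
        by (auto simp: X_def carrier_Q)
      show ?thesis using unit_chars_nz[OF e(1) det2_GL2_unit[OF e(3)]] by (simp add: e(2,4) ext[OF e(1,3)])
    qed
    show "\<alpha> C = 0" if "\<alpha> \<in> X" "C \<notin> carrier (Q l)" for \<alpha> C using that by (auto simp: X_def ext_def)
    show "finite I" by fact
    show "irrep (Q l) (fst i) (lift (rep i))" if i: "i \<in> I" for i
      using irrep_lift rep[OF i] repi[OF i] by (auto simp: irreducible_rep_iff)
    show "\<exists>x\<in>carrier (Q l). x \<otimes>\<^bsub>Q l\<^esub> C \<otimes>\<^bsub>Q l\<^esub> inv\<^bsub>Q l\<^esub> x = C'"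
      if "C \<in> {C \<in> carrier (Q l). \<forall>\<alpha>\<in>X. \<alpha> C = 1}" "C' \<in> {C \<in> carrier (Q l). \<forall>\<alpha>\<in>X. \<alpha> C = 1}" "cl C = cl C'" for C C'
    proof -
      have N: "C \<in> N" "C' \<in> N" using that by (simp_all add: N_def)
      then have Q: "C \<in> carrier (Q l)" "C' \<in> carrier (Q l)" by (simp_all add: N_def)
      have p: "pick C \<in> carrier GL2" "coset l (pick C) = C" "pick C' \<in> carrier GL2" "coset l (pick C') = C'"
        using pick[OF Q(1)] pick[OF Q(2)] by auto
      have "conj_mod l (pick C) (pick C')"
      proof (rule conj_of_same_type[OF p(1) Ndet[OF N(1)] p(3) Ndet[OF N(2)], of "cl C"])
        show "cl C \<in> types l" "has_type l (pick C) (cl C)" using cl[OF Q(1)] by simp_all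
        show "has_type l (pick C') (cl C)" using cl[OF Q(2)] unfolding that(3) by simp
      qed
      from conj_mod_coset[OF this p(1,3)] show ?thesis by (simp only: p(2,4))
    qed
    show "\<not> (\<exists>P\<in>carrier (GL (fst j)). \<forall>C\<in>carrier (Q l). P * lift (rep j) C = (\<alpha> C \<cdot>\<^sub>m lift (rep i) C) * P)"
      if i: "i \<in> I" and j: "j \<in> I" and ij: "i \<noteq> j" and \<alpha>: "\<alpha> \<in> X" and n: "fst i = fst j" for i j \<alpha>
    proof
      assume "\<exists>P\<in>carrier (GL (fst j)). \<forall>C\<in>carrier (Q l). P * lift (rep j) C = (\<alpha> C \<cdot>\<^sub>m lift (rep i) C) * P"
      then obtain P where P: "P \<in> carrier (GL (fst j))" "\<And>C. C \<in> carrier (Q l) \<Longrightarrow> P * lift (rep j) C = (\<alpha> C \<cdot>\<^sub>m lift (rep i) C) * P"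
        by (elim bexE) blast
      from \<alpha> obtain \<alpha>' where a: "\<alpha>' \<in> unit_chars l" "\<alpha> = ext \<alpha>'" by (auto simp: X_def)
      have "\<forall>g\<in>carrier GL2. P * rep j g = (\<alpha>' (det2 g) \<cdot>\<^sub>m rep i g) * P"
      proof
        fix g :: "'a mat" assume g: "g \<in> carrier GL2"
        have "coset l g \<in> carrier (Q l)" using g by (simp add: carrier_Q)
        from P(2)[OF this] show "P * rep j g = (\<alpha>' (det2 g) \<cdot>\<^sub>m rep i g) * P"
          using lift_coset_of_level[of l "rep i" g] lift_coset_of_level[of l "rep j" g] rep[OF i] rep[OF j] g
          by (simp add: a(2) ext[OF a(1) g])
      qed
      then have "twist_equivalent GL2 T (fst j) (rep j) (rep i)"
        unfolding twist_equivalent_iff using linear_char_det[OF a(1)] P(1)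
        by (intro exI[of _ "\<lambda>g. \<alpha>' (det2 g)"] conjI bexI[of _ P])
      then have "snd j = snd i"
        using class_eqI[OF cls[OF j] _ _ _, of "snd i" "rep j" "rep i"] cls[OF i] n rep[OF i] rep[OF j] by simp
      with n ij show False by (simp add: prod_eq_iff)
    qed
  qed
  also have "card (cl ` N) \<le> card (types l)"
    by (rule card_mono[OF finite_types]) (use cl in \<open>auto simp: N_def\<close>)
  finally show ?thesis by (simp add: card_types)
qed

lemma finite_classes_of_level: "finite (classes_of_level l n)"
proof -
  have "card F \<le> (l + 1) * q ^ l" if F: "F \<subseteq> classes_of_level l n" "finite F" for F
  proof -
    have "card (Pair n ` F) \<le> (l + 1) * q ^ l" by (rule finite_family_of_level) (use F in auto)
    then show ?thesis by (simp add: card_image inj_on_def)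
  qed
  then show ?thesis by (meson finite_if_finite_subsets_card_bdd)
qed

lemma sum_classes_of_level_le:
  assumes "finite A"
  shows "(\<Sum>n\<in>A. card (classes_of_level l n)) \<le> (l + 1) * q ^ l"
proof -
  have "(\<Sum>n\<in>A. card (classes_of_level l n)) = card (SIGMA n:A. classes_of_level l n)"
    by (rule card_SigmaI[symmetric]) (use assms finite_classes_of_level in auto)
  also have "\<dots> \<le> (l + 1) * q ^ l"
    by (rule finite_family_of_level) (use assms finite_classes_of_level in auto)
  finally show ?thesis .
qed

text \<open>
  The twist of \<open>exists_twist_of_small_level\<close> is again a member of the class.
\<close>

lemma class_has_small_level:
  assumes char2: "(1::'a) + 1 = 0" and C: "C \<in> twist_classes n"
  shows "\<exists>l. q ^ l \<le> q * n \<and> C \<in> classes_of_level l n"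
proof -
  obtain \<rho> where \<rho>: "\<rho> \<in> C" using class_nonempty[OF C] by auto
  then have \<rho>i: "\<rho> \<in> irreps n" using class_subset[OF C] by auto
  then obtain l where l: "irrep GL2 n \<rho>" "level_le l \<rho>" by (auto simp: irreducible_rep_iff)
  from exists_twist_of_small_level[OF char2 l] obtain \<alpha> k where
    \<alpha>: "\<alpha> \<in> unit_chars l" "level_le k (\<lambda>g. \<alpha> (det2 g) \<cdot>\<^sub>m \<rho> g)" "q ^ k \<le> q * n" by (elim bexE exE conjE)
  let ?\<sigma> = "\<lambda>g. \<alpha> (det2 g) \<cdot>\<^sub>m \<rho> g"
  have "?\<sigma> \<in> irreps n" using irrep_det_twist[OF l(1) \<alpha>(1)] \<alpha>(2) by (auto simp: irreducible_rep_iff)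
  moreover have "twist_equivalent GL2 T n \<rho> ?\<sigma>"
    unfolding twist_equivalent_iff
  proof (intro exI[of _ "\<lambda>g. inverse (\<alpha> (det2 g))"] conjI linear_char_inverse linear_char_det[OF \<alpha>(1)]
      bexI[of _ "1\<^sub>m n"] ballI GL_one_carrier)
    fix g :: "'a mat" assume g: "g \<in> carrier GL2"
    show "1\<^sub>m n * \<rho> g = (inverse (\<alpha> (det2 g)) \<cdot>\<^sub>m (\<alpha> (det2 g) \<cdot>\<^sub>m \<rho> g)) * 1\<^sub>m n"
      using irreps_mat[OF \<rho>i g] unit_chars_nz[OF \<alpha>(1) det2_GL2_unit[OF g]] by (simp add: smult_smult_mat)
  qed
  ultimately have "?\<sigma> \<in> C" by (rule class_closed[OF C \<rho>])
  then have "C \<in> classes_of_level k n" using C \<alpha>(2) by (auto simp: classes_of_level_def)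
  with \<alpha>(3) show ?thesis by blast
qed

end

section \<open>Representations induced from the Borel subgroup\<close>

context uniformizer_ideal
begin

text \<open>
  The preimage of the Borel subgroup of \<open>GL\<^sub>2(\<O>/\<pi>\<^sup>l)\<close>.
\<close>

definition borel :: "nat \<Rightarrow> 'a mat set" where
  "borel l = {g \<in> carrier GL2. \<pi> ^ l dvd g $$ (1,0)}"

lemma borel_M2: "M2 a b c d \<in> borel l \<longleftrightarrow> (a * d - b * c) dvd 1 \<and> \<pi> ^ l dvd c"
  by (simp add: borel_def)

lemma borel_cases:
  assumes "g \<in> borel l" "l > 0"
  obtains a b c d where "g = M2 a b c d" "a dvd 1" "d dvd 1" "\<pi> ^ l dvd c" "(a * d - b * c) dvd 1"
proof -
  obtain a b c d where e: "g = M2 a b c d" "(a * d - b * c) dvd 1"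
    using GL2_cases assms(1) unfolding borel_def by blast
  have c: "\<pi> ^ l dvd c" using assms(1) by (simp add: borel_def e)
  have "\<pi> ^ l dvd (a * d - b * c) - a * d" using c by simp
  then have "a * d dvd 1" using unit_cong[of l "a * d - b * c" "a * d"] e(2) assms(2) by simp
  then have "a dvd 1" "d dvd 1" by (simp_all add: unit_mult_iff)
  with that e c show ?thesis by blast
qed

lemma borel_mult:
  assumes "g \<in> borel l" "h \<in> borel l" "l > 0"
  shows "g * h \<in> borel l" "\<pi> ^ l dvd (g * h) $$ (0,0) - g $$ (0,0) * h $$ (0,0)"
proof -
  obtain a b c d where g: "g = M2 a b c d" "\<pi> ^ l dvd c" using borel_cases[OF assms(1,3)] by metis
  obtain a' b' c' d' where h: "h = M2 a' b' c' d'" "\<pi> ^ l dvd c'" using borel_cases[OF assms(2,3)] by metis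
  have gh: "g * h \<in> carrier GL2" using assms GL2_mult_closed by (simp add: borel_def)
  then show "g * h \<in> borel l" using g h by (simp add: borel_def)
  show "\<pi> ^ l dvd (g * h) $$ (0,0) - g $$ (0,0) * h $$ (0,0)" using g h by simp
qed

lemma level_le_entry:
  assumes \<chi>: "\<chi> \<in> unit_chars l" and l: "l > 0"
  shows "level_le l (\<lambda>g. \<chi> (g $$ (0,0)))"
  unfolding level_le_def
proof (intro ballI impI)
  fix g h :: "'a mat" assume "mcong l g h"
  then have c: "\<pi> ^ l dvd g $$ (0,0) - h $$ (0,0)" by (simp add: mcong_def)
  show "\<chi> (g $$ (0,0)) = \<chi> (h $$ (0,0))"
  proof (cases "g $$ (0,0) dvd 1")
    case True
    then show ?thesis using unit_chars_cong[OF \<chi> True _ c] unit_cong[OF c l] by simp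
  next
    case False
    then show ?thesis using unit_charsD(1)[OF \<chi>] unit_cong[OF c l] by simp
  qed
qed

text \<open>
  A constituent of the representation of \<open>Q l\<close> induced from the character
  \<open>\<chi>(a)\<close> of the Borel subgroup. Every element is, up to a factor in the Borel subgroup,
  lower unipotent or the product of an upper unipotent matrix with the Weyl element, according to whether
  \<open>a\<close> or \<open>c\<close> is a unit; representatives modulo \<open>\<pi>\<^sup>l\<close>
  thus give a bound \<open>2 q\<^sup>l\<close> for the index.
\<close>

lemma principal_series_exists:
  assumes \<chi>: "\<chi> \<in> unit_chars l" and l: "l > 0"
  shows "\<exists>n \<rho> \<phi> v. irrep GL2 n \<rho> \<and> level_le l \<rho> \<and> n \<le> 2 * q ^ l \<and> \<phi> \<in> carrier_vec n \<and> \<phi> \<noteq> 0\<^sub>v n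
    \<and> (\<forall>b\<in>borel l. \<forall>x\<in>carrier_vec n. \<phi> \<bullet> (\<rho> b *\<^sub>v x) = \<chi> (b $$ (0,0)) * (\<phi> \<bullet> x))
    \<and> v \<in> carrier_vec n \<and> v \<noteq> 0\<^sub>v n \<and> (\<forall>b\<in>borel l. \<rho> b *\<^sub>v v = \<chi> (b $$ (0,0)) \<cdot>\<^sub>v v)"
proof -
  interpret Q: finite_group "Q l" by (rule finite_group_Q)
  define H where "H = coset l ` borel l"
  define \<theta> where "\<theta> = lift (\<lambda>g. \<chi> (g $$ (0,0)))"
  have bc: "b \<in> carrier GL2" if "b \<in> borel l" for b using that by (simp add: borel_def)
  have \<theta>: "\<theta> (coset l b) = \<chi> (b $$ (0,0))" if "b \<in> carrier GL2" for b
    unfolding \<theta>_def by (rule lift_coset_of_level[OF level_le_entry[OF \<chi> l] that])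
  have b00: "b $$ (0,0) dvd 1" if "b \<in> borel l" for b using borel_cases[OF that l] by (metis M2_index(1))
  have one: "M2 1 0 0 1 \<in> borel l" by (simp add: borel_M2)
  have binv: "inv\<^bsub>GL2\<^esub> b \<in> borel l" if b: "b \<in> borel l" for b
  proof -
    obtain a x c d where e: "b = M2 a x c d" "\<pi> ^ l dvd c" "(a * d - x * c) dvd 1" using borel_cases[OF b l] by metis
    obtain u where u: "u dvd 1" "(a * d - x * c) * u = 1" using unit_inverse[OF e(3)] .
    have "inv\<^bsub>GL2\<^esub> b = M2 (d * u) (- (x * u)) (- (c * u)) (a * u)"
    proof (rule GL2_inv_eqI)
      have *: "a * (d * u) - x * (c * u) = 1" "d * (a * u) - c * (x * u) = 1" using u(2) by (simp_all add: algebra_simps)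
      have "(d * u) * (a * u) - (- (x * u)) * (- (c * u)) = ((a * d - x * c) * u) * u" by (simp add: algebra_simps)
      then show "M2 (d * u) (- (x * u)) (- (c * u)) (a * u) \<in> carrier GL2" using u(1) by (simp only: M2_in_GL2 u(2) mult_1)
      show "b * M2 (d * u) (- (x * u)) (- (c * u)) (a * u) = M2 1 0 0 1"
        unfolding e using * by (simp add: algebra_simps)
    qed (rule bc[OF b])
    then show ?thesis using e(2) GL2.inv_closed[OF bc[OF b]] by (simp add: borel_def)
  qed
  have subH: "subgroup H (Q l)"
  proof (rule Q.subgroupI)
    show "H \<subseteq> carrier (Q l)" using bc by (auto simp: H_def carrier_Q)
    show "H \<noteq> {}" using one by (auto simp: H_def)
    show "inv\<^bsub>Q l\<^esub> C \<in> H" if "C \<in> H" for C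
    proof -
      from that obtain b where b: "b \<in> borel l" "C = coset l b" by (auto simp: H_def)
      show ?thesis unfolding b(2) coset_inv[OF bc[OF b(1)]] H_def using binv[OF b(1)] by (rule imageI)
    qed
    show "C \<otimes>\<^bsub>Q l\<^esub> C' \<in> H" if "C \<in> H" "C' \<in> H" for C C'
    proof -
      from that obtain b b' where b: "b \<in> borel l" "C = coset l b" "b' \<in> borel l" "C' = coset l b'" by (auto simp: H_def)
      show ?thesis unfolding b(2,4) coset_mult[OF bc[OF b(1)] bc[OF b(3)]] H_def
        using borel_mult(1)[OF b(1,3) l] by (rule imageI)
    qed
  qed
  have \<theta>_mult: "\<theta> (C \<otimes>\<^bsub>Q l\<^esub> C') = \<theta> C * \<theta> C'" if C: "C \<in> H" "C' \<in> H" for C C'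
  proof -
    from C obtain b b' where b: "b \<in> borel l" "C = coset l b" "b' \<in> borel l" "C' = coset l b'" by (auto simp: H_def)
    note m = borel_mult[OF b(1,3) l]
    have u: "b $$ (0,0) * b' $$ (0,0) dvd 1" by (rule unit_mult[OF b00[OF b(1)] b00[OF b(3)]])
    have "\<chi> ((b * b') $$ (0,0)) = \<chi> (b $$ (0,0) * b' $$ (0,0))"
      by (rule unit_chars_cong[OF \<chi> b00[OF m(1)] u m(2)])
    also have "\<dots> = \<chi> (b $$ (0,0)) * \<chi> (b' $$ (0,0))" by (rule unit_charsD(2)[OF \<chi> b00[OF b(1)] b00[OF b(3)]])
    finally show ?thesis
      unfolding b(2,4) coset_mult[OF bc[OF b(1)] bc[OF b(3)]] \<theta>[OF bc[OF m(1)]] \<theta>[OF bc[OF b(1)]] \<theta>[OF bc[OF b(3)]] .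
  qed
  have Q1: "\<one>\<^bsub>Q l\<^esub> = coset l (M2 1 0 0 1)" using hom_one[OF coset_hom group_GL group_Q, of l] by (simp only: GL2_one)
  have \<theta>_one: "\<theta> \<one>\<^bsub>Q l\<^esub> = 1"
    unfolding Q1 using \<theta>[OF bc[OF one]] unit_chars_one[OF \<chi>] by simp
  define R1 where "R1 = (\<lambda>x. coset l (M2 1 0 x 1)) ` reps l"
  define R2 where "R2 = (\<lambda>y. coset l (M2 y 1 1 0)) ` reps l"
  have mc: "M2 1 0 x 1 \<in> carrier GL2" "M2 y 1 1 0 \<in> carrier GL2" for x y :: 'a by simp_all
  have finR: "finite (R1 \<union> R2)" by (simp add: R1_def R2_def finite_reps)
  have subR: "R1 \<union> R2 \<subseteq> carrier (Q l)" using mc by (auto simp: R1_def R2_def carrier_Q)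
  have "card (R1 \<union> R2) \<le> card R1 + card R2" by (rule card_Un_le)
  also have "\<dots> \<le> q ^ l + q ^ l"
    unfolding R1_def R2_def by (intro add_mono) (simp_all add: card_reps[symmetric] card_image_le finite_reps)
  finally have cardR: "card (R1 \<union> R2) \<le> 2 * q ^ l" by simp
  have cover: "\<exists>r\<in>R1 \<union> R2. inv\<^bsub>Q l\<^esub> r \<otimes>\<^bsub>Q l\<^esub> C \<in> H" if C: "C \<in> carrier (Q l)" for C
  proof -
    obtain g where g: "g \<in> carrier GL2" "C = coset l g" using C unfolding carrier_Q by blast
    obtain a b c d where e: "g = M2 a b c d" "(a * d - b * c) dvd 1" using GL2_cases[OF g(1)] .
    have in_H: "inv\<^bsub>Q l\<^esub> (coset l r) \<otimes>\<^bsub>Q l\<^esub> C \<in> H" if r: "r \<in> carrier GL2" "inv\<^bsub>GL2\<^esub> r = s" "\<pi> ^ l dvd (s * g) $$ (1,0)" for r s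
    proof -
      have s: "s \<in> carrier GL2" using r(1,2) by auto
      have "s * g \<in> borel l" using GL2_mult_closed[OF s g(1)] r(3) by (simp add: borel_def)
      then show ?thesis unfolding g(2) coset_inv[OF r(1)] r(2) coset_mult[OF s g(1)] H_def by (rule imageI)
    qed
    show ?thesis
    proof (cases "a dvd 1")
      case True
      obtain a' where a': "a' dvd 1" "a * a' = 1" using unit_inverse[OF True] .
      define x where "x = red l (c * a')"
      have "\<pi> ^ l dvd (c * a' - x) * a" using red(2)[of l "c * a'"] by (simp add: x_def)
      also have "(c * a' - x) * a = c * (a * a') - x * a" by (simp add: algebra_simps)
      finally have d: "\<pi> ^ l dvd c - x * a" by (simp add: a')
      have i: "inv\<^bsub>GL2\<^esub> (M2 1 0 x 1) = M2 1 0 (-x) 1" by (rule GL2_inv_eqI) simp_all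
      have "inv\<^bsub>Q l\<^esub> (coset l (M2 1 0 x 1)) \<otimes>\<^bsub>Q l\<^esub> C \<in> H"
        by (rule in_H[OF mc(1) i]) (use d in \<open>simp add: e\<close>)
      moreover have "coset l (M2 1 0 x 1) \<in> R1 \<union> R2" using red(1) by (auto simp: R1_def x_def)
      ultimately show ?thesis by (rule bexI)
    next
      case False
      then have pa: "\<pi> dvd a" by (simp add: unit_iff)
      have "\<pi> ^ 1 dvd (a * d - b * c) - (- (b * c))" using pa by simp
      then have "- (b * c) dvd 1" using unit_cong[of 1 "a * d - b * c" "- (b * c)"] e(2) by simp
      then have "c dvd 1" by (simp add: unit_mult_iff)
      then obtain c' where c': "c' dvd 1" "c * c' = 1" by (rule unit_inverse)
      define y where "y = red l (a * c')"
      have "\<pi> ^ l dvd (a * c' - y) * c" using red(2)[of l "a * c'"] by (simp add: y_def)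
      also have "(a * c' - y) * c = a * (c * c') - y * c" by (simp add: algebra_simps)
      finally have d: "\<pi> ^ l dvd a - y * c" by (simp add: c')
      have i: "inv\<^bsub>GL2\<^esub> (M2 y 1 1 0) = M2 0 1 1 (-y)" by (rule GL2_inv_eqI) simp_all
      have "inv\<^bsub>Q l\<^esub> (coset l (M2 y 1 1 0)) \<otimes>\<^bsub>Q l\<^esub> C \<in> H"
        by (rule in_H[OF mc(2) i]) (use d in \<open>simp add: e\<close>)
      moreover have "coset l (M2 y 1 1 0) \<in> R1 \<union> R2" using red(1) by (auto simp: R2_def y_def)
      ultimately show ?thesis by (rule bexI)
    qed
  qed
  have "\<exists>n \<sigma> \<phi>. irrep (Q l) n \<sigma> \<and> n \<le> card (R1 \<union> R2) \<and> \<phi> \<in> carrier_vec n \<and> \<phi> \<noteq> 0\<^sub>v n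
    \<and> (\<forall>b\<in>H. \<forall>x\<in>carrier_vec n. \<phi> \<bullet> (\<sigma> b *\<^sub>v x) = \<theta> b * (\<phi> \<bullet> x))"
    by (rule Q.irrep_with_eigenfunctional[where \<theta> = \<theta>, OF subH _ \<theta>_one finR subR]) (fact \<theta>_mult, fact cover)
  then obtain n \<sigma> \<phi> where \<sigma>: "irrep (Q l) n \<sigma>" "n \<le> card (R1 \<union> R2)" "\<phi> \<in> carrier_vec n" "\<phi> \<noteq> 0\<^sub>v n"
    "\<forall>b\<in>H. \<forall>x\<in>carrier_vec n. \<phi> \<bullet> (\<sigma> b *\<^sub>v x) = \<theta> b * (\<phi> \<bullet> x)"
    by (elim exE conjE)
  have hom: "\<sigma> \<in> hom (Q l) (GL n)" using \<sigma>(1) by (simp add: irrep_def)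
  have "\<exists>v\<in>carrier_vec n. v \<noteq> 0\<^sub>v n \<and> (\<forall>b\<in>H. \<sigma> b *\<^sub>v v = \<theta> b \<cdot>\<^sub>v v)"
  proof (rule Q.eigenvector_of_eigenfunctional[where \<theta> = \<theta>, OF subH _ \<theta>_one hom \<sigma>(3,4)])
    show "\<theta> (C \<otimes>\<^bsub>Q l\<^esub> C') = \<theta> C * \<theta> C'" if "C \<in> H" "C' \<in> H" for C C' using that by (rule \<theta>_mult)
    show "\<phi> \<bullet> (\<sigma> b *\<^sub>v x) = \<theta> b * (\<phi> \<bullet> x)" if "b \<in> H" "x \<in> carrier_vec n" for b x using \<sigma>(5) that by simp
  qed
  then obtain v where v: "v \<in> carrier_vec n" "v \<noteq> 0\<^sub>v n" "\<forall>b\<in>H. \<sigma> b *\<^sub>v v = \<theta> b \<cdot>\<^sub>v v"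
    by (elim bexE conjE)
  define \<rho> where "\<rho> g = \<sigma> (coset l g)" for g
  have bH: "coset l b \<in> H" "\<theta> (coset l b) = \<chi> (b $$ (0,0))" if "b \<in> borel l" for b
    using that \<theta>[OF bc[OF that]] by (auto simp: H_def)
  have "irrep GL2 n \<rho>" unfolding \<rho>_def[abs_def] using irrep_inflate \<sigma>(1) by blast
  moreover have "level_le l \<rho>" unfolding \<rho>_def[abs_def] by (rule level_le_inflate)
  moreover have "n \<le> 2 * q ^ l" using \<sigma>(2) cardR by simp
  moreover have "\<forall>b\<in>borel l. \<forall>x\<in>carrier_vec n. \<phi> \<bullet> (\<rho> b *\<^sub>v x) = \<chi> (b $$ (0,0)) * (\<phi> \<bullet> x)"
    unfolding \<rho>_def using \<sigma>(5) bH by simp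
  moreover have "\<forall>b\<in>borel l. \<rho> b *\<^sub>v v = \<chi> (b $$ (0,0)) \<cdot>\<^sub>v v"
    unfolding \<rho>_def using v(3) bH by simp
  ultimately show ?thesis using \<sigma>(3,4) v(1,2)
    by (intro exI[of _ n] exI[of _ \<rho>] exI[of _ \<phi>] exI[of _ v] conjI)
qed

text \<open>
  A linear character is invariant under conjugation by the Weyl element, and trivial on the commutators
  of diagonal with unipotent matrices.
\<close>

lemma linear_char_relations:
  assumes t: "linear_char t"
  shows "g \<in> carrier GL2 \<Longrightarrow> h \<in> carrier GL2 \<Longrightarrow> t (g * h) = t g * t h"
    and "t (M2 1 0 0 1) = 1"
    and "a dvd 1 \<Longrightarrow> t (M2 1 0 0 a) = t (M2 a 0 0 1)"
    and "a dvd 1 \<Longrightarrow> t (M2 1 ((a - 1) * x) 0 1) = 1"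
proof -
  show mult: "t (g * h) = t g * t h" if "g \<in> carrier GL2" "h \<in> carrier GL2" for g h
    using t that by (simp add: linear_char_def)
  have nz: "t g \<noteq> 0" if "g \<in> carrier GL2" for g using t that by (simp add: linear_char_def)
  show one: "t (M2 1 0 0 1) = 1" using mult[of "M2 1 0 0 1" "M2 1 0 0 1"] nz[of "M2 1 0 0 1"] by simp
  show "t (M2 1 0 0 a) = t (M2 a 0 0 1)" if a: "a dvd 1"
    using mult[of "M2 0 1 1 0" "M2 a 0 0 1"] mult[of "M2 1 0 0 a" "M2 0 1 1 0"] nz[of "M2 0 1 1 0"] a by simp
  show "t (M2 1 ((a - 1) * x) 0 1) = 1" if a: "a dvd 1"
  proof -
    have "t (M2 a (a * x) 0 1) = t (M2 a 0 0 1) * t (M2 1 x 0 1)"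
      using mult[of "M2 a 0 0 1" "M2 1 x 0 1"] a by simp
    moreover have "t (M2 a (a * x) 0 1) = t (M2 1 (a * x) 0 1) * t (M2 a 0 0 1)"
      using mult[of "M2 1 (a * x) 0 1" "M2 a 0 0 1"] a by simp
    ultimately have 1: "t (M2 1 (a * x) 0 1) = t (M2 1 x 0 1)" using nz[of "M2 a 0 0 1"] a by simp
    have "M2 1 (a * x) 0 1 * M2 1 (- x) 0 1 = M2 1 ((a - 1) * x) 0 1" by (simp add: algebra_simps)
    then have "t (M2 1 ((a - 1) * x) 0 1) = t (M2 1 (a * x) 0 1) * t (M2 1 (- x) 0 1)"
      using mult[of "M2 1 (a * x) 0 1" "M2 1 (- x) 0 1"] by simp
    also have "\<dots> = t (M2 1 x 0 1 * M2 1 (- x) 0 1)" unfolding 1 by (rule mult[symmetric]) simp_all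
    also have "\<dots> = 1" using one by simp
    finally show ?thesis .
  qed
qed

text \<open>
  Mackey's argument. The function \<open>f g = \<psi> (\<rho> g v)\<close> does not vanish identically,
  since \<open>\<rho>\<close> is irreducible, and it transforms by characters of the Borel subgroup
  \<open>B\<close> under multiplication from the left and from the right. If \<open>f g \<noteq>
  0\<close>, then these characters are related by \<open>compare\<close> on \<open>B \<inter> g B
  g\<inverse>\<close>. The double cosets are represented by \<open>1\<close>, by the Weyl element, and by
  lower unipotent matrices with an entry \<open>z\<close> of valuation \<open>0 < j < l\<close>. The
  first two lead to \<open>\<chi>' = \<chi>\<close> and \<open>\<chi>' = \<chi>\<inverse>\<close>. For
  the third one, primitivity of \<open>\<chi>\<close> forces the twist \<open>t\<close> to be non-trivial
  on some \<open>u(x)\<close>, which is impossible by \<open>linear_char_relations\<close> unless all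
  units are congruent to \<open>1\<close> modulo \<open>\<pi>\<close> and \<open>j = l - 1\<close>; in
  that exceptional case the relations show \<open>\<chi>' = \<chi>\<close>.
\<close>

lemma principal_series_distinct:
  fixes \<rho> :: "'a mat \<Rightarrow> complex mat"
  assumes l: "l \<ge> 2" and \<chi>: "\<chi> \<in> primitive_chars l" and \<chi>': "\<chi>' \<in> unit_chars l"
    and \<rho>: "irrep GL2 n \<rho>" and v: "v \<in> carrier_vec n" "v \<noteq> 0\<^sub>v n"
    and v_eig: "\<And>b. b \<in> borel l \<Longrightarrow> \<rho> b *\<^sub>v v = \<chi> (b $$ (0,0)) \<cdot>\<^sub>v v"
    and \<psi>: "\<psi> \<in> carrier_vec n" "\<psi> \<noteq> 0\<^sub>v n" and t: "linear_char t"
    and \<psi>_eig: "\<And>b x. b \<in> borel l \<Longrightarrow> x \<in> carrier_vec n \<Longrightarrow> \<psi> \<bullet> (\<rho> b *\<^sub>v x) = t b * \<chi>' (b $$ (0,0)) * (\<psi> \<bullet> x)"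
  shows "\<chi>' = \<chi> \<or> \<chi>' = (\<lambda>x. inverse (\<chi> x))"
proof -
  have \<chi>u: "\<chi> \<in> unit_chars l" using \<chi> by (simp add: primitive_chars_def)
  have hom: "\<rho> \<in> hom GL2 (GL n)" using \<rho> by (simp add: irrep_def)
  note r = hom_GL_D[OF hom]
  note tf = linear_char_relations[OF t]
  have c1: "\<chi> 1 = 1" "\<chi>' 1 = 1" using unit_chars_one[OF \<chi>u] unit_chars_one[OF \<chi>'] by auto
  have bc: "b \<in> carrier GL2" if "b \<in> borel l" for b using that by (simp add: borel_def)
  define f where "f g = \<psi> \<bullet> (\<rho> g *\<^sub>v v)" for g
  have \<rho>c: "\<rho> g *\<^sub>v x \<in> carrier_vec n" if "g \<in> carrier GL2" "x \<in> carrier_vec n" for g x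
    by (rule mult_mat_vec_carrier[OF r(1)[OF that(1)] that(2)])
  have \<rho>m: "\<rho> (g * h) *\<^sub>v x = \<rho> g *\<^sub>v (\<rho> h *\<^sub>v x)"
    if "g \<in> carrier GL2" "h \<in> carrier GL2" "x \<in> carrier_vec n" for g h x
    using r(2)[OF that(1,2)] assoc_mult_mat_vec[OF r(1)[OF that(1)] r(1)[OF that(2)] that(3)] by simp
  have f_left: "f (b * g) = t b * \<chi>' (b $$ (0,0)) * f g" if "b \<in> borel l" "g \<in> carrier GL2" for b g
    unfolding f_def \<rho>m[OF bc[OF that(1)] that(2) v(1)] by (rule \<psi>_eig[OF that(1) \<rho>c[OF that(2) v(1)]])
  have f_right: "f (g * b) = \<chi> (b $$ (0,0)) * f g" if "b \<in> borel l" "g \<in> carrier GL2" for b g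
  proof -
    have "\<rho> g *\<^sub>v (\<chi> (b $$ (0,0)) \<cdot>\<^sub>v v) = \<chi> (b $$ (0,0)) \<cdot>\<^sub>v (\<rho> g *\<^sub>v v)" by (rule mult_mat_vec[OF r(1)[OF that(2)] v(1)])
    then show ?thesis
      unfolding f_def \<rho>m[OF that(2) bc[OF that(1)] v(1)] v_eig[OF that(1)]
      using \<psi>(1) \<rho>c[OF that(2) v(1)] by simp
  qed
  have compare: "t b * \<chi>' (b $$ (0,0)) = \<chi> (b' $$ (0,0))"
    if "b \<in> borel l" "b' \<in> borel l" "b * g = g * b'" "f g \<noteq> 0" "g \<in> carrier GL2" for b b' g
    using f_left[OF that(1,5)] f_right[OF that(2,5)] that(3,4) by simp
  have "\<exists>g\<in>carrier GL2. f g \<noteq> 0"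
  proof (rule ccontr)
    assume neg: "\<not> ?thesis"
    define W where "W = {x \<in> carrier_vec n. \<forall>g\<in>carrier GL2. \<psi> \<bullet> (\<rho> g *\<^sub>v x) = 0}"
    have "W = {0\<^sub>v n} \<or> W = carrier_vec n"
    proof (rule irrepD[OF \<rho>])
      show "W \<subseteq> carrier_vec n" unfolding W_def by (rule subsetI) (elim CollectE conjE)
      have WI: "x \<in> W" if "x \<in> carrier_vec n" "\<And>g. g \<in> carrier GL2 \<Longrightarrow> \<psi> \<bullet> (\<rho> g *\<^sub>v x) = 0" for x
        unfolding W_def using that by simp
      have WD: "x \<in> carrier_vec n" "g \<in> carrier GL2 \<Longrightarrow> \<psi> \<bullet> (\<rho> g *\<^sub>v x) = 0" if "x \<in> W" for x g
        using that unfolding W_def by simp_all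
      show "0\<^sub>v n \<in> W"
      proof (rule WI)
        fix g :: "'a mat" assume g: "g \<in> carrier GL2"
        have "\<rho> g *\<^sub>v 0\<^sub>v n = 0\<^sub>v n" using r(1)[OF g] by (intro eq_vecI) (auto simp: scalar_prod_def)
        then show "\<psi> \<bullet> (\<rho> g *\<^sub>v 0\<^sub>v n) = 0" using \<psi>(1) by simp
      qed simp
      show "x + y \<in> W" if xy: "x \<in> W" "y \<in> W" for x y
      proof (rule WI)
        fix g :: "'a mat" assume g: "g \<in> carrier GL2"
        show "\<psi> \<bullet> (\<rho> g *\<^sub>v (x + y)) = 0"
          unfolding mult_add_distrib_mat_vec[OF r(1)[OF g] WD(1)[OF xy(1)] WD(1)[OF xy(2)]]
            scalar_prod_add_distrib[OF \<psi>(1) \<rho>c[OF g WD(1)[OF xy(1)]] \<rho>c[OF g WD(1)[OF xy(2)]]]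
          using WD(2)[OF xy(1) g] WD(2)[OF xy(2) g] by simp
      qed (simp add: WD(1)[OF xy(1)] WD(1)[OF xy(2)])
      show "c \<cdot>\<^sub>v x \<in> W" if x: "x \<in> W" for c x
      proof (rule WI)
        fix g :: "'a mat" assume g: "g \<in> carrier GL2"
        show "\<psi> \<bullet> (\<rho> g *\<^sub>v (c \<cdot>\<^sub>v x)) = 0"
          unfolding mult_mat_vec[OF r(1)[OF g] WD(1)[OF x]]
          using WD(2)[OF x g] \<psi>(1) \<rho>c[OF g WD(1)[OF x]] by simp
      qed (simp add: WD(1)[OF x])
      show "\<rho> h *\<^sub>v x \<in> W" if h: "h \<in> carrier GL2" and x: "x \<in> W" for h x
      proof (rule WI)
        fix g :: "'a mat" assume g: "g \<in> carrier GL2"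
        show "\<psi> \<bullet> (\<rho> g *\<^sub>v (\<rho> h *\<^sub>v x)) = 0"
          unfolding \<rho>m[OF g h WD(1)[OF x], symmetric] by (rule WD(2)[OF x GL2_mult_closed[OF g h]])
      qed (rule \<rho>c[OF h WD(1)[OF x]])
    qed
    moreover have "v \<in> W" using neg v(1) unfolding W_def f_def by simp
    ultimately have W: "W = carrier_vec n" using v(2) by auto
    obtain j where j: "j < n" "\<psi> $ j \<noteq> 0" using nonzero_vec_entry[OF \<psi>] .
    have "unit_vec n j \<in> W" unfolding W by simp
    then have "\<psi> \<bullet> (\<rho> (M2 1 0 0 1) *\<^sub>v unit_vec n j) = 0" by (simp add: W_def)
    then have "\<psi> \<bullet> unit_vec n j = 0" using hom_GL_one[OF group_GL hom] by (simp add: GL2_one)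
    then show False using j by simp
  qed
  then obtain g where g: "g \<in> carrier GL2" "f g \<noteq> 0" by (elim bexE)
  obtain a b c d where e: "g = M2 a b c d" "(a * d - b * c) dvd 1" using GL2_cases[OF g(1)] .
  have eqI: "\<chi>' = \<omega>" if "\<And>x. x dvd 1 \<Longrightarrow> \<chi>' x = \<omega> x" "\<And>x. \<not> x dvd 1 \<Longrightarrow> \<omega> x = 0" for \<omega>
  proof
    fix x show "\<chi>' x = \<omega> x" by (cases "x dvd 1") (simp_all add: that unit_charsD(1)[OF \<chi>'])
  qed
  show ?thesis
  proof (cases "\<pi> ^ l dvd c")
    case True
    then have gB: "g \<in> borel l" using g(1) by (simp add: borel_def e)
    have one: "M2 1 0 0 1 \<in> carrier GL2" by simp
    have f1: "f (M2 1 0 0 1) \<noteq> 0" using f_right[OF gB one] g GL2_mat[OF g(1)] by auto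
    have eq: "\<chi>' x = \<chi> x" if x: "x dvd 1" for x
    proof -
      have B: "M2 1 0 0 x \<in> borel l" "M2 x 0 0 1 \<in> borel l" using x by (simp_all add: borel_M2)
      have "t (M2 1 0 0 x) = 1" using compare[OF B(1,1) _ f1 one] by (simp add: c1)
      then have "t (M2 x 0 0 1) = 1" using tf(3)[OF x] by simp
      then show ?thesis using compare[OF B(2,2) _ f1 one] by simp
    qed
    have "\<chi>' = \<chi>" by (rule eqI) (simp_all add: eq unit_charsD(1)[OF \<chi>u])
    then show ?thesis by simp
  next
    case nc: False
    show ?thesis
    proof (cases "c dvd 1")
      case True
      obtain c' where c': "c' dvd 1" "c * c' = 1" using unit_inverse[OF True] .
      define s where "s = b - a * c' * d"
      let ?w = "M2 0 1 1 0 :: 'a mat"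
      have ce: "a * c' * c = a"
      proof -
        have "a * c' * c = a * (c * c')" by (simp only: mult_ac)
        then show ?thesis by (simp add: c')
      qed
      have ge: "M2 1 (a * c') 0 1 * (?w * M2 c d 0 s) = g"
        unfolding e(1) by (simp add: s_def ce)
      have "c * s = - (a * d - b * c) + a * d * (1 - c * c')" by (simp add: s_def algebra_simps)
      then have cs: "c * s = - (a * d - b * c)" by (simp add: c')
      have "c * s dvd 1" unfolding cs using e(2) by (simp only: minus_dvd_iff)
      then have B2: "M2 c d 0 s \<in> borel l" by (simp add: borel_M2)
      have B1: "M2 1 (a * c') 0 1 \<in> borel l" by (simp add: borel_M2)
      have w: "?w \<in> carrier GL2" by simp
      have fw: "f ?w \<noteq> 0"
        using f_left[OF B1 GL2_mult_closed[OF w bc[OF B2]]] f_right[OF B2 w] g(2) unfolding ge by auto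
      have eq: "\<chi>' x = inverse (\<chi> x)" if x: "x dvd 1" for x
      proof -
        have B: "M2 1 0 0 x \<in> borel l" "M2 x 0 0 1 \<in> borel l" using x by (simp_all add: borel_M2)
        have 1: "t (M2 1 0 0 x) = \<chi> x" using compare[OF B(1,2) _ fw w] by (simp add: c1)
        have 2: "t (M2 x 0 0 1) * \<chi>' x = 1" using compare[OF B(2,1) _ fw w] by (simp add: c1)
        have "\<chi> x * \<chi>' x = 1" using 1 2 tf(3)[OF x] by simp
        then show ?thesis by (rule inverse_unique[symmetric])
      qed
      have "\<chi>' = (\<lambda>x. inverse (\<chi> x))" by (rule eqI) (simp_all add: eq unit_charsD(1)[OF \<chi>u])
      then show ?thesis by simp
    next
      case False
      then have pc: "\<pi> dvd c" by (simp add: unit_iff)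
      obtain j u where ju: "j < l" "c = \<pi> ^ j * u" "u dvd 1" using valuation[OF nc] .
      have j0: "j > 0" using ju False by (cases j) auto
      have "\<pi> ^ 1 dvd (a * d - b * c) - a * d" using pc by simp
      then have "a * d dvd 1" using unit_cong[of 1 "a * d - b * c" "a * d"] e(2) by simp
      then have "a dvd 1" by (simp add: unit_mult_iff)
      then obtain a' where a': "a' dvd 1" "a * a' = 1" by (rule unit_inverse)
      define z where "z = \<pi> ^ j * (u * a')"
      have za: "z * a = c"
      proof -
        have "z * a = \<pi> ^ j * u * (a * a')" by (simp only: z_def mult_ac)
        then show ?thesis by (simp add: a' ju)
      qed
      define s where "s = d - z * b"
      let ?n = "M2 1 0 z 1"
      have nc': "?n \<in> carrier GL2" by simp
      have ge: "?n * M2 a b 0 s = g" unfolding e(1) by (simp add: s_def za)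
      have "a * s = a * d - b * c" by (simp add: s_def za[symmetric] algebra_simps)
      then have B2: "M2 a b 0 s \<in> borel l" using e(2) by (simp add: borel_M2)
      have fn: "f ?n \<noteq> 0" using f_right[OF B2 nc'] g(2) unfolding ge by auto
      have pz: "\<pi> dvd z" using j0 by (cases j) (simp_all add: z_def)
      have unit1: "1 + y dvd 1" if "\<pi> dvd y" for y using unit_cong[of 1 "1 + y" 1] that by simp
      have R1: "t (M2 1 0 0 (1 + x * z)) * t (M2 1 x 0 1) = \<chi> (1 + x * z)" for x
      proof -
        have u: "1 + x * z dvd 1" using pz by (intro unit1) simp
        have B: "M2 1 x 0 (1 + x * z) \<in> borel l" "M2 (1 + x * z) x 0 1 \<in> borel l" using u by (simp_all add: borel_M2)
        have "M2 1 x 0 (1 + x * z) * ?n = ?n * M2 (1 + x * z) x 0 1" by (simp add: algebra_simps)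
        then have "t (M2 1 x 0 (1 + x * z)) = \<chi> (1 + x * z)" using compare[OF B _ fn nc'] by (simp add: c1)
        moreover have "M2 1 0 0 (1 + x * z) * M2 1 x 0 1 = M2 1 x 0 (1 + x * z)" by simp
        moreover have "M2 1 0 0 (1 + x * z) \<in> carrier GL2" "M2 1 x 0 1 \<in> carrier GL2" using u by simp_all
        ultimately show ?thesis using tf(1)[of "M2 1 0 0 (1 + x * z)" "M2 1 x 0 1"] by simp
      qed
      have R2: "t (M2 1 0 0 (1 + y)) = 1" if y: "\<pi> dvd y" "\<pi> ^ l dvd y * z" for y
      proof -
        have B: "M2 1 0 0 (1 + y) \<in> borel l" "M2 1 0 (y * z) (1 + y) \<in> borel l" using unit1[OF y(1)] y(2) by (simp_all add: borel_M2)
        have "M2 1 0 0 (1 + y) * ?n = ?n * M2 1 0 (y * z) (1 + y)" by (simp add: algebra_simps)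
        then show ?thesis using compare[OF B _ fn nc'] by (simp add: c1)
      qed
      have R3: "t (M2 (1 + y) 0 0 1) * \<chi>' (1 + y) = \<chi> (1 + y)" if y: "\<pi> dvd y" "\<pi> ^ l dvd y * z" for y
      proof -
        have B: "M2 (1 + y) 0 0 1 \<in> borel l" "M2 (1 + y) 0 (- (y * z)) 1 \<in> borel l" using unit1[OF y(1)] y(2) by (simp_all add: borel_M2)
        have "M2 (1 + y) 0 0 1 * ?n = ?n * M2 (1 + y) 0 (- (y * z)) 1" by (simp add: algebra_simps)
        then show ?thesis using compare[OF B _ fn nc'] by simp
      qed
      obtain \<epsilon> where \<epsilon>: "\<epsilon> \<in> cong_one (l - 1)" "\<chi> \<epsilon> \<noteq> 1" using \<chi> by (auto simp: primitive_chars_def)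
      then obtain k where k: "\<epsilon> - 1 = \<pi> ^ (l - 1) * k" unfolding cong_one_def by (elim CollectE conjE dvdE)
      then have \<epsilon>k: "\<epsilon> = 1 + \<pi> ^ (l - 1) * k" by (simp add: algebra_simps)
      have "u * a' dvd 1" by (rule unit_mult[OF ju(3) a'(1)])
      then obtain u' where u': "u' dvd 1" "u * a' * u' = 1" by (rule unit_inverse)
      \<comment> \<open>With this \<open>x\<close>, the unit \<open>1 + x z\<close> is the \<open>\<epsilon>\<close> at which \<open>\<chi>\<close> is not \<open>1\<close>.\<close>
      define x where "x = \<pi> ^ (l - 1 - j) * (u' * k)"
      have xz: "x * z = \<pi> ^ (l - 1) * k"
      proof -
        have "x * z = (\<pi> ^ j * \<pi> ^ (l - 1 - j)) * ((u * a' * u') * k)" by (simp only: x_def z_def mult_ac)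
        also have "\<pi> ^ j * \<pi> ^ (l - 1 - j) = \<pi> ^ (l - 1)" using ju(1) by (simp add: power_add[symmetric])
        finally show ?thesis by (simp add: u')
      qed
      have not_trivial: "t (M2 1 x 0 1) \<noteq> 1"
      proof
        assume tx: "t (M2 1 x 0 1) = 1"
        have "\<pi> dvd \<pi> ^ (l - 1) * k" using l by (intro dvd_mult2) (simp add: dvd_power)
        moreover have "\<pi> ^ l dvd (\<pi> ^ (l - 1) * k) * z"
        proof -
          have "\<pi> ^ l = \<pi> ^ (l - 1) * \<pi>" using l by (simp add: power_Suc2[symmetric])
          then show ?thesis using pz by (simp add: mult_dvd_mono)
        qed
        ultimately have te: "t (M2 1 0 0 \<epsilon>) = 1" unfolding \<epsilon>k by (rule R2)
        have "t (M2 1 0 0 \<epsilon>) * t (M2 1 x 0 1) = \<chi> \<epsilon>" using R1[of x] by (simp only: xz \<epsilon>k[symmetric])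
        then have "\<chi> \<epsilon> = 1" unfolding te tx by simp
        with \<epsilon>(2) show False by simp
      qed
      have residue_one: "\<pi> dvd y - 1" if y: "y dvd 1" for y
      proof (rule ccontr)
        assume "\<not> \<pi> dvd y - 1"
        then have "y - 1 dvd 1" by (simp add: unit_iff)
        then obtain y' where y': "y' dvd 1" "(y - 1) * y' = 1" by (rule unit_inverse)
        have "(y - 1) * (y' * x) = x" by (simp only: mult.assoc[symmetric] y'(2) mult_1)
        with tf(4)[OF y, of "y' * x"] have "t (M2 1 x 0 1) = 1" by (simp only:)
        with not_trivial show False by simp
      qed
      have jl: "l - 1 - j = 0"
      proof (rule ccontr)
        assume "l - 1 - j \<noteq> 0"
        then have "\<pi> dvd x" unfolding x_def by (intro dvd_mult2) (simp add: dvd_power)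
        then obtain x' where x': "x = \<pi> * x'" by (elim dvdE)
        have "1 + \<pi> dvd 1" by (rule unit1) simp
        from tf(4)[OF this, of x'] have "t (M2 1 x 0 1) = 1" by (simp add: x')
        with not_trivial show False by simp
      qed
      have eq: "\<chi>' y = \<chi> y" if y: "y dvd 1" for y
      proof -
        define y0 where "y0 = y - 1"
        have y0: "\<pi> dvd y0" unfolding y0_def by (rule residue_one[OF y])
        have "l = Suc j" using jl ju(1) by simp
        then have "\<pi> ^ l = \<pi> * \<pi> ^ j" by simp
        moreover have "\<pi> ^ j dvd z" by (simp add: z_def)
        ultimately have yz: "\<pi> ^ l dvd y0 * z" using y0 by (simp add: mult_dvd_mono)
        have e1: "1 + y0 = y" by (simp add: y0_def)
        have "t (M2 1 0 0 y) = 1" using R2[OF y0 yz] by (simp only: e1)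
        then have "t (M2 y 0 0 1) = 1" using tf(3)[OF y] by simp
        then show ?thesis using R3[OF y0 yz] by (simp only: e1) simp
      qed
      have "\<chi>' = \<chi>" by (rule eqI) (simp_all add: eq unit_charsD(1)[OF \<chi>u])
      then show ?thesis by simp
    qed
  qed
qed

text \<open>
  By \<open>principal_series_distinct\<close> at most two primitive characters lead to the same twist
  isoclass.
\<close>

lemma many_classes_of_small_dimension:
  assumes l: "l \<ge> 2"
  shows "\<exists>I. finite I \<and> (\<forall>(n, C)\<in>I. 0 < n \<and> n \<le> 2 * q ^ l \<and> C \<in> twist_classes n) \<and> q ^ l \<le> 8 * card I"
proof -
  define good where "good \<chi> = (\<lambda>(n, \<rho>, \<phi>, v). irrep GL2 n \<rho> \<and> level_le l \<rho> \<and> n \<le> 2 * q ^ l \<and> \<phi> \<in> carrier_vec n \<and> \<phi> \<noteq> 0\<^sub>v n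
    \<and> (\<forall>b\<in>borel l. \<forall>x\<in>carrier_vec n. \<phi> \<bullet> (\<rho> b *\<^sub>v x) = \<chi> (b $$ (0,0)) * (\<phi> \<bullet> x))
    \<and> v \<in> carrier_vec n \<and> v \<noteq> 0\<^sub>v n \<and> (\<forall>b\<in>borel l. \<rho> b *\<^sub>v v = \<chi> (b $$ (0,0)) \<cdot>\<^sub>v v))"
    for \<chi> :: "'a \<Rightarrow> complex"
  define pick where "pick \<chi> = (SOME x. good \<chi> x)" for \<chi>
  have pick: "good \<chi> (pick \<chi>)" if "\<chi> \<in> unit_chars l" for \<chi>
  proof -
    have "l > 0" using l by simp
    from principal_series_exists[OF that this] have "\<exists>x. good \<chi> x" unfolding good_def by auto
    then show ?thesis unfolding pick_def by (rule someI_ex)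
  qed
  define dm where "dm \<chi> = fst (pick \<chi>)" for \<chi>
  define rp where "rp \<chi> = fst (snd (pick \<chi>))" for \<chi>
  define F where "F \<chi> = (dm \<chi>, twist_rel (dm \<chi>) `` {rp \<chi>})" for \<chi>
  have u: "\<chi> \<in> unit_chars l" if "\<chi> \<in> primitive_chars l" for \<chi> using that by (simp add: primitive_chars_def)
  have rp: "rp \<chi> \<in> irreps (dm \<chi>)" "0 < dm \<chi>" "dm \<chi> \<le> 2 * q ^ l" if "\<chi> \<in> unit_chars l" for \<chi>
    using pick[OF that] by (auto simp: good_def dm_def rp_def irreducible_rep_iff irrep_def split: prod.splits)
  have fibre: "\<chi>' = \<chi> \<or> \<chi>' = (\<lambda>x. inverse (\<chi> x))"
    if c: "\<chi> \<in> primitive_chars l" "\<chi>' \<in> primitive_chars l" and eq: "F \<chi> = F \<chi>'" for \<chi> \<chi>'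
  proof -
    define n where "n = dm \<chi>"
    note E = conjunct1[OF eq[unfolded F_def prod.inject]] conjunct2[OF eq[unfolded F_def prod.inject]]
    have n': "dm \<chi>' = n" by (simp only: n_def E(1))
    have cl: "twist_rel n `` {rp \<chi>} = twist_rel n `` {rp \<chi>'}" using E(2) by (simp only: E(1) n_def)
    obtain \<rho> \<phi> v where p: "pick \<chi> = (n, \<rho>, \<phi>, v)" unfolding n_def dm_def by (cases "pick \<chi>") auto
    obtain \<rho>' \<phi>' v' where p': "pick \<chi>' = (n, \<rho>', \<phi>', v')" using n' unfolding dm_def by (cases "pick \<chi>'") auto
    have r: "rp \<chi> = \<rho>" "rp \<chi>' = \<rho>'" by (simp_all add: rp_def p p')
    have G: "good \<chi> (n, \<rho>, \<phi>, v)" using pick[OF u[OF c(1)]] by (simp only: p)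
    have G': "good \<chi>' (n, \<rho>', \<phi>', v')" using pick[OF u[OF c(2)]] by (simp only: p')
    have i: "\<rho> \<in> irreps n" "\<rho>' \<in> irreps n" using rp(1)[OF u[OF c(1)]] rp(1)[OF u[OF c(2)]] by (simp_all only: r n' n_def[symmetric])
    have "(\<rho>, \<rho>') \<in> twist_rel n"
      using eq_equiv_class[OF cl twist_rel_equiv] i by (simp only: r)
    then have "twist_equivalent GL2 T n \<rho> \<rho>'" by simp
    then obtain t P where t: "linear_char t" and P: "P \<in> carrier (GL n)"
      "\<forall>g\<in>carrier GL2. P * \<rho> g = (t g \<cdot>\<^sub>m \<rho>' g) * P" unfolding twist_equivalent_iff by (elim exE conjE bexE)
    from P(1) obtain R where R: "R \<in> carrier_mat n n" "P * R = 1\<^sub>m n" and Pc: "P \<in> carrier_mat n n"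
      by (auto simp: GL_carrier)
    \<comment> \<open>The functional of \<open>\<rho>'\<close>, transported to \<open>\<rho>\<close> along the equivalence \<open>P\<close> with a twist of \<open>\<rho>'\<close>.\<close>
    define \<psi> where "\<psi> = transpose_mat P *\<^sub>v \<phi>'"
    have \<phi>': "\<phi>' \<in> carrier_vec n" "\<phi>' \<noteq> 0\<^sub>v n"
      "\<And>b x. b \<in> borel l \<Longrightarrow> x \<in> carrier_vec n \<Longrightarrow> \<phi>' \<bullet> (\<rho>' b *\<^sub>v x) = \<chi>' (b $$ (0,0)) * (\<phi>' \<bullet> x)"
      using G' by (simp_all add: good_def)
    have \<psi>: "\<psi> \<in> carrier_vec n" "\<And>x. x \<in> carrier_vec n \<Longrightarrow> \<psi> \<bullet> x = \<phi>' \<bullet> (P *\<^sub>v x)"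
      using Pc \<phi>'(1) transpose_vec_mult_scalar[OF Pc _ \<phi>'(1)] by (simp_all add: \<psi>_def)
    show ?thesis
    proof (rule principal_series_distinct[OF l c(1) u[OF c(2)] _ _ _ _ \<psi>(1) _ t])
      show "irrep GL2 n \<rho>" "v \<in> carrier_vec n" "v \<noteq> 0\<^sub>v n" using G by (simp_all add: good_def)
      show "\<rho> b *\<^sub>v v = \<chi> (b $$ (0,0)) \<cdot>\<^sub>v v" if "b \<in> borel l" for b using G that by (simp add: good_def)
      show "\<psi> \<noteq> 0\<^sub>v n"
      proof
        assume z: "\<psi> = 0\<^sub>v n"
        obtain j where j: "j < n" "\<phi>' $ j \<noteq> 0" using nonzero_vec_entry[OF \<phi>'(1,2)] .
        have "\<phi>' \<bullet> (P *\<^sub>v (R *\<^sub>v unit_vec n j)) = \<psi> \<bullet> (R *\<^sub>v unit_vec n j)" using R(1) by (intro \<psi>(2)[symmetric]) simp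
        also have "\<dots> = 0" unfolding z using R(1) by simp
        also have "P *\<^sub>v (R *\<^sub>v unit_vec n j) = unit_vec n j"
          using assoc_mult_mat_vec[OF Pc R(1) unit_vec_carrier[of n j]] by (simp add: R(2))
        finally show False using j by simp
      qed
      show "\<psi> \<bullet> (\<rho> b *\<^sub>v x) = t b * \<chi>' (b $$ (0,0)) * (\<psi> \<bullet> x)" if b: "b \<in> borel l" and x: "x \<in> carrier_vec n" for b x
      proof -
        have bc: "b \<in> carrier GL2" using b by (simp add: borel_def)
        have m: "\<rho> b \<in> carrier_mat n n" "\<rho>' b \<in> carrier_mat n n" using irreps_mat[OF i(1) bc] irreps_mat[OF i(2) bc] by auto
        have Px: "P *\<^sub>v x \<in> carrier_vec n" using Pc x by simp
        have "P *\<^sub>v (\<rho> b *\<^sub>v x) = (P * \<rho> b) *\<^sub>v x" by (rule assoc_mult_mat_vec[OF Pc m(1) x, symmetric])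
        also have "P * \<rho> b = (t b \<cdot>\<^sub>m \<rho>' b) * P" using P(2) bc by simp
        also have "((t b \<cdot>\<^sub>m \<rho>' b) * P) *\<^sub>v x = (t b \<cdot>\<^sub>m \<rho>' b) *\<^sub>v (P *\<^sub>v x)" using m Pc x by (intro assoc_mult_mat_vec) auto
        also have "\<dots> = t b \<cdot>\<^sub>v (\<rho>' b *\<^sub>v (P *\<^sub>v x))" by (rule smult_mat_mult_vec[OF m(2) Px])
        finally have e: "P *\<^sub>v (\<rho> b *\<^sub>v x) = t b \<cdot>\<^sub>v (\<rho>' b *\<^sub>v (P *\<^sub>v x))" .
        have "\<psi> \<bullet> (\<rho> b *\<^sub>v x) = \<phi>' \<bullet> (P *\<^sub>v (\<rho> b *\<^sub>v x))" using m x by (intro \<psi>(2)) simp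
        also have "\<dots> = t b * (\<phi>' \<bullet> (\<rho>' b *\<^sub>v (P *\<^sub>v x)))" unfolding e using m Px \<phi>'(1) by simp
        also have "\<dots> = t b * (\<chi>' (b $$ (0,0)) * (\<psi> \<bullet> x))" using \<phi>'(3)[OF b Px] \<psi>(2)[OF x] by simp
        finally show ?thesis by simp
      qed
    qed
  qed
  have fin: "finite (primitive_chars l)" using finite_unit_chars[of l] by (simp add: primitive_chars_def)
  have "card (primitive_chars l) = (\<Sum>\<chi>\<in>primitive_chars l. 1)" by simp
  also have "\<dots> = (\<Sum>y\<in>F ` primitive_chars l. \<Sum>\<chi>\<in>{\<chi>\<in>primitive_chars l. F \<chi> = y}. 1)"
    by (rule sum.image_gen[OF fin])
  also have "\<dots> \<le> (\<Sum>y\<in>F ` primitive_chars l. 2)"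
  proof (rule sum_mono)
    fix y assume "y \<in> F ` primitive_chars l"
    then obtain \<chi> where \<chi>: "\<chi> \<in> primitive_chars l" "y = F \<chi>" by blast
    have "{\<psi>\<in>primitive_chars l. F \<psi> = y} \<subseteq> {\<chi>, \<lambda>x. inverse (\<chi> x)}"
    proof
      fix \<psi> assume "\<psi> \<in> {\<psi>\<in>primitive_chars l. F \<psi> = y}"
      then have "\<psi> \<in> primitive_chars l" "F \<chi> = F \<psi>" using \<chi>(2) by simp_all
      from fibre[OF \<chi>(1) this] show "\<psi> \<in> {\<chi>, \<lambda>x. inverse (\<chi> x)}" by simp
    qed
    then have "card {\<psi>\<in>primitive_chars l. F \<psi> = y} \<le> card {\<chi>, \<lambda>x. inverse (\<chi> x)}" by (intro card_mono) auto
    also have "\<dots> \<le> 2" by (simp add: card_insert_if)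
    finally show "(\<Sum>\<psi>\<in>{\<psi>\<in>primitive_chars l. F \<psi> = y}. 1) \<le> (2::nat)" by simp
  qed
  also have "\<dots> = 2 * card (F ` primitive_chars l)" by simp
  finally have "q ^ l \<le> 8 * card (F ` primitive_chars l)" using card_primitive_chars_ge[OF l] by simp
  moreover have "\<forall>(n, C)\<in>F ` primitive_chars l. 0 < n \<and> n \<le> 2 * q ^ l \<and> C \<in> twist_classes n"
  proof (intro ballI, clarify)
    fix n C \<chi> assume \<chi>: "\<chi> \<in> primitive_chars l" and e: "(n, C) = F \<chi>"
    have "twist_rel (dm \<chi>) `` {rp \<chi>} \<in> irreps (dm \<chi>) // twist_rel (dm \<chi>)"
      using rp(1)[OF u[OF \<chi>]] by (rule quotientI)
    then show "0 < n \<and> n \<le> 2 * q ^ l \<and> C \<in> twist_classes n"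
      using rp(2,3)[OF u[OF \<chi>]] e by (simp add: F_def classes_eq)
  qed
  ultimately show ?thesis using fin by (intro exI[of _ "F ` primitive_chars l"] conjI finite_imageI)
qed

end

section \<open>Discrete valuation rings\<close>

text \<open>
  A non-unit is zero or divisible by an irreducible element, which generates a maximal ideal, and this is
  \<open>\<mm>\<close>. So the units are the elements not divisible by a generator \<open>\<pi>\<close>
  of \<open>\<mm>\<close>.
\<close>

lemma uniformizer_ideal_of_dvr:
  fixes \<mm> :: "'a::idom set"
  assumes dvr: "discrete_valuation_ring \<mm> (class_ring :: 'a ring)"
    and fin: "finite (carrier ((class_ring :: 'a ring) Quot \<mm>))"
  shows "\<exists>\<pi> D. uniformizer_ideal \<pi> D \<mm>"
proof -
  let ?R = "class_ring :: 'a ring"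
  interpret R: discrete_valuation_ring \<mm> ?R by fact
  obtain \<pi> where gen: "\<mm> = PIdl\<^bsub>?R\<^esub> \<pi>" using R.exists_gen[OF R.ideal_axioms] by (elim bexE)
  have PIdl: "PIdl\<^bsub>?R\<^esub> a = {x. a dvd x}" for a
    unfolding cgenideal_def by (auto simp: dvd_def mult.commute)
  have \<mm>: "\<mm> = {x. \<pi> dvd x}" unfolding gen PIdl ..
  have nz: "\<pi> \<noteq> 0" using R.maximal_nonzero unfolding \<mm> by auto
  have nu: "\<not> \<pi> dvd 1"
  proof
    assume "\<pi> dvd 1"
    then have "\<pi> dvd x" for x by (rule dvd_trans) simp
    then have "x \<in> \<mm>" for x unfolding \<mm> by simp
    then have "UNIV = \<mm>" by (rule UNIV_eq_I)
    with R.I_notcarr show False by simp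
  qed
  have unit: "x dvd 1 \<longleftrightarrow> \<not> \<pi> dvd x" for x
  proof
    show "\<not> \<pi> dvd x" if x: "x dvd 1"
    proof
      assume "\<pi> dvd x"
      then have "\<pi> dvd 1" using x by (rule dvd_trans)
      with nu show False ..
    qed
    show "x dvd 1" if x: "\<not> \<pi> dvd x"
    proof (rule ccontr)
      assume "\<not> x dvd 1"
      have "x \<notin> Units ?R"
      proof
        assume "x \<in> Units ?R"
        then obtain y where "x * y = 1" by (auto simp: Units_def)
        then have "x dvd 1" by (rule dvdI[OF sym])
        with \<open>\<not> x dvd 1\<close> show False ..
      qed
      have "x \<noteq> 0" using x by (intro notI) simp
      then have "x \<in> carrier ?R - {\<zero>\<^bsub>?R\<^esub>}" by simp
      then obtain b where b: "b \<in> carrier ?R" "ring_irreducible\<^bsub>?R\<^esub> b" "b divides\<^bsub>?R\<^esub> x"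
        using \<open>x \<notin> Units ?R\<close> by (rule R.exists_irreducible_divisor)
      have "PIdl\<^bsub>?R\<^esub> b = \<mm>"
        by (rule R.maximal_unique[OF R.irreducible_imp_maximalideal[OF b(1,2)]])
      moreover have "b \<in> PIdl\<^bsub>?R\<^esub> b" by (simp add: PIdl)
      ultimately have "b \<in> \<mm>" by (simp only:)
      then have "\<pi> dvd b" unfolding \<mm> by simp
      moreover have "b dvd x" using b(3) by (auto simp: factor_def)
      ultimately have "\<pi> dvd x" by (rule dvd_trans)
      with x show False ..
    qed
  qed
  \<comment> \<open>The residue classes as sets; the digits are chosen as one element of each class.\<close>
  define cs where "cs x = {y. \<pi> dvd x - y}" for x
  have cs: "\<mm> +>\<^bsub>?R\<^esub> x = cs x" for x
  proof (rule Set.set_eqI)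
    fix y
    have "y \<in> \<mm> +>\<^bsub>?R\<^esub> x \<longleftrightarrow> (\<exists>h\<in>\<mm>. y = h + x)" by (simp add: a_r_coset_def')
    also have "\<dots> \<longleftrightarrow> y - x \<in> \<mm>"
    proof
      assume "\<exists>h\<in>\<mm>. y = h + x"
      then obtain h where "h \<in> \<mm>" "y = h + x" by (elim bexE)
      then show "y - x \<in> \<mm>" by simp
    next
      assume "y - x \<in> \<mm>"
      then show "\<exists>h\<in>\<mm>. y = h + x" by (intro bexI[of _ "y - x"]) simp_all
    qed
    also have "\<dots> \<longleftrightarrow> \<pi> dvd y - x" unfolding \<mm> by (rule mem_Collect_eq)
    also have "\<dots> \<longleftrightarrow> y \<in> cs x" using dvd_minus_iff[of \<pi> "x - y"] by (simp add: cs_def)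
    finally show "y \<in> \<mm> +>\<^bsub>?R\<^esub> x \<longleftrightarrow> y \<in> cs x" .
  qed
  have "carrier (?R Quot \<mm>) = range cs" by (auto simp: FactRing_def A_RCOSETS_def' cs)
  then have fin_cs: "finite (range cs)" using fin by simp
  define rep where "rep C = (SOME y. y \<in> C)" for C :: "'a set"
  define D where "D = rep ` range cs"
  have rep: "\<pi> dvd x - rep (cs x)" for x
  proof -
    have "x \<in> cs x" by (simp add: cs_def)
    then have "rep (cs x) \<in> cs x" unfolding rep_def by (rule someI)
    then show ?thesis by (simp add: cs_def)
  qed
  have cs_eq: "cs x = cs y" if d: "\<pi> dvd x - y" for x y
  proof -
    have "\<pi> dvd x - z \<longleftrightarrow> \<pi> dvd y - z" for z
    proof -
      have "x - z = (x - y) + (y - z)" by simp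
      then show ?thesis using dvd_add_right_iff[OF d, of "y - z"] by simp
    qed
    then show ?thesis by (simp add: cs_def)
  qed
  have D: "\<exists>!d. d \<in> D \<and> \<pi> dvd x - d" for x
  proof (rule ex1I[of _ "rep (cs x)"])
    show "rep (cs x) \<in> D \<and> \<pi> dvd x - rep (cs x)" using rep by (simp add: D_def)
    fix d assume d: "d \<in> D \<and> \<pi> dvd x - d"
    then obtain z where z: "d = rep (cs z)" unfolding D_def by auto
    have 1: "cs x = cs d" using d by (intro cs_eq) simp
    have 2: "cs z = cs d" unfolding z by (rule cs_eq[OF rep])
    show "d = rep (cs x)" unfolding 1 2[symmetric] by (rule z)
  qed
  have pow: "\<mm> [^]\<^bsub>ideals_set ?R\<^esub> k = {x. \<pi> ^ k dvd x}" for k :: nat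
  proof (induction k)
    case 0
    show ?case by (simp add: nat_pow_def ideals_set_def)
  next
    case (Suc k)
    have "\<mm> [^]\<^bsub>ideals_set ?R\<^esub> Suc k = ideal_prod ?R (\<mm> [^]\<^bsub>ideals_set ?R\<^esub> k) \<mm>"
      by (simp add: nat_pow_def ideals_set_def)
    also have "\<dots> = ideal_prod ?R {x. \<pi> ^ k dvd x} {x. \<pi> dvd x}" unfolding Suc.IH unfolding \<mm> ..
    also have "\<dots> = {x. \<pi> ^ Suc k dvd x}"
    proof
      show "ideal_prod ?R {x. \<pi> ^ k dvd x} {x. \<pi> dvd x} \<subseteq> {x. \<pi> ^ Suc k dvd x}"
      proof
        fix x assume "x \<in> ideal_prod ?R {x. \<pi> ^ k dvd x} {x. \<pi> dvd x}"
        then have "\<pi> ^ k * \<pi> dvd x"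
        proof (induction rule: ideal_prod.induct)
          case (prod i j)
          then show ?case by (simp add: mult_dvd_mono)
        next
          case (sum x y)
          then show ?case by simp
        qed
        then show "x \<in> {x. \<pi> ^ Suc k dvd x}" by (simp add: mult.commute)
      qed
      show "{x. \<pi> ^ Suc k dvd x} \<subseteq> ideal_prod ?R {x. \<pi> ^ k dvd x} {x. \<pi> dvd x}"
      proof
        fix x assume "x \<in> {x. \<pi> ^ Suc k dvd x}"
        then obtain c where c: "x = \<pi> ^ Suc k * c" by (elim CollectE dvdE)
        have "\<pi> ^ k \<otimes>\<^bsub>?R\<^esub> (\<pi> * c) \<in> ideal_prod ?R {x. \<pi> ^ k dvd x} {x. \<pi> dvd x}"
          by (rule ideal_prod.prod) simp_all
        then show "x \<in> ideal_prod ?R {x. \<pi> ^ k dvd x} {x. \<pi> dvd x}" by (simp add: c mult_ac)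
      qed
    qed
    finally show ?case .
  qed
  have "uniformizer_ideal \<pi> D \<mm>"
    by unfold_locales (use nz unit D pow fin_cs in \<open>simp_all add: D_def\<close>)
  then show ?thesis by (intro exI)
qed

section \<open>The abscissa of convergence\<close>

context uniformizer_ideal
begin

lemma level_less_power: "l < q ^ l"
  using card_D_ge by (intro power_gt_expt) simp

lemma twist_classes_subset:
  assumes char2: "(1::'a) + 1 = 0"
  shows "twist_classes n \<subseteq> (\<Union>l\<in>{l\<in>{..q * n}. q ^ l \<le> q * n}. classes_of_level l n)"
proof
  fix C assume "C \<in> twist_classes n"
  from class_has_small_level[OF char2 this] obtain l where l: "q ^ l \<le> q * n" "C \<in> classes_of_level l n" by blast
  moreover have "l \<le> q * n" using level_less_power[of l] l(1) by simp
  ultimately show "C \<in> (\<Union>l\<in>{l\<in>{..q * n}. q ^ l \<le> q * n}. classes_of_level l n)" by auto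
qed

lemma finite_twist_classes: "(1::'a) + 1 = 0 \<Longrightarrow> finite (twist_classes n)"
  by (rule finite_subset[OF twist_classes_subset]) (simp_all add: finite_classes_of_level)

text \<open>
  A class of dimension \<open>n\<close> is counted at a level \<open>l\<close> with \<open>n \<ge>
  q\<^sup>l / q\<close>, where it contributes at most \<open>b l = (q\<^sup>l / q) powr - s\<close>.
  Exchanging the sums over dimensions and levels, the sum over the dimensions is at most \<open>(l + 1)
  q\<^sup>l\<close>, and what remains is the derivative of a geometric series in \<open>x = q powr (1 -
  s)\<close>.
\<close>

lemma twist_zeta_finite:
  assumes char2: "(1::'a) + 1 = 0" and s: "s > 1"
  shows "twist_zeta GL2 T s < \<infinity>"
proof -
  define x where "x = real q powr (1 - s)"
  define b where "b l = real q powr s * (real q powr - s) ^ l" for l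
  have q: "real q > 1" using card_D_ge by simp
  have x: "0 < x" "x < 1" unfolding x_def using q s by (simp_all add: powr_less_one)
  have b_pos: "b l \<ge> 0" for l by (simp add: b_def)
  have b_powr: "b l = (real (q ^ l) / real q) powr - s" for l
  proof -
    have "(real (q ^ l) / real q) powr - s = real (q ^ l) powr - s / real q powr - s" by (rule powr_divide)
    also have "real (q ^ l) powr - s = (real q powr - s) ^ l" using q
      by (simp add: powr_realpow[symmetric] powr_powr mult.commute)
    finally show ?thesis using q by (simp add: b_def powr_minus divide_simps)
  qed
  have bx: "real ((l + 1) * q ^ l) * b l = real q powr s * (of_nat (Suc l) * x ^ l)" for l
  proof -
    have "real q * real q powr - s = x" unfolding x_def using q by (simp add: powr_diff powr_minus divide_simps)
    then have "real q ^ l * (real q powr - s) ^ l = x ^ l" by (simp add: power_mult_distrib[symmetric])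
    then show ?thesis by (simp add: b_def algebra_simps)
  qed
  define f where "f i = real (card (twist_classes (Suc i))) * real (Suc i) powr - s" for i
  have f_pos: "f i \<ge> 0" for i by (simp add: f_def)
  have f_le: "f i \<le> (\<Sum>l\<le>q * N. real (card (classes_of_level l (Suc i))) * b l)" if i: "i < N" for i N
  proof -
    let ?n = "Suc i"
    \<comment> \<open>The levels at which classes of dimension \<open>Suc i\<close> may occur.\<close>
    define L where "L = {l\<in>{..q * ?n}. q ^ l \<le> q * ?n}"
    have finL: "finite L" by (simp add: L_def)
    have "card (twist_classes ?n) \<le> card (\<Union>l\<in>L. classes_of_level l ?n)"
      unfolding L_def by (rule card_mono[OF _ twist_classes_subset[OF char2]]) (simp add: finite_classes_of_level)
    also have "\<dots> \<le> (\<Sum>l\<in>L. card (classes_of_level l ?n))" by (rule card_UN_le[OF finL])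
    finally have "real (card (twist_classes ?n)) \<le> real (\<Sum>l\<in>L. card (classes_of_level l ?n))" by (simp only: of_nat_le_iff)
    then have "f i \<le> (\<Sum>l\<in>L. real (card (classes_of_level l ?n))) * real ?n powr - s"
      unfolding f_def of_nat_sum by (rule mult_right_mono) simp
    also have "\<dots> = (\<Sum>l\<in>L. real (card (classes_of_level l ?n)) * real ?n powr - s)" by (rule sum_distrib_right)
    also have "\<dots> \<le> (\<Sum>l\<in>L. real (card (classes_of_level l ?n)) * b l)"
    proof (intro sum_mono mult_left_mono)
      fix l assume "l \<in> L"
      then have "real (q ^ l) \<le> real (q * ?n)" unfolding L_def by (simp only: of_nat_le_iff mem_Collect_eq)
      then have le: "real (q ^ l) \<le> real ?n * real q" by (simp only: of_nat_mult mult.commute)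
      have "real (q ^ l) / real q \<le> real ?n" using q by (subst pos_divide_le_eq) (simp, rule le)
      moreover have "0 < real (q ^ l) / real q" using q by simp
      ultimately show "real ?n powr - s \<le> b l" unfolding b_powr using s by (intro powr_mono2') simp_all
    qed simp
    also have "\<dots> \<le> (\<Sum>l\<le>q * N. real (card (classes_of_level l ?n)) * b l)"
    proof (rule sum_mono2)
      show "L \<subseteq> {..q * N}"
      proof
        fix l assume "l \<in> L"
        then have "l \<le> q * ?n" by (simp add: L_def)
        also have "\<dots> \<le> q * N" using i by (intro mult_le_mono2) simp
        finally show "l \<in> {..q * N}" by simp
      qed
    qed (simp_all add: b_pos)
    finally show ?thesis .
  qed
  have "(\<lambda>l. of_nat (Suc l) * x ^ l) sums (1 / (1 - x)\<^sup>2)" using x by (intro geometric_deriv_sums) simp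
  then have partial: "(\<Sum>l\<le>M. of_nat (Suc l) * x ^ l) \<le> 1 / (1 - x)\<^sup>2" for M
    using sum_le_suminf[of "\<lambda>l. of_nat (Suc l) * x ^ l" "{..M}"] x by (simp add: sums_iff)
  have "(\<Sum>i<N. f i) \<le> real q powr s * (1 / (1 - x)\<^sup>2)" for N
  proof -
    have "(\<Sum>i<N. f i) \<le> (\<Sum>i<N. \<Sum>l\<le>q * N. real (card (classes_of_level l (Suc i))) * b l)"
      by (intro sum_mono f_le) simp
    also have "\<dots> = (\<Sum>l\<le>q * N. \<Sum>i<N. real (card (classes_of_level l (Suc i))) * b l)" by (rule sum.swap)
    also have "\<dots> = (\<Sum>l\<le>q * N. real (\<Sum>n\<in>Suc ` {..<N}. card (classes_of_level l n)) * b l)"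
      by (simp add: sum.reindex sum_distrib_right)
    also have "\<dots> \<le> (\<Sum>l\<le>q * N. real ((l + 1) * q ^ l) * b l)"
      by (intro sum_mono mult_right_mono b_pos) (simp only: of_nat_le_iff sum_classes_of_level_le finite_imageI finite_lessThan)
    also have "\<dots> = real q powr s * (\<Sum>l\<le>q * N. of_nat (Suc l) * x ^ l)" unfolding bx by (rule sum_distrib_left[symmetric])
    also have "\<dots> \<le> real q powr s * (1 / (1 - x)\<^sup>2)" by (intro mult_left_mono partial) simp
    finally show ?thesis .
  qed
  then have "(\<Sum>i<N. ennreal (f i)) \<le> ennreal (real q powr s * (1 / (1 - x)\<^sup>2))" for N
    using f_pos by (simp add: sum_ennreal ennreal_leI)
  then have "(\<Sum>i. ennreal (f i)) \<le> ennreal (real q powr s * (1 / (1 - x)\<^sup>2))"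
    by (intro suminf_le_const summableI)
  also have "\<dots> < \<infinity>" by simp
  also have "(\<Sum>i. ennreal (f i)) = twist_zeta GL2 T s"
    unfolding twist_zeta_def twist_rep_count_def f_def
    by (simp add: finite_twist_classes[OF char2] ennreal_mult ennreal_of_nat_eq_real_of_nat)
  finally show ?thesis .
qed

lemma twist_rep_count_ge:
  assumes "finite J" "J \<subseteq> twist_classes n"
  shows "ennreal (real (card J)) \<le> ennreal_of_enat (twist_rep_count GL2 T n)"
proof (cases "finite (twist_classes n)")
  case True
  then have "card J \<le> card (twist_classes n)" using assms(2) by (rule card_mono)
  then show ?thesis using True by (simp add: twist_rep_count_def ennreal_of_nat_eq_real_of_nat ennreal_leI)
qed (simp add: twist_rep_count_def)

text \<open>
  The exponent is replaced by a non-negative one, so that \<open>n powr - s'\<close> is decreasing in the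
  dimension \<open>n \<le> M\<close>.
\<close>

lemma twist_zeta_ge:
  assumes fin: "finite I" and I: "\<forall>(n, C)\<in>I. 0 < n \<and> n \<le> M \<and> C \<in> twist_classes n"
    and s: "s \<le> s'" "0 \<le> s'"
  shows "ennreal (real (card I) * real M powr - s') \<le> twist_zeta GL2 T s"
proof -
  define N where "N = fst ` I"
  define J where "J n = {C. (n, C) \<in> I}" for n
  have finN: "finite N" using fin by (simp add: N_def)
  have finJ: "finite (J n)" for n
  proof -
    have "J n \<subseteq> snd ` I" by (force simp: J_def)
    then show ?thesis using fin finite_subset by blast
  qed
  have J: "J n \<subseteq> twist_classes n" for n using I by (auto simp: J_def)
  have N: "0 < n" "n \<le> M" if "n \<in> N" for n using that I by (auto simp: N_def)
  have "I = (SIGMA n:N. J n)" by (force simp: N_def J_def)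
  then have "card I = (\<Sum>n\<in>N. card (J n))" using finN finJ by (simp add: card_SigmaI)
  then have "ennreal (real (card I) * real M powr - s') = (\<Sum>n\<in>N. ennreal (real (card (J n)) * real M powr - s'))"
    by (simp add: sum_ennreal sum_distrib_right)
  also have "\<dots> \<le> (\<Sum>n\<in>N. ennreal_of_enat (twist_rep_count GL2 T n) * ennreal (real n powr - s))"
  proof (rule sum_mono)
    fix n assume n: "n \<in> N"
    have "real M powr - s' \<le> real n powr - s'" using N[OF n] s(2) by (intro powr_mono2') simp_all
    also have "\<dots> \<le> real n powr - s" using N[OF n] s(1) by (intro powr_mono) simp_all
    finally have "ennreal (real M powr - s') \<le> ennreal (real n powr - s)" by (rule ennreal_leI)
    then have "ennreal (real (card (J n))) * ennreal (real M powr - s')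
        \<le> ennreal_of_enat (twist_rep_count GL2 T n) * ennreal (real n powr - s)"
      by (intro mult_mono twist_rep_count_ge[OF finJ J]) simp_all
    then show "ennreal (real (card (J n)) * real M powr - s')
        \<le> ennreal_of_enat (twist_rep_count GL2 T n) * ennreal (real n powr - s)" by (simp add: ennreal_mult)
  qed
  also have "\<dots> = (\<Sum>i\<in>(\<lambda>n. n - 1) ` N. ennreal_of_enat (twist_rep_count GL2 T (Suc i)) * ennreal (real (Suc i) powr - s))"
  proof (subst sum.reindex)
    show "inj_on (\<lambda>n. n - 1) N"
    proof (rule inj_onI)
      fix m n assume "m \<in> N" "n \<in> N" "m - 1 = n - 1"
      then show "m = n" using N(1)[of m] N(1)[of n] by simp
    qed
    show "(\<Sum>n\<in>N. ennreal_of_enat (twist_rep_count GL2 T n) * ennreal (real n powr - s))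
      = sum ((\<lambda>i. ennreal_of_enat (twist_rep_count GL2 T (Suc i)) * ennreal (real (Suc i) powr - s)) \<circ> (\<lambda>n. n - 1)) N"
    proof (rule sum.cong[OF refl])
      fix n assume "n \<in> N"
      then have "Suc (n - 1) = n" using N(1)[of n] by simp
      then show "ennreal_of_enat (twist_rep_count GL2 T n) * ennreal (real n powr - s)
        = ((\<lambda>i. ennreal_of_enat (twist_rep_count GL2 T (Suc i)) * ennreal (real (Suc i) powr - s)) \<circ> (\<lambda>n. n - 1)) n"
        by (simp only: o_def)
    qed
  qed
  also have "\<dots> \<le> twist_zeta GL2 T s"
    unfolding twist_zeta_def using finN by (intro sum_le_suminf summableI) simp_all
  finally show ?thesis .
qed

lemma twist_zeta_infinite:
  assumes s: "s < 1"
  shows "twist_zeta GL2 T s = \<infinity>"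
proof (rule ccontr)
  assume "twist_zeta GL2 T s \<noteq> \<infinity>"
  then obtain r where r: "0 \<le> r" "twist_zeta GL2 T s = ennreal r" by (cases "twist_zeta GL2 T s") auto
  define s' where "s' = max s 0"
  define y where "y = real q powr (1 - s')"
  have q: "real q > 1" using card_D_ge by simp
  have s': "s \<le> s'" "0 \<le> s'" "s' < 1" using s by (auto simp: s'_def)
  have y: "y > 1" unfolding y_def using q s'(3) by (simp add: gr_one_powr)
  \<comment> \<open>The constant makes the lower bound \<open>y ^ k / (8 * 2 powr s')\<close> exceed the assumed value \<open>r\<close>.\<close>
  obtain k where k: "8 * 2 powr s' * r < y ^ k" using real_arch_pow[OF y] by blast
  define l where "l = k + 2"
  have "y ^ k \<le> y ^ l" unfolding l_def using y by (intro power_increasing) simp_all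
  with k have k': "8 * 2 powr s' * r < y ^ l" by simp
  obtain I where I: "finite I" "\<forall>(n, C)\<in>I. 0 < n \<and> n \<le> 2 * q ^ l \<and> C \<in> twist_classes n" "q ^ l \<le> 8 * card I"
    using many_classes_of_small_dimension[of l] by (auto simp: l_def)
  have "ennreal (real (card I) * real (2 * q ^ l) powr - s') \<le> ennreal r"
    using twist_zeta_ge[OF I(1,2) s'(1,2)] by (simp only: r(2))
  then have 1: "real (card I) * real (2 * q ^ l) powr - s' \<le> r" using r(1) by (simp only: ennreal_le_iff)
  have yl: "real (q ^ l) * real (2 * q ^ l) powr - s' = 2 powr - s' * y ^ l"
  proof -
    have "real (2 * q ^ l) powr - s' = 2 powr - s' * (real q ^ l) powr - s'" using q by (simp add: powr_mult)
    also have "(real q ^ l) powr - s' = (real q powr - s') ^ l" using q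
      by (simp add: powr_realpow[symmetric] powr_powr mult.commute)
    finally have "real (q ^ l) * real (2 * q ^ l) powr - s' = 2 powr - s' * (real q * real q powr - s') ^ l"
      by (simp add: power_mult_distrib)
    also have "real q * real q powr - s' = y" unfolding y_def using q by (simp add: powr_diff powr_minus divide_simps)
    finally show ?thesis .
  qed
  have "real (q ^ l) \<le> real (8 * card I)" using I(3) by (simp only: of_nat_le_iff)
  then have "real (q ^ l) * real (2 * q ^ l) powr - s' \<le> real (8 * card I) * real (2 * q ^ l) powr - s'"
    by (rule mult_right_mono) simp
  also have "\<dots> \<le> 8 * r" using 1 by simp
  finally have "2 powr - s' * y ^ l \<le> 8 * r" unfolding yl .
  then have "2 powr s' * (2 powr - s' * y ^ l) \<le> 2 powr s' * (8 * r)" by (rule mult_left_mono) simp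
  moreover have "2 powr s' * (2 powr - s' * y ^ l) = y ^ l"
  proof -
    have "2 powr s' * 2 powr - s' = (1::real)" by (simp add: powr_add[symmetric])
    then show ?thesis by (simp only: mult.assoc[symmetric] mult_1)
  qed
  ultimately have "y ^ l \<le> 2 powr s' * (8 * r)" by (simp only:)
  also have "\<dots> = 8 * 2 powr s' * r" by simp
  finally show False using k' by linarith
qed

end

theorem theorem4p25:
  fixes \<mm> :: "'a::idom set"
  assumes "complete_dvr \<mm> (class_ring :: 'a ring)"
    and "finite (carrier ((class_ring :: 'a ring) Quot \<mm>))"
    and "CHAR('a) = 2"
  shows "abscissa_of_convergence (twist_zeta (GL 2) (GL_topology \<mm> 2)) = 1"
proof -
  have dvr: "discrete_valuation_ring \<mm> (class_ring :: 'a ring)"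
    using assms(1) by (rule complete_dvr.axioms(1))
  obtain \<pi> D where u: "uniformizer_ideal \<pi> D \<mm>"
    using uniformizer_ideal_of_dvr[OF dvr assms(2)] by (elim exE)
  have "of_nat CHAR('a) = (0 :: 'a)" by (rule of_nat_CHAR)
  then have char2: "(1::'a) + 1 = 0" unfolding assms(3) by simp
  let ?\<zeta> = "twist_zeta (GL 2) (GL_topology \<mm> 2)"
  have fin: "?\<zeta> s < \<infinity>" if "s > 1" for s by (rule uniformizer_ideal.twist_zeta_finite[OF u char2 that])
  have inf: "\<not> ?\<zeta> s < \<infinity>" if "s < 1" for s using uniformizer_ideal.twist_zeta_infinite[OF u that] by simp
  show ?thesis
    unfolding abscissa_of_convergence_def
  proof (rule antisym)
    show "1 \<le> Inf {ereal s | s. ?\<zeta> s < \<infinity>}"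
    proof (rule Inf_greatest)
      fix x assume "x \<in> {ereal s | s. ?\<zeta> s < \<infinity>}"
      then obtain s where s: "x = ereal s" "?\<zeta> s < \<infinity>" by blast
      then have "\<not> s < 1" using inf by blast
      then show "1 \<le> x" by (simp add: s(1) one_ereal_def)
    qed
    show "Inf {ereal s | s. ?\<zeta> s < \<infinity>} \<le> 1"
    proof (rule dense_ge)
      fix x :: ereal assume x: "1 < x"
      show "Inf {ereal s | s. ?\<zeta> s < \<infinity>} \<le> x"
      proof (cases x)
        case (real r)
        then have "r > 1" using x by simp
        then have "x \<in> {ereal s | s. ?\<zeta> s < \<infinity>}" using fin real by blast
        then show ?thesis by (rule Inf_lower)
      qed (use x in simp_all)
    qed
  qed
qed

end
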